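(* Consider a Barabanov linear switched system given by $A\in\mathbb{R}^{3\times3}$, $b,c\in\mathbb{R}^3$. Every periodic trajectory $(x(\cdot),l(\cdot))$, with $x(\cdot)$ and $l(\cdot)$ non-zero and of minimal period $T>0$, of the system $$\dot x(t)=Ax(t)+u(t)bc^Tx(t),\qquad \dot l(t)=-A^Tl(t)-u(t)cb^Tl(t),\qquad u(t)\in\tfrac12\big(1+\mathrm{sgn}(\phi(t))\big),$$ where $\phi(t)=(b^Tl(t))(c^Tx(t))$, is formed (on its period) either by two bang arcs or by four bang arcs. The first case happens whenever $b^Tl(\cdot)$ and $c^Tx(\cdot)$ have common zeroes.
   Context: Barabanov linear switched system: $A\in\mathbb{R}^{3\times3}$, $b,c\in\mathbb{R}^3$ are such that $A$ and $A+bc^T$ are Hurwitz, the pairs $(A,b)$ and $(A^T,c)$ are controllable, and $\rho(\mathcal{M})=0$, where $\mathcal{M}:=\{A+ubc^T:u\in[0,1]\}$ and $\rho(\mathcal{M}):=\sup\limsup_{t\to+\infty}\frac1t\log\|x(t)\|$, the supremum being over all measurable $u:[0,\infty)\to[0,1]$ and all solutions of $\dot x=Ax+u(t)bc^Tx$ with $x(0)\neq0$. Here $\mathrm{sgn}(r)=r/|r|$ if $r\ne0$ and $\mathrm{sgn}(0)=[-1,1]$ (so $u(t)=1$ if $\phi(t)>0$, $u(t)=0$ if $\phi(t)<0$, $u(t)\in[0,1]$ if $\phi(t)=0$); $x,l$ are absolutely continuous, $u$ is measurable, and the relations hold for a.e. $t$. A bang arc is a piece of trajectory on a time interval on which $A+u(\cdot)bc^T$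 is constant; maximal such pieces are counted, cyclically over one period $T$. *)

theory Defs
  imports "HOL-Analysis.Analysis"
begin

definition outer_product :: "real ^ 'n \<Rightarrow> real ^ 'n \<Rightarrow> real ^ 'n ^ 'n"
  where "outer_product b c = (\<chi> i j. b $ i * c $ j)"

definition hurwitz :: "real ^ 'n ^ 'n \<Rightarrow> bool"
  where "hurwitz A \<longleftrightarrow>
    (\<forall>(z::complex) (v::complex ^ 'n).
       v \<noteq> 0 \<and> map_matrix complex_of_real A *v v = z *s v \<longrightarrow> Re z < 0)"

text \<open>Controllability of a pair is the Kalman rank condition: the columns
  \<open>b, A b, \<dots>, A\<^sup>n\<^sup>-\<^sup>1 b\<close> of the controllability matrix span the whole space.\<close>

definition controllable_pair :: "real ^ 'n ^ 'n \<Rightarrow> real ^ 'n \<Rightarrow> bool"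
  where "controllable_pair A b \<longleftrightarrow> span {((*v) A ^^ k) b | k. k < CARD('n)} = UNIV"

text \<open>The intervals of a division have pairwise disjoint interiors, so for an interval \<open>S\<close> this
  is the usual epsilon-delta definition. Degenerate intervals contribute zero to both sums.\<close>

definition absolutely_continuous_on :: "real set \<Rightarrow> (real \<Rightarrow> 'a::real_normed_vector) \<Rightarrow> bool"
  where "absolutely_continuous_on S f \<longleftrightarrow>
    (\<forall>\<epsilon>>0. \<exists>\<delta>>0. \<forall>D. D division_of \<Union>D \<and> \<Union>D \<subseteq> S \<and> (\<Sum>K\<in>D. Sup K - Inf K) < \<delta> \<longrightarrow>
       (\<Sum>K\<in>D. norm (f (Sup K) - f (Inf K))) < \<epsilon>)"

text \<open>Solutions in the sense of Caratheodory. On unbounded time domains absolute continuity is, as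
  usual, required on compact intervals.\<close>

definition caratheodory_solution ::
    "real set \<Rightarrow> (real \<Rightarrow> 'a \<Rightarrow> 'a) \<Rightarrow> (real \<Rightarrow> 'a::real_normed_vector) \<Rightarrow> bool"
  where "caratheodory_solution S F x \<longleftrightarrow>
    (\<forall>a b. {a..b} \<subseteq> S \<longrightarrow> absolutely_continuous_on {a..b} x) \<and>
    (AE t in lebesgue. t \<in> S \<longrightarrow> (x has_vector_derivative F t (x t)) (at t within S))"

definition switched_matrix :: "real ^ 'n ^ 'n \<Rightarrow> real ^ 'n \<Rightarrow> real ^ 'n \<Rightarrow> real \<Rightarrow> real ^ 'n ^ 'n"
  where "switched_matrix A b c r = A + r *\<^sub>R outer_product b c"

definition max_growth_rate :: "real ^ 'n ^ 'n \<Rightarrow> real ^ 'n \<Rightarrow> real ^ 'n \<Rightarrow> ereal"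
  where "max_growth_rate A b c =
    Sup {Limsup at_top (\<lambda>t. ereal (1 / t * ln (norm (x t)))) | x u.
           u \<in> borel_measurable (lebesgue_on {0..}) \<and> (\<forall>t\<ge>0. u t \<in> {0..1}) \<and>
           caratheodory_solution {0..} (\<lambda>t y. switched_matrix A b c (u t) *v y) x \<and>
           x 0 \<noteq> 0}"

definition barabanov_system :: "real ^ 3 ^ 3 \<Rightarrow> real ^ 3 \<Rightarrow> real ^ 3 \<Rightarrow> bool"
  where "barabanov_system A b c \<longleftrightarrow>
    hurwitz A \<and> hurwitz (A + outer_product b c) \<and>
    controllable_pair A b \<and> controllable_pair (transpose A) c \<and>
    max_growth_rate A b c = 0"

definition set_sgn :: "real \<Rightarrow> real set"
  where "set_sgn r = (if r = 0 then {-1..1} else {r / \<bar>r\<bar>})"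

definition switching_function ::
    "real ^ 'n \<Rightarrow> real ^ 'n \<Rightarrow> (real \<Rightarrow> real ^ 'n) \<Rightarrow> (real \<Rightarrow> real ^ 'n) \<Rightarrow> real \<Rightarrow> real"
  where "switching_function b c x l t = (b \<bullet> l t) * (c \<bullet> x t)"

definition trajectory ::
    "real ^ 'n ^ 'n \<Rightarrow> real ^ 'n \<Rightarrow> real ^ 'n \<Rightarrow>
     (real \<Rightarrow> real ^ 'n) \<Rightarrow> (real \<Rightarrow> real ^ 'n) \<Rightarrow> (real \<Rightarrow> real) \<Rightarrow> bool"
  where "trajectory A b c x l u \<longleftrightarrow>
    u \<in> borel_measurable lebesgue \<and>
    caratheodory_solution UNIV
      (\<lambda>t y. A *v y + u t *\<^sub>R (outer_product b c *v y)) x \<and>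
    caratheodory_solution UNIV
      (\<lambda>t y. - (transpose A *v y) - u t *\<^sub>R (outer_product c b *v y)) l \<and>
    (AE t in lebesgue. u t \<in> (\<lambda>s. (1 + s) / 2) ` set_sgn (switching_function b c x l t))"

definition minimal_period :: "(real \<Rightarrow> 'a) \<Rightarrow> real \<Rightarrow> bool"
  where "minimal_period f T \<longleftrightarrow>
    0 < T \<and> (\<forall>t. f (t + T) = f t) \<and>
    (\<forall>S. 0 < S \<and> S < T \<longrightarrow> \<not> (\<forall>t. f (t + S) = f t))"

text \<open>The control is only determined up to null sets, so constancy is meant almost everywhere.\<close>

definition bang_arc ::
    "real ^ 'n ^ 'n \<Rightarrow> real ^ 'n \<Rightarrow> real ^ 'n \<Rightarrow> (real \<Rightarrow> real) \<Rightarrow> real \<Rightarrow> real \<Rightarrow> bool"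
  where "bang_arc A b c u s e \<longleftrightarrow>
    s < e \<and> (\<exists>M. AE t in lebesgue. t \<in> {s..e} \<longrightarrow> switched_matrix A b c (u t) = M)"

definition maximal_bang_arc ::
    "real ^ 'n ^ 'n \<Rightarrow> real ^ 'n \<Rightarrow> real ^ 'n \<Rightarrow> (real \<Rightarrow> real) \<Rightarrow> real \<Rightarrow> real \<Rightarrow> bool"
  where "maximal_bang_arc A b c u s e \<longleftrightarrow>
    bang_arc A b c u s e \<and>
    (\<forall>s' e'. s' \<le> s \<and> e \<le> e' \<and> bang_arc A b c u s' e' \<longrightarrow> s' = s \<and> e' = e)"

text \<open>Maximality refers to the whole real line, and the period \<open>[\<tau> 0, \<tau> 0 + T]\<close> may start at any
  switching time \<open>\<tau> 0\<close>: this is what makes the count cyclic.\<close>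

definition formed_by_bang_arcs ::
    "real ^ 'n ^ 'n \<Rightarrow> real ^ 'n \<Rightarrow> real ^ 'n \<Rightarrow> (real \<Rightarrow> real) \<Rightarrow> real \<Rightarrow> nat \<Rightarrow> bool"
  where "formed_by_bang_arcs A b c u T k \<longleftrightarrow>
    (\<exists>\<tau> :: nat \<Rightarrow> real. \<tau> k = \<tau> 0 + T \<and>
       (\<forall>i<k. maximal_bang_arc A b c u (\<tau> i) (\<tau> (Suc i))))"

end

theory Submission
  imports Defs
begin

text \<open>Because \<open>\<rho> = 0\<close> and the controllability conditions make the system irreducible, there is a norm
  \<open>v\<close> that does not increase along bang arcs; it is constant along the periodic orbit \<open>x\<close>. Unless the
  period map fixes only the line through \<open>x\<close>, perturbing the switching times would make \<open>v\<close> grow; so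
  \<open>l\<close> is, up to a positive factor, the unique supporting functional of the unit ball of \<open>v\<close> transported
  along the orbit. Comparing supporting functionals at a self-intersection shows that \<open>x\<close> is a Jordan
  curve on the sphere of \<open>v\<close>, and the same holds for \<open>l\<close> with respect to the dual norm.

  The plane \<open>c \<bullet> x = 0\<close> cuts the sphere into two discs. Inside each disc the arcs of \<open>x\<close> are disjoint,
  hence nested, and monotonicity of the crossing points forces exactly two zeros of \<open>c \<bullet> x\<close> per period,
  both transversal. The same is true of \<open>b \<bullet> l\<close>. Their product changes sign at the zeros that the two
  factors do not share: four times per period without a common zero, otherwise twice, since a control
  of constant sign would make all points of the orbit fixed by the period map.\<close>

text \<open>The extremal norm \<open>v\<close> need be neither smooth nor strictly convex, so a
  point of the orbit may have several supporting functionals. The comparison at a self-intersection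
  therefore relies only on the sign of \<open>b \<bullet> \<eta>\<close>, which contraction under
  the opposite control forces on every support \<open>\<eta>\<close>. The sphere of \<open>v\<close>
  is replaced by the rays through \<open>(c \<bullet> x, c \<bullet> (A *v x), c \<bullet> (A *v (A
  *v x)))\<close>, projected stereographically to the plane, where a crossing theorem for arcs in a
  half-plane does the work of the Jordan curve theorem. These numbers are coordinates by
  observability, and at a zero of \<open>c \<bullet> x\<close> they determine the one-sided signs
  although \<open>u\<close> is only measurable, because the control term carries the factor
  \<open>c \<bullet> x\<close>. The hard case of the perturbation argument is a two-dimensional
  fixed space on which the compressed generator rotates: lengthening and shortening an arc does not
  exclude it, and a short pulse of the opposite control is needed as well.\<close>

section \<open>A mean value inequality for almost everywhere derivatives\<close>

lemma ac_mean_value_bound: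
  fixes f :: "real \<Rightarrow> 'a::real_normed_vector"
  assumes ac: "absolutely_continuous_on {a..b} f" and "a \<le> b" and "0 \<le> K"
    and der: "AE t in lebesgue. t \<in> {a..b} \<longrightarrow>
      (\<exists>D. (f has_vector_derivative D) (at t within {a..b}) \<and> norm D \<le> K)"
  shows "norm (f b - f a) \<le> K * (b - a)"
proof -
  \<comment> \<open>Cousin's lemma replaces integration. A fine tagged division splits into
    intervals tagged in the null set \<open>N\<close>, whose total length is below the
    \<open>d\<close> of absolute continuity because they lie in the thin open set \<open>U\<close>,
    and intervals at whose tag \<open>f\<close> is differentiable. The two groups contribute at most
    \<open>e\<close> and \<open>(K + e) * (b - a)\<close>.\<close>
  have key: "norm (f b - f a) \<le> (K + e) * (b - a) + e" if "e > 0" for e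
  proof -
    obtain N where N: "N \<in> null_sets lebesgue"
      "\<And>t. t \<in> {a..b} \<Longrightarrow> t \<notin> N \<Longrightarrow>
         \<exists>D. (f has_vector_derivative D) (at t within {a..b}) \<and> norm D \<le> K"
      using der unfolding eventually_ae_filter by (auto simp: subset_iff) blast
    obtain d where "d > 0" and d: "\<And>D. D division_of \<Union>D \<Longrightarrow> \<Union>D \<subseteq> {a..b} \<Longrightarrow>
        (\<Sum>K\<in>D. Sup K - Inf K) < d \<Longrightarrow> (\<Sum>K\<in>D. norm (f (Sup K) - f (Inf K))) < e"
      using ac \<open>e > 0\<close> unfolding absolutely_continuous_on_def by meson
    have Nl: "N \<in> sets lebesgue" using N(1) by auto
    obtain U where U: "open U" "N \<subseteq> U" "(U - N) \<in> lmeasurable" "emeasure lebesgue (U - N) < ennreal d"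
      using sets_lebesgue_outer_open[OF Nl \<open>d > 0\<close>] by blast
    have eU: "emeasure lebesgue U < ennreal d"
    proof -
      have "emeasure lebesgue U = emeasure lebesgue (U - N)"
        using emeasure_Diff_null_set[OF N(1), of U] U(1) by (simp add: borel_open)
      then show ?thesis using U(4) by simp
    qed
    have "\<exists>r>0. (t \<in> N \<longrightarrow> ball t r \<subseteq> U) \<and> (t \<in> {a..b} - N \<longrightarrow>
        (\<forall>y\<in>ball t r \<inter> {a..b}. norm (f y - f t) \<le> (K + e) * \<bar>y - t\<bar>))" for t
    proof (cases "t \<in> N")
      case True
      then show ?thesis using U(1,2) open_contains_ball by blast
    next
      case False
      show ?thesis
      proof (cases "t \<in> {a..b}")
        case True
        then obtain D where D: "(f has_vector_derivative D) (at t within {a..b})" "norm D \<le> K"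
          using N(2) False by blast
        from D(1) \<open>e > 0\<close> obtain r where r: "r > 0" "\<And>y. y \<in> {a..b} \<Longrightarrow> norm (y - t) < r \<Longrightarrow>
            norm (f y - f t - (y - t) *\<^sub>R D) \<le> e * norm (y - t)"
          unfolding has_vector_derivative_def has_derivative_within_alt by blast
        have "norm (f y - f t) \<le> (K + e) * \<bar>y - t\<bar>" if "y \<in> ball t r \<inter> {a..b}" for y
        proof -
          have y: "y \<in> {a..b}" "norm (y - t) < r" using that by (auto simp: dist_real_def)
          have "norm (f y - f t) \<le> norm (f y - f t - (y - t) *\<^sub>R D) + norm ((y - t) *\<^sub>R D)"
            by (metis diff_add_cancel norm_triangle_ineq)
          also have "\<dots> \<le> e * \<bar>y - t\<bar> + \<bar>y - t\<bar> * K"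
            using r(2)[OF y] D(2) by (auto intro!: add_mono mult_left_mono)
          finally show ?thesis by (simp add: algebra_simps)
        qed
        then show ?thesis using r(1) False by blast
      qed (use False in \<open>auto intro: exI[of _ 1]\<close>)
    qed
    then obtain r where r: "\<And>t. r t > 0" "\<And>t. t \<in> N \<Longrightarrow> ball t (r t) \<subseteq> U"
      "\<And>t y. t \<in> {a..b} - N \<Longrightarrow> y \<in> ball t (r t) \<inter> {a..b} \<Longrightarrow> norm (f y - f t) \<le> (K + e) * \<bar>y - t\<bar>"
      by metis
    have "gauge (\<lambda>t. ball t (r t))" using r(1) by (auto simp: gauge_def)
    then obtain p where p: "p tagged_division_of {a..b}" "(\<lambda>t. ball t (r t)) fine p"
      using fine_division_exists_real by blast
    let ?F = "\<lambda>K. f (Sup K) - f (Inf K)"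
    let ?p1 = "{q\<in>p. fst q \<in> N}" and ?p2 = "{q\<in>p. fst q \<notin> N}"
    have fin: "finite p" using p(1) by blast
    have tele: "(\<Sum>(t,k)\<in>p. ?F k) = f b - f a"
      using additive_tagged_division_1[OF \<open>a \<le> b\<close> p(1), of f] by simp
    have form: "\<exists>s u. k = {s..u} \<and> s \<le> u \<and> t \<in> {s..u} \<and> {s..u} \<subseteq> {a..b} \<and> {s..u} \<subseteq> ball t (r t)"
      if tk: "(t,k) \<in> p" for t k
    proof -
      obtain s u where k: "k = cbox s u" using tagged_division_ofD(4)[OF p(1) tk] by blast
      moreover have "t \<in> k" "k \<subseteq> {a..b}" using tagged_division_ofD(2,3)[OF p(1) tk] by auto
      moreover have "k \<subseteq> ball t (r t)" using p(2) tk by (auto simp: fine_def)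
      ultimately show ?thesis by (intro exI[of _ s] exI[of _ u]) auto
    qed
    have len: "(\<Sum>(t,k)\<in>p. Sup k - Inf k) = b - a"
      using additive_tagged_division_1[OF \<open>a \<le> b\<close> p(1), of "\<lambda>x. x"] by simp
    have nn: "0 \<le> Sup k - Inf k" if "(t,k) \<in> p" for t k
      using form[OF that] by auto
    have s2: "(\<Sum>(t,k)\<in>?p2. norm (?F k)) \<le> (K + e) * (b - a)"
    proof -
      have "(\<Sum>(t,k)\<in>?p2. norm (?F k)) \<le> (\<Sum>(t,k)\<in>?p2. (K + e) * (Sup k - Inf k))"
      proof (rule sum_mono, clarify)
        fix t k assume tk: "(t,k) \<in> p" "fst (t,k) \<notin> N"
        then obtain s u where k: "k = {s..u}" "s \<le> u" "t \<in> {s..u}" "{s..u} \<subseteq> {a..b}" "{s..u} \<subseteq> ball t (r t)"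
          using form by blast
        have "t \<in> {a..b} - N" using k tk by auto
        then have "norm (f u - f t) \<le> (K + e) * \<bar>u - t\<bar>" "norm (f s - f t) \<le> (K + e) * \<bar>s - t\<bar>"
          using r(3)[of t u] r(3)[of t s] k by (auto simp: subset_iff)
        moreover have "norm (f u - f s) \<le> norm (f u - f t) + norm (f s - f t)"
          by (metis norm_triangle_ineq4 diff_diff_eq2 add.commute diff_add_cancel)
        ultimately show "norm (?F k) \<le> (K + e) * (Sup k - Inf k)"
          using k by (auto simp: algebra_simps)
      qed
      also have "\<dots> \<le> (\<Sum>(t,k)\<in>p. (K + e) * (Sup k - Inf k))"
        by (rule sum_mono2) (use fin nn \<open>e > 0\<close> \<open>0 \<le> K\<close> in auto)
      also have "\<dots> = (K + e) * (b - a)"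
        using len by (simp add: sum_distrib_left[symmetric] case_prod_unfold)
      finally show ?thesis .
    qed
    have nonempty: "k \<noteq> {}" if "k \<in> snd ` ?p1" for k
      using that form by fastforce
    \<comment> \<open>An interval that occurs with two tags has empty interior, so it is a
      singleton, where \<open>h\<close> vanishes; hence the sum over tagged pairs equals the sum
      over intervals. The value \<open>h {}\<close> is uncontrolled, as it involves
      \<open>Sup {}\<close>, and \<open>?h\<close> overrides it by 0.\<close>
    have over: "(\<Sum>(t,k)\<in>?p1. h k) = (\<Sum>k\<in>snd ` ?p1. h k)" if "\<And>u. h {u} = 0" for h :: "real set \<Rightarrow> real"
    proof -
      let ?h = "\<lambda>k. if k = {} then 0 else h k"
      have pp: "?p1 tagged_partial_division_of {a..b}"
        by (rule tagged_partial_division_subset[of p]) (use p(1) in \<open>auto simp: tagged_division_of_def\<close>)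
      have "(\<Sum>(t,k)\<in>?p1. ?h k) = (\<Sum>k\<in>snd ` ?p1. ?h k)"
        by (rule sum.over_tagged_division_lemma[OF tagged_partial_division_of_Union_self[OF pp]])
          (use that in \<open>auto simp: box_eq_empty not_less order_le_less\<close>)
      moreover have "(\<Sum>(t,k)\<in>?p1. ?h k) = (\<Sum>(t,k)\<in>?p1. h k)"
        by (rule sum.cong) (use nonempty in force)+
      moreover have "(\<Sum>k\<in>snd ` ?p1. ?h k) = (\<Sum>k\<in>snd ` ?p1. h k)"
        by (rule sum.cong) (use nonempty in auto)
      ultimately show ?thesis by simp
    qed
    have s1: "(\<Sum>(t,k)\<in>?p1. norm (?F k)) \<le> e"
    proof -
      let ?D = "snd ` ?p1"
      have pp: "?p1 tagged_partial_division_of {a..b}"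
        by (rule tagged_partial_division_subset[of p]) (use p(1) in \<open>auto simp: tagged_division_of_def\<close>)
      have Ddiv: "?D division_of \<Union>?D"
        using partial_division_of_tagged_division[OF pp] by simp
      have "(\<Sum>(t,k)\<in>?p1. Sup k - Inf k) = (\<Sum>k\<in>?D. Sup k - Inf k)"
        by (rule over) simp
      moreover have "(\<Sum>k\<in>?D. Sup k - Inf k) < d"
      proof -
        have Dlen: "Sup k - Inf k = measure lebesgue k" if kD: "k \<in> ?D" for k
        proof -
          obtain t where "(t, k) \<in> p" using kD by auto
          from form[OF this] show ?thesis by auto
        qed
        have "(\<Sum>k\<in>?D. Sup k - Inf k) = (\<Sum>k\<in>?D. measure lebesgue k)"
          by (rule sum.cong[OF refl Dlen])
        also have "\<dots> = measure lebesgue (\<Union>?D)"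
          using content_division[OF Ddiv] by (simp add: )
        also have "\<dots> < d"
        proof -
          have "\<Union>?D \<subseteq> U" using form r(2) by fastforce
          then have "emeasure lebesgue (\<Union>?D) \<le> emeasure lebesgue U"
            by (rule emeasure_mono) (use U(1) in \<open>simp add: borel_open\<close>)
          then have "emeasure lebesgue (\<Union>?D) < ennreal d" using eU by simp
          moreover from this have "emeasure lebesgue (\<Union>?D) = ennreal (measure lebesgue (\<Union>?D))"
            by (intro emeasure_eq_ennreal_measure) auto
          ultimately show ?thesis by (simp add: ennreal_less_iff)
        qed
        finally show ?thesis .
      qed
      moreover have "\<Union>?D \<subseteq> {a..b}" using form by fastforce
      ultimately have "(\<Sum>k\<in>?D. norm (?F k)) < e" using d[OF Ddiv] by simp
      moreover have "(\<Sum>(t,k)\<in>?p1. norm (?F k)) = (\<Sum>k\<in>?D. norm (?F k))"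
        by (rule over) simp
      ultimately show ?thesis by simp
    qed
    have "norm (f b - f a) \<le> (\<Sum>(t,k)\<in>p. norm (?F k))"
      unfolding tele[symmetric] case_prod_unfold by (rule norm_sum)
    also have "\<dots> = (\<Sum>(t,k)\<in>?p1. norm (?F k)) + (\<Sum>(t,k)\<in>?p2. norm (?F k))"
    proof -
      have "p = ?p1 \<union> ?p2" by auto
      moreover have "?p1 \<inter> ?p2 = {}" by auto
      ultimately show ?thesis using fin
        by (metis (no_types, lifting) finite_Un sum.union_disjoint)
    qed
    finally show ?thesis using s1 s2 by linarith
  qed
  have "(\<lambda>e. (K + e) * (b - a) + e) \<midarrow>0\<rightarrow> (K + 0) * (b - a) + 0" by (intro tendsto_intros)
  then have "((\<lambda>e. (K + e) * (b - a) + e) \<longlongrightarrow> K * (b - a)) (at_right 0)"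
    by (simp add: filterlim_at_split)
  then show ?thesis
    by (rule tendsto_lowerbound) (auto simp: eventually_at_right_less key intro!: eventually_at_rightI[of 0 1])
qed

section \<open>The matrix exponential\<close>

definition mpow :: "real^'n^'n \<Rightarrow> nat \<Rightarrow> real^'n^'n" where
  "mpow M n = (((**) M) ^^ n) (mat 1)"

text \<open>The exponential of \<open>h\<close> times \<open>M\<close>, written entry by entry as a
  scalar power series in \<open>h\<close>, to which termwise differentiation applies
  directly.\<close>

definition mexp :: "real^'n^'n \<Rightarrow> real \<Rightarrow> real^'n^'n" where
  "mexp M h = (\<chi> i j. \<Sum>n. mpow M n $ i $ j / fact n * h ^ n)"

lemma mpow_0 [simp]: "mpow M 0 = mat 1" and mpow_Suc: "mpow M (Suc n) = M ** mpow M n"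
  by (simp_all add: mpow_def)

lemma mpow_commute: "mpow M n ** M = M ** mpow M n"
  by (induction n) (simp_all add: mpow_Suc matrix_mul_assoc[symmetric])

lemma transpose_mpow: "transpose (mpow M n) = mpow (transpose M) n"
  by (induction n) (simp_all add: mpow_Suc matrix_transpose_mul mpow_commute transpose_mat)

text \<open>The sum of all absolute entries dominates every row sum, so its powers majorise the
  entries of the matrix powers and an exponential series majorises \<open>mexp\<close>.\<close>

lemma mpow_bound: "\<bar>mpow M n $ i $ j\<bar> \<le> (\<Sum>i\<in>UNIV. \<Sum>j\<in>UNIV. \<bar>M $ i $ j\<bar>) ^ n"
proof (induction n arbitrary: i j)
  case 0
  then show ?case by (simp add: mat_def)
next
  case (Suc n)
  let ?K = "\<Sum>i\<in>UNIV. \<Sum>j\<in>UNIV. \<bar>M $ i $ j\<bar>"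
  have "\<bar>mpow M (Suc n) $ i $ j\<bar> \<le> (\<Sum>k\<in>UNIV. \<bar>M $ i $ k\<bar> * \<bar>mpow M n $ k $ j\<bar>)"
    unfolding mpow_Suc matrix_matrix_mult_def by (simp add: order_trans[OF sum_abs] abs_mult)
  also have "\<dots> \<le> (\<Sum>k\<in>UNIV. \<bar>M $ i $ k\<bar> * ?K ^ n)"
    by (intro sum_mono mult_left_mono Suc.IH) auto
  also have "\<dots> = (\<Sum>k\<in>UNIV. \<bar>M $ i $ k\<bar>) * ?K ^ n" by (simp add: sum_distrib_right)
  also have "\<dots> \<le> ?K * ?K ^ n"
    by (intro mult_right_mono member_le_sum[of i UNIV "\<lambda>i. \<Sum>j\<in>UNIV. \<bar>M $ i $ j\<bar>"])
      (auto intro!: sum_nonneg zero_le_power)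
  finally show ?case by simp
qed

lemma summable_mexp: "summable (\<lambda>n. mpow M n $ i $ j / fact n * h ^ n)"
proof (rule summable_comparison_test)
  let ?K = "\<Sum>i\<in>UNIV. \<Sum>j\<in>UNIV. \<bar>M $ i $ j\<bar>"
  show "summable (\<lambda>n. (?K * \<bar>h\<bar>) ^ n /\<^sub>R fact n)" by (rule summable_exp_generic)
  show "\<exists>N. \<forall>n\<ge>N. norm (mpow M n $ i $ j / fact n * h ^ n) \<le> (?K * \<bar>h\<bar>) ^ n /\<^sub>R fact n"
    by (auto simp: abs_mult power_abs power_mult_distrib divide_simps intro!: mult_right_mono mpow_bound)
qed

lemma mexp_sums: "(\<lambda>n. mpow M n $ i $ j / fact n * h ^ n) sums (mexp M h $ i $ j)"
  unfolding mexp_def vec_lambda_beta by (rule summable_sums[OF summable_mexp])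

lemma mexp_mult_sums: "(\<lambda>n. (M ** mpow M n) $ i $ j / fact n * h ^ n) sums ((M ** mexp M h) $ i $ j)"
proof -
  have "(\<lambda>n. \<Sum>k\<in>UNIV. M $ i $ k * (mpow M n $ k $ j / fact n * h ^ n)) sums
     (\<Sum>k\<in>UNIV. M $ i $ k * mexp M h $ k $ j)"
    by (intro sums_sum sums_mult mexp_sums)
  then show ?thesis
    by (simp add: matrix_matrix_mult_def sum_distrib_left sum_divide_distrib mult_ac)
qed

lemma mexp_commute: "mexp M h ** M = M ** mexp M h"
proof -
  have "(\<lambda>n. (mpow M n ** M) $ i $ j / fact n * h ^ n) sums ((mexp M h ** M) $ i $ j)" for i j
  proof -
    have "(\<lambda>n. \<Sum>k\<in>UNIV. (mpow M n $ i $ k / fact n * h ^ n) * M $ k $ j) sums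
       (\<Sum>k\<in>UNIV. mexp M h $ i $ k * M $ k $ j)"
      by (intro sums_sum sums_mult2 mexp_sums)
    then show ?thesis
      by (simp add: matrix_matrix_mult_def sum_distrib_left sum_divide_distrib mult_ac)
  qed
  then show ?thesis
    using mexp_mult_sums[of M _ _ h] unfolding vec_eq_iff mpow_commute by (blast intro: sums_unique2)
qed

lemma transpose_mexp: "transpose (mexp M h) = mexp (transpose M) h"
proof -
  have "mpow (transpose M) n $ i $ j = mpow M n $ j $ i" for n i j
    unfolding transpose_mpow[symmetric] by (simp add: transpose_def)
  then show ?thesis by (simp add: vec_eq_iff mexp_def transpose_def)
qed

lemma mexp_0 [simp]: "mexp M 0 = mat 1"
proof -
  have "mexp M 0 $ i $ j = mpow M 0 $ i $ j / fact 0" for i j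
    using powser_zero[of "\<lambda>n. mpow M n $ i $ j / fact n"] by (simp add: mexp_def)
  then show ?thesis by (simp add: vec_eq_iff)
qed

lemma mexp_component_deriv:
  "((\<lambda>h. mexp M h $ i $ j) has_real_derivative (M ** mexp M h) $ i $ j) (at h within S)"
proof -
  let ?c = "\<lambda>n. mpow M n $ i $ j / fact n"
  have "((\<lambda>h. \<Sum>n. ?c n * h ^ n) has_field_derivative (\<Sum>n. diffs ?c n * h ^ n)) (at h)"
    by (rule termdiffs_strong_converges_everywhere) (rule summable_mexp)
  moreover have "diffs ?c n = (M ** mpow M n) $ i $ j / fact n" for n
    by (simp add: diffs_def mpow_Suc field_simps del: of_nat_Suc)
  ultimately show ?thesis
    using sums_unique[OF mexp_mult_sums[of M i j h]]
    by (simp add: mexp_def has_field_derivative_at_within)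
qed

lemma has_vector_derivative_cart:
  fixes f :: "real \<Rightarrow> real^'n"
  shows "(f has_vector_derivative D) (at t within S) \<longleftrightarrow>
    (\<forall>i. ((\<lambda>t. f t $ i) has_real_derivative D $ i) (at t within S))"
  unfolding has_vector_derivative_def has_field_derivative_def
  by (subst has_derivative_componentwise_within)
    (auto simp: Basis_vec_def inner_axis mult.commute[of _ "D $ _"] mult_commute_abs)

lemma has_vector_derivative_matrix_vector_mult:
  fixes P :: "real \<Rightarrow> real^'n^'m" and w :: "real \<Rightarrow> real^'n"
  assumes "\<And>i j. ((\<lambda>t. P t $ i $ j) has_real_derivative P' $ i $ j) (at t within S)"
    and "(w has_vector_derivative w') (at t within S)"
  shows "((\<lambda>t. P t *v w t) has_vector_derivative P' *v w t + P t *v w') (at t within S)"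
  unfolding has_vector_derivative_cart
proof
  fix i
  have w: "((\<lambda>t. w t $ j) has_real_derivative w' $ j) (at t within S)" for j
    using assms(2) by (simp add: has_vector_derivative_cart)
  show "((\<lambda>t. (P t *v w t) $ i) has_real_derivative (P' *v w t + P t *v w') $ i) (at t within S)"
    unfolding matrix_vector_mult_def
    by (simp add: sum.distrib[symmetric], rule DERIV_sum)
      (rule DERIV_cong[OF DERIV_mult[OF assms(1) w]], simp)
qed

lemma mexp_deriv:
  "((\<lambda>h. mexp M h *v y) has_vector_derivative M *v (mexp M h *v y)) (at h within S)"
proof -
  have "((\<lambda>h. mexp M h *v y) has_vector_derivative (M ** mexp M h) *v y + mexp M h *v 0) (at h within S)"
    by (rule has_vector_derivative_matrix_vector_mult[OF mexp_component_deriv has_vector_derivative_const])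
  then show ?thesis by (simp add: matrix_vector_mul_assoc)
qed

lemma mexp_deriv':
  assumes "(g has_real_derivative g') (at t within S)"
  shows "((\<lambda>t. mexp M (g t) *v y) has_vector_derivative g' *\<^sub>R (M *v (mexp M (g t) *v y))) (at t within S)"
  using vector_diff_chain_within[OF assms[unfolded has_real_derivative_iff_has_vector_derivative] mexp_deriv]
  by (simp add: o_def)

text \<open>Variation of constants: only the defect \<open>w' - M *v w t\<close> moves the
  transformed curve.\<close>

lemma mexp_uminus_mult_deriv:
  assumes w: "(w has_vector_derivative w') (at t within S)"
  shows "((\<lambda>t. mexp M (- t) *v w t) has_vector_derivative mexp M (- t) *v (w' - M *v w t)) (at t within S)"
proof -
  have "((\<lambda>t. mexp M (- t) $ i $ j) has_real_derivative (- (M ** mexp M (- t))) $ i $ j) (at t within S)" for i j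
  proof -
    have "((\<lambda>t. mexp M (- t) $ i $ j) has_real_derivative (M ** mexp M (- t)) $ i $ j * (- 1)) (at t within S)"
      by (rule DERIV_chain2[OF mexp_component_deriv]) (auto intro!: derivative_eq_intros)
    then show ?thesis by simp
  qed
  from has_vector_derivative_matrix_vector_mult[OF this w]
  have "((\<lambda>t. mexp M (- t) *v w t) has_vector_derivative
     (- (M ** mexp M (- t))) *v w t + mexp M (- t) *v w') (at t within S)" .
  moreover have "(- (M ** mexp M (- t))) *v w t + mexp M (- t) *v w' = mexp M (- t) *v (w' - M *v w t)"
    by (simp add: matrix_vector_mult_diff_distrib matrix_vector_mul_assoc mexp_commute)
      (simp add: matrix_vector_mult_def vec_eq_iff sum_negf)
  ultimately show ?thesis by simp
qed

text \<open>The left side has zero derivative in \<open>h\<close> and equals the right side at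
  \<open>h = 0\<close>. Inversion and the group law follow from this without multiplying
  series.\<close>

lemma mexp_uminus_mexp_add: "mexp M (- h) *v (mexp M (h + k) *v y) = mexp M k *v y"
proof -
  let ?z = "\<lambda>h. mexp M (- h) *v (mexp M (h + k) *v y)"
  have "(?z has_vector_derivative 0) (at h within UNIV)" for h
  proof -
    have "((\<lambda>h. mexp M (h + k) *v y) has_vector_derivative 1 *\<^sub>R (M *v (mexp M (h + k) *v y))) (at h within UNIV)"
      by (rule mexp_deriv') (auto intro!: derivative_eq_intros)
    from mexp_uminus_mult_deriv[OF this, of M] show ?thesis by simp
  qed
  then obtain c where "\<And>h. ?z h = c"
    using has_vector_derivative_zero_constant[of UNIV ?z] by auto
  from this[of h] this[of 0] show ?thesis by simp
qed

lemma mexp_cancel [simp]: "mexp M (- h) *v (mexp M h *v y) = y" "mexp M h *v (mexp M (- h) *v y) = y"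
  using mexp_uminus_mexp_add[of M h 0 y] mexp_uminus_mexp_add[of M "- h" 0 y] by simp_all

lemma mexp_add: "mexp M (h + k) *v y = mexp M h *v (mexp M k *v y)"
  by (metis mexp_uminus_mexp_add mexp_cancel(2))

lemma mexp_commute_vec: "M *v (mexp M h *v y) = mexp M h *v (M *v y)"
  by (simp add: matrix_vector_mul_assoc mexp_commute)

lemma mexp_eq_0_iff [simp]: "mexp M h *v y = 0 \<longleftrightarrow> y = 0"
  by (metis mexp_cancel(1) matrix_vector_mult_0_right)

lemma inner_mexp: "y \<bullet> (mexp M h *v z) = (mexp (transpose M) h *v y) \<bullet> z"
  by (metis dot_lmul_matrix transpose_mexp matrix_transpose_mul transpose_transpose vector_transpose_matrix)

lemma continuous_on_mexp [continuous_intros]: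
  "continuous_on S g \<Longrightarrow> continuous_on S (\<lambda>t. mexp M (g t) *v y)"
proof -
  have "continuous_on UNIV (\<lambda>h. mexp M h *v y)"
    by (rule continuous_on_vector_derivative) (rule mexp_deriv)
  then show "continuous_on S g \<Longrightarrow> ?thesis" 
    by (rule continuous_on_compose2) auto
qed

section \<open>Absolutely continuous functions: comparison, uniqueness, signs near zeros\<close>

lemma ac_dominated:
  fixes f :: "real \<Rightarrow> 'a::real_normed_vector" and g :: "real \<Rightarrow> 'b::real_normed_vector"
  assumes ac: "absolutely_continuous_on {a..b} f" and "0 \<le> C"
    and dom: "\<And>s u. a \<le> s \<Longrightarrow> s \<le> u \<Longrightarrow> u \<le> b \<Longrightarrow> norm (g u - g s) \<le> C * (norm (f u - f s) + (u - s))"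
  shows "absolutely_continuous_on {a..b} g"
  unfolding absolutely_continuous_on_def
proof (intro allI impI)
  fix e :: real assume "e > 0"
  \<comment> \<open>The factor 2 pays for the two terms of the bound, increments of \<open>f\<close>
    and lengths; \<open>C + 1\<close> avoids division by zero and makes the final inequality
    strict.\<close>
  define e' where "e' = e / (2 * (C + 1))"
  have "e' > 0" using \<open>e > 0\<close> \<open>0 \<le> C\<close> by (simp add: e'_def)
  then obtain d where "d > 0" and d: "\<And>D. D division_of \<Union>D \<Longrightarrow> \<Union>D \<subseteq> {a..b} \<Longrightarrow>
        (\<Sum>K\<in>D. Sup K - Inf K) < d \<Longrightarrow> (\<Sum>K\<in>D. norm (f (Sup K) - f (Inf K))) < e'"
    using ac unfolding absolutely_continuous_on_def by meson
  show "\<exists>d>0. \<forall>D. D division_of \<Union>D \<and> \<Union>D \<subseteq> {a..b} \<and> (\<Sum>K\<in>D. Sup K - Inf K) < d \<longrightarrow>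
       (\<Sum>K\<in>D. norm (g (Sup K) - g (Inf K))) < e"
  proof (intro exI[of _ "min d e'"] conjI allI impI)
    fix D assume D: "D division_of \<Union>D \<and> \<Union>D \<subseteq> {a..b} \<and> (\<Sum>K\<in>D. Sup K - Inf K) < min d e'"
    have "(\<Sum>K\<in>D. norm (g (Sup K) - g (Inf K)))
        \<le> (\<Sum>K\<in>D. C * (norm (f (Sup K) - f (Inf K)) + (Sup K - Inf K)))"
    proof (rule sum_mono)
      fix K assume K: "K \<in> D"
      then obtain s u where su: "K = cbox s u" "K \<noteq> {}" "K \<subseteq> \<Union>D"
        using D division_ofD(2-4)[of D "\<Union>D"] by metis
      then have "K = {s..u}" "s \<le> u" by auto
      moreover from this have "{s..u} \<subseteq> {a..b}" using D su(3) by blast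
      ultimately have "K = {s..u}" "s \<le> u" "a \<le> s" "u \<le> b" by auto
      then show "norm (g (Sup K) - g (Inf K)) \<le> C * (norm (f (Sup K) - f (Inf K)) + (Sup K - Inf K))"
        using dom[of s u] by simp
    qed
    also have "\<dots> = C * ((\<Sum>K\<in>D. norm (f (Sup K) - f (Inf K))) + (\<Sum>K\<in>D. Sup K - Inf K))"
      by (simp add: sum_distrib_left[symmetric] sum.distrib)
    also have "\<dots> \<le> C * (e' + e')"
      using d[of D] D \<open>0 \<le> C\<close> by (intro mult_left_mono add_mono) auto
    also have "\<dots> = e * (C / (C + 1))"
    proof -
      have "e' + e' = e / (C + 1)" using \<open>0 \<le> C\<close> by (simp add: e'_def divide_simps)
      then show ?thesis by simp
    qed
    also have "\<dots> < e * 1"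
      using \<open>e > 0\<close> \<open>0 \<le> C\<close> by (intro mult_strict_left_mono) auto
    also have "\<dots> = e" by simp
    finally show "(\<Sum>K\<in>D. norm (g (Sup K) - g (Inf K))) < e" .
  qed (use \<open>d > 0\<close> \<open>e' > 0\<close> in auto)
qed

lemma ac_subset:
  "absolutely_continuous_on S f \<Longrightarrow> T \<subseteq> S \<Longrightarrow> absolutely_continuous_on T f"
  unfolding absolutely_continuous_on_def by (meson order_trans)

lemma ac_imp_continuous:
  fixes f :: "real \<Rightarrow> 'a::real_normed_vector"
  assumes ac: "absolutely_continuous_on {a..b} f"
  shows "continuous_on {a..b} f"
  unfolding continuous_on_iff
proof (intro ballI allI impI)
  fix t e :: real assume "t \<in> {a..b}" "e > 0"
  obtain d where "d > 0" and d: "\<And>D. D division_of \<Union>D \<Longrightarrow> \<Union>D \<subseteq> {a..b} \<Longrightarrow>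
        (\<Sum>K\<in>D. Sup K - Inf K) < d \<Longrightarrow> (\<Sum>K\<in>D. norm (f (Sup K) - f (Inf K))) < e"
    using ac \<open>e > 0\<close> unfolding absolutely_continuous_on_def by meson
  have *: "norm (f u - f s) < e" if "a \<le> s" "s \<le> u" "u \<le> b" "u - s < d" for s u
    using d[of "{{s..u}}"] that division_of_self[of s u] by (simp add: box_real)
  show "\<exists>d>0. \<forall>s\<in>{a..b}. dist s t < d \<longrightarrow> dist (f s) (f t) < e"
  proof (intro exI[of _ d] conjI ballI impI)
    fix s assume "s \<in> {a..b}" "dist s t < d"
    then show "dist (f s) (f t) < e"
      using *[of s t] *[of t s] \<open>t \<in> {a..b}\<close>
      by (cases "s \<le> t") (auto simp: dist_norm norm_minus_commute)
  qed (rule \<open>d > 0\<close>)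
qed

lemma lipschitz_imp_ac:
  fixes g :: "real \<Rightarrow> 'b::real_normed_vector"
  assumes "0 \<le> C" and "\<And>s u. a \<le> s \<Longrightarrow> s \<le> u \<Longrightarrow> u \<le> b \<Longrightarrow> norm (g u - g s) \<le> C * (u - s)"
  shows "absolutely_continuous_on {a..b} g"
proof (rule ac_dominated)
  show "absolutely_continuous_on {a..b} (\<lambda>t. 0::real)"
    unfolding absolutely_continuous_on_def by (auto intro: exI[of _ 1])
qed (use assms in auto)

text \<open>Subtracting the line of slope \<open>(m + M) / 2\<close> turns the two-sided bound into
  a norm bound by \<open>(M - m) / 2\<close>.\<close>

lemma ac_mean_value_between:
  fixes f :: "real \<Rightarrow> real"
  assumes ac: "absolutely_continuous_on {a..b} f" and "a \<le> b" and "m \<le> M"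
    and der: "AE t in lebesgue. t \<in> {a..b} \<longrightarrow>
      (f has_real_derivative D t) (at t within {a..b}) \<and> m \<le> D t \<and> D t \<le> M"
  shows "m * (b - a) \<le> f b - f a" and "f b - f a \<le> M * (b - a)"
proof -
  define g where "g t = f t - (m + M) / 2 * t" for t
  have "absolutely_continuous_on {a..b} g"
  proof (rule ac_dominated[OF ac, of "1 + \<bar>(m + M) / 2\<bar>"])
    fix s u :: real assume "a \<le> s" "s \<le> u" "u \<le> b"
    have "norm (g u - g s) = \<bar>(f u - f s) - (m + M) / 2 * (u - s)\<bar>"
      by (simp add: g_def algebra_simps add_divide_distrib diff_divide_distrib)
    also have "\<dots> \<le> \<bar>f u - f s\<bar> + \<bar>(m + M) / 2\<bar> * (u - s)"
      using \<open>s \<le> u\<close> by (intro order_trans[OF abs_triangle_ineq4]) (simp add: abs_mult)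
    also have "\<dots> \<le> (1 + \<bar>(m + M) / 2\<bar>) * (norm (f u - f s) + (u - s))"
    proof -
      have *: "X + k * Y \<le> (1 + k) * (X + Y)" if "0 \<le> X" "0 \<le> Y" "0 \<le> k" for X Y k :: real
        using mult_nonneg_nonneg[OF that(3,1)] that by (simp add: algebra_simps)
      show ?thesis using *[of "\<bar>f u - f s\<bar>" "u - s" "\<bar>(m + M) / 2\<bar>"] \<open>s \<le> u\<close> by simp
    qed
    finally show "norm (g u - g s) \<le> \<dots>" .
  qed simp
  moreover have "AE t in lebesgue. t \<in> {a..b} \<longrightarrow>
      (\<exists>D. (g has_vector_derivative D) (at t within {a..b}) \<and> norm D \<le> (M - m) / 2)"
    using der
  proof eventually_elim
    case (elim t)
    show ?case
    proof
      assume "t \<in> {a..b}"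
      with elim have "(g has_real_derivative D t - (m + M) / 2) (at t within {a..b})"
        unfolding g_def by (auto intro!: derivative_eq_intros)
      then show "\<exists>D. (g has_vector_derivative D) (at t within {a..b}) \<and> norm D \<le> (M - m) / 2"
        using elim \<open>t \<in> {a..b}\<close>
        by (intro exI[of _ "D t - (m + M) / 2"]) (auto simp: has_real_derivative_iff_has_vector_derivative abs_le_iff field_simps)
    qed
  qed
  ultimately have "norm (g b - g a) \<le> (M - m) / 2 * (b - a)"
    using \<open>a \<le> b\<close> \<open>m \<le> M\<close> by (intro ac_mean_value_bound) auto
  then show "m * (b - a) \<le> f b - f a" "f b - f a \<le> M * (b - a)"
    by (auto simp: g_def abs_le_iff field_simps)
qed

text \<open>On an interval shorter than \<open>1 / (2 * (L + 1))\<close> that contains a zero, the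
  maximum of the norm is at most half of itself, hence zero; bisection carries this to the whole
  interval.\<close>

lemma ae_linear_zero:
  fixes x :: "real \<Rightarrow> 'a::real_normed_vector"
  assumes ac: "absolutely_continuous_on {a..b} x" and "0 \<le> L"
    and der: "AE t in lebesgue. t \<in> {a..b} \<longrightarrow>
      (\<exists>D. (x has_vector_derivative D) (at t within {a..b}) \<and> norm D \<le> L * norm (x t))"
    and t0: "t0 \<in> {a..b}" "x t0 = 0" and t: "t \<in> {a..b}"
  shows "x t = 0"
proof -
  have "a \<le> b" using t by simp
  have sub: "absolutely_continuous_on {s..u} x" if "a \<le> s" "u \<le> b" for s u
    using ac_subset[OF ac] that by simp
  obtain lo hi where lh: "a = lo" "b = hi" by blast
  \<comment> \<open>\<open>lo\<close> and \<open>hi\<close> remember the original interval, because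
    the local step of the bisection also speaks of intervals that stick out of it. The zero may lie
    anywhere in the subinterval, so that it can be handed on at the midpoint.\<close>
  have "lo \<le> a \<and> b \<le> hi \<longrightarrow> (\<exists>t\<in>{a..b}. x t = 0) \<longrightarrow> (\<forall>t\<in>{a..b}. x t = 0)"
    using \<open>a \<le> b\<close>
  proof (induction rule: Bolzano)
    case (trans s m u)
    show ?case
    proof (intro impI ballI)
      fix t assume su: "lo \<le> s \<and> u \<le> hi" and z: "\<exists>t\<in>{s..u}. x t = 0" and t: "t \<in> {s..u}"
      have "lo \<le> s \<and> m \<le> hi" using trans(4) su by linarith
      note 1 = mp[OF trans(1) this]
      have "lo \<le> m \<and> u \<le> hi" using trans(3) su by linarith
      note 2 = mp[OF trans(2) this]
      from z obtain r where r: "r \<in> {s..u}" "x r = 0" by (rule bexE)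
      have m: "m \<in> {s..m}" "m \<in> {m..u}" using trans(3,4) by simp_all
      have xm: "x m = 0"
      proof (cases "r \<le> m")
        case True
        then have "r \<in> {s..m}" using r(1) by simp
        then show ?thesis using bspec[OF mp[OF 1 bexI[where P="\<lambda>t. x t = 0", OF r(2)]]] m(1) by simp
      next
        case False
        then have "r \<in> {m..u}" using r(1) by simp
        then show ?thesis using bspec[OF mp[OF 2 bexI[where P="\<lambda>t. x t = 0", OF r(2)]]] m(2) by simp
      qed
      show "x t = 0"
      proof (cases "t \<le> m")
        case True
        then have "t \<in> {s..m}" using t by simp
        then show ?thesis by (rule bspec[OF mp[OF 1 bexI[where P="\<lambda>t. x t = 0", OF xm m(1)]]])
      next
        case False
        then have "t \<in> {m..u}" using t by simp
        then show ?thesis by (rule bspec[OF mp[OF 2 bexI[where P="\<lambda>t. x t = 0", OF xm m(2)]]])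
      qed
    qed
  next
    case (local r)
    show ?case
    proof (intro exI[of _ "1 / (2 * (L + 1))"] conjI allI impI ballI)
      fix s u t assume su: "s \<le> r \<and> r \<le> u \<and> u - s < 1 / (2 * (L + 1))" "lo \<le> s \<and> u \<le> hi"
        "\<exists>t\<in>{s..u}. x t = 0" "t \<in> {s..u}"
      note su = su[folded lh]
      then obtain t0 where t0: "t0 \<in> {s..u}" "x t0 = 0" by blast
      have acs: "absolutely_continuous_on {s..u} x" using su(2) sub by blast
      have "\<exists>t1\<in>{s..u}. \<forall>t\<in>{s..u}. norm (x t) \<le> norm (x t1)"
        by (rule continuous_attains_sup) (use su ac_imp_continuous[OF acs] in \<open>auto intro!: continuous_on_norm\<close>)
      then obtain t1 where t1: "t1 \<in> {s..u}" "\<And>t. t \<in> {s..u} \<Longrightarrow> norm (x t) \<le> norm (x t1)" by blast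
      have bd: "norm (x q - x p) \<le> L * norm (x t1) * (q - p)" if "p \<in> {s..u}" "q \<in> {s..u}" "p \<le> q" for p q
      proof (rule ac_mean_value_bound)
        show "absolutely_continuous_on {p..q} x" using that su(2) by (intro sub) auto
        show "AE t in lebesgue. t \<in> {p..q} \<longrightarrow>
          (\<exists>D. (x has_vector_derivative D) (at t within {p..q}) \<and> norm D \<le> L * norm (x t1))"
          using der
        proof eventually_elim
          case (elim t)
          show ?case
          proof
            assume tp: "t \<in> {p..q}"
            then have "t \<in> {a..b}" "t \<in> {s..u}" using that su(2) by auto
            with elim obtain D where D: "(x has_vector_derivative D) (at t within {a..b})"
              "norm D \<le> L * norm (x t)" by blast
            have "norm D \<le> L * norm (x t1)"
              by (rule order_trans[OF D(2) mult_left_mono[OF t1(2)[OF \<open>t \<in> {s..u}\<close>] \<open>0 \<le> L\<close>]])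
            moreover have "{p..q} \<subseteq> {a..b}" using that su(2) by auto
            ultimately show "\<exists>D. (x has_vector_derivative D) (at t within {p..q}) \<and> norm D \<le> L * norm (x t1)"
              using D(1) has_vector_derivative_within_subset by blast
          qed
        qed
      qed (use that \<open>0 \<le> L\<close> in auto)
      have "norm (x t1) \<le> L * norm (x t1) * \<bar>t1 - t0\<bar>"
        using bd[of t0 t1] bd[of t1 t0] t0 t1(1) by (cases "t0 \<le> t1") (auto simp: norm_minus_commute)
      also have "\<dots> \<le> L * norm (x t1) * (u - s)"
        using t0 t1(1) \<open>0 \<le> L\<close> by (intro mult_left_mono) auto
      also have "\<dots> \<le> L * norm (x t1) * (1 / (2 * (L + 1)))"
        using su \<open>0 \<le> L\<close> by (intro mult_left_mono) auto
      finally have "norm (x t1) * (1 - L / (2 * (L + 1))) \<le> 0"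
        by (simp add: field_simps)
      moreover have "1 - L / (2 * (L + 1)) > 0" using \<open>0 \<le> L\<close> by (simp add: field_simps)
      ultimately have "norm (x t1) \<le> 0" by (simp add: mult_le_0_iff)
      then show "x t = 0" using t1(2)[of t] su by simp
    qed (use \<open>0 \<le> L\<close> in auto)
  qed
  then show ?thesis using t0 t lh by blast
qed

lemma vector_derivative_bound:
  fixes f :: "real \<Rightarrow> 'a::real_normed_vector"
  assumes "\<And>t. t \<in> {a..b} \<Longrightarrow> (f has_vector_derivative D t) (at t within {a..b})"
    and "\<And>t. t \<in> {a..b} \<Longrightarrow> norm (D t) \<le> B" and "a \<le> b"
  shows "norm (f b - f a) \<le> B * (b - a)"
proof -
  have "norm (f b - f a) \<le> B * norm (b - a)"
    by (rule differentiable_bound[of "{a..b}" f "\<lambda>t h. h *\<^sub>R D t"])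
      (use assms in \<open>auto simp: has_vector_derivative_def mult.commute[of "\<bar>_\<bar>"] intro!: onorm_le mult_right_mono\<close>)
  then show ?thesis using \<open>a \<le> b\<close> by simp
qed

definition ae_deriv :: "(real \<Rightarrow> 'a::real_normed_vector) \<Rightarrow> (real \<Rightarrow> 'a) \<Rightarrow> bool" where
  "ae_deriv f D \<longleftrightarrow> (\<forall>a b. absolutely_continuous_on {a..b} f) \<and>
     (AE t in lebesgue. (f has_vector_derivative D t) (at t))"

lemma ae_deriv_continuous:
  assumes "ae_deriv f D"
  shows "continuous_on S f"
proof -
  have "isCont f t" for t
  proof (rule continuous_on_interior[of "{t - 1..t + 1}"])
    show "continuous_on {t - 1..t + 1} f"
      using assms by (auto simp: ae_deriv_def intro: ac_imp_continuous)
  qed simp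
  then show ?thesis by (simp add: continuous_at_imp_continuous_on)
qed

lemma ae_deriv_inner:
  assumes "ae_deriv f D"
  shows "ae_deriv (\<lambda>t. c \<bullet> f t) (\<lambda>t. c \<bullet> D t)"
  unfolding ae_deriv_def
proof (intro conjI allI)
  fix a b
  show "absolutely_continuous_on {a..b} (\<lambda>t. c \<bullet> f t)"
  proof (rule ac_dominated[of _ _ f "norm c"])
    fix s u :: real assume "s \<le> u"
    have "norm (c \<bullet> f u - c \<bullet> f s) \<le> norm c * norm (f u - f s)"
      by (metis inner_diff_right Cauchy_Schwarz_ineq2 real_norm_def)
    also have "\<dots> \<le> norm c * (norm (f u - f s) + (u - s))"
      using \<open>s \<le> u\<close> by (intro mult_left_mono) auto
    finally show "norm (c \<bullet> f u - c \<bullet> f s) \<le> \<dots>" .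
  qed (use assms in \<open>auto simp: ae_deriv_def\<close>)
  have "AE t in lebesgue. (f has_vector_derivative D t) (at t)"
    using assms by (simp add: ae_deriv_def)
  then show "AE t in lebesgue. ((\<lambda>t. c \<bullet> f t) has_vector_derivative c \<bullet> D t) (at t)"
    by eventually_elim (rule bounded_linear.has_vector_derivative[OF bounded_linear_inner_right])
qed

lemma ae_deriv_between:
  fixes p :: "real \<Rightarrow> real"
  assumes "ae_deriv p D" "a \<le> b" "m \<le> M" "AE t in lebesgue. t \<in> {a..b} \<longrightarrow> m \<le> D t \<and> D t \<le> M"
  shows "m * (b - a) \<le> p b - p a" "p b - p a \<le> M * (b - a)"
proof -
  have "AE t in lebesgue. (p has_vector_derivative D t) (at t)"
    using assms(1) by (simp add: ae_deriv_def)
  then have *: "AE t in lebesgue. t \<in> {a..b} \<longrightarrow>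
      (p has_real_derivative D t) (at t within {a..b}) \<and> m \<le> D t \<and> D t \<le> M"
    using assms(4) by eventually_elim
      (auto simp: has_real_derivative_iff_has_vector_derivative intro: has_vector_derivative_at_within)
  have "absolutely_continuous_on {a..b} p" using assms(1) by (simp add: ae_deriv_def)
  from ac_mean_value_between[OF this assms(2,3) *]
  show "m * (b - a) \<le> p b - p a" "p b - p a \<le> M * (b - a)" .
qed

text \<open>Meant for \<open>p = c \<bullet> x\<close>, with \<open>w\<close> the part of its
  derivative free of the control. The control enters only through \<open>r\<close>, which is as
  small as \<open>p\<close>, so near the zero the derivative stays above \<open>w t0 / 2\<close>
  whatever the measurable control does.\<close>

lemma sign_near_simple_zero:
  fixes p w :: "real \<Rightarrow> real"
  assumes p: "ae_deriv p (\<lambda>t. w t + r t)" and w: "continuous_on UNIV w"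
    and r: "AE t in lebesgue. \<bar>r t\<bar> \<le> K * \<bar>p t\<bar>" and "0 \<le> K"
    and 0: "p t0 = 0" "w t0 > 0"
  shows "\<exists>e>0. \<forall>h. 0 < h \<and> h < e \<longrightarrow> p (t0 + h) > 0 \<and> p (t0 - h) < 0"
proof -
  let ?a = "w t0"
  have "isCont w t0" "isCont p t0"
    using w ae_deriv_continuous[OF p, of UNIV] by (auto simp: continuous_on_eq_continuous_at)
  then have "isCont (\<lambda>t. w t - K * \<bar>p t\<bar>) t0" "isCont (\<lambda>t. w t + K * \<bar>p t\<bar>) t0"
    by (auto intro!: continuous_intros)
  then have lim: "((\<lambda>t. w t - K * \<bar>p t\<bar>) \<longlongrightarrow> w t0) (at t0)" "((\<lambda>t. w t + K * \<bar>p t\<bar>) \<longlongrightarrow> w t0) (at t0)"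
    using 0 by (auto simp: isCont_def)
  then have "\<forall>\<^sub>F t in at t0. w t - K * \<bar>p t\<bar> > ?a / 2" "\<forall>\<^sub>F t in at t0. w t + K * \<bar>p t\<bar> < 2 * ?a"
    using 0 by - (rule order_tendstoD(1)[OF lim(1)] order_tendstoD(2)[OF lim(2)], simp)+
  then have "\<forall>\<^sub>F t in at t0. w t - K * \<bar>p t\<bar> > ?a / 2 \<and> w t + K * \<bar>p t\<bar> < 2 * ?a"
    by eventually_elim simp
  then obtain e where "e > 0" and e: "\<And>t. t \<noteq> t0 \<Longrightarrow> dist t t0 < e \<Longrightarrow>
      w t - K * \<bar>p t\<bar> > ?a / 2 \<and> w t + K * \<bar>p t\<bar> < 2 * ?a"
    unfolding eventually_at by blast
  have e': "w t - K * \<bar>p t\<bar> > ?a / 2 \<and> w t + K * \<bar>p t\<bar> < 2 * ?a" if "dist t t0 < e" for t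
    using e[of t] that 0 by (cases "t = t0") auto
  have inc: "?a / 2 * (v - s) \<le> p v - p s" if "s \<le> v" "dist s t0 < e" "dist v t0 < e" for s v
  proof (rule ae_deriv_between[OF p])
    show "AE t in lebesgue. t \<in> {s..v} \<longrightarrow> ?a / 2 \<le> w t + r t \<and> w t + r t \<le> 2 * ?a"
      using r
    proof eventually_elim
      case (elim t)
      show ?case
      proof
        assume "t \<in> {s..v}"
        then have "dist t t0 < e" using that by (auto simp: dist_real_def)
        from e'[OF this] elim show "?a / 2 \<le> w t + r t \<and> w t + r t \<le> 2 * ?a" by auto
      qed
    qed
  qed (use that 0 in auto)
  have "p (t0 + h) > 0 \<and> p (t0 - h) < 0" if "0 < h" "h < e" for h
  proof -
    have "0 < ?a * h" using 0 that by simp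
    moreover have "?a / 2 * h \<le> p (t0 + h) - p t0" "?a / 2 * h \<le> p t0 - p (t0 - h)"
      using inc[of t0 "t0 + h"] inc[of "t0 - h" t0] that \<open>e > 0\<close> by (auto simp: dist_real_def)
    ultimately show ?thesis using 0 by (intro conjI; linarith)
  qed
  then show ?thesis using \<open>e > 0\<close> by blast
qed

text \<open>Near \<open>t0\<close> the function \<open>p\<close> grows quadratically, driven by
  \<open>g t0\<close>. The point is that the remainder \<open>r\<close> must be of smaller order
  than \<open>w\<close>, which itself vanishes linearly; this requires knowing beforehand that
  \<open>p\<close> is quadratically small.\<close>

lemma sign_near_double_zero:
  fixes p w g :: "real \<Rightarrow> real"
  assumes p: "ae_deriv p (\<lambda>t. w t + r t)" and w: "ae_deriv w (\<lambda>t. g t + r' t)"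
    and g: "continuous_on UNIV g"
    and r: "AE t in lebesgue. \<bar>r t\<bar> \<le> K * \<bar>p t\<bar>" and r': "AE t in lebesgue. \<bar>r' t\<bar> \<le> K * \<bar>p t\<bar>"
    and "0 \<le> K"
    and 0: "p t0 = 0" "w t0 = 0" "g t0 > 0"
  shows "\<exists>e>0. \<forall>h. 0 < h \<and> h < e \<longrightarrow> p (t0 + h) > 0 \<and> p (t0 - h) > 0"
proof -
  let ?c = "g t0"
  have "isCont g t0" "isCont p t0"
    using g ae_deriv_continuous[OF p, of UNIV] by (auto simp: continuous_on_eq_continuous_at)
  then have "isCont (\<lambda>t. g t - K * \<bar>p t\<bar>) t0" "isCont (\<lambda>t. g t + K * \<bar>p t\<bar>) t0"
    by (auto intro!: continuous_intros)
  then have lim: "((\<lambda>t. g t - K * \<bar>p t\<bar>) \<longlongrightarrow> g t0) (at t0)" "((\<lambda>t. g t + K * \<bar>p t\<bar>) \<longlongrightarrow> g t0) (at t0)"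
    using 0 by (auto simp: isCont_def)
  then have "\<forall>\<^sub>F t in at t0. g t - K * \<bar>p t\<bar> > ?c / 2" "\<forall>\<^sub>F t in at t0. g t + K * \<bar>p t\<bar> < 2 * ?c"
    using 0 by - (rule order_tendstoD(1)[OF lim(1)] order_tendstoD(2)[OF lim(2)], simp)+
  then have "\<forall>\<^sub>F t in at t0. g t - K * \<bar>p t\<bar> > ?c / 2 \<and> g t + K * \<bar>p t\<bar> < 2 * ?c"
    by eventually_elim simp
  then obtain e1 where "e1 > 0" and e1: "\<And>t. t \<noteq> t0 \<Longrightarrow> dist t t0 < e1 \<Longrightarrow>
      g t - K * \<bar>p t\<bar> > ?c / 2 \<and> g t + K * \<bar>p t\<bar> < 2 * ?c"
    unfolding eventually_at by blast
  \<comment> \<open>With \<open>\<bar>p t\<bar> \<le> 4 * ?c * (t - t0)\<^sup>2\<close>, the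
    constant 16 yields \<open>K * \<bar>p t\<bar> \<le> ?c / 4 * \<bar>t - t0\<bar>\<close>, half of
    the lower bound for \<open>\<bar>w t\<bar>\<close>.\<close>
  define e where "e = min e1 (1 / (16 * (K + 1)))"
  have "e > 0" "e \<le> e1" "e \<le> 1 / (16 * (K + 1))" using \<open>e1 > 0\<close> \<open>0 \<le> K\<close> by (auto simp: e_def)
  have Ke: "K * h \<le> 1 / 16" if "h < e" "0 \<le> h" for h
  proof -
    have "K * h \<le> K * (1 / (16 * (K + 1)))"
      using that \<open>e \<le> 1 / (16 * (K + 1))\<close> \<open>0 \<le> K\<close> by (intro mult_left_mono) auto
    also have "\<dots> \<le> 1 / 16" using \<open>0 \<le> K\<close> by (simp add: field_simps)
    finally show ?thesis .
  qed
  have e': "g t - K * \<bar>p t\<bar> > ?c / 2 \<and> g t + K * \<bar>p t\<bar> < 2 * ?c" if "dist t t0 < e" for t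
    using e1[of t] that 0 \<open>e \<le> e1\<close> by (cases "t = t0") auto
  have winc: "?c / 2 * (v - s) \<le> w v - w s" "w v - w s \<le> 2 * ?c * (v - s)"
    if "s \<le> v" "dist s t0 < e" "dist v t0 < e" for s v
  proof -
    have "AE t in lebesgue. t \<in> {s..v} \<longrightarrow> ?c / 2 \<le> g t + r' t \<and> g t + r' t \<le> 2 * ?c"
      using r'
    proof eventually_elim
      case (elim t)
      show ?case
      proof
        assume "t \<in> {s..v}"
        then have "dist t t0 < e" using that by (auto simp: dist_real_def)
        from e'[OF this] elim show "?c / 2 \<le> g t + r' t \<and> g t + r' t \<le> 2 * ?c" by auto
      qed
    qed
    from ae_deriv_between[OF w \<open>s \<le> v\<close> _ this]
    show "?c / 2 * (v - s) \<le> w v - w s" "w v - w s \<le> 2 * ?c * (v - s)" using 0 by auto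
  qed
  have wr: "?c / 2 * (t - t0) \<le> w t" "w t \<le> 2 * ?c * (t - t0)" if "t0 \<le> t" "t < t0 + e" for t
    using winc[of t0 t] that 0 by (auto simp: dist_real_def)
  have wl: "w t \<le> - (?c / 2 * (t0 - t))" "- (2 * ?c * (t0 - t)) \<le> w t" if "t \<le> t0" "t0 - e < t" for t
    using winc[of t t0] that 0 by (auto simp: dist_real_def)
  \<comment> \<open>A bound by absorption: at a maximum point \<open>t1\<close> of
    \<open>\<bar>p\<bar>\<close> within distance \<open>h\<close>, the remainder contributes at most
    \<open>K * h * \<bar>p t1\<bar>\<close>, a sixteenth of the left side.\<close>
  have pb: "\<bar>p t\<bar> \<le> 4 * ?c * (t - t0)\<^sup>2" if "dist t t0 < e" for t
  proof -
    define h where "h = \<bar>t - t0\<bar>"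
    have h: "0 \<le> h" "h < e" using that by (auto simp: h_def dist_real_def)
    have "\<exists>t1\<in>{t0 - h..t0 + h}. \<forall>t\<in>{t0 - h..t0 + h}. \<bar>p t\<bar> \<le> \<bar>p t1\<bar>"
      using h by (intro continuous_attains_sup continuous_on_rabs ae_deriv_continuous[OF p]) auto
    then obtain t1 where t1: "t1 \<in> {t0 - h..t0 + h}"
      "\<And>t. t \<in> {t0 - h..t0 + h} \<Longrightarrow> \<bar>p t\<bar> \<le> \<bar>p t1\<bar>" by blast
    let ?B = "2 * ?c * h + K * \<bar>p t1\<bar>"
    have "?B \<ge> 0" using h 0 \<open>0 \<le> K\<close> by simp
    have bd: "- ?B * (v - s) \<le> p v - p s \<and> p v - p s \<le> ?B * (v - s)"
      if "s \<le> v" "s \<in> {t0 - h..t0 + h}" "v \<in> {t0 - h..t0 + h}" for s v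
    proof -
      have "AE t in lebesgue. t \<in> {s..v} \<longrightarrow> - ?B \<le> w t + r t \<and> w t + r t \<le> ?B"
        using r
      proof eventually_elim
        case (elim t)
        show ?case
        proof
          assume "t \<in> {s..v}"
          then have t: "t \<in> {t0 - h..t0 + h}" using that by auto
          have "\<bar>w t\<bar> \<le> 2 * ?c * h"
          proof (cases "t0 \<le> t")
            case True
            have "0 \<le> ?c / 2 * (t - t0)" using 0 True by simp
            then have "0 \<le> w t" using wr(1)[of t] True t h by auto
            moreover have "2 * ?c * (t - t0) \<le> 2 * ?c * h" using t 0 by (intro mult_left_mono) auto
            ultimately show ?thesis using wr(2)[of t] True t h by auto
          next
            case False
            have "0 \<le> ?c / 2 * (t0 - t)" using 0 False by simp
            then have "w t \<le> 0" using wl(1)[of t] False t h by auto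
            moreover have "2 * ?c * (t0 - t) \<le> 2 * ?c * h" using t 0 by (intro mult_left_mono) auto
            ultimately show ?thesis using wl(2)[of t] False t h by auto
          qed
          moreover have "\<bar>r t\<bar> \<le> K * \<bar>p t1\<bar>"
            by (rule order_trans[OF elim mult_left_mono[OF t1(2)[OF t] \<open>0 \<le> K\<close>]])
          ultimately show "- ?B \<le> w t + r t \<and> w t + r t \<le> ?B" by auto
        qed
      qed
      note ae_deriv_between[OF p \<open>s \<le> v\<close> _ this]
      then show ?thesis using \<open>?B \<ge> 0\<close> by (metis neg_le_0_iff_le order_trans)
    qed
    have "\<bar>p t1\<bar> \<le> ?B * \<bar>t1 - t0\<bar>"
      using bd[of t0 t1] bd[of t1 t0] t1(1) 0 h
      by (cases "t0 \<le> t1") (auto simp: abs_le_iff algebra_simps)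
    also have "\<dots> \<le> ?B * h" using t1(1) \<open>?B \<ge> 0\<close> by (intro mult_left_mono) auto
    also have "\<dots> = 2 * ?c * h\<^sup>2 + (K * h) * \<bar>p t1\<bar>" by (simp add: algebra_simps power2_eq_square)
    also have "\<dots> \<le> 2 * ?c * h\<^sup>2 + 1 / 16 * \<bar>p t1\<bar>"
      using Ke[of h] h by (intro add_left_mono mult_right_mono) auto
    finally have "\<bar>p t1\<bar> * (15 / 16) \<le> 2 * ?c * h\<^sup>2" by simp
    moreover have "0 \<le> ?c * h\<^sup>2" using 0 by simp
    ultimately have "\<bar>p t1\<bar> \<le> 4 * ?c * h\<^sup>2" by linarith
    moreover have "h\<^sup>2 = (t - t0)\<^sup>2" by (simp add: h_def)
    moreover have "t \<in> {t0 - h..t0 + h}" by (auto simp: h_def)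
    ultimately show ?thesis using t1(2)[of t] by simp
  qed
  have "p (t0 + h) > 0 \<and> p (t0 - h) > 0" if h: "0 < h" "h < e" for h
  proof -
    have rb: "K * \<bar>p t\<bar> \<le> ?c / 4 * \<bar>t - t0\<bar>" if "dist t t0 < e" for t
    proof -
      have "K * \<bar>p t\<bar> \<le> K * (4 * ?c * (t - t0)\<^sup>2)" using pb[OF that] \<open>0 \<le> K\<close> by (rule mult_left_mono)
      also have "\<dots> = (K * \<bar>t - t0\<bar>) * (4 * ?c * \<bar>t - t0\<bar>)"
        using abs_mult_self_eq[of "t - t0"] by (simp add: power2_eq_square mult.assoc mult.left_commute del: abs_mult_self_eq)
      also have "\<dots> \<le> 1 / 16 * (4 * ?c * \<bar>t - t0\<bar>)"
        using Ke[of "\<bar>t - t0\<bar>"] that 0 by (intro mult_right_mono) (auto simp: dist_real_def)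
      finally show ?thesis by simp
    qed
    \<comment> \<open>The slope is estimated at distance at least \<open>m\<close> from
      \<open>t0\<close>, since it vanishes at \<open>t0\<close> itself; strict positivity is then
      gained on the second half, from \<open>h / 2\<close> to \<open>h\<close>.\<close>
    have right: "?c / 4 * m * (v - s) \<le> p v - p s" if "t0 + m \<le> s" "s \<le> v" "v < t0 + e" "0 \<le> m" for s v m
    proof (rule ae_deriv_between[OF p, of s v "?c / 4 * m" "?c / 4 * m + 4 * ?c * e"])
      show "AE t in lebesgue. t \<in> {s..v} \<longrightarrow> ?c / 4 * m \<le> w t + r t \<and> w t + r t \<le> ?c / 4 * m + 4 * ?c * e"
        using r
      proof eventually_elim
        case (elim t)
        show ?case
        proof
          assume "t \<in> {s..v}"
          then have t: "t0 + m \<le> t" "t0 \<le> t" "t < t0 + e" "dist t t0 < e" using that by (auto simp: dist_real_def)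
          have a: "?c * m \<le> ?c * (t - t0)" "?c * (t - t0) \<le> ?c * e" "?c * m \<ge> 0"
            using t 0 that by (auto intro!: mult_left_mono)
          show "?c / 4 * m \<le> w t + r t \<and> w t + r t \<le> ?c / 4 * m + 4 * ?c * e"
            using wr[of t] rb[of t] elim t a by (auto simp: abs_le_iff)
        qed
      qed
    qed (use that 0 \<open>e > 0\<close> in auto)
    have left: "?c / 4 * m * (v - s) \<le> p s - p v" if "v \<le> t0 - m" "s \<le> v" "t0 - e < s" "0 \<le> m" for s v m
    proof -
      have "AE t in lebesgue. t \<in> {s..v} \<longrightarrow> - (?c / 4 * m + 4 * ?c * e) \<le> w t + r t \<and> w t + r t \<le> - (?c / 4 * m)"
        using r
      proof eventually_elim
        case (elim t)
        show ?case
        proof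
          assume "t \<in> {s..v}"
          then have t: "t \<le> t0 - m" "t \<le> t0" "t0 - e < t" "dist t t0 < e" using that by (auto simp: dist_real_def)
          have a: "?c * m \<le> ?c * (t0 - t)" "?c * (t0 - t) \<le> ?c * e" "?c * m \<ge> 0"
            using t 0 that by (auto intro!: mult_left_mono)
          show "- (?c / 4 * m + 4 * ?c * e) \<le> w t + r t \<and> w t + r t \<le> - (?c / 4 * m)"
            using wl[of t] rb[of t] elim t a by (auto simp: abs_le_iff)
        qed
      qed
      from ae_deriv_between(2)[OF p \<open>s \<le> v\<close> _ this] show ?thesis
        using 0 \<open>e > 0\<close> that by (simp add: algebra_simps) 
    qed
    have "0 < ?c * h * h" using 0 h by simp
    moreover have "p (t0 + h / 2) \<ge> 0" "?c / 4 * (h / 2) * (h / 2) \<le> p (t0 + h) - p (t0 + h / 2)"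
      "p (t0 - h / 2) \<ge> 0" "?c / 4 * (h / 2) * (h / 2) \<le> p (t0 - h) - p (t0 - h / 2)"
      using right[of 0 t0 "t0 + h / 2"] right[of "h / 2" "t0 + h / 2" "t0 + h"]
        left[of t0 0 "t0 - h / 2"] left[of "t0 - h / 2" "h / 2" "t0 - h"] 0 h by auto
    moreover have "?c / 4 * (h / 2) * (h / 2) = ?c * h * h / 16" by simp
    ultimately show ?thesis by auto
  qed
  then show ?thesis using \<open>e > 0\<close> by blast
qed

lemma outer_product_mult: "outer_product b c *v y = (c \<bullet> y) *\<^sub>R b"
  by (simp add: vec_eq_iff outer_product_def matrix_vector_mult_def inner_vec_def sum_distrib_left sum_distrib_right mult_ac)

text \<open>Kalman duality: the hypotheses make \<open>y\<close> orthogonal to \<open>e\<close> and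
  its first two images under \<open>transpose N\<close>, which span the space.\<close>

lemma controllable_pair_observable:
  fixes N :: "real^3^3"
  assumes "controllable_pair (transpose N) e"
    and "e \<bullet> y = 0" "e \<bullet> (N *v y) = 0" "e \<bullet> (N *v (N *v y)) = 0"
  shows "y = 0"
proof -
  have "((*v) (transpose N) ^^ k) e \<bullet> y = 0" if k: "k < 3" for k
  proof -
    consider "k = 0" | "k = 1" | "k = 2" using k by linarith
    then show ?thesis
      using assms(2-4) by cases (simp_all add: numeral_2_eq_2 dot_lmul_matrix[symmetric])
  qed
  then have *: "y \<bullet> v = 0" if "v \<in> {((*v) (transpose N) ^^ k) e | k. k < CARD(3)}" for v
    using that by (auto simp: inner_commute)
  have "y \<bullet> v = 0" if "v \<in> span {((*v) (transpose N) ^^ k) e | k. k < CARD(3)}" for v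
    using orthogonal_to_span[OF that, of y] * by (auto simp: orthogonal_def)
  then have "y \<bullet> y = 0" using assms(1) unfolding controllable_pair_def by blast
  then show ?thesis by simp
qed

section \<open>Solutions of switched equations\<close>

text \<open>One equation for both halves of a trajectory: \<open>x\<close> has \<open>N = A\<close>,
  \<open>d = b\<close>, \<open>e = c\<close>, and the time reversal of \<open>l\<close> has
  \<open>N = transpose A\<close>, \<open>d = c\<close>, \<open>e = b\<close>.\<close>

definition control_solution :: "real^'n^'n \<Rightarrow> real^'n \<Rightarrow> real^'n \<Rightarrow> (real \<Rightarrow> real) \<Rightarrow> (real \<Rightarrow> real^'n) \<Rightarrow> bool" where
  "control_solution N d e u z \<longleftrightarrow> (AE t in lebesgue. 0 \<le> u t \<and> u t \<le> 1) \<and>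
     ae_deriv z (\<lambda>t. N *v z t + (u t * (e \<bullet> z t)) *\<^sub>R d)"

lemma control_solution_scale:
  assumes "control_solution N d e u z"
  shows "control_solution N d e u (\<lambda>t. k *\<^sub>R z t)"
  unfolding control_solution_def ae_deriv_def
proof (intro conjI allI)
  fix a b
  show "absolutely_continuous_on {a..b} (\<lambda>t. k *\<^sub>R z t)"
    by (rule ac_dominated[of _ _ z "\<bar>k\<bar>"])
      (use assms in \<open>auto simp: control_solution_def ae_deriv_def scaleR_diff_right[symmetric] intro!: mult_left_mono\<close>)
  have "AE t in lebesgue. (z has_vector_derivative N *v z t + (u t * (e \<bullet> z t)) *\<^sub>R d) (at t)"
    using assms by (simp add: control_solution_def ae_deriv_def)
  then show "AE t in lebesgue. ((\<lambda>t. k *\<^sub>R z t) has_vector_derivative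
      N *v (k *\<^sub>R z t) + (u t * (e \<bullet> (k *\<^sub>R z t))) *\<^sub>R d) (at t)"
  proof eventually_elim
    case (elim t)
    from bounded_linear.has_vector_derivative[OF bounded_linear_scaleR_right elim, of k]
    show ?case by (simp add: matrix_vector_mult_scaleR scaleR_add_right mult_ac)
  qed
qed (use assms in \<open>simp add: control_solution_def\<close>)

lemma control_solution_zero:
  assumes z: "control_solution N d e u z" and "z t0 = 0"
  shows "z t = 0"
proof -
  obtain L where L: "L > 0" "\<And>y. norm (N *v y) \<le> norm y * L"
    using bounded_linear.pos_bounded[OF matrix_vector_mul_bounded_linear] by blast
  define L' where "L' = L + norm d * norm e"
  have u: "AE t in lebesgue. 0 \<le> u t \<and> u t \<le> 1"
    and D: "AE t in lebesgue. (z has_vector_derivative N *v z t + (u t * (e \<bullet> z t)) *\<^sub>R d) (at t)"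
    and ac: "\<And>a b. absolutely_continuous_on {a..b} z"
    using z by (auto simp: control_solution_def ae_deriv_def)
  have "AE s in lebesgue. s \<in> {min t t0..max t t0} \<longrightarrow>
      (\<exists>D. (z has_vector_derivative D) (at s within {min t t0..max t t0}) \<and> norm D \<le> L' * norm (z s))"
    using u D
  proof eventually_elim
    case (elim s)
    have "norm (N *v z s + (u s * (e \<bullet> z s)) *\<^sub>R d) \<le> norm (N *v z s) + \<bar>u s\<bar> * \<bar>e \<bullet> z s\<bar> * norm d"
      by (intro order_trans[OF norm_triangle_ineq]) (simp add: abs_mult)
    also have "\<dots> \<le> norm (z s) * L + 1 * (norm e * norm (z s)) * norm d"
      using elim L by (intro add_mono mult_mono Cauchy_Schwarz_ineq2) auto
    also have "\<dots> = L' * norm (z s)" by (simp add: L'_def algebra_simps)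
    finally show ?case using elim by (blast intro: has_vector_derivative_at_within)
  qed
  from ae_linear_zero[OF ac _ this _ \<open>z t0 = 0\<close>, of t]
  show ?thesis using L(1) by (auto simp: L'_def)
qed

text \<open>\<open>sgR\<close> and \<open>sgL\<close> are the signs of \<open>e \<bullet> z\<close>
  just after and just before a time at which \<open>z = y\<close>, read off the first three Taylor
  coefficients. The control is absent because it multiplies \<open>e \<bullet> z\<close>, which
  vanishes wherever the later coefficients matter.\<close>

definition sgR :: "real^'n^'n \<Rightarrow> real^'n \<Rightarrow> real^'n \<Rightarrow> real" where
  "sgR N e y = (if e \<bullet> y \<noteq> 0 then sgn (e \<bullet> y) else if e \<bullet> (N *v y) \<noteq> 0 then sgn (e \<bullet> (N *v y))
     else sgn (e \<bullet> (N *v (N *v y))))"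

definition sgL :: "real^'n^'n \<Rightarrow> real^'n \<Rightarrow> real^'n \<Rightarrow> real" where
  "sgL N e y = (if e \<bullet> y \<noteq> 0 then sgn (e \<bullet> y) else if e \<bullet> (N *v y) \<noteq> 0 then - sgn (e \<bullet> (N *v y))
     else sgn (e \<bullet> (N *v (N *v y))))"

lemma control_solution_signs_aux:
  assumes z: "control_solution N d e u z" and ez: "e \<bullet> z t0 = 0"
  shows "e \<bullet> (N *v z t0) > 0 \<Longrightarrow>
      \<exists>r>0. \<forall>h. 0 < h \<and> h < r \<longrightarrow> e \<bullet> z (t0 + h) > 0 \<and> e \<bullet> z (t0 - h) < 0"
    and "e \<bullet> (N *v z t0) = 0 \<Longrightarrow> e \<bullet> (N *v (N *v z t0)) > 0 \<Longrightarrow>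
      \<exists>r>0. \<forall>h. 0 < h \<and> h < r \<longrightarrow> e \<bullet> z (t0 + h) > 0 \<and> e \<bullet> z (t0 - h) > 0"
proof -
  have zd: "ae_deriv z (\<lambda>t. N *v z t + (u t * (e \<bullet> z t)) *\<^sub>R d)"
    and u: "AE t in lebesgue. 0 \<le> u t \<and> u t \<le> 1"
    using z by (auto simp: control_solution_def)
  define K where "K = \<bar>e \<bullet> d\<bar> + \<bar>e \<bullet> (N *v d)\<bar>"
  have pd: "ae_deriv (\<lambda>t. e \<bullet> z t) (\<lambda>t. e \<bullet> (N *v z t) + u t * (e \<bullet> z t) * (e \<bullet> d))"
    using ae_deriv_inner[OF zd, of e] by (simp add: inner_add_right)
  have wd: "ae_deriv (\<lambda>t. e \<bullet> (N *v z t)) (\<lambda>t. e \<bullet> (N *v (N *v z t)) + u t * (e \<bullet> z t) * (e \<bullet> (N *v d)))"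
    using ae_deriv_inner[OF zd, of "transpose N *v e"]
    by (simp add: inner_add_right dot_lmul_matrix[symmetric])
  have bd: "AE t in lebesgue. \<bar>u t * (e \<bullet> z t) * f\<bar> \<le> K * \<bar>e \<bullet> z t\<bar>" if "\<bar>f\<bar> \<le> K" for f
    using u
  proof eventually_elim
    case (elim t)
    then have "\<bar>u t\<bar> * \<bar>f\<bar> * \<bar>e \<bullet> z t\<bar> \<le> 1 * K * \<bar>e \<bullet> z t\<bar>"
      using that by (intro mult_mono) auto
    then show ?case by (simp add: abs_mult mult_ac)
  qed
  have cz: "continuous_on UNIV z" by (rule ae_deriv_continuous[OF zd])
  show "\<exists>r>0. \<forall>h. 0 < h \<and> h < r \<longrightarrow> e \<bullet> z (t0 + h) > 0 \<and> e \<bullet> z (t0 - h) < 0"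
    if "e \<bullet> (N *v z t0) > 0"
    by (rule sign_near_simple_zero[OF pd _ bd[of "e \<bullet> d"]])
      (use that ez in \<open>auto simp: K_def intro!: continuous_intros continuous_on_compose2[OF matrix_vector_mult_linear_continuous_on cz]\<close>)
  show "\<exists>r>0. \<forall>h. 0 < h \<and> h < r \<longrightarrow> e \<bullet> z (t0 + h) > 0 \<and> e \<bullet> z (t0 - h) > 0"
    if "e \<bullet> (N *v z t0) = 0" "e \<bullet> (N *v (N *v z t0)) > 0"
    by (rule sign_near_double_zero[OF pd wd _ bd[of "e \<bullet> d"] bd[of "e \<bullet> (N *v d)"]])
      (use that ez in \<open>auto simp: K_def matrix_vector_mul_assoc intro!: continuous_intros continuous_on_compose2[OF matrix_vector_mult_linear_continuous_on cz]\<close>)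
qed

text \<open>Observability leaves one of the three coefficients non-zero, so zeros of
  \<open>e \<bullet> z\<close> have order at most two, are isolated, and have a definite sign on
  either side. Negative coefficients are reduced to positive ones by passing to
  \<open>- z\<close>.\<close>

lemma control_solution_signs:
  fixes N :: "real^3^3"
  assumes z: "control_solution N d e u z" and obs: "controllable_pair (transpose N) e" and nz: "z t0 \<noteq> 0"
  shows "sgR N e (z t0) \<noteq> 0" "sgL N e (z t0) \<noteq> 0"
    "\<exists>r>0. \<forall>h. 0 < h \<and> h < r \<longrightarrow> sgn (e \<bullet> z (t0 + h)) = sgR N e (z t0) \<and> sgn (e \<bullet> z (t0 - h)) = sgL N e (z t0)"
proof -
  show "sgR N e (z t0) \<noteq> 0" "sgL N e (z t0) \<noteq> 0"
    using controllable_pair_observable[OF obs, of "z t0"] nz by (auto simp: sgR_def sgL_def sgn_zero_iff)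
  let ?P = "\<lambda>r. \<forall>h. 0 < h \<and> h < r \<longrightarrow> sgn (e \<bullet> z (t0 + h)) = sgR N e (z t0) \<and> sgn (e \<bullet> z (t0 - h)) = sgL N e (z t0)"
  have mz: "control_solution N d e u (\<lambda>t. (- 1) *\<^sub>R z t)" by (rule control_solution_scale[OF z])
  consider "e \<bullet> z t0 \<noteq> 0" | "e \<bullet> z t0 = 0" "e \<bullet> (N *v z t0) > 0" | "e \<bullet> z t0 = 0" "e \<bullet> (N *v z t0) < 0"
    | "e \<bullet> z t0 = 0" "e \<bullet> (N *v z t0) = 0" "e \<bullet> (N *v (N *v z t0)) > 0"
    | "e \<bullet> z t0 = 0" "e \<bullet> (N *v z t0) = 0" "e \<bullet> (N *v (N *v z t0)) < 0"
    using controllable_pair_observable[OF obs, of "z t0"] nz by (metis linorder_neqE_linordered_idom)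
  then show "\<exists>r>0. ?P r"
  proof cases
    case 1
    have "isCont (\<lambda>t. e \<bullet> z t) t0"
      using ae_deriv_continuous[of z _ UNIV] z
      by (auto simp: control_solution_def continuous_on_eq_continuous_at intro!: continuous_intros)
    then have lim: "((\<lambda>t. e \<bullet> z t) \<longlongrightarrow> e \<bullet> z t0) (at t0)" by (simp add: isCont_def)
    have "\<forall>\<^sub>F t in at t0. sgn (e \<bullet> z t) = sgn (e \<bullet> z t0)"
    proof (cases "e \<bullet> z t0 > 0")
      case True
      from order_tendstoD(1)[OF lim this] show ?thesis
        by eventually_elim (use True in \<open>simp add: sgn_if\<close>)
    next
      case False
      then have "e \<bullet> z t0 < 0" using 1 by simp
      from order_tendstoD(2)[OF lim this] show ?thesis
        by eventually_elim (use \<open>e \<bullet> z t0 < 0\<close> in \<open>simp add: sgn_if\<close>)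
    qed
    then obtain r where "r > 0" "\<And>t. t \<noteq> t0 \<Longrightarrow> dist t t0 < r \<Longrightarrow> sgn (e \<bullet> z t) = sgn (e \<bullet> z t0)"
      unfolding eventually_at by blast
    then show ?thesis using 1 by (intro exI[of _ r]) (auto simp: sgR_def sgL_def dist_real_def)
  next
    case 2
    with control_solution_signs_aux(1)[OF z 2] show ?thesis by (auto simp: sgR_def sgL_def)
  next
    case 3
    with control_solution_signs_aux(1)[OF mz, of t0] show ?thesis
      by (auto simp: sgR_def sgL_def linear_neg[OF matrix_vector_mul_linear])
  next
    case 4
    with control_solution_signs_aux(2)[OF z, of t0] show ?thesis by (auto simp: sgR_def sgL_def)
  next
    case 5
    with control_solution_signs_aux(2)[OF mz, of t0] show ?thesis
      by (auto simp: sgR_def sgL_def linear_neg[OF matrix_vector_mul_linear])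
  qed
qed

text \<open>The difference \<open>y\<close> from the exponential curve solves a homogeneous linear
  equation almost everywhere and starts at zero. The open interval suffices because its endpoints
  form a null set.\<close>

lemma control_solution_arc:
  assumes z: "control_solution N d e u z"
    and w: "AE t in lebesgue. t \<in> {s<..<r} \<longrightarrow> u t = w" and "s \<le> r"
  shows "z r = mexp (switched_matrix N d e w) (r - s) *v z s"
proof -
  let ?M = "switched_matrix N d e w"
  define y where "y t = z t - mexp ?M (t - s) *v z s" for t
  have ym: "((\<lambda>t. mexp ?M (t - s) *v z s) has_vector_derivative ?M *v (mexp ?M (t - s) *v z s)) (at t within S)" for t S
  proof -
    have "((\<lambda>t. t - s) has_real_derivative 1) (at t within S)" by (auto intro!: derivative_eq_intros)
    from mexp_deriv'[OF this] show ?thesis by simp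
  qed
  obtain L where L: "L > 0" "\<And>y. norm (?M *v y) \<le> norm y * L"
    using bounded_linear.pos_bounded[OF matrix_vector_mul_bounded_linear] by blast
  have "continuous_on {s..r} (\<lambda>t. mexp ?M (t - s) *v z s)" by (intro continuous_intros)
  then have "bounded ((\<lambda>t. mexp ?M (t - s) *v z s) ` {s..r})"
    by (intro compact_imp_bounded compact_continuous_image compact_Icc)
  then obtain B where B: "\<And>t. t \<in> {s..r} \<Longrightarrow> norm (mexp ?M (t - s) *v z s) \<le> B"
    unfolding bounded_iff by blast
  have "0 \<le> B" using order_trans[OF norm_ge_zero B[of s]] \<open>s \<le> r\<close> by simp
  have zd: "\<And>a b. absolutely_continuous_on {a..b} z"
    "AE t in lebesgue. (z has_vector_derivative N *v z t + (u t * (e \<bullet> z t)) *\<^sub>R d) (at t)"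
    using z by (auto simp: control_solution_def ae_deriv_def)
  have "absolutely_continuous_on {s..r} y"
  proof (rule ac_dominated[OF zd(1), of "1 + B * L"])
    fix p q :: real assume pq: "s \<le> p" "p \<le> q" "q \<le> r"
    have "norm (mexp ?M (q - s) *v z s - mexp ?M (p - s) *v z s) \<le> (B * L) * (q - p)"
    proof (rule vector_derivative_bound)
      show "\<And>t. t \<in> {p..q} \<Longrightarrow> ((\<lambda>t. mexp ?M (t - s) *v z s) has_vector_derivative ?M *v (mexp ?M (t - s) *v z s)) (at t within {p..q})"
        by (rule ym)
      show "norm (?M *v (mexp ?M (t - s) *v z s)) \<le> B * L" if "t \<in> {p..q}" for t
        by (rule order_trans[OF L(2) mult_right_mono[OF B]]) (use L(1) that pq in auto)
    qed (use pq in auto)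
    then have "norm (y q - y p) \<le> norm (z q - z p) + (B * L) * (q - p)"
      using norm_triangle_ineq4[of "z q - z p" "mexp ?M (q - s) *v z s - mexp ?M (p - s) *v z s"] pq
      by (simp add: y_def algebra_simps)
    also have "\<dots> \<le> (1 + B * L) * (norm (z q - z p) + (q - p))"
    proof -
      have "0 \<le> (B * L) * norm (z q - z p)" using \<open>0 \<le> B\<close> L(1) by simp
      then show ?thesis using pq unfolding distrib_right distrib_left mult_1 by linarith
    qed
    finally show "norm (y q - y p) \<le> (1 + B * L) * (norm (z q - z p) + (q - p))" .
  qed (use \<open>0 \<le> B\<close> L(1) in auto)
  moreover have "AE t in lebesgue. t \<in> {s..r} \<longrightarrow>
      (\<exists>D. (y has_vector_derivative D) (at t within {s..r}) \<and> norm D \<le> L * norm (y t))"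
  proof -
    have "AE t in lebesgue. t \<noteq> s" "AE t in lebesgue. t \<noteq> r"
      by (rule AE_I'[of "{s}"], auto intro!: null_sets_completionI finite_imp_null_set_lborel)
        (rule AE_I'[of "{r}"], auto intro!: null_sets_completionI finite_imp_null_set_lborel)
    with w zd(2) show ?thesis
    proof eventually_elim
      case (elim t)
      show ?case
      proof
        assume "t \<in> {s..r}"
        then have "u t = w" using elim by auto
        moreover have "?M *v z t = N *v z t + (w * (e \<bullet> z t)) *\<^sub>R d"
          by (simp add: switched_matrix_def matrix_vector_mult_add_rdistrib scaleR_matrix_vector_assoc[symmetric] outer_product_mult)
        ultimately have "(y has_vector_derivative ?M *v y t) (at t within {s..r})"
          unfolding y_def matrix_vector_mult_diff_distrib
          using elim ym by (auto intro!: has_vector_derivative_diff intro: has_vector_derivative_at_within)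
        then show "\<exists>D. (y has_vector_derivative D) (at t within {s..r}) \<and> norm D \<le> L * norm (y t)"
          using L(2)[of "y t"] by (auto simp: mult.commute)
      qed
    qed
  qed
  ultimately have "y r = 0"
    using ae_linear_zero[of s r y L s r] L(1) \<open>s \<le> r\<close> by (auto simp: y_def)
  then show ?thesis by (simp add: y_def)
qed

section \<open>Extremal norms\<close>

text \<open>A predicate on functions, because the norm in question is built from the system and not
  attached to the type.\<close>

definition is_norm :: "('a::real_vector \<Rightarrow> real) \<Rightarrow> bool" where
  "is_norm v \<longleftrightarrow> (\<forall>y. 0 \<le> v y) \<and> (\<forall>y. v y = 0 \<longleftrightarrow> y = 0) \<and>
     (\<forall>k y. v (k *\<^sub>R y) = \<bar>k\<bar> * v y) \<and> (\<forall>y z. v (y + z) \<le> v y + v z)"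

text \<open>By Cauchy-Schwarz the squared norm times \<open>exp (- 2 * L * t)\<close> has
  nonpositive derivative.\<close>

lemma norm_mexp_le:
  assumes L: "\<And>y. norm (M *v y) \<le> L * norm y" and "0 \<le> h"
  shows "norm (mexp M h *v y) \<le> exp (L * h) * norm y"
proof -
  define f where "f t = exp (- 2 * L * t) * ((mexp M t *v y) \<bullet> (mexp M t *v y))" for t
  define f' where "f' t = exp (- 2 * L * t) * (2 * ((mexp M t *v y) \<bullet> (M *v (mexp M t *v y))) - 2 * L * ((mexp M t *v y) \<bullet> (mexp M t *v y)))" for t
  have "f h \<le> f 0"
  proof (rule DERIV_nonpos_imp_nonincreasing[OF \<open>0 \<le> h\<close>])
    fix t
    have "((\<lambda>t. (mexp M t *v y) \<bullet> (mexp M t *v y)) has_real_derivative 2 * ((mexp M t *v y) \<bullet> (M *v (mexp M t *v y)))) (at t)"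
      using bounded_bilinear.has_vector_derivative[OF bounded_bilinear_inner mexp_deriv[of M y t UNIV] mexp_deriv[of M y t UNIV]]
      by (simp add: has_real_derivative_iff_has_vector_derivative inner_commute)
    then have "(f has_real_derivative f' t) (at t)"
      unfolding f_def f'_def by (auto intro!: derivative_eq_intros simp: algebra_simps)
    moreover have "f' t \<le> 0"
    proof -
      have "(mexp M t *v y) \<bullet> (M *v (mexp M t *v y)) \<le> norm (mexp M t *v y) * norm (M *v (mexp M t *v y))"
        by (rule norm_cauchy_schwarz)
      also have "\<dots> \<le> norm (mexp M t *v y) * (L * norm (mexp M t *v y))"
        by (intro mult_left_mono L) simp
      also have "\<dots> = L * ((mexp M t *v y) \<bullet> (mexp M t *v y))" by (simp add: dot_square_norm power2_eq_square)
      finally show ?thesis unfolding f'_def by (simp add: mult_le_0_iff)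
    qed
    ultimately show "\<exists>d. (f has_real_derivative d) (at t) \<and> d \<le> 0" by blast
  qed
  then have "exp (- 2 * L * h) * (norm (mexp M h *v y))\<^sup>2 \<le> (norm y)\<^sup>2"
    by (simp add: f_def dot_square_norm)
  then have "(norm (mexp M h *v y))\<^sup>2 \<le> exp (2 * L * h) * (norm y)\<^sup>2"
    using mult_left_mono[of _ _ "exp (2 * L * h)"] by (simp add: exp_minus field_simps)
  also have "\<dots> = (exp (L * h) * norm y)\<^sup>2"
    by (simp add: power_mult_distrib exp_double[symmetric] mult.assoc)
  finally show ?thesis by (rule power2_le_imp_le) simp
qed

text \<open>A word \<open>(h\<^sub>1, w\<^sub>1), \<dots>\<close> is a piecewise constant control, applied from left to right.\<close>

primrec wact :: "real^3^3 \<Rightarrow> real^3 \<Rightarrow> real^3 \<Rightarrow> (real \<times> real) list \<Rightarrow> real^3 \<Rightarrow> real^3" where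
  "wact A b c [] y = y"
| "wact A b c (p # ps) y = wact A b c ps (mexp (switched_matrix A b c (snd p)) (fst p) *v y)"

definition wvalid :: "(real \<times> real) list \<Rightarrow> bool" where
  "wvalid ps \<longleftrightarrow> (\<forall>p\<in>set ps. 0 < fst p \<and> snd p \<in> {0, 1})"

definition wdur :: "(real \<times> real) list \<Rightarrow> real" where
  "wdur ps = sum_list (map fst ps)"

lemma wvalid_simps [simp]: "wvalid []" "wvalid (p # ps) \<longleftrightarrow> 0 < fst p \<and> snd p \<in> {0, 1} \<and> wvalid ps"
  by (auto simp: wvalid_def)

lemma wdur_simps [simp]: "wdur [] = 0" "wdur (p # ps) = fst p + wdur ps"
  by (auto simp: wdur_def)

lemma wdur_nonneg: "wvalid ps \<Longrightarrow> 0 \<le> wdur ps"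
  by (induction ps) auto

lemma wact_linear: "linear (wact A b c ps)"
proof (induction ps)
  case Nil
  then show ?case by (simp add: linear_id[unfolded id_def] linear_iff)
next
  case (Cons p ps)
  from linear_compose[OF matrix_vector_mul_linear Cons.IH] show ?case by (simp add: o_def)
qed

lemma switched_mult_bound:
  obtains L where "L > 0" "\<And>w y. w \<in> {0, 1} \<Longrightarrow> norm (switched_matrix A b c w *v y) \<le> L * norm y"
proof -
  obtain L0 where L0: "L0 > 0" "\<And>y. norm (switched_matrix A b c 0 *v y) \<le> norm y * L0"
    using bounded_linear.pos_bounded[OF matrix_vector_mul_bounded_linear] by blast
  obtain L1 where L1: "L1 > 0" "\<And>y. norm (switched_matrix A b c 1 *v y) \<le> norm y * L1"
    using bounded_linear.pos_bounded[OF matrix_vector_mul_bounded_linear] by blast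
  show ?thesis
  proof (rule that[of "L0 + L1"])
    fix w :: real and y :: "real^'a" assume "w \<in> {0, 1}"
    moreover have "norm y * L0 \<le> (L0 + L1) * norm y" "norm y * L1 \<le> (L0 + L1) * norm y"
      using L0(1) L1(1) by (auto simp: algebra_simps)
    ultimately show "norm (switched_matrix A b c w *v y) \<le> (L0 + L1) * norm y"
      using L0(2)[of y] L1(2)[of y] by auto
  qed (use L0 L1 in auto)
qed

text \<open>The bridge to \<open>max_growth_rate\<close>, a supremum over measurable controls and
  Caratheodory solutions: infinitely many bang arcs are glued into one such solution. That
  \<open>\<sigma>\<close> exceeds every natural number rules out an accumulation of switching
  times.\<close>

lemma switched_path_admissible:
  fixes Y :: "nat \<Rightarrow> real^'n" and H W \<sigma> :: "nat \<Rightarrow> real"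
  assumes H: "\<And>n. 0 < H n" and W: "\<And>n. W n \<in> {0, 1}"
    and \<sigma>: "\<sigma> 0 = 0" "\<And>n. \<sigma> (Suc n) = \<sigma> n + H n" "\<And>k::nat. \<exists>n. real k \<le> \<sigma> n"
    and Y: "\<And>n. Y (Suc n) = mexp (switched_matrix A b c (W n)) (H n) *v Y n"
  shows "\<exists>u x. u \<in> borel_measurable (lebesgue_on {0..}) \<and> (\<forall>t\<ge>0. u t \<in> {0..1}) \<and>
     caratheodory_solution {0..} (\<lambda>t y. switched_matrix A b c (u t) *v y) x \<and> (\<forall>n. x (\<sigma> n) = Y n)"
proof -
  let ?M = "\<lambda>w. switched_matrix A b c w"
  obtain L where L: "L > 0" "\<And>w y. w \<in> {0, 1} \<Longrightarrow> norm (?M w *v y) \<le> L * norm y"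
    by (rule switched_mult_bound[of A b c]) blast
  \<comment> \<open>At a switching time the next arc is already the active one; \<open>x_eq\<close>
    shows that the arc formula still holds at the right end of the previous arc, which makes the
    glued curve continuous.\<close>
  define idx where "idx t = (LEAST n. t < \<sigma> (Suc n))" for t
  define u where "u t = W (idx t)" for t
  define x where "x t = mexp (?M (W (idx t))) (t - \<sigma> (idx t)) *v Y (idx t)" for t
  have inc: "strict_mono \<sigma>" using H by (simp add: strict_mono_Suc_iff \<sigma>(2))
  have nn: "0 \<le> \<sigma> n" for n
    using strict_mono_less_eq[OF inc, of 0 n] \<sigma>(1) by simp
  have idx_eq: "idx t = n" if "\<sigma> n \<le> t" "t < \<sigma> (Suc n)" for t n
    unfolding idx_def
  proof (rule Least_equality)
    fix m assume "t < \<sigma> (Suc m)"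
    show "n \<le> m"
    proof (rule ccontr)
      assume "\<not> n \<le> m"
      then have "\<sigma> (Suc m) \<le> \<sigma> n" using inc by (simp add: strict_mono_less_eq)
      then show False using \<open>t < \<sigma> (Suc m)\<close> that by simp
    qed
  qed (rule that(2))
  have ex: "\<exists>n. \<sigma> n \<le> t \<and> t < \<sigma> (Suc n)" if "0 \<le> t" for t
  proof -
    obtain k :: nat where "t < real k" using reals_Archimedean2 by blast
    obtain m where "real k \<le> \<sigma> m" using \<sigma>(3) by blast
    then have "t < \<sigma> m" using \<open>t < real k\<close> by simp
    define n where "n = (LEAST n. t < \<sigma> n)"
    have n: "t < \<sigma> n" "\<And>m. m < n \<Longrightarrow> \<sigma> m \<le> t"
      unfolding n_def using LeastI[of "\<lambda>n. t < \<sigma> n", OF \<open>t < \<sigma> m\<close>]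
      by (assumption, metis not_less_Least not_le)
    show ?thesis
    proof (cases n)
      case 0
      then show ?thesis using n(1) \<sigma>(1) that by simp
    next
      case (Suc n')
      then show ?thesis using n(1) n(2)[of n'] by auto
    qed
  qed
  have x_eq: "x t = mexp (?M (W n)) (t - \<sigma> n) *v Y n" if "\<sigma> n \<le> t" "t \<le> \<sigma> (Suc n)" for t n
  proof (cases "t < \<sigma> (Suc n)")
    case True
    then show ?thesis using idx_eq[OF that(1)] by (simp add: x_def)
  next
    case False
    then have "t = \<sigma> (Suc n)" using that by simp
    moreover have "idx t = Suc n" using idx_eq[of "Suc n" t] \<open>t = _\<close> \<sigma>(2)[of "Suc n"] H[of "Suc n"] by simp
    ultimately show ?thesis by (simp add: x_def Y \<sigma>(2))
  qed
  have x\<sigma>: "x (\<sigma> n) = Y n" for n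
    using x_eq[of n "\<sigma> n"] \<sigma>(2)[of n] H[of n] by simp
  have Yb: "norm (Y n) \<le> exp (L * \<sigma> n) * norm (Y 0)" for n
  proof (induction n)
    case (Suc n)
    have "norm (Y (Suc n)) \<le> exp (L * H n) * norm (Y n)"
      unfolding Y by (rule norm_mexp_le) (use L W[of n] H[of n] in auto)
    also have "\<dots> \<le> exp (L * H n) * (exp (L * \<sigma> n) * norm (Y 0))" by (intro mult_left_mono Suc) simp
    also have "\<dots> = exp (L * \<sigma> (Suc n)) * norm (Y 0)" by (simp add: \<sigma>(2) algebra_simps exp_add)
    finally show ?case .
  qed (simp add: \<sigma>(1))
  have xb: "norm (x t) \<le> exp (L * t) * norm (Y 0)" if "0 \<le> t" for t
  proof -
    obtain n where n: "\<sigma> n \<le> t" "t < \<sigma> (Suc n)" using ex[OF \<open>0 \<le> t\<close>] by blast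
    have "norm (x t) \<le> exp (L * (t - \<sigma> n)) * norm (Y n)"
      using x_eq[of n t] n norm_mexp_le[of "?M (W n)" L "t - \<sigma> n" "Y n"] L(2) W[of n] by auto
    also have "\<dots> \<le> exp (L * (t - \<sigma> n)) * (exp (L * \<sigma> n) * norm (Y 0))" by (intro mult_left_mono Yb) simp
    also have "\<dots> = exp (L * t) * norm (Y 0)" by (simp add: algebra_simps exp_add[symmetric])
    finally show ?thesis .
  qed
  have xd: "((\<lambda>t. mexp (?M (W n)) (t - \<sigma> n) *v Y n) has_vector_derivative
      ?M (W n) *v (mexp (?M (W n)) (t - \<sigma> n) *v Y n)) (at t within S)" for n t S
  proof -
    have "((\<lambda>t. t - \<sigma> n) has_real_derivative 1) (at t within S)" by (auto intro!: derivative_eq_intros)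
    from mexp_deriv'[OF this] show ?thesis by simp
  qed
  have lip: "norm (x q - x p) \<le> L * (exp (L * B) * norm (Y 0)) * (q - p)"
    if "0 \<le> p" "p \<le> q" "q \<le> B" "q \<le> \<sigma> n" for n p q B
    using that
  proof (induction n arbitrary: p q)
    case 0
    then have "p = q" using \<sigma>(1) by simp
    then show ?case by simp
  next
    case (Suc n)
    let ?K = "L * (exp (L * B) * norm (Y 0))"
    have piece: "norm (x s' - x s) \<le> ?K * (s' - s)" if "\<sigma> n \<le> s" "s \<le> s'" "s' \<le> \<sigma> (Suc n)" "s' \<le> B" for s s'
    proof -
      have "norm (mexp (?M (W n)) (s' - \<sigma> n) *v Y n - mexp (?M (W n)) (s - \<sigma> n) *v Y n) \<le> ?K * (s' - s)"
      proof (rule vector_derivative_bound[OF xd])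
        fix t assume t: "t \<in> {s..s'}"
        then have "0 \<le> t" using nn[of n] that by auto
        have "norm (?M (W n) *v x t) \<le> L * norm (x t)" by (rule L(2)[OF W])
        also have "\<dots> \<le> L * (exp (L * t) * norm (Y 0))" using xb[OF \<open>0 \<le> t\<close>] L(1) by simp
        also have "\<dots> \<le> ?K" using t that L(1) by (intro mult_left_mono mult_right_mono) auto
        finally show "norm (?M (W n) *v (mexp (?M (W n)) (t - \<sigma> n) *v Y n)) \<le> ?K"
          using x_eq[of n t] t that by simp
      qed (use that in auto)
      then show ?thesis using x_eq[of n s] x_eq[of n s'] that by simp
    qed
    consider "q \<le> \<sigma> n" | "\<sigma> n \<le> p" | "p \<le> \<sigma> n" "\<sigma> n \<le> q" by linarith
    then show ?case
    proof cases
      case 1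
      then show ?thesis using Suc.IH[of p q] Suc.prems by simp
    next
      case 2
      then show ?thesis using piece[of p q] Suc.prems by simp
    next
      case 3
      have "norm (x q - x p) \<le> norm (x q - x (\<sigma> n)) + norm (x (\<sigma> n) - x p)"
        using norm_triangle_ineq[of "x q - x (\<sigma> n)" "x (\<sigma> n) - x p"] by simp
      also have "\<dots> \<le> ?K * (q - \<sigma> n) + ?K * (\<sigma> n - p)"
        using piece[of "\<sigma> n" q] Suc.IH[of p "\<sigma> n"] 3 Suc.prems by (intro add_mono) auto
      finally show ?thesis by (simp add: algebra_simps)
    qed
  qed
  have car: "caratheodory_solution {0..} (\<lambda>t y. ?M (u t) *v y) x"
    unfolding caratheodory_solution_def
  proof (intro conjI allI impI)
    fix p q :: real assume sub: "{p..q} \<subseteq> {0..}"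
    obtain k :: nat where "q < real k" using reals_Archimedean2 by blast
    obtain n where "real k \<le> \<sigma> n" using \<sigma>(3) by blast
    then have n: "q \<le> \<sigma> n" using \<open>q < real k\<close> by simp
    show "absolutely_continuous_on {p..q} x"
      by (rule lipschitz_imp_ac[of "L * (exp (L * q) * norm (Y 0))"])
        (use L(1) lip[of _ _ q n] n sub in \<open>auto simp: subset_iff\<close>)
  next
    have "AE t in lebesgue. t \<notin> range \<sigma>"
      by (rule AE_I'[of "range \<sigma>"]) (auto intro: countable_imp_null_set_lborel null_sets_completionI)
    then show "AE t in lebesgue. t \<in> {0..} \<longrightarrow> (x has_vector_derivative ?M (u t) *v x t) (at t within {0..})"
    proof eventually_elim
      case (elim t)
      show ?case
      proof
        assume "t \<in> {0..}"
        then obtain n where n: "\<sigma> n \<le> t" "t < \<sigma> (Suc n)" using ex[of t] by auto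
        then have "\<sigma> n < t" using elim by (cases "\<sigma> n = t") auto
        have "(x has_vector_derivative ?M (W n) *v (mexp (?M (W n)) (t - \<sigma> n) *v Y n)) (at t within UNIV)"
          by (rule has_vector_derivative_transform_within_open[OF xd, where S = "{\<sigma> n<..<\<sigma> (Suc n)}"])
            (use n \<open>\<sigma> n < t\<close> x_eq[of n] in auto)
        then show "(x has_vector_derivative ?M (u t) *v x t) (at t within {0..})"
          using x_eq[of n t] n idx_eq[of n t] by (auto simp: u_def intro: has_vector_derivative_at_within)
      qed
    qed
  qed
  have "u \<in> borel_measurable (lebesgue_on {0..})"
  proof -
    have "idx \<in> measurable borel (count_space UNIV)"
      unfolding idx_def by measurable
    then have "u \<in> borel_measurable borel"
      unfolding u_def by (rule measurable_compose) simp
    then have "u \<in> borel_measurable lebesgue" by (simp add: measurable_completion)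
    then show ?thesis by (rule measurable_restrict_space1)
  qed
  moreover have "\<forall>t\<ge>0. u t \<in> {0..1}" 
  proof (intro allI impI)
    fix t show "u t \<in> {0..1}" using W[of "idx t"] by (auto simp: u_def)
  qed
  ultimately show ?thesis using car x\<sigma> by blast
qed


lemma wact_norm_le:
  assumes L: "\<And>w y. w \<in> {0, 1} \<Longrightarrow> norm (switched_matrix A b c w *v y) \<le> L * norm y"
  shows "wvalid ps \<Longrightarrow> norm (wact A b c ps y) \<le> exp (L * wdur ps) * norm y"
proof (induction ps arbitrary: y)
  case (Cons p ps)
  let ?y = "mexp (switched_matrix A b c (snd p)) (fst p) *v y"
  have "norm (wact A b c ps ?y) \<le> exp (L * wdur ps) * norm ?y" using Cons by simp
  also have "\<dots> \<le> exp (L * wdur ps) * (exp (L * fst p) * norm y)"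
    using Cons.prems L[of "snd p"] by (intro mult_left_mono norm_mexp_le) auto
  also have "\<dots> = exp (L * wdur (p # ps)) * norm y" by (simp add: algebra_simps exp_add)
  finally show ?case by simp
qed simp

text \<open>From the end of one growing word another one is available, so words can be concatenated
  for ever. Durations of at least 1 make the total time diverge, and at the ends of words the norm
  is at least \<open>exp (\<gamma> * t)\<close>.\<close>

lemma growing_words_positive_rate:
  assumes grow: "\<And>y. y \<noteq> 0 \<Longrightarrow> \<exists>ps. ps \<noteq> [] \<and> wvalid ps \<and> 1 \<le> wdur ps \<and>
      exp (\<gamma> * wdur ps) * norm y \<le> norm (wact A b c ps y)"
    and "0 < \<gamma>"
  shows "max_growth_rate A b c > 0"
proof -
  let ?M = "\<lambda>w. switched_matrix A b c w"
  obtain P where P: "\<And>y. y \<noteq> 0 \<Longrightarrow> P y \<noteq> []" "\<And>y. y \<noteq> 0 \<Longrightarrow> wvalid (P y)"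
    "\<And>y. y \<noteq> 0 \<Longrightarrow> 1 \<le> wdur (P y)"
    "\<And>y. y \<noteq> 0 \<Longrightarrow> exp (\<gamma> * wdur (P y)) * norm y \<le> norm (wact A b c (P y) y)"
    using grow by metis
  obtain y0 :: "real^3" where y0: "norm y0 = 1" using vector_choose_size[of 1] by auto
  then have y0nz: "y0 \<noteq> 0" by auto
  \<comment> \<open>The state is the current point together with the letters not yet executed; the
    list is refilled from \<open>P\<close> when its last letter has been consumed.\<close>
  define step where "step = (\<lambda>(y, ps). let y' = mexp (?M (snd (hd ps))) (fst (hd ps)) *v y in
     (y', if tl ps = [] then P y' else tl ps))"
  define st where "st n = (step ^^ n) (y0, P y0)" for n
  define Y Q where "Y n = fst (st n)" and "Q n = snd (st n)" for n
  define H W where "H n = fst (hd (Q n))" and "W n = snd (hd (Q n))" for n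
  define \<sigma> where "\<sigma> n = (\<Sum>i<n. H i)" for n
  have Y0: "Y 0 = y0" "Q 0 = P y0" by (simp_all add: Y_def Q_def st_def)
  have YS: "Y (Suc n) = mexp (?M (W n)) (H n) *v Y n" and
    QS: "Q (Suc n) = (if tl (Q n) = [] then P (Y (Suc n)) else tl (Q n))" for n
    by (simp_all add: Y_def Q_def st_def step_def H_def W_def case_prod_unfold Let_def)
  have \<sigma>S: "\<sigma> 0 = 0" "\<sigma> (Suc n) = \<sigma> n + H n" for n by (simp_all add: \<sigma>_def)
  have Ynz: "Y n \<noteq> 0" for n by (induction n) (use y0 Y0 in \<open>auto simp: YS\<close>)
  have Qv: "Q n \<noteq> [] \<and> wvalid (Q n)" for n
  proof (induction n)
    case 0
    then show ?case using P(1,2)[OF y0nz] Y0 by simp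
  next
    case (Suc n)
    then show ?case using P(1,2)[OF Ynz[of "Suc n"]] by (cases "Q n") (auto simp: QS)
  qed
  have HW: "0 < H n" "W n \<in> {0, 1}" for n
    using Qv[of n] by (cases "Q n"; simp add: H_def W_def)+
  have Qc: "Q n = (H n, W n) # tl (Q n)" for n
    using Qv[of n] by (cases "Q n") (auto simp: H_def W_def)
  have durQ: "wdur (Q n) = H n + wdur (tl (Q n))" and actQ: "wact A b c (Q n) (Y n) = wact A b c (tl (Q n)) (Y (Suc n))" for n
    by (subst Qc, simp add: YS)+
  \<comment> \<open>The estimate concerns the end of the current word and not the present moment,
    since the norm may drop in the middle of a word.\<close>
  have inv: "exp (\<gamma> * (\<sigma> n + wdur (Q n))) \<le> norm (wact A b c (Q n) (Y n))" for n
  proof (induction n)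
    case 0
    then show ?case using P(4)[OF y0nz] y0 Y0 by (simp add: \<sigma>S)
  next
    case (Suc n)
    show ?case
    proof (cases "tl (Q n) = []")
      case True
      have "exp (\<gamma> * (\<sigma> (Suc n) + wdur (Q (Suc n)))) = exp (\<gamma> * wdur (Q (Suc n))) * exp (\<gamma> * \<sigma> (Suc n))"
        by (simp add: algebra_simps exp_add)
      also have "\<dots> \<le> exp (\<gamma> * wdur (Q (Suc n))) * norm (Y (Suc n))"
        using Suc True by (intro mult_left_mono) (auto simp: durQ actQ \<sigma>S)
      also have "\<dots> \<le> norm (wact A b c (Q (Suc n)) (Y (Suc n)))"
        using P(4)[OF Ynz[of "Suc n"]] True by (simp add: QS)
      finally show ?thesis .
    next
      case False
      then show ?thesis using Suc by (simp add: durQ actQ QS \<sigma>S add.assoc)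
    qed
  qed
  have refresh: "\<exists>m\<ge>n. tl (Q m) = [] \<and> \<sigma> (Suc m) = \<sigma> n + wdur (Q n)" for n
  proof (induction "length (Q n)" arbitrary: n)
    case 0
    then show ?case using Qv by auto
  next
    case (Suc k)
    show ?case
    proof (cases "tl (Q n) = []")
      case True
      then show ?thesis by (intro exI[of _ n]) (simp add: durQ \<sigma>S)
    next
      case False
      then have "k = length (Q (Suc n))" using Suc(2) by (simp add: QS)
      from Suc(1)[OF this] obtain m where "m \<ge> Suc n" "tl (Q m) = []" "\<sigma> (Suc m) = \<sigma> (Suc n) + wdur (Q (Suc n))" by blast
      then show ?thesis using False by (intro exI[of _ m]) (simp add: durQ QS \<sigma>S)
    qed
  qed
  have far: "\<exists>m. real k \<le> \<sigma> m \<and> exp (\<gamma> * \<sigma> m) \<le> norm (Y m) \<and> 1 \<le> wdur (Q m)" for k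
  proof (induction k)
    case 0
    then show ?case using P(3)[OF y0nz] y0 Y0 by (intro exI[of _ 0]) (simp add: \<sigma>S)
  next
    case (Suc k)
    then obtain n where n: "real k \<le> \<sigma> n" "1 \<le> wdur (Q n)" by blast
    obtain m where m: "tl (Q m) = []" "\<sigma> (Suc m) = \<sigma> n + wdur (Q n)" using refresh by blast
    have "exp (\<gamma> * \<sigma> (Suc m)) \<le> norm (Y (Suc m))"
      using inv[of m] m(1) by (simp add: durQ actQ \<sigma>S)
    moreover have "1 \<le> wdur (Q (Suc m))" using P(3)[OF Ynz[of "Suc m"]] m(1) by (simp add: QS)
    ultimately show ?case using n m(2) by (intro exI[of _ "Suc m"]) auto
  qed
  obtain u x where u: "u \<in> borel_measurable (lebesgue_on {0..})" "\<forall>t\<ge>0. u t \<in> {0..1}"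
    and x: "caratheodory_solution {0..} (\<lambda>t y. ?M (u t) *v y) x" "\<And>n. x (\<sigma> n) = Y n"
  proof -
    have "\<exists>n. real k \<le> \<sigma> n" for k using far by blast
    from switched_path_admissible[OF HW \<sigma>S this YS] show ?thesis using that by blast
  qed
  have "ereal \<gamma> \<le> Limsup at_top (\<lambda>t. ereal (1 / t * ln (norm (x t))))"
  proof (rule ccontr)
    assume "\<not> ?thesis"
    then have "\<forall>\<^sub>F t in at_top. ereal (1 / t * ln (norm (x t))) < ereal \<gamma>"
      by (intro Limsup_lessD) (simp add: not_le)
    then obtain t0 where t0: "\<And>t. t0 \<le> t \<Longrightarrow> 1 / t * ln (norm (x t)) < \<gamma>"
      unfolding eventually_at_top_linorder by auto
    obtain k :: nat where k: "max t0 1 < real k" using reals_Archimedean2 by blast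
    obtain m where m: "real k \<le> \<sigma> m" "exp (\<gamma> * \<sigma> m) \<le> norm (Y m)" using far by blast
    have "\<gamma> * \<sigma> m \<le> ln (norm (Y m))" using m(2) Ynz[of m] by (simp add: ln_ge_iff)
    then have "\<gamma> \<le> 1 / \<sigma> m * ln (norm (x (\<sigma> m)))" using m(1) k by (simp add: x field_simps)
    moreover have "1 / \<sigma> m * ln (norm (x (\<sigma> m))) < \<gamma>" using t0[of "\<sigma> m"] k m(1) by simp
    ultimately show False by simp
  qed
  also have "\<dots> \<le> max_growth_rate A b c"
    unfolding max_growth_rate_def
  proof (rule Sup_upper, intro CollectI exI conjI)
    show "x 0 \<noteq> 0" using x(2)[of 0] \<sigma>S(1) Y0(1) y0nz by simp
  qed (rule refl u x(1))+
  finally have "ereal \<gamma> \<le> max_growth_rate A b c" .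
  then show ?thesis using \<open>0 < \<gamma>\<close> by (metis ereal_less(2) less_le_trans)
qed

lemma wact_scale: "wact A b c ps (k *\<^sub>R y) = k *\<^sub>R wact A b c ps y"
  using wact_linear linear_scale by blast

text \<open>Compactness of the unit sphere: finitely many words enlarge every direction by the
  factor \<open>exp L\<close>, so their durations have a common bound \<open>D\<close> and the rate
  \<open>L / D\<close> is available everywhere.\<close>

lemma unbounded_words_positive_rate:
  fixes A :: "real^3^3"
  assumes unb: "\<And>y K. y \<noteq> 0 \<Longrightarrow> \<exists>ps. wvalid ps \<and> K < norm (wact A b c ps y)"
  shows "max_growth_rate A b c > 0"
proof -
  obtain L where L: "L > 0" "\<And>w y. w \<in> {0, 1} \<Longrightarrow> norm (switched_matrix A b c w *v y) \<le> L * norm y"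
    by (rule switched_mult_bound[of A b c]) blast
  define S where "S = sphere (0::real^3) 1"
  \<comment> \<open>The factor \<open>exp L\<close> is chosen because norms grow at most like
    \<open>exp (L * t)\<close>: a word that achieves it lasts longer than 1.\<close>
  have "\<forall>y\<in>S. \<exists>ps. wvalid ps \<and> exp L < norm (wact A b c ps y)"
  proof
    fix y assume "y \<in> S"
    then have "y \<noteq> 0" by (auto simp: S_def)
    then show "\<exists>ps. wvalid ps \<and> exp L < norm (wact A b c ps y)" by (rule unb)
  qed
  then obtain P where P: "\<And>y. y \<in> S \<Longrightarrow> wvalid (P y)" "\<And>y. y \<in> S \<Longrightarrow> exp L < norm (wact A b c (P y) y)"
    by metis
  have op: "open {z. exp L < norm (wact A b c ps z)}" for ps
    by (intro open_Collect_less continuous_intros linear_continuous_on linear_conv_bounded_linear[THEN iffD1] wact_linear)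
  have "compact S" by (simp add: S_def)
  then obtain F where F: "finite F" "F \<subseteq> S" "S \<subseteq> (\<Union>y\<in>F. {z. exp L < norm (wact A b c (P y) z)})"
    by (rule compactE_image[of S S "\<lambda>y. {z. exp L < norm (wact A b c (P y) z)}"]) (use op P(2) in auto)
  define D where "D = (\<Sum>y\<in>F. wdur (P y)) + 1"
  have D: "wdur (P y) \<le> D" if "y \<in> F" for y
    unfolding D_def using F P(1) that
    by (intro add_increasing2 member_le_sum) (auto intro: wdur_nonneg)
  have "D > 0" unfolding D_def using F P(1) by (intro add_nonneg_pos sum_nonneg) (auto intro: wdur_nonneg)
  show ?thesis
  proof (rule growing_words_positive_rate[where \<gamma> = "L / D"])
    fix y :: "real^3" assume "y \<noteq> 0"
    define z where "z = (1 / norm y) *\<^sub>R y"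
    have z: "z \<in> S" "y = norm y *\<^sub>R z" using \<open>y \<noteq> 0\<close> by (auto simp: z_def S_def)
    obtain q where q: "q \<in> F" "exp L < norm (wact A b c (P q) z)" using F(3) z(1) by auto
    have v: "wvalid (P q)" using q F(2) P(1) by blast
    have "exp L < exp (L * wdur (P q)) * norm z" using q(2) wact_norm_le[OF L(2) v, of z] by simp
    then have 1: "1 < wdur (P q)" using z(1) L(1) by (simp add: S_def)
    have "L / D * wdur (P q) \<le> L" using D[OF q(1)] L(1) \<open>D > 0\<close> by (simp add: field_simps)
    then have "exp (L / D * wdur (P q)) \<le> norm (wact A b c (P q) z)"
      using q(2) by (meson exp_le_cancel_iff less_imp_le order_trans)
    then have "exp (L / D * wdur (P q)) * norm y \<le> norm y * norm (wact A b c (P q) z)"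
      by (simp add: mult.commute mult_left_mono)
    also have "\<dots> = norm (wact A b c (P q) y)" by (subst (2) z(2)) (simp add: wact_scale)
    finally show "\<exists>ps. ps \<noteq> [] \<and> wvalid ps \<and> 1 \<le> wdur ps \<and>
      exp (L / D * wdur ps) * norm y \<le> norm (wact A b c ps y)"
      using 1 v by (intro exI[of _ "P q"]) auto
  qed (use L(1) \<open>D > 0\<close> in simp)
qed

text \<open>Irreducibility. The vectors with bounded orbit form a subspace \<open>V\<close>
  invariant under both matrices. If \<open>V\<close> were zero the growth rate would be positive;
  otherwise observability provides a vector of \<open>V\<close> not annihilated by \<open>c\<close>,
  the difference of the two matrices puts \<open>b\<close> into \<open>V\<close>, and
  controllability makes \<open>V\<close> the whole space.\<close>

lemma bounded_words:
  fixes A :: "real^3^3"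
  assumes "controllable_pair A b" "controllable_pair (transpose A) c" "max_growth_rate A b c = 0"
  shows "\<exists>C. \<forall>ps. wvalid ps \<longrightarrow> norm (wact A b c ps y) \<le> C"
proof -
  let ?M = "\<lambda>w. switched_matrix A b c w"
  define V where "V = {y. \<exists>C. \<forall>ps. wvalid ps \<longrightarrow> norm (wact A b c ps y) \<le> C}"
  have V: "subspace V"
    unfolding subspace_def
  proof (intro conjI ballI allI)
    show "0 \<in> V" by (auto simp: V_def linear_0[OF wact_linear])
  next
    fix y z assume "y \<in> V" "z \<in> V"
    then obtain C D where "\<And>ps. wvalid ps \<Longrightarrow> norm (wact A b c ps y) \<le> C"
      "\<And>ps. wvalid ps \<Longrightarrow> norm (wact A b c ps z) \<le> D" unfolding V_def by blast
    then show "y + z \<in> V" unfolding V_def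
      by (intro CollectI exI[of _ "C + D"]) (auto simp: linear_add[OF wact_linear] intro: norm_triangle_le add_mono)
  next
    fix k :: real and y assume "y \<in> V"
    then obtain C where "\<And>ps. wvalid ps \<Longrightarrow> norm (wact A b c ps y) \<le> C" unfolding V_def by blast
    then show "k *\<^sub>R y \<in> V" unfolding V_def
      by (intro CollectI exI[of _ "\<bar>k\<bar> * C"]) (auto simp: wact_scale intro: mult_left_mono)
  qed
  have closed: "closed V" by (rule closed_subspace[OF V])
  have step: "mexp (?M w) h *v y \<in> V" if y: "y \<in> V" and w: "w \<in> {0, 1}" and h: "0 < h" for y w h
  proof -
    obtain C where C: "\<And>ps. wvalid ps \<Longrightarrow> norm (wact A b c ps y) \<le> C" using y unfolding V_def by blast
    have "norm (wact A b c ps (mexp (?M w) h *v y)) \<le> C" if "wvalid ps" for ps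
      using C[of "(h, w) # ps"] that w h by auto
    then show ?thesis unfolding V_def by blast
  qed
  \<comment> \<open>A closed invariant subspace contains the right derivative at 0 of every curve
    that stays in it.\<close>
  have MV: "?M w *v y \<in> V" if y: "y \<in> V" and w: "w \<in> {0, 1}" for y w
  proof -
    have "((\<lambda>h. mexp (?M w) h *v y) has_vector_derivative ?M w *v (mexp (?M w) 0 *v y)) (at_right 0)"
      by (rule mexp_deriv)
    then have "((\<lambda>h. (1 / norm (h - 0)) *\<^sub>R (mexp (?M w) h *v y - (y + (h - 0) *\<^sub>R (?M w *v y))) + ?M w *v y)
        \<longlongrightarrow> 0 + ?M w *v y) (at_right 0)"
      unfolding has_vector_derivative_def has_derivative_within by (intro tendsto_add) auto
    then have "((\<lambda>h. (1 / h) *\<^sub>R (mexp (?M w) h *v y - y)) \<longlongrightarrow> 0 + ?M w *v y) (at_right 0)"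
    proof (rule Lim_transform_eventually)
      show "\<forall>\<^sub>F h in at_right 0. (1 / norm (h - 0)) *\<^sub>R (mexp (?M w) h *v y - (y + (h - 0) *\<^sub>R (?M w *v y))) + ?M w *v y =
          (1 / h) *\<^sub>R (mexp (?M w) h *v y - y)"
        using eventually_at_right_less[of 0]
        by eventually_elim (simp add: algebra_simps)
    qed
    then have lim: "((\<lambda>h. (1 / h) *\<^sub>R (mexp (?M w) h *v y - y)) \<longlongrightarrow> ?M w *v y) (at_right 0)" by simp
    have "\<forall>\<^sub>F h in at_right 0. (1 / h) *\<^sub>R (mexp (?M w) h *v y - y) \<in> V"
      using eventually_at_right_less[of 0]
      by eventually_elim (intro subspace_scale[OF V] subspace_diff[OF V] step y w)
    then show ?thesis by (rule Lim_in_closed_set[OF closed _ trivial_limit_at_right_real lim])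
  qed
  have M0: "?M 0 *v y = A *v y" for y by (simp add: switched_matrix_def)
  have M1: "?M 1 *v y = A *v y + (c \<bullet> y) *\<^sub>R b" for y
    by (simp add: switched_matrix_def matrix_vector_mult_add_rdistrib outer_product_mult)
  have AV: "A *v y \<in> V" if "y \<in> V" for y using MV[OF that, of 0] by (simp add: M0)
  have "V = UNIV"
  proof (cases "V \<subseteq> {0}")
    case True
    have "\<exists>ps. wvalid ps \<and> K < norm (wact A b c ps y)" if "y \<noteq> 0" for y K
    proof -
      have "y \<notin> V" using True that by auto
      then show ?thesis unfolding V_def by (auto simp: not_le)
    qed
    then have "max_growth_rate A b c > 0" by (rule unbounded_words_positive_rate)
    then show ?thesis using assms(3) by simp
  next
    case False
    then obtain y where y: "y \<in> V" "y \<noteq> 0" by blast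
    have bV: "b \<in> V" if "z \<in> V" "c \<bullet> z \<noteq> 0" for z
    proof -
      have "?M 1 *v z - ?M 0 *v z \<in> V" by (intro subspace_diff[OF V] MV that) auto
      then have "(c \<bullet> z) *\<^sub>R b \<in> V" by (simp add: M0 M1)
      then have "(1 / (c \<bullet> z)) *\<^sub>R ((c \<bullet> z) *\<^sub>R b) \<in> V" by (rule subspace_scale[OF V])
      then show ?thesis using that by simp
    qed
    have "b \<in> V"
      using controllable_pair_observable[OF assms(2), of y] y bV[of y] bV[of "A *v y"] bV[of "A *v (A *v y)"] AV
      by blast
    have "((*v) A ^^ k) b \<in> V" for k by (induction k) (simp_all add: \<open>b \<in> V\<close> AV)
    then have "span {((*v) A ^^ k) b | k. k < CARD(3)} \<subseteq> V" by (intro span_minimal V) auto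
    then show ?thesis using assms(1) by (auto simp: controllable_pair_def)
  qed
  then show ?thesis by (auto simp: V_def)
qed

text \<open>\<open>v\<close> is the supremum of the Euclidean norm over all words. Applying an arc
  first only restricts the words that compete, and the empty word makes \<open>v\<close>
  definite.\<close>

lemma extremal_norm_exists:
  fixes A :: "real^3^3"
  assumes "controllable_pair A b" "controllable_pair (transpose A) c" "max_growth_rate A b c = 0"
  obtains v where "is_norm v"
    "\<And>w h y. w \<in> {0, 1} \<Longrightarrow> 0 \<le> h \<Longrightarrow> v (mexp (switched_matrix A b c w) h *v y) \<le> v y"
proof -
  define v where "v y = (SUP ps\<in>Collect wvalid. norm (wact A b c ps y))" for y
  have bdd: "bdd_above ((\<lambda>ps. norm (wact A b c ps y)) ` Collect wvalid)" for y
    using bounded_words[OF assms, of y] by (force simp: bdd_above_def)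
  have ne: "Collect wvalid \<noteq> {}" using wvalid_simps(1) by blast
  have up: "norm (wact A b c ps y) \<le> v y" if "wvalid ps" for ps y
    unfolding v_def using that by (intro cSUP_upper bdd) auto
  have least: "v y \<le> K" if "\<And>ps. wvalid ps \<Longrightarrow> norm (wact A b c ps y) \<le> K" for y K
    unfolding v_def using that by (intro cSUP_least ne) auto
  have ny: "norm y \<le> v y" for y using up[of "[]" y] by simp
  have sc: "v (k *\<^sub>R y) \<le> \<bar>k\<bar> * v y" for k y
    by (rule least) (simp add: wact_scale mult_left_mono up)
  have "is_norm v"
    unfolding is_norm_def
  proof (intro conjI allI)
    show "0 \<le> v y" for y using ny[of y] norm_ge_zero order_trans by blast
    show "v y = 0 \<longleftrightarrow> y = 0" for y
      using ny[of y] sc[of 0 y] \<open>0 \<le> v y\<close> by auto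
    show "v (k *\<^sub>R y) = \<bar>k\<bar> * v y" for k y
    proof (rule antisym[OF sc])
      show "\<bar>k\<bar> * v y \<le> v (k *\<^sub>R y)"
      proof (cases "k = 0")
        case True
        then show ?thesis using \<open>0 \<le> v (k *\<^sub>R y)\<close> by simp
      next
        case False
        then show ?thesis using sc[of "1 / k" "k *\<^sub>R y"] by (simp add: field_simps)
      qed
    qed
    show "v (y + z) \<le> v y + v z" for y z
    proof (rule least)
      fix ps assume "wvalid ps"
      then show "norm (wact A b c ps (y + z)) \<le> v y + v z"
        using up[of ps y] up[of ps z] by (auto simp: linear_add[OF wact_linear] intro: norm_triangle_le)
    qed
  qed
  moreover have "v (mexp (switched_matrix A b c w) h *v y) \<le> v y" if "w \<in> {0, 1}" "0 \<le> h" for w h y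
  proof (cases "h = 0")
    case False
    show ?thesis
    proof (rule least)
      fix ps assume "wvalid ps"
      then show "norm (wact A b c ps (mexp (switched_matrix A b c w) h *v y)) \<le> v y"
        using up[of "(h, w) # ps" y] that False by auto
    qed
  qed simp
  ultimately show ?thesis by (rule that)
qed

lemma is_normD:
  assumes "is_norm v"
  shows "0 \<le> v y" "v y = 0 \<longleftrightarrow> y = 0" "v (k *\<^sub>R y) = \<bar>k\<bar> * v y" "v (y + z) \<le> v y + v z"
  using assms by (auto simp: is_norm_def)

lemma is_norm_uminus: "is_norm v \<Longrightarrow> v (- y) = v y"
  using is_normD(3)[of v "-1" y] by simp

lemma is_norm_diff_le: "is_norm v \<Longrightarrow> v (y - z) \<le> v y + v z"
  using is_normD(4)[of v y "- z"] by (simp add: is_norm_uminus)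

lemma is_norm_diff_ge: "is_norm v \<Longrightarrow> v y - v z \<le> v (y - z)"
  using is_normD(4)[of v "y - z" z] by simp

lemma is_norm_sum: "is_norm v \<Longrightarrow> v (\<Sum>i\<in>S. f i) \<le> (\<Sum>i\<in>S. v (f i))"
proof (induction S rule: infinite_finite_induct)
  case (insert x F)
  then show ?case using is_normD(4)[of v "f x" "sum f F"] by simp
qed (use is_normD(2)[of v 0] in auto)

lemma is_norm_upper:
  fixes v :: "'a::euclidean_space \<Rightarrow> real"
  assumes v: "is_norm v"
  obtains C where "C > 0" "\<And>y. v y \<le> C * norm y"
proof (rule that[of "(\<Sum>i\<in>Basis. v i) + 1"])
  have "0 \<le> (\<Sum>i\<in>Basis. v i)" by (intro sum_nonneg is_normD(1)[OF v])
  then show "(\<Sum>i\<in>Basis. v i) + 1 > 0" by simp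
  fix y :: 'a
  have "v y = v (\<Sum>i\<in>Basis. (y \<bullet> i) *\<^sub>R i)" by (simp add: euclidean_representation)
  also have "\<dots> \<le> (\<Sum>i\<in>Basis. \<bar>y \<bullet> i\<bar> * v i)"
    using is_norm_sum[OF v] by (simp add: is_normD(3)[OF v, symmetric])
  also have "\<dots> \<le> (\<Sum>i\<in>Basis. norm y * v i)"
    by (intro sum_mono mult_right_mono Basis_le_norm is_normD(1)[OF v])
  also have "\<dots> \<le> ((\<Sum>i\<in>Basis. v i) + 1) * norm y"
    by (simp add: sum_distrib_left[symmetric] algebra_simps)
  finally show "v y \<le> ((\<Sum>i\<in>Basis. v i) + 1) * norm y" .
qed

lemma is_norm_continuous:
  fixes v :: "'a::euclidean_space \<Rightarrow> real"
  assumes v: "is_norm v"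
  shows "continuous_on S v"
proof -
  obtain C where C: "C > 0" "\<And>y. v y \<le> C * norm y" using is_norm_upper[OF v] by blast
  have le: "\<bar>v y - v z\<bar> \<le> C * norm (y - z)" for y z
    using is_norm_diff_ge[OF v, of y z] is_norm_diff_ge[OF v, of z y] C(2)[of "y - z"] C(2)[of "z - y"]
    by (auto simp: norm_minus_commute)
  show ?thesis
    unfolding continuous_on_iff
  proof (intro ballI allI impI)
    fix y and e :: real assume "0 < e"
    show "\<exists>d>0. \<forall>z\<in>S. dist z y < d \<longrightarrow> dist (v z) (v y) < e"
    proof (intro exI[of _ "e / C"] conjI ballI impI)
      fix z assume "dist z y < e / C"
      then have "C * norm (z - y) < e" using C(1) by (simp add: dist_norm field_simps)
      then show "dist (v z) (v y) < e" using le[of z y] by (simp add: dist_real_def)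
    qed (use \<open>0 < e\<close> C(1) in simp)
  qed
qed

lemma is_norm_lower:
  fixes v :: "'a::euclidean_space \<Rightarrow> real"
  assumes v: "is_norm v"
  obtains C where "C > 0" "\<And>y. norm y \<le> C * v y"
proof -
  have "\<exists>x\<in>sphere (0::'a) 1. \<forall>y\<in>sphere 0 1. v x \<le> v y"
    by (rule continuous_attains_inf) (auto intro: is_norm_continuous[OF v])
  then obtain x where x: "norm x = 1" "\<And>y. norm y = 1 \<Longrightarrow> v x \<le> v y" by auto
  then have "v x > 0" using is_normD(1,2)[OF v, of x] by (metis less_eq_real_def norm_zero zero_neq_one)
  have "norm y \<le> (1 / v x) * v y" for y
  proof (cases "y = 0")
    case False
    have "v x \<le> v ((1 / norm y) *\<^sub>R y)" by (rule x(2)) (use False in simp)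
    then show ?thesis using False \<open>v x > 0\<close> by (simp add: is_normD(3)[OF v] field_simps)
  qed (use is_normD(2)[OF v, of 0] in simp)
  then show ?thesis using that[of "1 / v x"] \<open>v x > 0\<close> by simp
qed

section \<open>Mean ergodic projection, characteristic polynomials, expansions\<close>

lemma mean_ergodic_projection:
  fixes R :: "real^'n \<Rightarrow> real^'n"
  assumes v: "is_norm v" and R: "linear R" and con: "\<And>y. v (R y) \<le> v y"
  obtains P where "linear P" "\<And>y. v (P y) \<le> v y" "\<And>y. R (P y) = P y" "\<And>y. P (R y) = P y"
    "\<And>y. R y = y \<Longrightarrow> P y = y"
proof -
  obtain C where C: "C > 0" "\<And>y. norm y \<le> C * v y" using is_norm_lower[OF v] by blast
  obtain D where D: "D > 0" "\<And>y. v y \<le> D * norm y" using is_norm_upper[OF v] by blast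
  have Rl: "linear (R ^^ j)" for j
    by (induction j) (auto simp: linear_id[unfolded id_def] linear_compose[OF _ R, unfolded o_def] id_def linear_iff linear_add[OF R] linear_scale[OF R])
  have Rv: "v ((R ^^ j) y) \<le> v y" for j y
    by (induction j) (auto intro: order_trans[OF con])
  define S where "S n y = (1 / real (Suc n)) *\<^sub>R (\<Sum>j<Suc n. (R ^^ j) y)" for n y
  have Sl: "linear (S n)" for n
    unfolding S_def by (intro linear_compose_scale_right linear_compose_sum ballI Rl)
  have Sv: "v (S n y) \<le> v y" for n y
  proof -
    have "v (\<Sum>j<Suc n. (R ^^ j) y) \<le> (\<Sum>j<Suc n. v ((R ^^ j) y))" by (rule is_norm_sum[OF v])
    also have "\<dots> \<le> real (Suc n) * v y" using sum_mono[of "{..<Suc n}" "\<lambda>j. v ((R ^^ j) y)" "\<lambda>_. v y"] Rv by simp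
    finally show ?thesis
      unfolding S_def is_normD(3)[OF v] by (simp add: field_simps del: sum.lessThan_Suc)
  qed
  have Sb: "norm (S n y) \<le> C * D * norm y" for n y
    using C(2)[of "S n y"] Sv[of n y] D(2)[of y] C(1)
    by (smt (verit, best) mult.assoc mult_left_mono)
  define X where "X n = matrix (S n)" for n
  have XS: "X n *v y = S n y" for n y using fun_cong[OF matrix_vector_mul(2)[OF Sl[of n]], of y] by (simp add: X_def)
  have "bounded (range X)"
  proof (rule boundedI)
    fix Z assume "Z \<in> range X"
    then obtain n where Z: "Z = X n" by blast
    have e: "\<bar>X n $ i $ j\<bar> \<le> C * D" for i j
    proof -
      have "X n $ i $ j = (S n (axis j 1)) $ i"
        using matrix_vector_mult_basis[of "X n" j] by (simp add: XS column_def)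
      then show ?thesis
        using component_le_norm_cart[of "S n (axis j 1)" i] Sb[of n "axis j 1"] by (simp add: norm_axis_1)
    qed
    have "norm (X n) \<le> (\<Sum>i\<in>UNIV. norm (X n $ i))" unfolding norm_vec_def by (rule L2_set_le_sum) simp
    also have "\<dots> \<le> (\<Sum>i\<in>(UNIV::'n set). \<Sum>j\<in>(UNIV::'n set). C * D)"
      by (intro sum_mono order_trans[OF norm_le_l1_cart] e)
    finally show "norm Z \<le> (\<Sum>i\<in>(UNIV::'n set). \<Sum>j\<in>(UNIV::'n set). C * D)" by (simp add: Z)
  qed
  then obtain Y r where Y: "strict_mono r" "(X \<circ> r) \<longlonglongrightarrow> Y"
    using bounded_imp_convergent_subsequence[of X] by blast
  have lim: "(\<lambda>n. S (r n) y) \<longlonglongrightarrow> Y *v y" for y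
  proof -
    have "(\<lambda>n. X (r n) *v y) \<longlonglongrightarrow> Y *v y"
      unfolding matrix_vector_mult_def
      by (intro vec_tendstoI) (use Y(2) in \<open>auto simp: o_def intro!: tendsto_sum tendsto_mult tendsto_const tendsto_vec_nth\<close>)
    then show ?thesis by (simp add: XS)
  qed
  have cR: "continuous_on UNIV R" using R by (simp add: linear_continuous_on linear_conv_bounded_linear)
  have diff: "(\<lambda>n. (1 / real (Suc (r n))) *\<^sub>R ((R ^^ Suc (r n)) y - y)) \<longlonglongrightarrow> 0" for y
  proof (rule Lim_null_comparison)
    show "\<forall>\<^sub>F n in sequentially. norm ((1 / real (Suc (r n))) *\<^sub>R ((R ^^ Suc (r n)) y - y)) \<le> (1 / real (Suc (r n))) * (C * (2 * v y))"
    proof (rule always_eventually, rule allI)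
      fix n
      have "norm ((R ^^ Suc (r n)) y - y) \<le> C * v ((R ^^ Suc (r n)) y - y)" by (rule C(2))
      also have "\<dots> \<le> C * (v y + v y)"
        using is_norm_diff_le[OF v, of "(R ^^ Suc (r n)) y" y] Rv[of "Suc (r n)" y] C(1) by (intro mult_left_mono) auto
      finally show "norm ((1 / real (Suc (r n))) *\<^sub>R ((R ^^ Suc (r n)) y - y)) \<le> (1 / real (Suc (r n))) * (C * (2 * v y))"
        by (simp add: divide_right_mono)
    qed
    have "(\<lambda>n. 1 / real (Suc (r n))) \<longlonglongrightarrow> 0"
      using LIMSEQ_subseq_LIMSEQ[OF LIMSEQ_inverse_real_of_nat Y(1)] by (simp add: o_def inverse_eq_divide)
    then show "(\<lambda>n. (1 / real (Suc (r n))) * (C * (2 * v y))) \<longlonglongrightarrow> 0"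
      using tendsto_mult_left_zero by blast
  qed
  have RS: "R (S n y) - S n y = (1 / real (Suc n)) *\<^sub>R ((R ^^ Suc n) y - y)"
    and SR: "S n (R y) - S n y = (1 / real (Suc n)) *\<^sub>R ((R ^^ Suc n) y - y)" for n y
  proof -
    have 1: "R (\<Sum>j<Suc n. (R ^^ j) y) = (\<Sum>j<Suc n. (R ^^ Suc j) y)" by (simp add: linear_sum[OF R] del: sum.lessThan_Suc)
    have 2: "(\<Sum>j<Suc n. (R ^^ j) (R y)) = (\<Sum>j<Suc n. (R ^^ Suc j) y)" by (simp add: funpow_swap1)
    have 3: "(\<Sum>j<Suc n. (R ^^ Suc j) y) - (\<Sum>j<Suc n. (R ^^ j) y) = (R ^^ Suc n) y - y"
      using sum_lessThan_telescope[of "\<lambda>j. (R ^^ j) y" "Suc n"] by (simp add: sum_subtractf del: sum.lessThan_Suc funpow.simps(2))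
    show "R (S n y) - S n y = (1 / real (Suc n)) *\<^sub>R ((R ^^ Suc n) y - y)"
      unfolding S_def linear_scale[OF R] 1 scaleR_diff_right[symmetric] 3 ..
    show "S n (R y) - S n y = (1 / real (Suc n)) *\<^sub>R ((R ^^ Suc n) y - y)"
      unfolding S_def 2 scaleR_diff_right[symmetric] 3 ..
  qed
  show ?thesis
  proof (rule that[of "\<lambda>y. Y *v y"])
    show "linear (\<lambda>y. Y *v y)" by simp
    show "v (Y *v y) \<le> v y" for y
    proof (rule tendsto_upperbound)
      show "(\<lambda>n. v (S (r n) y)) \<longlonglongrightarrow> v (Y *v y)"
        by (rule continuous_on_tendsto_compose[OF is_norm_continuous[OF v, of UNIV] lim]) auto
    qed (use Sv in auto)
    show "R (Y *v y) = Y *v y" for y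
    proof -
      have "(\<lambda>n. R (S (r n) y)) \<longlonglongrightarrow> R (Y *v y)"
        by (rule continuous_on_tendsto_compose[OF cR lim]) auto
      then have "(\<lambda>n. R (S (r n) y) - S (r n) y) \<longlonglongrightarrow> R (Y *v y) - Y *v y" by (intro tendsto_diff lim)
      then have "R (Y *v y) - Y *v y = 0" using diff[of y] LIMSEQ_unique unfolding RS by blast
      then show ?thesis by simp
    qed
    show "Y *v (R y) = Y *v y" for y
    proof -
      have "(\<lambda>n. S (r n) (R y) - S (r n) y) \<longlonglongrightarrow> Y *v (R y) - Y *v y" by (intro tendsto_diff lim)
      then have "Y *v (R y) - Y *v y = 0" using diff[of y] LIMSEQ_unique unfolding SR by blast
      then show ?thesis by simp
    qed
    show "Y *v y = y" if "R y = y" for y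
    proof -
      have "(R ^^ j) y = y" for j by (induction j) (use that in auto)
      then have "S n y = (1 / real (Suc n)) *\<^sub>R (\<Sum>j<Suc n. y)" for n by (simp only: S_def)
      then have "S n y = y" for n by (simp only: sum_constant_scaleR card_lessThan) simp
      then have "(\<lambda>n. y) \<longlonglongrightarrow> Y *v y" using lim[of y] by simp
      then show ?thesis using LIMSEQ_unique tendsto_const by blast
    qed
  qed
qed

lemma det_shift_cubic:
  fixes M :: "real^3^3"
  obtains a b where "\<And>t. det (M - t *\<^sub>R mat 1) = - (t ^ 3) + a * t\<^sup>2 + b * t + det M"
proof (rule that[of "M$1$1 + M$2$2 + M$3$3"
      "- (M$1$1 * M$2$2 - M$1$2 * M$2$1 + M$1$1 * M$3$3 - M$1$3 * M$3$1 + M$2$2 * M$3$3 - M$2$3 * M$3$2)"])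
  fix t
  show "det (M - t *\<^sub>R mat 1) = - (t ^ 3) + (M$1$1 + M$2$2 + M$3$3) * t\<^sup>2
     + - (M$1$1 * M$2$2 - M$1$2 * M$2$1 + M$1$1 * M$3$3 - M$1$3 * M$3$1 + M$2$2 * M$3$3 - M$2$3 * M$3$2) * t + det M"
    unfolding det_3 by (simp add: mat_def) algebra
qed

lemma det_zero_eigenvector:
  fixes M :: "real^'n^'n"
  assumes "det (M - t *\<^sub>R mat 1) = 0"
  obtains y where "y \<noteq> 0" "M *v y = t *\<^sub>R y"
proof -
  have "\<not> invertible (M - t *\<^sub>R mat 1)" using assms by (simp add: invertible_det_nz)
  then obtain y where "y \<noteq> 0" "(M - t *\<^sub>R mat 1) *v y = 0"
    using matrix_left_invertible_ker[of "M - t *\<^sub>R mat 1"] by (auto simp: invertible_left_inverse)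
  then show ?thesis
    by (intro that[of y]) (auto simp: matrix_vector_mult_diff_rdistrib scaleR_matrix_vector_assoc[symmetric])
qed

lemma cubic_bound:
  fixes a b c t :: real
  assumes "t \<ge> 1 + \<bar>a\<bar> + \<bar>b\<bar> + \<bar>c\<bar>"
  shows "\<bar>a * t\<^sup>2 + b * t + c\<bar> < t ^ 3"
proof -
  have t1: "1 \<le> t" using assms by linarith
  have t2: "t \<le> t\<^sup>2" using t1 mult_left_mono[OF t1, of t] by (simp add: power2_eq_square)
  then have t2: "t \<le> t\<^sup>2" "1 \<le> t\<^sup>2" using t1 by linarith+
  have "\<bar>a * t\<^sup>2 + b * t + c\<bar> \<le> \<bar>a\<bar> * t\<^sup>2 + \<bar>b\<bar> * t + \<bar>c\<bar> * 1"
    using t1 by (intro order_trans[OF abs_triangle_ineq] add_mono) (auto simp: abs_mult)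
  also have "\<dots> \<le> \<bar>a\<bar> * t\<^sup>2 + \<bar>b\<bar> * t\<^sup>2 + \<bar>c\<bar> * t\<^sup>2"
    using t2 by (intro add_mono mult_left_mono) auto
  also have "\<dots> = (\<bar>a\<bar> + \<bar>b\<bar> + \<bar>c\<bar>) * t\<^sup>2" by (simp add: algebra_simps)
  also have "\<dots> < t * t\<^sup>2" using assms t2 by (intro mult_strict_right_mono) auto
  finally show ?thesis by (simp add: power3_eq_cube power2_eq_square)
qed

lemma real_eigenvector_3:
  fixes M :: "real^3^3"
  obtains t y where "y \<noteq> 0" "M *v y = t *\<^sub>R y"
proof -
  obtain a b where f: "\<And>t. det (M - t *\<^sub>R mat 1) = - (t ^ 3) + a * t\<^sup>2 + b * t + det M"
    by (rule det_shift_cubic[of M]) blast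
  define f where "f t = - (t ^ 3) + a * t\<^sup>2 + b * t + det M" for t
  define T where "T = 1 + \<bar>a\<bar> + \<bar>b\<bar> + \<bar>det M\<bar>"
  have "T > 0" by (simp add: T_def add_pos_nonneg)
  have "\<bar>a * T\<^sup>2 + b * T + det M\<bar> < T ^ 3" "\<bar>a * T\<^sup>2 + (- b) * T + det M\<bar> < T ^ 3"
    by (rule cubic_bound, simp add: T_def)+
  moreover have "f (- T) = T ^ 3 + a * T\<^sup>2 - b * T + det M" by (simp add: f_def)
  ultimately have "f T \<le> 0" "0 \<le> f (- T)" by (auto simp: f_def abs_less_iff)
  moreover have "continuous_on {- T..T} f" unfolding f_def by (intro continuous_intros)
  ultimately obtain t where "f t = 0" using IVT2'[of f T 0 "- T"] \<open>T > 0\<close> by auto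
  then have "det (M - t *\<^sub>R mat 1) = 0" using f by (simp add: f_def)
  then show ?thesis using that det_zero_eigenvector by blast
qed

text \<open>The characteristic polynomial equals \<open>det M\<close> at 0 and is nonpositive far to
  the right, so a nonnegative value at 0 would produce a nonnegative root.\<close>

lemma det_neg_if_no_nonneg_eigenvalue:
  fixes M :: "real^3^3"
  assumes "\<And>t y. 0 \<le> t \<Longrightarrow> M *v y = t *\<^sub>R y \<Longrightarrow> y = 0"
  shows "det M < 0"
proof (rule ccontr)
  obtain a b where f: "\<And>t. det (M - t *\<^sub>R mat 1) = - (t ^ 3) + a * t\<^sup>2 + b * t + det M"
    by (rule det_shift_cubic[of M]) blast
  define f where "f t = - (t ^ 3) + a * t\<^sup>2 + b * t + det M" for t
  define T where "T = 1 + \<bar>a\<bar> + \<bar>b\<bar> + \<bar>det M\<bar>"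
  have "T > 0" by (simp add: T_def add_pos_nonneg)
  assume "\<not> det M < 0"
  then have "0 \<le> f 0" by (simp add: f_def)
  moreover have "\<bar>a * T\<^sup>2 + b * T + det M\<bar> < T ^ 3" by (rule cubic_bound) (simp add: T_def)
  then have "f T \<le> 0" by (auto simp: f_def abs_less_iff)
  moreover have "continuous_on {0..T} f" unfolding f_def by (intro continuous_intros)
  ultimately obtain t where t: "f t = 0" "0 \<le> t" using IVT2'[of f T 0 0] \<open>T > 0\<close> by auto
  then have "det (M - t *\<^sub>R mat 1) = 0" using f t(1) by (simp add: f_def)
  then show False using det_zero_eigenvector[of M t] assms[OF t(2)] by metis
qed

text \<open>The remainder is needed uniformly in \<open>y\<close> and for both signs of
  \<open>h\<close>, since arcs are both lengthened and shortened.\<close>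

lemma mexp_second_order:
  obtains K where "K > 0" "\<And>h y. \<bar>h\<bar> \<le> 1 \<Longrightarrow> norm (mexp M h *v y - y - h *\<^sub>R (M *v y)) \<le> K * h\<^sup>2 * norm y"
proof -
  obtain L where L: "L > 0" "\<And>y. norm (M *v y) \<le> norm y * L"
    using bounded_linear.pos_bounded[OF matrix_vector_mul_bounded_linear] by blast
  obtain L' where L': "L' > 0" "\<And>y. norm ((- M) *v y) \<le> norm y * L'"
    using bounded_linear.pos_bounded[OF matrix_vector_mul_bounded_linear] by blast
  have neg: "mexp (- M) h *v y = mexp M (- h) *v y" for h y
  proof -
    have "mpow (- M) n $ i $ j = (- 1) ^ n * mpow M n $ i $ j" for n i j
      by (induction n arbitrary: i j) (auto simp: mpow_Suc matrix_matrix_mult_def sum_negf sum_distrib_left mult_ac intro!: sum.cong)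
    then have "mexp (- M) h = mexp M (- h)"
      by (simp add: vec_eq_iff mexp_def power_minus[of h] mult_ac)
    then show ?thesis by simp
  qed
  have bd: "norm (mexp M h *v y) \<le> exp (L + L') * norm y" if "\<bar>h\<bar> \<le> 1" for h y
  proof (cases "0 \<le> h")
    case True
    have "norm (mexp M h *v y) \<le> exp (L * h) * norm y"
      by (rule norm_mexp_le) (use L True in \<open>auto simp: mult.commute\<close>)
    also have "\<dots> \<le> exp (L + L') * norm y"
    proof (intro mult_right_mono)
      have "L * h \<le> L * 1" using that L(1) by (intro mult_left_mono) auto
      then show "exp (L * h) \<le> exp (L + L')" using L'(1) by simp
    qed simp
    finally show ?thesis .
  next
    case False
    have "norm (mexp (- M) (- h) *v y) \<le> exp (L' * (- h)) * norm y"
      by (rule norm_mexp_le) (use L' False in \<open>auto simp: mult.commute\<close>)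
    also have "\<dots> \<le> exp (L + L') * norm y"
    proof (intro mult_right_mono)
      have "L' * (- h) \<le> L' * 1" using that L'(1) by (intro mult_left_mono) auto
      then show "exp (L' * (- h)) \<le> exp (L + L')" using L(1) by simp
    qed simp
    finally show ?thesis by (simp add: neg)
  qed
  define B where "B = L * exp (L + L')"
  have first: "norm (mexp M q *v y - mexp M p *v y) \<le> B * norm y * (q - p)" if "\<bar>p\<bar> \<le> 1" "\<bar>q\<bar> \<le> 1" "p \<le> q" for p q y
  proof (rule vector_derivative_bound[OF mexp_deriv])
    fix t assume "t \<in> {p..q}"
    then have "\<bar>t\<bar> \<le> 1" using that by auto
    have "norm (M *v (mexp M t *v y)) \<le> norm (mexp M t *v y) * L" by (rule L(2))
    also have "\<dots> \<le> (exp (L + L') * norm y) * L" using bd[OF \<open>\<bar>t\<bar> \<le> 1\<close>] L(1) by (intro mult_right_mono) auto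
    finally show "norm (M *v (mexp M t *v y)) \<le> B * norm y" by (simp add: B_def mult_ac)
  qed (use that in auto)
  have B: "B > 0" using L(1) by (simp add: B_def)
  have second: "norm ((mexp M q *v y - q *\<^sub>R (M *v y)) - (mexp M p *v y - p *\<^sub>R (M *v y))) \<le> (L * B * m * norm y) * (q - p)"
    if "\<bar>p\<bar> \<le> m" "\<bar>q\<bar> \<le> m" "m \<le> 1" "p \<le> q" for p q m y
  proof (rule vector_derivative_bound)
    fix t assume t: "t \<in> {p..q}"
    show "((\<lambda>h. mexp M h *v y - h *\<^sub>R (M *v y)) has_vector_derivative M *v (mexp M t *v y) - M *v y) (at t within {p..q})"
      using has_vector_derivative_scaleR[OF DERIV_ident has_vector_derivative_const[of "M *v y"], of t "{p..q}"]
      by (intro has_vector_derivative_diff mexp_deriv) simp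
    have tm: "\<bar>t\<bar> \<le> m" using t that by auto
    have "norm (mexp M t *v y - mexp M 0 *v y) \<le> B * norm y * \<bar>t\<bar>"
      using first[of 0 t y] first[of t 0 y] tm that by (cases "0 \<le> t") (auto simp: norm_minus_commute)
    also have "\<dots> \<le> B * norm y * m" using tm B by (intro mult_left_mono) auto
    finally have "norm (mexp M t *v y - y) \<le> B * norm y * m" by simp
    then have "norm (M *v (mexp M t *v y - y)) \<le> (B * norm y * m) * L"
      by (intro order_trans[OF L(2)] mult_right_mono) (use L(1) in auto)
    then show "norm (M *v (mexp M t *v y) - M *v y) \<le> L * B * m * norm y"
      by (simp add: matrix_vector_mult_diff_distrib mult_ac)
  qed (use that in auto)
  show ?thesis
  proof (rule that[of "L * B"])
    fix h :: real and y assume h: "\<bar>h\<bar> \<le> 1"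
    have "norm ((mexp M h *v y - h *\<^sub>R (M *v y)) - y) \<le> (L * B * \<bar>h\<bar> * norm y) * \<bar>h\<bar>"
      using second[of 0 "\<bar>h\<bar>" h y] second[of h "\<bar>h\<bar>" 0 y] h by (cases "0 \<le> h") (auto simp: norm_minus_commute)
    also have "\<dots> = L * B * h\<^sup>2 * norm y" by (simp add: power2_eq_square abs_if)
    finally show "norm (mexp M h *v y - y - h *\<^sub>R (M *v y)) \<le> L * B * h\<^sup>2 * norm y"
      by (simp add: algebra_simps)
  qed (use L(1) B in simp)
qed

text \<open>Exchanging the two points makes the one-sided bound two-sided, so the derivative
  vanishes. The constant may depend on a bound for \<open>r\<close> but not on \<open>r\<close>,
  because the exchange moves the base point.\<close>

lemma const_if_quadratic_increase:
  fixes g :: "real \<Rightarrow> real"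
  assumes "0 < \<epsilon>" and g: "\<And>B. \<exists>C. \<forall>r h. \<bar>r\<bar> \<le> B \<longrightarrow> \<bar>h\<bar> \<le> \<epsilon> \<longrightarrow> g (r + h) \<le> g r + C * h\<^sup>2"
  shows "g r = g 0"
proof -
  have "(g has_real_derivative 0) (at r)" for r
  proof -
    obtain C where C: "\<And>r' h. \<bar>r'\<bar> \<le> \<bar>r\<bar> + \<epsilon> \<Longrightarrow> \<bar>h\<bar> \<le> \<epsilon> \<Longrightarrow> g (r' + h) \<le> g r' + C * h\<^sup>2"
      using g[of "\<bar>r\<bar> + \<epsilon>"] by blast
    have b: "\<bar>g (r + h) - g r\<bar> \<le> \<bar>C\<bar> * h\<^sup>2" if "\<bar>h\<bar> \<le> \<epsilon>" for h
    proof -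
      have "C * h\<^sup>2 \<le> \<bar>C\<bar> * h\<^sup>2" by (intro mult_right_mono) auto
      moreover have "\<bar>r + h\<bar> \<le> \<bar>r\<bar> + \<epsilon>" "\<bar>r\<bar> \<le> \<bar>r\<bar> + \<epsilon>" "\<bar>- h\<bar> \<le> \<epsilon>" using that \<open>0 < \<epsilon>\<close> by linarith+
      ultimately show ?thesis using C[of r h] C[of "r + h" "- h"] that by simp
    qed
    have "((\<lambda>h. (g (r + h) - g r) / h) \<longlongrightarrow> 0) (at 0)"
    proof (rule Lim_null_comparison)
      have "\<forall>\<^sub>F h in at 0. \<bar>h\<bar> < \<epsilon>" using \<open>0 < \<epsilon>\<close> by (auto simp: eventually_at dist_real_def)
      then show "\<forall>\<^sub>F h in at 0. norm ((g (r + h) - g r) / h) \<le> \<bar>C\<bar> * \<bar>h\<bar>"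
      proof eventually_elim
        case (elim h)
        then show ?case using b[of h] by (cases "h = 0") (auto simp: abs_div_pos divide_simps power2_eq_square abs_mult abs_if split: if_splits)
      qed
      show "((\<lambda>h. \<bar>C\<bar> * \<bar>h\<bar>) \<longlongrightarrow> 0) (at 0)" by (auto intro!: tendsto_eq_intros)
    qed
    then show ?thesis by (simp add: DERIV_def)
  qed
  then show ?thesis using DERIV_isconst_all by blast
qed

section \<open>The fixed space of the period map\<close>

text \<open>The end of the rotation case: \<open>C1\<close>, \<open>C2\<close>, \<open>C3\<close>
  will be the values of \<open>c\<close> on a moving basis, \<open>B1\<close>, \<open>B2\<close>,
  \<open>B3\<close> the coordinates of \<open>b\<close> moved backwards, and \<open>con\<close> says
  that their planar parts stay parallel. After division of \<open>B3\<close> by \<open>a\<close> the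
  two systems differ only in the sign of \<open>d\<close>, which is incompatible with lasting
  proportionality.\<close>

lemma planar_ode_contradiction:
  fixes B1 B2 B3 C1 C2 C3 :: "real \<Rightarrow> real"
  assumes "0 < \<epsilon>" and "\<kappa> \<noteq> 0" "0 < a" "d \<noteq> 0" "(r1, r2) \<noteq> (0::real, 0::real)"
    and C: "\<And>h. (C1 has_real_derivative \<kappa> * C2 h - a * r1 * C3 h) (at h)"
      "\<And>h. (C2 has_real_derivative - \<kappa> * C1 h - a * r2 * C3 h) (at h)"
      "\<And>h. (C3 has_real_derivative r1 * C1 h + r2 * C2 h + d * C3 h) (at h)"
    and B: "\<And>h. (B1 has_real_derivative \<kappa> * B2 h - r1 * B3 h) (at h)"
      "\<And>h. (B2 has_real_derivative - \<kappa> * B1 h - r2 * B3 h) (at h)"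
      "\<And>h. (B3 has_real_derivative a * (r1 * B1 h + r2 * B2 h) - d * B3 h) (at h)"
    and C_nz: "\<And>h. \<not> (C1 h = 0 \<and> C2 h = 0 \<and> C3 h = 0)"
    and B_nz: "\<And>h. \<not> (B1 h = 0 \<and> B2 h = 0 \<and> B3 h = 0)"
    and con: "\<And>h. 0 < h \<Longrightarrow> h < \<epsilon> \<Longrightarrow> B1 h * C2 h = B2 h * C1 h"
  shows False
proof -
  define \<rho> where "\<rho> = r1\<^sup>2 + r2\<^sup>2"
  have "\<rho> > 0" using assms(5) by (auto simp: \<rho>_def sum_power2_gt_zero_iff)
  \<comment> \<open>Components of the planar parts along \<open>(r1, r2)\<close>, namely
    \<open>c\<close> and \<open>e\<close>, and perpendicular to it, namely \<open>P\<close> and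
    \<open>Q\<close>; in these coordinates the direction of \<open>(r1, r2)\<close>
    disappears.\<close>
  define P c Q e where "P h = r1 * C2 h - r2 * C1 h" and "c h = r1 * C1 h + r2 * C2 h"
    and "Q h = r1 * B2 h - r2 * B1 h" and "e h = r1 * B1 h + r2 * B2 h" for h
  have P: "(P has_real_derivative - \<kappa> * c h) (at h)" for h
    unfolding P_def c_def by (auto intro!: derivative_eq_intros C simp: algebra_simps)
  have c: "(c has_real_derivative \<kappa> * P h - a * \<rho> * C3 h) (at h)" for h
    unfolding P_def c_def \<rho>_def by (auto intro!: derivative_eq_intros C simp: algebra_simps power2_eq_square)
  have C3: "(C3 has_real_derivative c h + d * C3 h) (at h)" for h
    using C(3) by (simp add: c_def)
  have Q: "(Q has_real_derivative - \<kappa> * e h) (at h)" for h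
    unfolding Q_def e_def by (auto intro!: derivative_eq_intros B simp: algebra_simps)
  have B3: "(B3 has_real_derivative a * e h - d * B3 h) (at h)" for h
    using B(3) by (simp add: e_def)
  have recC: "\<rho> * C1 h = r1 * c h - r2 * P h" "\<rho> * C2 h = r2 * c h + r1 * P h"
    and recB: "\<rho> * B1 h = r1 * e h - r2 * Q h" "\<rho> * B2 h = r2 * e h + r1 * Q h" for h
    by (simp_all add: \<rho>_def P_def c_def Q_def e_def algebra_simps power2_eq_square)
  have Cnz: "\<not> (P h = 0 \<and> c h = 0 \<and> C3 h = 0)" for h
    using recC[of h] C_nz[of h] \<open>\<rho> > 0\<close> by auto
  have Bnz: "\<not> (Q h = 0 \<and> e h = 0 \<and> B3 h = 0)" for h
    using recB[of h] B_nz[of h] \<open>\<rho> > 0\<close> by auto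
  have con1: "P h * e h = Q h * c h" if "0 < h" "h < \<epsilon>" for h
  proof -
    have "P h * e h - Q h * c h = \<rho> * (B1 h * C2 h - B2 h * C1 h)"
      by (simp add: P_def c_def Q_def e_def \<rho>_def algebra_simps power2_eq_square)
    then show ?thesis using con[OF that] by simp
  qed
  have zero_deriv: "D = 0" if "(f has_real_derivative D) (at h)" "open J" "h \<in> J" "\<And>x. x \<in> J \<Longrightarrow> f x = 0"
    for f :: "real \<Rightarrow> real" and D h J
  proof -
    have "((\<lambda>x. 0::real) has_real_derivative D) (at h)"
      by (rule has_field_derivative_transform_within_open[OF that(1-3)]) (use that(4) in auto)
    then show ?thesis using DERIV_unique DERIV_const by blast
  qed
  \<comment> \<open>The derivative of the constraint, in which the rotation terms cancel.\<close>
  have con2: "B3 h * P h = a * C3 h * Q h" if "0 < h" "h < \<epsilon>" for h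
  proof -
    have "((\<lambda>h. B1 h * C2 h - B2 h * C1 h) has_real_derivative a * C3 h * Q h - B3 h * P h) (at h)"
      by (auto intro!: derivative_eq_intros C B simp: P_def Q_def algebra_simps)
    from zero_deriv[OF this, of "{0<..<\<epsilon>}"] show ?thesis using con that by auto
  qed
  have contP: "continuous_on UNIV P" by (rule DERIV_continuous_on[OF has_field_derivative_at_within[OF P]])
  have "\<exists>h0. 0 < h0 \<and> h0 < \<epsilon> \<and> P h0 \<noteq> 0"
  proof (rule ccontr)
    assume "\<nexists>h0. 0 < h0 \<and> h0 < \<epsilon> \<and> P h0 \<noteq> 0"
    then have P0: "P h = 0" if "h \<in> {0<..<\<epsilon>}" for h using that by auto
    have c0: "c h = 0" if "h \<in> {0<..<\<epsilon>}" for h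
      using zero_deriv[OF P[of h] open_greaterThanLessThan that P0] \<open>\<kappa> \<noteq> 0\<close> by simp
    have "C3 h = 0" if "h \<in> {0<..<\<epsilon>}" for h
      using zero_deriv[OF c[of h] open_greaterThanLessThan that c0] P0[OF that] \<open>0 < a\<close> \<open>\<rho> > 0\<close> by simp
    then show False using P0[of "\<epsilon> / 2"] c0[of "\<epsilon> / 2"] Cnz[of "\<epsilon> / 2"] \<open>0 < \<epsilon>\<close> by auto
  qed
  then obtain h0 where h0: "0 < h0" "h0 < \<epsilon>" "P h0 \<noteq> 0" by blast
  have "open (P -` (- {0}) \<inter> {0<..<\<epsilon>})"
    by (intro open_Int open_vimage open_greaterThanLessThan contP) auto
  then obtain \<eta> where \<eta>: "\<eta> > 0" "ball h0 \<eta> \<subseteq> P -` (- {0}) \<inter> {0<..<\<epsilon>}"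
    using h0 openE[of "P -` (- {0}) \<inter> {0<..<\<epsilon>}" h0] by (metis ComplI IntI greaterThanLessThan_iff singletonD vimageI)
  let ?J = "ball h0 \<eta>"
  have J: "P h \<noteq> 0" "0 < h" "h < \<epsilon>" if "h \<in> ?J" for h using \<eta>(2) that by auto
  define \<beta> where "\<beta> = Q h0 / P h0"
  have Q\<beta>: "Q h = \<beta> * P h" if "h \<in> ?J" for h
  proof -
    have der: "((\<lambda>h. Q h / P h) has_real_derivative 0) (at h within ?J)" if "h \<in> ?J" for h
    proof -
      have "((\<lambda>h. Q h / P h) has_real_derivative ((- \<kappa> * e h) * P h - Q h * (- \<kappa> * c h)) / (P h * P h)) (at h)"
        by (rule DERIV_divide[OF Q P]) (use J[OF that] in simp)
      moreover have "(- \<kappa> * e h) * P h - Q h * (- \<kappa> * c h) = 0"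
        using con1[of h] J[OF that] by (simp add: algebra_simps)
      ultimately have "((\<lambda>h. Q h / P h) has_real_derivative 0) (at h)" by (simp only: div_0)
      then show ?thesis by (rule has_field_derivative_at_within)
    qed
    have "Q h / P h = Q h0 / P h0"
    proof -
      obtain k where "\<And>h. h \<in> ?J \<Longrightarrow> Q h / P h = k"
        using has_field_derivative_zero_constant[OF convex_ball der] by blast
      then show ?thesis using that \<eta>(1) by simp
    qed
    then show ?thesis using J[OF that] by (simp add: \<beta>_def field_simps)
  qed
  have e\<beta>: "e h = \<beta> * c h" if "h \<in> ?J" for h
    using con1[of h] J[OF that] Q\<beta>[OF that] by simp
  have B\<beta>: "B3 h - \<beta> * a * C3 h = 0" if "h \<in> ?J" for h
    using con2[of h] J[OF that] Q\<beta>[OF that] by (simp add: algebra_simps)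
  have "\<beta> \<noteq> 0" using Q\<beta>[of h0] e\<beta>[of h0] B\<beta>[of h0] Bnz[of h0] \<eta>(1) by auto
  \<comment> \<open>Differentiating \<open>B3 = \<beta> * a * C3\<close> brings in \<open>d\<close>
    with both signs, which forces \<open>C3 = 0\<close>; then \<open>c\<close> and \<open>P\<close>
    vanish in turn.\<close>
  have C30: "C3 h = 0" if "h \<in> ?J" for h
  proof -
    have "((\<lambda>h. B3 h - \<beta> * a * C3 h) has_real_derivative (a * e h - d * B3 h) - \<beta> * a * (c h + d * C3 h)) (at h)"
      by (auto intro!: derivative_eq_intros B3 C3 simp: algebra_simps)
    from zero_deriv[OF this open_ball that B\<beta>]
    have "d * B3 h + \<beta> * a * d * C3 h = 0" using e\<beta>[OF that] by (simp add: algebra_simps)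
    moreover have "B3 h = \<beta> * a * C3 h" using B\<beta>[OF that] by simp
    ultimately have "\<beta> * a * d * C3 h = 0" by (simp add: mult_ac)
    then show ?thesis using \<open>\<beta> \<noteq> 0\<close> \<open>0 < a\<close> \<open>d \<noteq> 0\<close> by simp
  qed
  have c0: "c h = 0" if "h \<in> ?J" for h
    using zero_deriv[OF C3[of h] open_ball that C30] C30[OF that] by simp
  have "P h0 = 0"
    using zero_deriv[OF c[of h0] open_ball _ c0, of h0 \<eta>] C30[of h0] \<eta>(1) \<open>\<kappa> \<noteq> 0\<close> by simp
  then show False using h0(3) by simp
qed

text \<open>A product of two linear forms in the plane takes both signs unless the forms are
  proportional. \<open>D\<close> is the discriminant of the product and also the squared determinant
  of the forms.\<close>

lemma semidefinite_product_parallel: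
  fixes b1 b2 c1 c2 \<sigma> :: real
  assumes "\<sigma> \<noteq> 0" and sd: "\<And>y1 y2. \<sigma> * ((b1 * y1 + b2 * y2) * (c1 * y1 + c2 * y2)) \<le> 0"
  shows "b1 * c2 = b2 * c1"
proof -
  define D where "D = (b1 * c2 - b2 * c1)\<^sup>2"
  define m where "m = b1 * c2 + b2 * c1"
  have a: "\<sigma> * (b1 * c1) \<le> 0" "\<sigma> * (b2 * c2) \<le> 0" using sd[of 1 0] sd[of 0 1] by simp_all
  \<comment> \<open>The test vectors \<open>(m, - 2 * b1 * c1)\<close> and
    \<open>(2 * b2 * c2, - m)\<close> come from completing the square: on them the product equals
    minus a diagonal coefficient times \<open>D\<close>.\<close>
  have "\<sigma> * ((b1 * m + b2 * (- 2 * b1 * c1)) * (c1 * m + c2 * (- 2 * b1 * c1))) = - (\<sigma> * (b1 * c1)) * D"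
    unfolding D_def m_def by algebra
  then have 1: "- (\<sigma> * (b1 * c1)) * D \<le> 0" using sd[of m "- 2 * b1 * c1"] by simp
  have "\<sigma> * ((b1 * (2 * b2 * c2) + b2 * (- m)) * (c1 * (2 * b2 * c2) + c2 * (- m))) = - (\<sigma> * (b2 * c2)) * D"
    unfolding D_def m_def by algebra
  then have 2: "- (\<sigma> * (b2 * c2)) * D \<le> 0" using sd[of "2 * b2 * c2" "- m"] by simp
  have "D = 0"
  proof (rule ccontr)
    assume "D \<noteq> 0"
    then have "D > 0" by (simp add: D_def)
    then have "0 \<le> X" if "- X * D \<le> 0" for X using that by (simp add: zero_le_mult_iff)
    then have "\<sigma> * (b1 * c1) \<ge> 0" "\<sigma> * (b2 * c2) \<ge> 0" using 1 2 by blast+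
    then have "\<sigma> * (b1 * c1) = 0" "\<sigma> * (b2 * c2) = 0" using a by linarith+
    then have z: "b1 * c1 = 0" "b2 * c2 = 0" using \<open>\<sigma> \<noteq> 0\<close> by simp_all
    have "(b1 * 1 + b2 * 1) * (c1 * 1 + c2 * 1) = b1 * c1 + b2 * c2 + m"
      "(b1 * 1 + b2 * (- 1)) * (c1 * 1 + c2 * (- 1)) = b1 * c1 + b2 * c2 - m"
      unfolding m_def by algebra+
    then have "\<sigma> * m \<le> 0" "\<sigma> * (- m) \<le> 0" using sd[of 1 1] sd[of 1 "- 1"] z by simp_all
    then have "\<sigma> * m = 0" by simp
    then have "m = 0" using \<open>\<sigma> \<noteq> 0\<close> by simp
    moreover have "D = m\<^sup>2 - 4 * ((b1 * c1) * (b2 * c2))" unfolding D_def m_def by algebra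
    ultimately show False using z \<open>D \<noteq> 0\<close> by simp
  qed
  then show ?thesis by (simp add: D_def)
qed

lemma second_derivative_test:
  fixes f :: "real \<Rightarrow> real"
  assumes "0 < \<epsilon>" and max: "\<And>h. 0 < h \<Longrightarrow> h < \<epsilon> \<Longrightarrow> f h \<le> f 0"
    and f: "\<And>h. (f has_real_derivative f' h) (at h)" and "f' 0 = 0"
    and f': "(f' has_real_derivative D) (at 0)"
  shows "D \<le> 0"
proof (rule ccontr)
  assume "\<not> D \<le> 0"
  then obtain d where d: "d > 0" "\<And>h. 0 < h \<Longrightarrow> h < d \<Longrightarrow> 0 < f' h"
    using DERIV_pos_inc_right[OF f'] \<open>f' 0 = 0\<close> by auto
  define h where "h = min d \<epsilon> / 2"
  have h: "0 < h" "h < d" "h < \<epsilon>" using d(1) \<open>0 < \<epsilon>\<close> by (auto simp: h_def)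
  have "f 0 < f h"
  proof (rule DERIV_pos_imp_increasing_open[OF h(1)])
    show "\<exists>y. (f has_real_derivative y) (at t) \<and> 0 < y" if "0 < t" "t < h" for t
      using f[of t] d(2)[of t] that h by auto
  qed (rule DERIV_continuous_on[OF has_field_derivative_at_within[OF f]])
  then show False using max[of h] h by simp
qed


lemma linear_bound_quadratic_zero:
  fixes m :: real
  assumes "0 < \<epsilon>" and b: "\<And>h. \<bar>h\<bar> \<le> \<epsilon> \<Longrightarrow> h * m \<le> K * h\<^sup>2"
  shows "m = 0"
proof (rule ccontr)
  assume "m \<noteq> 0"
  define t where "t = min \<epsilon> (\<bar>m\<bar> / (\<bar>K\<bar> + 1))"
  have "t \<le> \<bar>m\<bar> / (\<bar>K\<bar> + 1)" by (simp add: t_def)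
  then have t: "0 < t" "t \<le> \<epsilon>" "t * (\<bar>K\<bar> + 1) \<le> \<bar>m\<bar>"
    using \<open>m \<noteq> 0\<close> \<open>0 < \<epsilon>\<close> pos_le_divide_eq[of "\<bar>K\<bar> + 1" t "\<bar>m\<bar>"] by (auto simp: t_def add_nonneg_pos)
  have "sgn m * t * m \<le> K * (sgn m * t)\<^sup>2"
    using t by (intro b) (auto simp: abs_mult abs_sgn_eq)
  then have "t * \<bar>m\<bar> \<le> t * (K * t)"
    using \<open>m \<noteq> 0\<close> by (simp add: power_mult_distrib abs_sgn power2_eq_square sgn_mult_self_eq mult_ac)
  then have "\<bar>m\<bar> \<le> K * t" using t(1) by simp
  also have "\<dots> \<le> \<bar>K\<bar> * t" using t(1) by (intro mult_right_mono) auto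
  also have "\<dots> < t * (\<bar>K\<bar> + 1)" using t(1) by (simp add: algebra_simps)
  finally show False using t(3) by simp
qed

lemma basis3_coordinates:
  fixes f1 f2 f3 :: "real^3"
  assumes indep: "\<And>\<alpha> \<beta> \<gamma>. \<alpha> *\<^sub>R f1 + \<beta> *\<^sub>R f2 + \<gamma> *\<^sub>R f3 = 0 \<Longrightarrow> \<alpha> = 0 \<and> \<beta> = 0 \<and> \<gamma> = 0"
  obtains \<phi>1 \<phi>2 \<phi>3 :: "real^3 \<Rightarrow> real" where
    "bounded_linear \<phi>1" "bounded_linear \<phi>2" "bounded_linear \<phi>3"
    "\<And>z. z = \<phi>1 z *\<^sub>R f1 + \<phi>2 z *\<^sub>R f2 + \<phi>3 z *\<^sub>R f3"
    "\<And>\<alpha> \<beta> \<gamma>. \<phi>1 (\<alpha> *\<^sub>R f1 + \<beta> *\<^sub>R f2 + \<gamma> *\<^sub>R f3) = \<alpha>"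
    "\<And>\<alpha> \<beta> \<gamma>. \<phi>2 (\<alpha> *\<^sub>R f1 + \<beta> *\<^sub>R f2 + \<gamma> *\<^sub>R f3) = \<beta>"
    "\<And>\<alpha> \<beta> \<gamma>. \<phi>3 (\<alpha> *\<^sub>R f1 + \<beta> *\<^sub>R f2 + \<gamma> *\<^sub>R f3) = \<gamma>"
proof -
  define F where "F z = z $ 1 *\<^sub>R f1 + z $ 2 *\<^sub>R f2 + z $ 3 *\<^sub>R f3" for z :: "real^3"
  have F: "linear F" unfolding F_def by (rule linearI) (simp_all add: algebra_simps)
  have "inj F"
  proof (rule linear_injective_0[THEN iffD2, OF F], intro allI impI)
    fix z assume "F z = 0"
    then have "z $ 1 = 0 \<and> z $ 2 = 0 \<and> z $ 3 = 0" unfolding F_def by (rule indep)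
    then show "z = 0" by (simp add: vec_eq_iff forall_3)
  qed
  then obtain G where G: "linear G" "\<And>z. G (F z) = z" "\<And>z. F (G z) = z"
    using linear_injective_isomorphism[OF F] by blast
  have co: "G (\<alpha> *\<^sub>R f1 + \<beta> *\<^sub>R f2 + \<gamma> *\<^sub>R f3) = vector [\<alpha>, \<beta>, \<gamma>]" for \<alpha> \<beta> \<gamma>
    using G(2)[of "vector [\<alpha>, \<beta>, \<gamma>]"] by (simp add: F_def)
  have bl: "bounded_linear (\<lambda>z. G z $ i)" for i
    by (rule bounded_linear_compose[OF bounded_linear_vec_nth]) (use G(1) linear_conv_bounded_linear in blast)
  show ?thesis
    by (rule that[of "\<lambda>z. G z $ 1" "\<lambda>z. G z $ 2" "\<lambda>z. G z $ 3"])
      (use G(3) in \<open>simp_all add: bl co F_def\<close>)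
qed

lemma sin_cos_quadratic:
  fixes h :: real
  shows "\<bar>cos h - 1\<bar> \<le> h\<^sup>2" and "\<bar>h\<bar> \<le> 1 \<Longrightarrow> \<bar>sin h - h\<bar> \<le> h\<^sup>2"
proof -
  have c: "\<bar>cos t - 1\<bar> \<le> t\<^sup>2" for t :: real
  proof -
    have "cos t - 1 = - 2 * (sin (t / 2))\<^sup>2" using cos_double_sin[of "t / 2"] by simp
    moreover have "(sin (t / 2))\<^sup>2 \<le> (t / 2)\<^sup>2" using abs_sin_x_le_abs_x[of "t / 2"] by (rule abs_le_square_iff[THEN iffD1])
    moreover have "0 \<le> (sin (t / 2))\<^sup>2" "(t / 2)\<^sup>2 = t\<^sup>2 / 4" by (simp_all add: power_divide)
    ultimately show ?thesis by linarith
  qed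
  then show "\<bar>cos h - 1\<bar> \<le> h\<^sup>2" .
  have b: "norm ((sin q - q) - (sin p - p)) \<le> 1 * h\<^sup>2 * (q - p)" if "\<bar>p\<bar> \<le> \<bar>h\<bar>" "\<bar>q\<bar> \<le> \<bar>h\<bar>" "p \<le> q" for p q :: real
  proof (rule vector_derivative_bound)
    fix t assume t: "t \<in> {p..q}"
    have "((\<lambda>t. sin t - t) has_real_derivative cos t - 1) (at t within {p..q})"
      by (auto intro!: derivative_eq_intros)
    then show "((\<lambda>t. sin t - t) has_vector_derivative cos t - 1) (at t within {p..q})"
      by (simp add: has_real_derivative_iff_has_vector_derivative)
    have "t\<^sup>2 \<le> h\<^sup>2" by (rule abs_le_square_iff[THEN iffD1]) (use t that in auto)
    then show "norm (cos t - 1) \<le> 1 * h\<^sup>2" using c[of t] by simp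
  qed (use that in auto)
  have "\<bar>sin h - h\<bar> \<le> h\<^sup>2 * \<bar>h\<bar>" using b[of 0 h] b[of h 0] by (cases "0 \<le> h") auto
  then show "\<bar>sin h - h\<bar> \<le> h\<^sup>2" if "\<bar>h\<bar> \<le> 1"
    using mult_left_mono[OF that, of "h\<^sup>2"] by simp
qed

text \<open>The infinitesimal form of \<open>con\<close> on the fixed space of \<open>R\<close>: as
  \<open>P\<close> absorbs \<open>R\<close>, projecting \<open>mexp M h *v z\<close> gives a step of
  length \<open>h\<close> along the compressed generator, up to second order.\<close>

lemma extremal_fixed_space_aux:
  fixes M :: "real^3^3" and R P :: "real^3 \<Rightarrow> real^3"
  assumes v: "is_norm v" and R: "linear R" and "0 < \<epsilon>"
    and con: "\<And>h y. \<bar>h\<bar> \<le> \<epsilon> \<Longrightarrow> v (R (mexp M h *v y)) \<le> v y"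
    and P: "linear P" "\<And>y. v (P y) \<le> v y" "\<And>y. R (P y) = P y" "\<And>y. P (R y) = P y" "\<And>y. R y = y \<Longrightarrow> P y = y"
  obtains e K where "0 < e" "e \<le> 1" "0 \<le> K" "\<And>z h. R z = z \<Longrightarrow> \<bar>h\<bar> \<le> e \<Longrightarrow> v (z + h *\<^sub>R P (M *v z)) \<le> v z + K * norm z * h\<^sup>2"
proof -
  obtain K where K: "K > 0" "\<And>h y. \<bar>h\<bar> \<le> 1 \<Longrightarrow> norm (mexp M h *v y - y - h *\<^sub>R (M *v y)) \<le> K * h\<^sup>2 * norm y"
    using mexp_second_order[of M] by blast
  obtain D where D: "D > 0" "\<And>y. v y \<le> D * norm y" using is_norm_upper[OF v] by blast
  show ?thesis
  proof (rule that[of "min \<epsilon> 1" "D * K"])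
    fix z h assume z: "R z = z" and "\<bar>h\<bar> \<le> min \<epsilon> 1"
    then have h: "\<bar>h\<bar> \<le> \<epsilon>" "\<bar>h\<bar> \<le> 1" by auto
    let ?r = "mexp M h *v z - z - h *\<^sub>R (M *v z)"
    have "P (mexp M h *v z) = z + h *\<^sub>R P (M *v z) + P ?r"
      using P(5)[OF z] by (simp add: linear_diff[OF P(1)] linear_scale[OF P(1)])
    then have "v (z + h *\<^sub>R P (M *v z)) = v (P (R (mexp M h *v z)) - P ?r)" by (simp add: P(4))
    also have "\<dots> \<le> v (P (R (mexp M h *v z))) + v (P ?r)" by (rule is_norm_diff_le[OF v])
    also have "\<dots> \<le> v z + D * norm ?r"
      using P(2)[of "R (mexp M h *v z)"] con[OF h(1), of z] P(2)[of ?r] D(2)[of ?r] by linarith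
    also have "\<dots> \<le> v z + D * (K * h\<^sup>2 * norm z)"
      using K(2)[OF h(2)] D(1) by (intro add_left_mono mult_left_mono) auto
    finally show "v (z + h *\<^sub>R P (M *v z)) \<le> v z + D * K * norm z * h\<^sup>2" by (simp add: mult_ac)
  qed (use \<open>0 < \<epsilon>\<close> D K in auto)
qed

text \<open>The fixed plane is spanned by \<open>f1\<close> and \<open>f2\<close>, and the
  compressed generator has a pair of complex eigenvalues. Contraction for both signs of
  \<open>h\<close> makes it an exact rotation and \<open>v\<close> Euclidean on the plane. Then
  \<open>con\<close> yields a condition of second order and \<open>pulse\<close> one of first order,
  each saying that two planar vectors are parallel.\<close>

lemma extremal_rotation_contradiction:
  fixes M M' :: "real^3^3" and R P :: "real^3 \<Rightarrow> real^3"
  assumes v: "is_norm v" and R: "linear R" and "0 < \<epsilon>"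
    and con: "\<And>h y. \<bar>h\<bar> \<le> \<epsilon> \<Longrightarrow> v (R (mexp M h *v y)) \<le> v y"
    and pulse: "\<And>h \<delta> y. 0 \<le> h \<Longrightarrow> h \<le> \<epsilon> \<Longrightarrow> 0 \<le> \<delta> \<Longrightarrow> \<delta> \<le> \<epsilon> \<Longrightarrow>
      v (R (mexp M (- (h + \<delta>)) *v (mexp M' \<delta> *v (mexp M h *v y)))) \<le> v y"
    and M': "\<And>y. M' *v y = M *v y + (\<sigma> * (c \<bullet> y)) *\<^sub>R b" "\<sigma> \<noteq> 0" "b \<noteq> 0" "c \<noteq> 0"
    and rot: "\<And>p q \<omega>. M *v p = (- \<omega>) *\<^sub>R q \<Longrightarrow> M *v q = \<omega> *\<^sub>R p \<Longrightarrow> p = 0"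
    and P: "linear P" "\<And>y. v (P y) \<le> v y" "\<And>y. R (P y) = P y" "\<And>y. P (R y) = P y" "\<And>y. R y = y \<Longrightarrow> P y = y"
    and eK: "0 < e" "0 \<le> K" "\<And>z h. R z = z \<Longrightarrow> \<bar>h\<bar> \<le> e \<Longrightarrow> v (z + h *\<^sub>R P (M *v z)) \<le> v z + K * norm z * h\<^sup>2"
    and f: "R f1 = f1" "R f2 = f2"
    and indep: "\<And>\<alpha> \<beta> \<gamma>. \<alpha> *\<^sub>R f1 + \<beta> *\<^sub>R f2 + \<gamma> *\<^sub>R g = 0 \<Longrightarrow> \<alpha> = 0 \<and> \<beta> = 0 \<and> \<gamma> = 0"
    and Pg: "P g = 0" and "0 < \<kappa>"
    and W1: "P (M *v f1) = \<tau> *\<^sub>R f1 + \<kappa> *\<^sub>R f2" and W2: "P (M *v f2) = \<tau> *\<^sub>R f2 - \<kappa> *\<^sub>R f1"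
  shows False
proof -
  define W where "W z = P (M *v z)" for z
  have W: "W (\<alpha> *\<^sub>R f1 + \<beta> *\<^sub>R f2) = (\<alpha> * \<tau> - \<beta> * \<kappa>) *\<^sub>R f1 + (\<alpha> * \<kappa> + \<beta> * \<tau>) *\<^sub>R f2" for \<alpha> \<beta>
    unfolding W_def matrix_vector_right_distrib matrix_vector_mult_scaleR linear_add[OF P(1)] linear_scale[OF P(1)] W1 W2
    by (simp add: algebra_simps)
  have Rf: "R (\<alpha> *\<^sub>R f1 + \<beta> *\<^sub>R f2) = \<alpha> *\<^sub>R f1 + \<beta> *\<^sub>R f2" for \<alpha> \<beta>
    using f by (simp add: linear_add[OF R] linear_scale[OF R])
  have tool: "v (z + h *\<^sub>R W z) \<le> v z + K * norm z * h\<^sup>2" if "R z = z" "\<bar>h\<bar> \<le> e" for z h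
    using eK(3)[OF that] by (simp add: W_def)
  have polar: "\<exists>r t. 0 \<le> r \<and> r\<^sup>2 = \<alpha>\<^sup>2 + \<beta>\<^sup>2 \<and> 0 \<le> t \<and> t \<le> 2 * pi \<and> \<alpha> = r * cos t \<and> \<beta> = r * sin t" for \<alpha> \<beta> :: real
  proof (cases "\<alpha>\<^sup>2 + \<beta>\<^sup>2 = 0")
    case True
    then show ?thesis by (intro exI[of _ 0]) (auto simp: sum_power2_eq_zero_iff)
  next
    case False
    define r where "r = sqrt (\<alpha>\<^sup>2 + \<beta>\<^sup>2)"
    have r: "r > 0" "r\<^sup>2 = \<alpha>\<^sup>2 + \<beta>\<^sup>2" using False by (auto simp: r_def sum_power2_gt_zero_iff)
    then have "(\<alpha> / r)\<^sup>2 + (\<beta> / r)\<^sup>2 = 1" using False by (simp add: power_divide add_divide_distrib[symmetric])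
    then obtain t where "0 \<le> t" "t < 2 * pi" "\<alpha> / r = cos t" "\<beta> / r = sin t" by (rule sincos_total_2pi)
    then show ?thesis using r by (intro exI[of _ r] exI[of _ t]) (auto simp: field_simps)
  qed
  define y where "y \<theta> = cos \<theta> *\<^sub>R f1 + sin \<theta> *\<^sub>R f2" for \<theta>
  define y' where "y' \<theta> = (- sin \<theta>) *\<^sub>R f1 + cos \<theta> *\<^sub>R f2" for \<theta>
  have Ry: "R (y \<theta>) = y \<theta>" for \<theta> by (simp add: y_def Rf)
  have vpol: "v (r *\<^sub>R y t) = r * v (y t)" if "0 \<le> r" for r t using that by (simp add: is_normD(3)[OF v])
  have "continuous_on {0..2 * pi} (\<lambda>\<theta>. v (y \<theta>))"
    unfolding y_def by (intro continuous_on_compose2[OF is_norm_continuous[OF v, of UNIV]] continuous_intros) auto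
  then obtain \<theta> where \<theta>: "\<And>t. 0 \<le> t \<Longrightarrow> t \<le> 2 * pi \<Longrightarrow> v (y \<theta>) \<le> v (y t)"
    using continuous_attains_inf[of "{0..2 * pi}" "\<lambda>\<theta>. v (y \<theta>)"] by force
  \<comment> \<open>\<open>\<theta>\<close> minimises \<open>v\<close> on the unit circle of the
    coordinates, while the displaced point has coordinate length \<open>r\<close> at least
    \<open>1 + h * \<tau>\<close>. As \<open>h\<close> takes both signs, \<open>\<tau>\<close> must
    vanish.\<close>
  have "\<tau> * v (y \<theta>) = 0"
  proof (rule linear_bound_quadratic_zero[OF eK(1)])
    fix h assume h: "\<bar>h\<bar> \<le> e"
    define \<alpha> where "\<alpha> = cos \<theta> + h * (cos \<theta> * \<tau> - sin \<theta> * \<kappa>)"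
    define \<beta> where "\<beta> = sin \<theta> + h * (cos \<theta> * \<kappa> + sin \<theta> * \<tau>)"
    have e1: "y \<theta> + h *\<^sub>R W (y \<theta>) = \<alpha> *\<^sub>R f1 + \<beta> *\<^sub>R f2"
      unfolding y_def W \<alpha>_def \<beta>_def by (simp add: algebra_simps)
    obtain r t where rt: "0 \<le> r" "r\<^sup>2 = \<alpha>\<^sup>2 + \<beta>\<^sup>2" "0 \<le> t" "t \<le> 2 * pi" "\<alpha> = r * cos t" "\<beta> = r * sin t"
      using polar by blast
    have "\<alpha>\<^sup>2 + \<beta>\<^sup>2 = ((1 + h * \<tau>)\<^sup>2 + (h * \<kappa>)\<^sup>2) * ((cos \<theta>)\<^sup>2 + (sin \<theta>)\<^sup>2)"
      unfolding \<alpha>_def \<beta>_def by algebra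
    then have "(1 + h * \<tau>)\<^sup>2 \<le> r\<^sup>2" using rt(2) by simp
    then have "1 + h * \<tau> \<le> r" using rt(1) by (rule power2_le_imp_le)
    then have "(1 + h * \<tau>) * v (y \<theta>) \<le> r * v (y \<theta>)" by (intro mult_right_mono is_normD(1)[OF v])
    also have "\<dots> \<le> r * v (y t)" using \<theta>[OF rt(3,4)] rt(1) by (intro mult_left_mono)
    also have "\<dots> = v (y \<theta> + h *\<^sub>R W (y \<theta>))"
      unfolding e1 vpol[OF rt(1), symmetric] by (simp add: y_def rt(5,6) scaleR_add_right)
    also have "\<dots> \<le> v (y \<theta>) + K * norm (y \<theta>) * h\<^sup>2" by (rule tool[OF Ry h])
    finally show "h * (\<tau> * v (y \<theta>)) \<le> K * norm (y \<theta>) * h\<^sup>2" by (simp add: algebra_simps)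
  qed
  moreover have "y \<theta> \<noteq> 0"
  proof
    assume "y \<theta> = 0"
    then have "cos \<theta> = 0 \<and> sin \<theta> = 0" using indep[of "cos \<theta>" "sin \<theta>" 0] by (simp add: y_def)
    then show False using sin_cos_squared_add[of \<theta>] by simp
  qed
  ultimately have \<tau>: "\<tau> = 0" using is_normD(2)[OF v] by simp
  \<comment> \<open>Now \<open>W\<close> generates the rotation, and turning by the angle
    \<open>h\<close> agrees with a step \<open>h / \<kappa>\<close> along \<open>W\<close> up to
    second order.\<close>
  have Gc: "v (y t) = v (y 0)" for t
  proof (rule const_if_quadratic_increase)
    show "0 < min (e * \<kappa>) 1" using eK(1) \<open>0 < \<kappa>\<close> by simp
    fix B
    define L where "L = v f1 + v f2"
    define N where "N = norm f1 + norm f2"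
    have vy: "v (\<alpha> *\<^sub>R f1 + \<beta> *\<^sub>R f2) \<le> L" if "\<bar>\<alpha>\<bar> \<le> 1" "\<bar>\<beta>\<bar> \<le> 1" for \<alpha> \<beta>
      unfolding L_def
      using mult_right_mono[OF that(1) is_normD(1)[OF v, of f1]] mult_right_mono[OF that(2) is_normD(1)[OF v, of f2]]
      by (intro order_trans[OF is_normD(4)[OF v]]) (simp add: is_normD(3)[OF v])
    have ny: "norm (\<alpha> *\<^sub>R f1 + \<beta> *\<^sub>R f2) \<le> N" if "\<bar>\<alpha>\<bar> \<le> 1" "\<bar>\<beta>\<bar> \<le> 1" for \<alpha> \<beta>
      unfolding N_def
      using mult_right_mono[OF that(1) norm_ge_zero[of f1]] mult_right_mono[OF that(2) norm_ge_zero[of f2]]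
      by (intro order_trans[OF norm_triangle_ineq]) simp
    show "\<exists>C. \<forall>r h. \<bar>r\<bar> \<le> B \<longrightarrow> \<bar>h\<bar> \<le> min (e * \<kappa>) 1 \<longrightarrow> v (y (r + h)) \<le> v (y r) + C * h\<^sup>2"
    proof (intro exI[of _ "K * N / \<kappa>\<^sup>2 + 2 * L"] allI impI)
      fix r h assume "\<bar>h\<bar> \<le> min (e * \<kappa>) 1"
      then have h: "\<bar>h / \<kappa>\<bar> \<le> e" "\<bar>h\<bar> \<le> 1" using \<open>0 < \<kappa>\<close> by (auto simp: field_simps)
      have "y (r + h) = (y r + (h / \<kappa>) *\<^sub>R W (y r)) + ((cos h - 1) *\<^sub>R y r + (sin h - h) *\<^sub>R y' r)"
        unfolding y_def W y'_def \<tau> using \<open>0 < \<kappa>\<close> by (simp add: cos_add sin_add algebra_simps)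
      then have "v (y (r + h)) \<le> v (y r + (h / \<kappa>) *\<^sub>R W (y r)) + (\<bar>cos h - 1\<bar> * v (y r) + \<bar>sin h - h\<bar> * v (y' r))"
        using is_normD(4)[OF v, of "y r + (h / \<kappa>) *\<^sub>R W (y r)" "(cos h - 1) *\<^sub>R y r + (sin h - h) *\<^sub>R y' r"]
          is_normD(4)[OF v, of "(cos h - 1) *\<^sub>R y r" "(sin h - h) *\<^sub>R y' r"]
        by (simp add: is_normD(3)[OF v])
      also have "\<dots> \<le> (v (y r) + K * N * (h / \<kappa>)\<^sup>2) + (h\<^sup>2 * L + h\<^sup>2 * L)"
      proof (intro add_mono)
        have "v (y r + (h / \<kappa>) *\<^sub>R W (y r)) \<le> v (y r) + K * norm (y r) * (h / \<kappa>)\<^sup>2" by (rule tool[OF Ry h(1)])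
        also have "\<dots> \<le> v (y r) + K * N * (h / \<kappa>)\<^sup>2"
          using ny[of "cos r" "sin r"] eK(2) by (intro add_left_mono mult_right_mono mult_left_mono) (auto simp: y_def)
        finally show "v (y r + (h / \<kappa>) *\<^sub>R W (y r)) \<le> \<dots>" .
        show "\<bar>cos h - 1\<bar> * v (y r) \<le> h\<^sup>2 * L"
          using vy[of "cos r" "sin r"] by (intro mult_mono sin_cos_quadratic is_normD(1)[OF v]) (auto simp: y_def)
        show "\<bar>sin h - h\<bar> * v (y' r) \<le> h\<^sup>2 * L"
          using vy[of "- sin r" "cos r"] h(2) by (intro mult_mono sin_cos_quadratic is_normD(1)[OF v]) (auto simp: y'_def)
      qed
      finally show "v (y (r + h)) \<le> v (y r) + (K * N / \<kappa>\<^sup>2 + 2 * L) * h\<^sup>2"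
        by (simp add: algebra_simps power_divide)
    qed
  qed
  define \<nu> where "\<nu> = v (y 0)"
  have "f1 \<noteq> 0" using indep[of 1 0 0] by auto
  then have \<nu>: "\<nu> > 0" using is_normD(1,2)[OF v, of f1] by (simp add: \<nu>_def y_def less_le)
  have vE: "v (\<alpha> *\<^sub>R f1 + \<beta> *\<^sub>R f2) = sqrt (\<alpha>\<^sup>2 + \<beta>\<^sup>2) * \<nu>" for \<alpha> \<beta>
  proof -
    obtain r t where rt: "0 \<le> r" "r\<^sup>2 = \<alpha>\<^sup>2 + \<beta>\<^sup>2" "\<alpha> = r * cos t" "\<beta> = r * sin t"
      using polar by blast
    have "\<alpha> *\<^sub>R f1 + \<beta> *\<^sub>R f2 = r *\<^sub>R y t" by (simp add: rt(3,4) y_def scaleR_add_right)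
    then show ?thesis using vpol[OF rt(1), of t] Gc[of t] rt(1) by (simp add: \<nu>_def rt(2)[symmetric])
  qed
  obtain \<phi>1 \<phi>2 \<phi>3 :: "real^3 \<Rightarrow> real" where
    bl: "bounded_linear \<phi>1" "bounded_linear \<phi>2" "bounded_linear \<phi>3" and
    \<phi>: "\<And>z. z = \<phi>1 z *\<^sub>R f1 + \<phi>2 z *\<^sub>R f2 + \<phi>3 z *\<^sub>R g" and
    co: "\<And>\<alpha> \<beta> \<gamma>. \<phi>1 (\<alpha> *\<^sub>R f1 + \<beta> *\<^sub>R f2 + \<gamma> *\<^sub>R g) = \<alpha>"
    "\<And>\<alpha> \<beta> \<gamma>. \<phi>2 (\<alpha> *\<^sub>R f1 + \<beta> *\<^sub>R f2 + \<gamma> *\<^sub>R g) = \<beta>"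
    "\<And>\<alpha> \<beta> \<gamma>. \<phi>3 (\<alpha> *\<^sub>R f1 + \<beta> *\<^sub>R f2 + \<gamma> *\<^sub>R g) = \<gamma>"
    using basis3_coordinates[OF indep] by blast
  have Pz: "P z = \<phi>1 z *\<^sub>R f1 + \<phi>2 z *\<^sub>R f2" for z
    by (subst \<phi>[of z]) (simp only: linear_add[OF P(1)] linear_scale[OF P(1)] P(5)[OF f(1)] P(5)[OF f(2)] Pg scaleR_zero_right add_0_right)
  \<comment> \<open>From here on contraction in \<open>v\<close> is contraction of the Euclidean
    length of the planar coordinates, because \<open>P\<close> forgets the coordinate along
    \<open>g\<close>.\<close>
  have euc: "(\<phi>1 z)\<^sup>2 + (\<phi>2 z)\<^sup>2 \<le> \<alpha>\<^sup>2 + \<beta>\<^sup>2" if "v (R z) \<le> v (\<alpha> *\<^sub>R f1 + \<beta> *\<^sub>R f2)" for z \<alpha> \<beta>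
  proof -
    have "v (P z) \<le> v (\<alpha> *\<^sub>R f1 + \<beta> *\<^sub>R f2)"
      using P(2)[of "R z"] that unfolding P(4) by linarith
    then show ?thesis unfolding Pz vE using \<nu> by simp
  qed
  define r1 r2 d s1 s2 where "r1 = \<phi>1 (M *v g)" and "r2 = \<phi>2 (M *v g)" and "d = \<phi>3 (M *v g)"
    and "s1 = \<phi>3 (M *v f1)" and "s2 = \<phi>3 (M *v f2)"
  have Mf: "M *v f1 = \<kappa> *\<^sub>R f2 + s1 *\<^sub>R g" "M *v f2 = (- \<kappa>) *\<^sub>R f1 + s2 *\<^sub>R g" "M *v g = r1 *\<^sub>R f1 + r2 *\<^sub>R f2 + d *\<^sub>R g"
  proof -
    show "M *v g = r1 *\<^sub>R f1 + r2 *\<^sub>R f2 + d *\<^sub>R g" unfolding r1_def r2_def d_def by (rule \<phi>)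
    have "\<phi>1 (M *v f1) *\<^sub>R f1 + \<phi>2 (M *v f1) *\<^sub>R f2 = \<kappa> *\<^sub>R f2" using W1 by (simp add: Pz \<tau>)
    then show "M *v f1 = \<kappa> *\<^sub>R f2 + s1 *\<^sub>R g" unfolding s1_def using \<phi>[of "M *v f1"] by simp
    have "\<phi>1 (M *v f2) *\<^sub>R f1 + \<phi>2 (M *v f2) *\<^sub>R f2 = (- \<kappa>) *\<^sub>R f1" using W2 by (simp add: Pz \<tau>)
    then show "M *v f2 = (- \<kappa>) *\<^sub>R f1 + s2 *\<^sub>R g" unfolding s2_def using \<phi>[of "M *v f2"] by simp
  qed
  have Mz: "M *v z = (- \<kappa> * \<phi>2 z + r1 * \<phi>3 z) *\<^sub>R f1 + (\<kappa> * \<phi>1 z + r2 * \<phi>3 z) *\<^sub>R f2 + (s1 * \<phi>1 z + s2 * \<phi>2 z + d * \<phi>3 z) *\<^sub>R g" for z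
    by (subst \<phi>[of z]) (simp only: matrix_vector_right_distrib matrix_vector_mult_scaleR Mf, simp add: algebra_simps)
  have \<phi>M: "\<phi>1 (M *v z) = - \<kappa> * \<phi>2 z + r1 * \<phi>3 z" "\<phi>2 (M *v z) = \<kappa> * \<phi>1 z + r2 * \<phi>3 z"
    "\<phi>3 (M *v z) = s1 * \<phi>1 z + s2 * \<phi>2 z + d * \<phi>3 z" for z
    unfolding Mz[of z] by (rule co)+
  have \<phi>E: "\<phi>1 (\<alpha> *\<^sub>R f1 + \<beta> *\<^sub>R f2) = \<alpha>" "\<phi>2 (\<alpha> *\<^sub>R f1 + \<beta> *\<^sub>R f2) = \<beta>" "\<phi>3 (\<alpha> *\<^sub>R f1 + \<beta> *\<^sub>R f2) = 0" for \<alpha> \<beta>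
    using co[of \<alpha> \<beta> 0] by simp_all
  have der: "((\<lambda>h. \<psi> (mexp M h *v z)) has_real_derivative \<psi> (M *v (mexp M h *v z))) (at h)"
    if "bounded_linear \<psi>" for \<psi> :: "real^3 \<Rightarrow> real" and h z
    using bounded_linear.has_vector_derivative[OF that mexp_deriv]
    by (simp add: has_real_derivative_iff_has_vector_derivative)
  \<comment> \<open>The squared planar length along \<open>mexp M h *v z\<close> has zero derivative
    at 0, the planar part of \<open>M\<close> being skew; the product in question is half of its
    second derivative.\<close>
  have sr: "(s1 * \<alpha> + s2 * \<beta>) * (r1 * \<alpha> + r2 * \<beta>) \<le> 0" for \<alpha> \<beta>
  proof -
    define z where "z = \<alpha> *\<^sub>R f1 + \<beta> *\<^sub>R f2"
    define a1 a2 a3 where "a1 h = \<phi>1 (mexp M h *v z)" and "a2 h = \<phi>2 (mexp M h *v z)" and "a3 h = \<phi>3 (mexp M h *v z)" for h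
    have a: "(a1 has_real_derivative - \<kappa> * a2 h + r1 * a3 h) (at h)" "(a2 has_real_derivative \<kappa> * a1 h + r2 * a3 h) (at h)"
      "(a3 has_real_derivative s1 * a1 h + s2 * a2 h + d * a3 h) (at h)" for h
      unfolding a1_def a2_def a3_def using der[OF bl(1), of z h] der[OF bl(2), of z h] der[OF bl(3), of z h] by (simp_all add: \<phi>M)
    have a0: "a1 0 = \<alpha>" "a2 0 = \<beta>" "a3 0 = 0" by (simp_all add: a1_def a2_def a3_def z_def \<phi>E)
    have "2 * (s1 * \<alpha> + s2 * \<beta>) * (r1 * \<alpha> + r2 * \<beta>) \<le> 0"
    proof (rule second_derivative_test[OF \<open>0 < \<epsilon>\<close>, where f = "\<lambda>h. (a1 h)\<^sup>2 + (a2 h)\<^sup>2"])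
      show "(a1 h)\<^sup>2 + (a2 h)\<^sup>2 \<le> (a1 0)\<^sup>2 + (a2 0)\<^sup>2" if "0 < h" "h < \<epsilon>" for h
        unfolding a0 unfolding a1_def a2_def by (rule euc) (use con[of h z] that in \<open>simp add: z_def\<close>)
      show "((\<lambda>h. (a1 h)\<^sup>2 + (a2 h)\<^sup>2) has_real_derivative 2 * a3 h * (r1 * a1 h + r2 * a2 h)) (at h)" for h
        by (auto intro!: derivative_eq_intros a simp: algebra_simps)
      show "((\<lambda>h. 2 * a3 h * (r1 * a1 h + r2 * a2 h)) has_real_derivative 2 * (s1 * \<alpha> + s2 * \<beta>) * (r1 * \<alpha> + r2 * \<beta>)) (at 0)"
        by (auto intro!: derivative_eq_intros a simp: a0 algebra_simps)
    qed (simp add: a0)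
    then have "2 * ((s1 * \<alpha> + s2 * \<beta>) * (r1 * \<alpha> + r2 * \<beta>)) \<le> 0" by (simp only: mult.assoc)
    then show ?thesis by linarith
  qed
  define C1 C2 C3 where "C1 h = c \<bullet> (mexp M h *v f1)" and "C2 h = c \<bullet> (mexp M h *v f2)" and "C3 h = c \<bullet> (mexp M h *v g)" for h
  define B1 B2 B3 where "B1 h = \<phi>1 (mexp M (- h) *v b)" and "B2 h = \<phi>2 (mexp M (- h) *v b)" and "B3 h = \<phi>3 (mexp M (- h) *v b)" for h
  \<comment> \<open>First-order effect of the pulse: replacing \<open>M\<close> by \<open>M'\<close>
    for a short time after \<open>h\<close> changes the squared planar length at twice the rate
    \<open>\<sigma>\<close> times the product of the two linear forms with coefficients
    \<open>B1 h\<close>, \<open>B2 h\<close> and \<open>C1 h\<close>, \<open>C2 h\<close>.\<close>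
  have con0: "B1 h * C2 h = B2 h * C1 h" if h: "0 < h" "h < \<epsilon>" for h
  proof (rule semidefinite_product_parallel[OF M'(2)])
    fix \<alpha> \<beta>
    define z where "z = \<alpha> *\<^sub>R f1 + \<beta> *\<^sub>R f2"
    define z1 where "z1 = mexp M h *v z"
    define X where "X \<delta> = mexp M (- (h + \<delta>)) *v (mexp M' \<delta> *v z1)" for \<delta>
    have X0: "X 0 = z" by (simp add: X_def z1_def)
    have "(X has_vector_derivative mexp M (- h) *v ((\<sigma> * (c \<bullet> z1)) *\<^sub>R b)) (at 0 within UNIV)"
    proof -
      have "((\<lambda>t. mexp M' (t - h) *v z1) has_vector_derivative 1 *\<^sub>R (M' *v (mexp M' (h - h) *v z1))) (at h within UNIV)"
        by (rule mexp_deriv') (auto intro!: derivative_eq_intros)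
      from mexp_uminus_mult_deriv[OF this, of M]
      have "((\<lambda>t. mexp M (- t) *v (mexp M' (t - h) *v z1)) has_vector_derivative mexp M (- h) *v ((\<sigma> * (c \<bullet> z1)) *\<^sub>R b)) (at (h + 0) within UNIV)"
        by (simp add: M'(1))
      moreover have "((\<lambda>\<delta>. h + \<delta>) has_vector_derivative 1) (at 0 within UNIV)"
        by (auto intro!: derivative_eq_intros simp: has_vector_derivative_def)
      ultimately show ?thesis
        using vector_diff_chain_at[of "\<lambda>\<delta>. h + \<delta>" 1 0 "\<lambda>t. mexp M (- t) *v (mexp M' (t - h) *v z1)"]
        by (simp add: X_def[abs_def] o_def)
    qed
    then have dX: "((\<lambda>\<delta>. \<psi> (X \<delta>)) has_real_derivative \<sigma> * (c \<bullet> z1) * \<psi> (mexp M (- h) *v b)) (at 0)" if "bounded_linear \<psi>" for \<psi>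
      using bounded_linear.has_vector_derivative[OF that]
      by (fastforce simp: has_real_derivative_iff_has_vector_derivative matrix_vector_mult_scaleR linear_scale[OF bounded_linear.linear[OF that]])
    define D where "D = 2 * \<alpha> * (\<sigma> * (c \<bullet> z1) * B1 h) + 2 * \<beta> * (\<sigma> * (c \<bullet> z1) * B2 h)"
    have dN: "((\<lambda>\<delta>. (\<phi>1 (X \<delta>))\<^sup>2 + (\<phi>2 (X \<delta>))\<^sup>2) has_real_derivative D) (at 0)"
      unfolding D_def B1_def B2_def
      by (auto intro!: derivative_eq_intros dX bl simp: X0 z_def \<phi>E)
    have "D \<le> 0"
    proof (rule ccontr)
      assume "\<not> D \<le> 0"
      then obtain \<eta> where \<eta>: "\<eta> > 0" "\<And>\<delta>. 0 < \<delta> \<Longrightarrow> \<delta> < \<eta> \<Longrightarrow> (\<phi>1 (X 0))\<^sup>2 + (\<phi>2 (X 0))\<^sup>2 < (\<phi>1 (X \<delta>))\<^sup>2 + (\<phi>2 (X \<delta>))\<^sup>2"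
        using DERIV_pos_inc_right[OF dN] by auto
      define \<delta> where "\<delta> = min \<eta> \<epsilon> / 2"
      have \<delta>: "0 < \<delta>" "\<delta> < \<eta>" "\<delta> \<le> \<epsilon>" using \<eta>(1) \<open>0 < \<epsilon>\<close> by (auto simp: \<delta>_def)
      have "(\<phi>1 (X \<delta>))\<^sup>2 + (\<phi>2 (X \<delta>))\<^sup>2 \<le> \<alpha>\<^sup>2 + \<beta>\<^sup>2"
        by (rule euc) (use pulse[of h \<delta> z] h \<delta> in \<open>simp add: X_def z1_def z_def\<close>)
      then show False using \<eta>(2)[OF \<delta>(1,2)] by (simp add: X0 z_def \<phi>E)
    qed
    moreover have "c \<bullet> z1 = \<alpha> * C1 h + \<beta> * C2 h"
      by (simp add: z1_def z_def C1_def C2_def matrix_vector_right_distrib matrix_vector_mult_scaleR inner_add_right)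
    ultimately show "\<sigma> * ((B1 h * \<alpha> + B2 h * \<beta>) * (C1 h * \<alpha> + C2 h * \<beta>)) \<le> 0"
      by (simp add: D_def algebra_simps)
  qed
  have s0: "(s1, s2) \<noteq> (0, 0)"
  proof
    assume "(s1, s2) = (0, 0)"
    then have "f2 = 0" using rot[of f2 \<kappa> f1] Mf by simp
    then show False using indep[of 0 1 0] by simp
  qed
  \<comment> \<open>If \<open>g\<close> fed nothing back into the plane, \<open>g\<close> would be
    an eigenvector of \<open>M\<close> and \<open>M\<close> would rotate the quotient by its line.
    \<open>\<zeta>1\<close> and \<open>\<zeta>2\<close> solve the linear system that lifts the
    quotient to an invariant plane, on which \<open>M\<close> has imaginary eigenvalues.\<close>
  have r0: "(r1, r2) \<noteq> (0, 0)"
  proof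
    assume r: "(r1, r2) = (0, 0)"
    define \<zeta>1 where "\<zeta>1 = - (\<kappa> * s2 + d * s1) / (\<kappa>\<^sup>2 + d\<^sup>2)"
    define \<zeta>2 where "\<zeta>2 = (s1 + d * \<zeta>1) / \<kappa>"
    have k: "\<kappa>\<^sup>2 + d\<^sup>2 > 0" using \<open>0 < \<kappa>\<close> by (simp add: add_pos_nonneg)
    have z1: "\<zeta>1 * (\<kappa>\<^sup>2 + d\<^sup>2) = - (\<kappa> * s2 + d * s1)" using k by (simp add: \<zeta>1_def)
    have z2: "\<kappa> * \<zeta>2 = s1 + d * \<zeta>1" using \<open>0 < \<kappa>\<close> by (simp add: \<zeta>2_def)
    have "\<kappa> * (s2 + d * \<zeta>2) = \<kappa> * (- \<kappa> * \<zeta>1)" using z1 z2 by algebra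
    moreover have "\<kappa> \<noteq> 0" using \<open>0 < \<kappa>\<close> by simp
    ultimately have z3: "s2 + d * \<zeta>2 = - \<kappa> * \<zeta>1" using mult_left_cancel by blast
    have "M *v (f2 + \<zeta>2 *\<^sub>R g) = (- \<kappa>) *\<^sub>R f1 + (s2 + d * \<zeta>2) *\<^sub>R g"
      using r by (simp add: matrix_vector_right_distrib matrix_vector_mult_scaleR Mf algebra_simps)
    then have e1: "M *v (f2 + \<zeta>2 *\<^sub>R g) = (- \<kappa>) *\<^sub>R (f1 + \<zeta>1 *\<^sub>R g)" unfolding z3 by (simp add: algebra_simps)
    have "M *v (f1 + \<zeta>1 *\<^sub>R g) = \<kappa> *\<^sub>R f2 + (s1 + d * \<zeta>1) *\<^sub>R g"
      using r by (simp add: matrix_vector_right_distrib matrix_vector_mult_scaleR Mf algebra_simps)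
    then have "M *v (f1 + \<zeta>1 *\<^sub>R g) = \<kappa> *\<^sub>R (f2 + \<zeta>2 *\<^sub>R g)" unfolding z2[symmetric] by (simp add: algebra_simps)
    then have "f2 + \<zeta>2 *\<^sub>R g = 0" using rot e1 by blast
    then show False using indep[of 0 1 \<zeta>2] by simp
  qed
  define \<rho> where "\<rho> = r1\<^sup>2 + r2\<^sup>2"
  have \<rho>: "\<rho> > 0" using r0 by (auto simp: \<rho>_def sum_power2_gt_zero_iff)
  define a where "a = - (s1 * r1 + s2 * r2) / \<rho>"
  have par: "s1 * r2 = s2 * r1"
    by (rule semidefinite_product_parallel[of 1]) (use sr in auto)
  have s: "s1 = - a * r1" "s2 = - a * r2"
  proof -
    have "\<rho> * s1 = (s1 * r1 + s2 * r2) * r1" "\<rho> * s2 = (s1 * r1 + s2 * r2) * r2"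
      unfolding \<rho>_def using par by algebra+
    then show "s1 = - a * r1" "s2 = - a * r2" using \<rho> by (simp_all add: a_def field_simps)
  qed
  have "a > 0"
  proof -
    have "(s1 * r1 + s2 * r2) * \<rho> \<le> 0" using sr[of r1 r2] by (simp add: \<rho>_def power2_eq_square)
    then have "s1 * r1 + s2 * r2 \<le> 0" using \<rho> by (simp add: mult_le_0_iff)
    then have "0 \<le> a" using \<rho> by (simp add: a_def)
    moreover have "a \<noteq> 0" using s s0 by auto
    ultimately show ?thesis by simp
  qed
  \<comment> \<open>For \<open>d = 0\<close> the rotation can cancel the contribution of
    \<open>g\<close>: the planar part perpendicular to \<open>(r1, r2)\<close> used in
    \<open>z\<close> gives a kernel vector of \<open>M\<close>.\<close>
  have "d \<noteq> 0"
  proof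
    assume "d = 0"
    define z where "z = (- r2 / \<kappa>) *\<^sub>R f1 + (r1 / \<kappa>) *\<^sub>R f2 + 1 *\<^sub>R g"
    have "\<phi>1 z = - r2 / \<kappa>" "\<phi>2 z = r1 / \<kappa>" "\<phi>3 z = 1" unfolding z_def by (rule co)+
    then have "M *v z = 0" unfolding Mz[of z] using \<open>0 < \<kappa>\<close> \<open>d = 0\<close> by (simp add: s)
    then have "z = 0" using rot[of z 0 0] by simp
    then show False using indep[of "- r2 / \<kappa>" "r1 / \<kappa>" 1] by (simp add: z_def)
  qed
  have C: "(C1 has_real_derivative \<kappa> * C2 h - a * r1 * C3 h) (at h)" "(C2 has_real_derivative - \<kappa> * C1 h - a * r2 * C3 h) (at h)"
    "(C3 has_real_derivative r1 * C1 h + r2 * C2 h + d * C3 h) (at h)" for h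
    unfolding C1_def C2_def C3_def
    using der[OF bounded_linear_inner_right[of c], of f1 h] der[OF bounded_linear_inner_right[of c], of f2 h] der[OF bounded_linear_inner_right[of c], of g h]
    by (simp_all add: mexp_commute_vec Mf s matrix_vector_right_distrib matrix_vector_mult_diff_distrib matrix_vector_mult_scaleR inner_add_right inner_diff_right linear_neg[OF matrix_vector_mul_linear] algebra_simps)
  have derb: "((\<lambda>h. \<psi> (mexp M (- h) *v b)) has_real_derivative - \<psi> (M *v (mexp M (- h) *v b))) (at h)" if "bounded_linear \<psi>" for \<psi> :: "real^3 \<Rightarrow> real" and h
  proof -
    have "(uminus has_real_derivative - 1) (at h)" by (auto intro!: derivative_eq_intros)
    from DERIV_chain2[OF der[OF that, of b "- h"] this] show ?thesis by simp
  qed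
  have B: "(B1 has_real_derivative \<kappa> * B2 h - r1 * B3 h) (at h)" "(B2 has_real_derivative - \<kappa> * B1 h - r2 * B3 h) (at h)"
    "(B3 has_real_derivative a * (r1 * B1 h + r2 * B2 h) - d * B3 h) (at h)" for h
    unfolding B1_def B2_def B3_def
    using derb[OF bl(1), of h] derb[OF bl(2), of h] derb[OF bl(3), of h] by (simp_all add: \<phi>M s algebra_simps)
  show False
  proof (rule planar_ode_contradiction[of \<epsilon> \<kappa> a d r1 r2 C1 C2 C3 B1 B2 B3])
    fix h
    show "\<not> (C1 h = 0 \<and> C2 h = 0 \<and> C3 h = 0)"
    proof
      assume z: "C1 h = 0 \<and> C2 h = 0 \<and> C3 h = 0"
      have "c \<bullet> (mexp M h *v y) = 0" for y
        by (subst \<phi>[of y]) (use z in \<open>simp add: C1_def C2_def C3_def matrix_vector_right_distrib matrix_vector_mult_scaleR inner_add_right\<close>)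
      from this[of "mexp M (- h) *v c"] show False using M'(4) by simp
    qed
    show "\<not> (B1 h = 0 \<and> B2 h = 0 \<and> B3 h = 0)"
    proof
      assume z: "B1 h = 0 \<and> B2 h = 0 \<and> B3 h = 0"
      then have "mexp M (- h) *v b = 0" using \<phi>[of "mexp M (- h) *v b"] by (simp add: B1_def B2_def B3_def)
      then show False using M'(3) by simp
    qed
  qed (use \<open>0 < \<epsilon>\<close> \<open>0 < \<kappa>\<close> \<open>a > 0\<close> \<open>d \<noteq> 0\<close> r0 C B con0 in auto)
qed

text \<open>\<open>R\<close> will be the map over one period; \<open>con\<close> allows an adjacent
  arc of \<open>M\<close> to be lengthened or shortened, \<open>pulse\<close> allows the other
  control to be inserted. On the fixed space the compressed generator can then have neither a
  non-zero real eigenvalue nor a shear; if it vanishes on a plane, \<open>M\<close> has a kernel,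
  and if all vectors are fixed, a real eigenvector of \<open>M\<close> lies in the kernel. Rotation
  is excluded separately.\<close>

lemma extremal_fixed_space:
  fixes M M' :: "real^3^3" and R :: "real^3 \<Rightarrow> real^3"
  assumes v: "is_norm v" and R: "linear R" and "0 < \<epsilon>"
    and con: "\<And>h y. \<bar>h\<bar> \<le> \<epsilon> \<Longrightarrow> v (R (mexp M h *v y)) \<le> v y"
    and pulse: "\<And>h \<delta> y. 0 \<le> h \<Longrightarrow> h \<le> \<epsilon> \<Longrightarrow> 0 \<le> \<delta> \<Longrightarrow> \<delta> \<le> \<epsilon> \<Longrightarrow>
      v (R (mexp M (- (h + \<delta>)) *v (mexp M' \<delta> *v (mexp M h *v y)))) \<le> v y"
    and M': "\<And>y. M' *v y = M *v y + (\<sigma> * (c \<bullet> y)) *\<^sub>R b" "\<sigma> \<noteq> 0" "b \<noteq> 0" "c \<noteq> 0"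
    and rot: "\<And>p q \<omega>. M *v p = (- \<omega>) *\<^sub>R q \<Longrightarrow> M *v q = \<omega> *\<^sub>R p \<Longrightarrow> p = 0"
    and fx: "R x = x" "R y = y" "x \<noteq> 0"
  shows "\<exists>k. y = k *\<^sub>R x"
proof (rule ccontr)
  assume "\<nexists>k. y = k *\<^sub>R x"
  then have ne: "\<And>k. y \<noteq> k *\<^sub>R x" by blast
  have Rcon: "v (R y) \<le> v y" for y using con[of 0 y] \<open>0 < \<epsilon>\<close> by simp
  obtain P where P: "linear P" "\<And>y. v (P y) \<le> v y" "\<And>y. R (P y) = P y" "\<And>y. P (R y) = P y" "\<And>y. R y = y \<Longrightarrow> P y = y"
    using mean_ergodic_projection[OF v R Rcon] by blast
  define W where "W z = P (M *v z)" for z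
  have RW: "R (W z) = W z" for z by (simp add: W_def P(3))
  have Wl: "W (z + z') = W z + W z'" "W (k *\<^sub>R z) = k *\<^sub>R W z" for z z' k
    by (simp_all add: W_def linear_add[OF P(1)] linear_scale[OF P(1)] matrix_vector_mult_scaleR matrix_vector_right_distrib)
  have Rl: "R (\<alpha> *\<^sub>R z + \<beta> *\<^sub>R z') = \<alpha> *\<^sub>R z + \<beta> *\<^sub>R z'" if "R z = z" "R z' = z'" for z z' \<alpha> \<beta>
    using that by (simp add: linear_add[OF R] linear_scale[OF R])
  have ker: "z = 0" if "M *v z = 0" for z using rot[of z 0 0] that by simp
  obtain e K where eK: "0 < e" "e \<le> 1" "0 \<le> K"
    "\<And>z h. R z = z \<Longrightarrow> \<bar>h\<bar> \<le> e \<Longrightarrow> v (z + h *\<^sub>R W z) \<le> v z + K * norm z * h\<^sup>2"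
    using extremal_fixed_space_aux[OF v R \<open>0 < \<epsilon>\<close> con P] unfolding W_def by blast
  \<comment> \<open>Along an eigenvector the norm changes at the rate \<open>\<mu> * v z\<close> in
    first order, and no growth is allowed in either direction of \<open>h\<close>.\<close>
  have eig0: "\<mu> = 0" if z: "R z = z" "W z = \<mu> *\<^sub>R z" "z \<noteq> 0" for z \<mu>
  proof -
    have "\<mu> * v z = 0"
    proof (rule linear_bound_quadratic_zero[OF eK(1)])
      fix h assume h: "\<bar>h\<bar> \<le> e"
      have "z + h *\<^sub>R W z = (1 + h * \<mu>) *\<^sub>R z" by (simp add: z(2) algebra_simps)
      then have "\<bar>1 + h * \<mu>\<bar> * v z \<le> v z + K * norm z * h\<^sup>2"
        using eK(4)[OF z(1) h] by (simp add: is_normD(3)[OF v])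
      moreover have "(1 + h * \<mu>) * v z \<le> \<bar>1 + h * \<mu>\<bar> * v z" by (intro mult_right_mono is_normD(1)[OF v]) simp
      ultimately show "h * (\<mu> * v z) \<le> K * norm z * h\<^sup>2" by (simp add: algebra_simps)
    qed
    then show ?thesis using is_normD(2)[OF v, of z] z(3) by simp
  qed
  show False
  proof (cases "\<forall>z. R z = z")
    case True
    obtain t z where z: "z \<noteq> 0" "M *v z = t *\<^sub>R z" using real_eigenvector_3[of M] by blast
    then have "t = 0" using eig0[of z t] True P(5) by (simp add: W_def)
    then show False using z ker by simp
  next
    case False
    then obtain w0 where w0: "R w0 \<noteq> w0" by blast
    \<comment> \<open>A vector killed by \<open>P\<close>; it completes two independent fixed
      vectors to a basis, so the fixed space is exactly a plane.\<close>
    define g where "g = w0 - P w0"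
    have Pg: "P g = 0" by (simp add: g_def linear_diff[OF P(1)] P(5)[OF P(3)])
    have g0: "g \<noteq> 0" using w0 P(3)[of w0] by (auto simp: g_def)
    have indep: "\<alpha> = 0 \<and> \<beta> = 0 \<and> \<gamma> = 0"
      if f: "R f1 = f1" "R f2 = f2" "f1 \<noteq> 0" "\<And>k. f2 \<noteq> k *\<^sub>R f1" and z: "\<alpha> *\<^sub>R f1 + \<beta> *\<^sub>R f2 + \<gamma> *\<^sub>R g = 0" for f1 f2 \<alpha> \<beta> \<gamma>
    proof -
      have "P (\<alpha> *\<^sub>R f1 + \<beta> *\<^sub>R f2 + \<gamma> *\<^sub>R g) = \<alpha> *\<^sub>R f1 + \<beta> *\<^sub>R f2"
        using f by (simp add: linear_add[OF P(1)] linear_scale[OF P(1)] P(5) Pg)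
      then have 1: "\<alpha> *\<^sub>R f1 + \<beta> *\<^sub>R f2 = 0" using z linear_0[OF P(1)] by simp
      have "\<beta> = 0"
      proof (rule ccontr)
        assume "\<beta> \<noteq> 0"
        have "f2 = (1 / \<beta>) *\<^sub>R (\<beta> *\<^sub>R f2)" using \<open>\<beta> \<noteq> 0\<close> by simp
        also have "\<beta> *\<^sub>R f2 = (- \<alpha>) *\<^sub>R f1" using 1 by (simp add: add_eq_0_iff)
        finally show False using f(4)[of "(1 / \<beta>) * (- \<alpha>)"] by simp
      qed
      then show ?thesis using 1 z f(3) g0 by simp
    qed
    show False
    proof (cases "\<exists>z0 \<mu>. R z0 = z0 \<and> z0 \<noteq> 0 \<and> W z0 = \<mu> *\<^sub>R z0")
      case True
      then obtain z0 \<mu> where z0: "R z0 = z0" "z0 \<noteq> 0" "W z0 = \<mu> *\<^sub>R z0" by blast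
      then have Wz0: "W z0 = 0" using eig0[of z0 \<mu>] by simp
      obtain z1 where z1: "R z1 = z1" "\<And>k. z1 \<noteq> k *\<^sub>R z0"
      proof (cases "\<exists>k. x = k *\<^sub>R z0")
        case True
        then obtain k where k: "x = k *\<^sub>R z0" by blast
        then have "k \<noteq> 0" using fx(3) by auto
        have "y \<noteq> k' *\<^sub>R z0" for k' using ne[of "k' / k"] \<open>k \<noteq> 0\<close> by (simp add: k)
        then show ?thesis using that fx(2) by blast
      qed (use that fx(1) in blast)
      obtain \<phi>1 \<phi>2 \<phi>3 :: "real^3 \<Rightarrow> real" where \<phi>: "\<And>z. z = \<phi>1 z *\<^sub>R z0 + \<phi>2 z *\<^sub>R z1 + \<phi>3 z *\<^sub>R g"
        using basis3_coordinates[of z0 z1 g] indep[OF z0(1) z1(1) z0(2) z1(2)] by metis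
      have Pz: "P z = \<phi>1 z *\<^sub>R z0 + \<phi>2 z *\<^sub>R z1" for z
        by (subst \<phi>[of z]) (simp only: linear_add[OF P(1)] linear_scale[OF P(1)] P(5)[OF z0(1)] P(5)[OF z1(1)] Pg scaleR_zero_right add_0_right)
      define \<alpha> \<beta> where "\<alpha> = \<phi>1 (M *v z1)" and "\<beta> = \<phi>2 (M *v z1)"
      have Wz1: "W z1 = \<alpha> *\<^sub>R z0 + \<beta> *\<^sub>R z1" by (simp add: W_def Pz \<alpha>_def \<beta>_def)
      have "\<beta> = 0"
      proof (rule ccontr)
        assume "\<beta> \<noteq> 0"
        define z2 where "z2 = (\<alpha> / \<beta>) *\<^sub>R z0 + 1 *\<^sub>R z1"
        have "W z2 = \<beta> *\<^sub>R z2" using \<open>\<beta> \<noteq> 0\<close> by (simp add: z2_def Wl Wz0 Wz1 scaleR_add_right)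
        moreover have "R z2 = z2" unfolding z2_def by (rule Rl[OF z0(1) z1(1)])
        moreover have "z2 \<noteq> 0" using z1(2)[of "- (\<alpha> / \<beta>)"] by (auto simp: z2_def add_eq_0_iff)
        ultimately show False using eig0[of z2 \<beta>] \<open>\<beta> \<noteq> 0\<close> by simp
      qed
      \<comment> \<open>A shear along \<open>z0\<close> would keep
        \<open>v (z1 + r *\<^sub>R z0)\<close> constant in \<open>r\<close>, whereas it grows like
        \<open>\<bar>r\<bar> * v z0\<close>.\<close>
      have "\<alpha> = 0"
      proof (rule ccontr)
        assume "\<alpha> \<noteq> 0"
        define G where "G r = v (z1 + r *\<^sub>R z0)" for r
        have "G r = G 0" for r
        proof (rule const_if_quadratic_increase)
          show "0 < e * \<bar>\<alpha>\<bar>" using eK(1) \<open>\<alpha> \<noteq> 0\<close> by simp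
          fix B
          show "\<exists>C. \<forall>r h. \<bar>r\<bar> \<le> B \<longrightarrow> \<bar>h\<bar> \<le> e * \<bar>\<alpha>\<bar> \<longrightarrow> G (r + h) \<le> G r + C * h\<^sup>2"
          proof (intro exI[of _ "K * (norm z1 + B * norm z0) / \<alpha>\<^sup>2"] allI impI)
            fix r h assume rh: "\<bar>r\<bar> \<le> B" "\<bar>h\<bar> \<le> e * \<bar>\<alpha>\<bar>"
            let ?z = "r *\<^sub>R z0 + 1 *\<^sub>R z1"
            have "W ?z = \<alpha> *\<^sub>R z0" by (simp only: Wl Wz0 Wz1 \<open>\<beta> = 0\<close>) simp
            moreover have "\<bar>h / \<alpha>\<bar> \<le> e" using rh \<open>\<alpha> \<noteq> 0\<close> by (simp add: field_simps)
            moreover have "R ?z = ?z" by (rule Rl[OF z0(1) z1(1)])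
            ultimately have "v (?z + (h / \<alpha>) *\<^sub>R (\<alpha> *\<^sub>R z0)) \<le> v ?z + K * norm ?z * (h / \<alpha>)\<^sup>2"
              using eK(4)[of ?z "h / \<alpha>"] by simp
            also have "\<dots> \<le> v ?z + K * (norm z1 + B * norm z0) * (h / \<alpha>)\<^sup>2"
            proof -
              have "norm ?z \<le> norm z1 + B * norm z0"
                using rh(1) norm_triangle_ineq[of "r *\<^sub>R z0" z1] mult_right_mono[of "\<bar>r\<bar>" B "norm z0"] by simp
              then show ?thesis using eK(3) by (intro add_left_mono mult_right_mono mult_left_mono) auto
            qed
            finally show "G (r + h) \<le> G r + K * (norm z1 + B * norm z0) / \<alpha>\<^sup>2 * h\<^sup>2"
              using \<open>\<alpha> \<noteq> 0\<close> by (simp add: G_def algebra_simps power_divide)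
          qed
        qed
        then have "v (z1 + r *\<^sub>R z0) = v z1" for r by (simp add: G_def)
        then have "\<bar>r\<bar> * v z0 \<le> 2 * v z1" for r
          using is_norm_diff_le[OF v, of "z1 + r *\<^sub>R z0" z1] by (simp add: is_normD(3)[OF v])
        from this[of "(2 * v z1 + 1) / v z0"] show False
          using is_normD(1,2)[OF v, of z0] is_normD(1)[OF v, of z1] z0(2) by (simp add: abs_mult abs_div)
      qed
      have indz: "a = 0 \<and> a' = 0 \<and> a'' = 0" if "a *\<^sub>R z0 + a' *\<^sub>R z1 + a'' *\<^sub>R g = 0" for a a' a''
        by (rule indep[OF z0(1) z1(1) z0(2) z1(2) that])
      have Mg: "M *v z = \<phi>3 (M *v z) *\<^sub>R g" if "W z = 0" for z
      proof -
        have "\<phi>1 (M *v z) *\<^sub>R z0 + \<phi>2 (M *v z) *\<^sub>R z1 = 0" using that by (simp add: W_def Pz)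
        then show ?thesis using \<phi>[of "M *v z"] by simp
      qed
      define a a' where "a = \<phi>3 (M *v z0)" and "a' = \<phi>3 (M *v z1)"
      have MM: "M *v z0 = a *\<^sub>R g" "M *v z1 = a' *\<^sub>R g"
        using Mg[of z0] Mg[of z1] Wz0 Wz1 \<open>\<alpha> = 0\<close> \<open>\<beta> = 0\<close> by (simp_all add: a_def a'_def)
      \<comment> \<open>With \<open>W = 0\<close> on the plane, \<open>M\<close> maps the plane into
        the line of \<open>g\<close>, so some combination of \<open>z0\<close> and \<open>z1\<close>
        is killed.\<close>
      have "M *v (a' *\<^sub>R z0 + (- a) *\<^sub>R z1) = 0"
        by (simp only: matrix_vector_right_distrib matrix_vector_mult_scaleR MM) (simp add: mult.commute)
      then have "a' *\<^sub>R z0 + (- a) *\<^sub>R z1 = 0" by (rule ker)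
      then have "a' *\<^sub>R z0 + (- a) *\<^sub>R z1 + 0 *\<^sub>R g = 0" by simp
      then have "a = 0" using indz[of a' "- a" 0] by simp
      then show False using MM(1) ker[of z0] z0(2) by simp
    next
      case False
      then have noeig: "\<And>z \<mu>. R z = z \<Longrightarrow> z \<noteq> 0 \<Longrightarrow> W z \<noteq> \<mu> *\<^sub>R z" by blast
      have RWx: "R (W x) = W x" by (rule RW)
      have Wxi: "\<And>k. W x \<noteq> k *\<^sub>R x" using noeig[OF fx(1,3)] .
      obtain p q where pq: "W (W x) = p *\<^sub>R x + q *\<^sub>R W x"
      proof -
        obtain \<phi>1 \<phi>2 \<phi>3 :: "real^3 \<Rightarrow> real" where \<phi>: "\<And>z. z = \<phi>1 z *\<^sub>R x + \<phi>2 z *\<^sub>R W x + \<phi>3 z *\<^sub>R g"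
          using basis3_coordinates[of x "W x" g] indep[OF fx(1) RWx fx(3) Wxi] by metis
        have "W (W x) = P (W (W x))" using P(5)[OF RW] by simp
        also have "\<dots> = \<phi>1 (W (W x)) *\<^sub>R x + \<phi>2 (W (W x)) *\<^sub>R W x"
          by (subst \<phi>[of "W (W x)"]) (simp only: linear_add[OF P(1)] linear_scale[OF P(1)] P(5)[OF fx(1)] P(5)[OF RWx] Pg scaleR_zero_right add_0_right)
        finally show ?thesis using that by blast
      qed
      \<comment> \<open>\<open>q\<close> is the trace of \<open>W\<close> on the plane and
        \<open>- p\<close> its determinant, so \<open>p + \<tau>\<^sup>2\<close> is a quarter of the
        discriminant; if it is a square \<open>s\<^sup>2\<close>, then \<open>\<tau> + s\<close> is
        a real eigenvalue.\<close>
      define \<tau> where "\<tau> = q / 2"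
      have neg: "p + \<tau>\<^sup>2 < 0"
      proof (rule ccontr)
        assume "\<not> p + \<tau>\<^sup>2 < 0"
        then obtain s where s: "s\<^sup>2 = p + \<tau>\<^sup>2" by (metis not_less real_sqrt_pow2)
        define z where "z = (s - \<tau>) *\<^sub>R x + 1 *\<^sub>R W x"
        have "W z = (\<tau> + s) *\<^sub>R z"
        proof -
          have "W z = p *\<^sub>R x + (s - \<tau> + q) *\<^sub>R W x"
            unfolding z_def Wl pq by (simp add: algebra_simps)
          moreover have "(\<tau> + s) *\<^sub>R z = (s\<^sup>2 - \<tau>\<^sup>2) *\<^sub>R x + (\<tau> + s) *\<^sub>R W x"
            unfolding z_def by (simp add: algebra_simps power2_eq_square)
          ultimately show ?thesis using s by (simp add: \<tau>_def)
        qed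
        moreover have "R z = z" unfolding z_def by (rule Rl[OF fx(1) RWx])
        moreover have "z \<noteq> 0"
        proof
          assume "z = 0"
          then have "W x = - ((s - \<tau>) *\<^sub>R x)" by (simp add: z_def add_eq_0_iff)
          then have "W x = (- (s - \<tau>)) *\<^sub>R x" by (simp only: scaleR_minus_left)
          then show False using Wxi by blast
        qed
        ultimately show False using noeig by blast
      qed
      define \<kappa> where "\<kappa> = sqrt (- (p + \<tau>\<^sup>2))"
      have \<kappa>: "\<kappa> > 0" "\<kappa>\<^sup>2 = - (p + \<tau>\<^sup>2)" using neg by (auto simp: \<kappa>_def)
      define f1 f2 where "f1 = x" and "f2 = (- \<tau> / \<kappa>) *\<^sub>R x + (1 / \<kappa>) *\<^sub>R W x"
      have f: "R f1 = f1" "R f2 = f2" "f1 \<noteq> 0"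
        using Rl[OF fx(1) RWx] fx by (simp_all only: f1_def f2_def not_False_eq_True)
      have W1: "W f1 = \<tau> *\<^sub>R f1 + \<kappa> *\<^sub>R f2"
        using \<kappa>(1) by (simp add: f1_def f2_def scaleR_diff_right)
      have W2: "W f2 = \<tau> *\<^sub>R f2 - \<kappa> *\<^sub>R f1"
      proof -
        have "W f2 = (p / \<kappa>) *\<^sub>R x + ((q - \<tau>) / \<kappa>) *\<^sub>R W x"
          unfolding f2_def Wl pq by (simp add: algebra_simps add_divide_distrib diff_divide_distrib)
        moreover have "\<tau> *\<^sub>R f2 - \<kappa> *\<^sub>R f1 = (- (\<tau>\<^sup>2 / \<kappa>) - \<kappa>) *\<^sub>R x + (\<tau> / \<kappa>) *\<^sub>R W x"
          unfolding f2_def f1_def by (simp add: algebra_simps power2_eq_square)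
        moreover have "p / \<kappa> = - (\<tau>\<^sup>2 / \<kappa>) - \<kappa>" using \<kappa> by (simp add: field_simps power2_eq_square)
        moreover have "(q - \<tau>) / \<kappa> = \<tau> / \<kappa>" by (simp add: \<tau>_def)
        ultimately show ?thesis by simp
      qed
      have f2i: "f2 \<noteq> k *\<^sub>R f1" for k
      proof
        assume "f2 = k *\<^sub>R f1"
        then have "W f1 = (\<tau> + \<kappa> * k) *\<^sub>R f1" using W1 by (simp add: algebra_simps)
        then show False using noeig[OF f(1,3)] by blast
      qed
      show False
        by (rule extremal_rotation_contradiction[OF v R \<open>0 < \<epsilon>\<close> con pulse M' rot P eK(1,3) eK(4)[unfolded W_def] f(1,2)
              indep[OF f(1,2,3) f2i] Pg \<kappa>(1) W1[unfolded W_def] W2[unfolded W_def]])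
    qed
  qed
qed

section \<open>Linear algebra in space and a third-order maximum test\<close>

lemma basis3_decomposition:
  fixes f1 f2 f3 :: "real^3"
  assumes indep: "\<And>\<alpha> \<beta> \<gamma>. \<alpha> *\<^sub>R f1 + \<beta> *\<^sub>R f2 + \<gamma> *\<^sub>R f3 = 0 \<Longrightarrow> \<alpha> = 0 \<and> \<beta> = 0 \<and> \<gamma> = 0"
  shows "\<exists>\<phi>1 \<phi>2 \<phi>3 :: real^3 \<Rightarrow> real. \<forall>z. z = \<phi>1 z *\<^sub>R f1 + \<phi>2 z *\<^sub>R f2 + \<phi>3 z *\<^sub>R f3"
  by (rule basis3_coordinates[of f1 f2 f3, OF indep]) (assumption, intro exI allI, assumption)

text \<open>Both vectors are multiples of the cross product of \<open>a1\<close> and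
  \<open>a2\<close>.\<close>

lemma orthogonal_pair_parallel:
  fixes a1 a2 u w :: "real^3"
  assumes u: "a1 \<bullet> u = 0" "a2 \<bullet> u = 0" and w: "a1 \<bullet> w = 0" "a2 \<bullet> w = 0"
    and indep: "a1 \<noteq> 0" "\<And>k. a2 \<noteq> k *\<^sub>R a1" and "w \<noteq> 0"
  shows "\<exists>k. u = k *\<^sub>R w"
proof -
  have n: "cross3 a1 a2 \<noteq> 0"
    using indep(1) indep(2)[of 0] indep(2) unfolding cross_eq_0 collinear_lemma by simp
  have ex: "\<exists>k. z = k *\<^sub>R cross3 a1 a2" if "a1 \<bullet> z = 0" "a2 \<bullet> z = 0" for z
  proof -
    have "cross3 z (cross3 a1 a2) = 0" using that by (simp add: Lagrange inner_commute)
    then have "cross3 (cross3 a1 a2) z = 0" using cross_skew[of "cross3 a1 a2" z] by simp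
    then have "z = 0 \<or> (\<exists>k. z = k *\<^sub>R cross3 a1 a2)" using n unfolding cross_eq_0 collinear_lemma by blast
    then show ?thesis by (metis scaleR_zero_left)
  qed
  obtain k1 k2 where k: "u = k1 *\<^sub>R cross3 a1 a2" "w = k2 *\<^sub>R cross3 a1 a2" using ex[OF u] ex[OF w] by blast
  then have "k2 \<noteq> 0" using \<open>w \<noteq> 0\<close> by auto
  then have "u = (k1 / k2) *\<^sub>R w" by (simp add: k)
  then show ?thesis by blast
qed

lemma switched_matrix_mult: "switched_matrix A b c w *v y = A *v y + (w * (c \<bullet> y)) *\<^sub>R b"
  by (simp add: switched_matrix_def matrix_vector_mult_add_rdistrib scaleR_matrix_vector_assoc[symmetric] outer_product_mult)

lemma transpose_switched_matrix: "transpose (switched_matrix A b c w) = switched_matrix (transpose A) c b w"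
  by (simp add: vec_eq_iff switched_matrix_def transpose_def outer_product_def mult.commute)

lemma inner_transpose: "y \<bullet> (M *v z) = (transpose M *v y) \<bullet> z" for M :: "real^'n^'n"
  by (simp add: dot_lmul_matrix)

text \<open>A leading term of odd order takes both signs near 0; the second inequality for
  \<open>D\<close> comes from reversing \<open>h\<close>.\<close>

lemma third_order_maximum:
  fixes f f' f'' :: "real \<Rightarrow> real"
  assumes "0 < \<epsilon>" and max: "\<And>h. \<bar>h\<bar> < \<epsilon> \<Longrightarrow> f h \<le> f 0"
    and f: "\<And>h. (f has_real_derivative f' h) (at h)" and f': "\<And>h. (f' has_real_derivative f'' h) (at h)"
    and f'': "(f'' has_real_derivative D) (at 0)"
  shows "f' 0 = 0" and "f'' 0 \<le> 0" and "f'' 0 = 0 \<Longrightarrow> D = 0"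
proof -
  show 0: "f' 0 = 0"
    by (rule DERIV_local_max[OF f \<open>0 < \<epsilon>\<close>]) (use max in simp)
  show le: "f'' 0 \<le> 0"
    by (rule second_derivative_test[OF \<open>0 < \<epsilon>\<close> _ f 0 f']) (use max in simp)
  have aux: "E \<le> 0" if "0 < \<epsilon>" and max: "\<And>h. 0 < h \<Longrightarrow> h < \<epsilon> \<Longrightarrow> f h \<le> f 0"
    and f: "\<And>h. (f has_real_derivative f' h) (at h)" and f': "\<And>h. (f' has_real_derivative f'' h) (at h)"
    and f'': "(f'' has_real_derivative E) (at 0)" and 0: "f' 0 = 0" "f'' 0 = 0" for f f' f'' :: "real \<Rightarrow> real" and E
  proof (rule ccontr)
    assume "\<not> E \<le> 0"
    then obtain d where d: "d > 0" "\<And>h. 0 < h \<Longrightarrow> h < d \<Longrightarrow> 0 < f'' h"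
      using DERIV_pos_inc_right[OF f''] 0 by auto
    define h where "h = min d \<epsilon> / 2"
    have h: "0 < h" "h < d" "h < \<epsilon>" using d(1) \<open>0 < \<epsilon>\<close> by (auto simp: h_def)
    have pos: "0 < f' r" if "0 < r" "r < d" for r
    proof -
      have "f' 0 < f' r"
      proof (rule DERIV_pos_imp_increasing_open[OF \<open>0 < r\<close>])
        show "\<exists>y. (f' has_real_derivative y) (at t) \<and> 0 < y" if "0 < t" "t < r" for t
          using f'[of t] d(2)[of t] that \<open>r < d\<close> by auto
      qed (rule DERIV_continuous_on[OF has_field_derivative_at_within[OF f']])
      then show ?thesis using 0 by simp
    qed
    have "f 0 < f h"
    proof (rule DERIV_pos_imp_increasing_open[OF h(1)])
      show "\<exists>y. (f has_real_derivative y) (at t) \<and> 0 < y" if "0 < t" "t < h" for t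
        using f[of t] pos[of t] that h by auto
    qed (rule DERIV_continuous_on[OF has_field_derivative_at_within[OF f]])
    then show False using max[of h] h by simp
  qed
  show "D = 0" if z: "f'' 0 = 0"
  proof -
    have "D \<le> 0" by (rule aux[OF \<open>0 < \<epsilon>\<close> _ f f' f'' 0 z]) (use max in simp)
    have m: "(uminus has_real_derivative - 1) (at h)" for h :: real by (auto intro!: derivative_eq_intros)
    have "- D \<le> 0"
    proof (rule aux[where f = "\<lambda>h. f (- h)" and f' = "\<lambda>h. - f' (- h)" and f'' = "\<lambda>h. f'' (- h)"])
      show "((\<lambda>h. f (- h)) has_real_derivative - f' (- h)) (at h)" for h
        using DERIV_chain2[OF f m, of h] by simp
      show "((\<lambda>h. - f' (- h)) has_real_derivative f'' (- h)) (at h)" for h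
        using DERIV_minus[OF DERIV_chain2[OF f' m, of h]] by simp
      show "((\<lambda>h. f'' (- h)) has_real_derivative - D) (at 0)"
        using DERIV_chain2[of f'' D uminus 0 "- 1" UNIV] f'' m[of 0] by simp
    qed (use \<open>0 < \<epsilon>\<close> max 0 z in auto)
    with \<open>D \<le> 0\<close> show ?thesis by simp
  qed
qed

section \<open>Supporting functionals and self-intersections\<close>

text \<open>Removes \<open>u\<close> from the description: \<open>w\<close> is the value prescribed
  by the sign of the switching function on the open interval. The inequality is weak so that an
  interval may run through zeros that are not switchings.\<close>

definition bang_interval :: "real^'n \<Rightarrow> real^'n \<Rightarrow> (real \<Rightarrow> real^'n) \<Rightarrow> (real \<Rightarrow> real^'n) \<Rightarrow> real \<Rightarrow> real \<Rightarrow> real \<Rightarrow> bool" where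
  "bang_interval b c x l s r w \<longleftrightarrow> s \<le> r \<and> w \<in> {0, 1} \<and>
     (\<forall>\<tau>. s < \<tau> \<and> \<tau> < r \<longrightarrow> 0 \<le> (b \<bullet> l \<tau>) * (c \<bullet> x \<tau>) * (2 * w - 1))"

lemma periodic_int:
  fixes f :: "real \<Rightarrow> 'a"
  assumes per: "\<And>t. f (t + T) = f t"
  shows "f (t + of_int n * T) = f t"
proof -
  have nat: "f (t + real n * T) = f t" for n :: nat and t
  proof (induction n)
    case (Suc n)
    then show ?case using per[of "t + real n * T"] by (simp add: algebra_simps)
  qed simp
  show ?thesis
  proof (cases "0 \<le> n")
    case True
    then show ?thesis using nat[of t "nat n"] by simp
  next
    case False
    then show ?thesis using nat[of "t + of_int n * T" "nat (- n)"] by simp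
  qed
qed

text \<open>For \<open>l\<close> the roles of \<open>sgR\<close> and \<open>sgL\<close> are
  exchanged, since it is \<open>l (- t)\<close> that solves an equation of the form satisfied by
  \<open>x\<close>.\<close>

locale bang_signs =
  fixes A :: "real^3^3" and b c :: "real^3" and x l :: "real \<Rightarrow> real^3"
  assumes sg_x: "sgR A c (x t) \<noteq> 0" "sgL A c (x t) \<noteq> 0"
      "\<exists>r>0. \<forall>h. 0 < h \<and> h < r \<longrightarrow> sgn (c \<bullet> x (t + h)) = sgR A c (x t) \<and> sgn (c \<bullet> x (t - h)) = sgL A c (x t)"
    and sg_l: "sgR (transpose A) b (l t) \<noteq> 0" "sgL (transpose A) b (l t) \<noteq> 0"
      "\<exists>r>0. \<forall>h. 0 < h \<and> h < r \<longrightarrow> sgn (b \<bullet> l (t - h)) = sgR (transpose A) b (l t) \<and> sgn (b \<bullet> l (t + h)) = sgL (transpose A) b (l t)"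
begin

abbreviation "Mw \<equiv> switched_matrix A b c"
abbreviation "Q \<equiv> transpose A"

definition p where "p t = c \<bullet> x t"
definition q where "q t = b \<bullet> l t"

lemma bang_iff: "bang_interval b c x l s r w \<longleftrightarrow> s \<le> r \<and> w \<in> {0, 1} \<and>
     (\<forall>\<tau>. s < \<tau> \<and> \<tau> < r \<longrightarrow> 0 \<le> q \<tau> * p \<tau> * (2 * w - 1))"
  by (simp add: bang_interval_def p_def q_def)

lemma bang_sub: "bang_interval b c x l s r w \<Longrightarrow> s \<le> s' \<Longrightarrow> s' \<le> r' \<Longrightarrow> r' \<le> r \<Longrightarrow> bang_interval b c x l s' r' w"
  by (auto simp: bang_interval_def)

lemma sgn_cases: "sgR N e y \<noteq> 0 \<Longrightarrow> sgR N e y = 1 \<or> sgR N e y = - 1"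
  "sgL N e y \<noteq> 0 \<Longrightarrow> sgL N e y = 1 \<or> sgL N e y = - 1"
  by (auto simp: sgR_def sgL_def sgn_if split: if_splits)

text \<open>\<open>wR t\<close> and \<open>wL t\<close> are the control values just after and just
  before \<open>t\<close>; a product of two signs in \<open>{1, - 1}\<close> is rescaled to
  \<open>{1, 0}\<close>.\<close>

definition wR where "wR t = (1 + sgR A c (x t) * sgL Q b (l t)) / 2"
definition wL where "wL t = (1 + sgL A c (x t) * sgR Q b (l t)) / 2"

lemma wR_01: "wR t \<in> {0, 1}" and wL_01: "wL t \<in> {0, 1}"
  using sgn_cases[of A c "x t"] sgn_cases[of Q b "l t"] sg_x[of t] sg_l[of t]
  by (auto simp: wR_def wL_def)

lemma right_signs: "\<exists>e>0. \<forall>h. 0 < h \<and> h < e \<longrightarrow>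
    sgn (p (t + h)) = sgR A c (x t) \<and> sgn (q (t + h)) = sgL Q b (l t)"
proof -
  obtain r1 where "r1 > 0" "\<And>h. 0 < h \<Longrightarrow> h < r1 \<Longrightarrow> sgn (p (t + h)) = sgR A c (x t)"
    using sg_x(3)[of t] unfolding p_def by blast
  moreover obtain r2 where "r2 > 0" "\<And>h. 0 < h \<Longrightarrow> h < r2 \<Longrightarrow> sgn (q (t + h)) = sgL Q b (l t)"
    using sg_l(3)[of t] unfolding q_def by blast
  ultimately show ?thesis by (intro exI[of _ "min r1 r2"]) auto
qed

lemma left_signs: "\<exists>e>0. \<forall>h. 0 < h \<and> h < e \<longrightarrow>
    sgn (p (t - h)) = sgL A c (x t) \<and> sgn (q (t - h)) = sgR Q b (l t)"
proof -
  obtain r1 where "r1 > 0" "\<And>h. 0 < h \<Longrightarrow> h < r1 \<Longrightarrow> sgn (p (t - h)) = sgL A c (x t)"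
    using sg_x(3)[of t] unfolding p_def by blast
  moreover obtain r2 where "r2 > 0" "\<And>h. 0 < h \<Longrightarrow> h < r2 \<Longrightarrow> sgn (q (t - h)) = sgR Q b (l t)"
    using sg_l(3)[of t] unfolding q_def by blast
  ultimately show ?thesis by (intro exI[of _ "min r1 r2"]) auto
qed

lemma sgn_product_nonneg: "sgn a = \<alpha> \<Longrightarrow> sgn b' = \<beta> \<Longrightarrow> 0 \<le> b' * a * (2 * ((1 + \<alpha> * \<beta>) / 2) - 1)" for a b' \<alpha> \<beta> :: real
proof -
  assume s: "sgn a = \<alpha>" "sgn b' = \<beta>"
  have "b' * a * (2 * ((1 + \<alpha> * \<beta>) / 2) - 1) = \<bar>a\<bar> * \<bar>b'\<bar>"
    unfolding s[symmetric] by (simp add: abs_if sgn_if)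
  then show ?thesis by simp
qed

lemma right_bang: "\<exists>e>0. bang_interval b c x l t (t + e) (wR t)"
proof -
  obtain e where e: "e > 0" "\<And>h. 0 < h \<Longrightarrow> h < e \<Longrightarrow> sgn (p (t + h)) = sgR A c (x t) \<and> sgn (q (t + h)) = sgL Q b (l t)"
    using right_signs by blast
  have "0 \<le> q \<tau> * p \<tau> * (2 * wR t - 1)" if "t < \<tau>" "\<tau> < t + e" for \<tau>
    unfolding wR_def using sgn_product_nonneg[of "p \<tau>" _ "q \<tau>"] e(2)[of "\<tau> - t"] that by simp
  then show ?thesis using e(1) wR_01 by (auto simp: bang_iff)
qed

lemma left_bang: "\<exists>e>0. bang_interval b c x l (t - e) t (wL t)"
proof -
  obtain e where e: "e > 0" "\<And>h. 0 < h \<Longrightarrow> h < e \<Longrightarrow> sgn (p (t - h)) = sgL A c (x t) \<and> sgn (q (t - h)) = sgR Q b (l t)"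
    using left_signs by blast
  have "0 \<le> q \<tau> * p \<tau> * (2 * wL t - 1)" if "t - e < \<tau>" "\<tau> < t" for \<tau>
    unfolding wL_def using sgn_product_nonneg[of "p \<tau>" _ "q \<tau>"] e(2)[of "t - \<tau>"] that by simp
  then show ?thesis using e(1) wL_01 by (auto simp: bang_iff)
qed

end

text \<open>The normalised situation, stated without \<open>u\<close> so that it is preserved when
  \<open>x\<close> and \<open>l\<close> are exchanged and time is reversed. \<open>uniq_x\<close>
  and \<open>uniq_l\<close> express that the period map and its transpose fix a single line each;
  \<open>min_T\<close> concerns common periods, because minimality is known for the pair
  only.\<close>

locale bang_pair = bang_signs A b c x l
  for A :: "real^3^3" and b c :: "real^3" and x l :: "real \<Rightarrow> real^3" +
  fixes v :: "real^3 \<Rightarrow> real" and T :: real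
  assumes T_pos: "0 < T" and x_T: "x (t + T) = x t" and l_T: "l (t + T) = l t"
    and x_cont: "continuous_on UNIV x" and l_cont: "continuous_on UNIV l"
    and arc_x: "bang_interval b c x l s r w \<Longrightarrow> x r = mexp (switched_matrix A b c w) (r - s) *v x s"
    and arc_l: "bang_interval b c x l s r w \<Longrightarrow> l s = mexp (transpose (switched_matrix A b c w)) (r - s) *v l r"
    and nonsing: "w \<in> {0, 1} \<Longrightarrow> switched_matrix A b c w *v y = 0 \<Longrightarrow> y = 0"
    and norm_v: "is_norm v"
    and contr: "w \<in> {0, 1} \<Longrightarrow> 0 \<le> h \<Longrightarrow> v (mexp (switched_matrix A b c w) h *v y) \<le> v y"
    and v_x: "v (x t) = 1" and l_x: "l t \<bullet> x t = 1" and l_le: "l t \<bullet> y \<le> v y"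
    and uniq_x: "(\<And>t. f (t + T) = f t) \<Longrightarrow>
      (\<And>s r w. bang_interval b c x l s r w \<Longrightarrow> f r = mexp (switched_matrix A b c w) (r - s) *v f s) \<Longrightarrow> \<exists>k. \<forall>t. f t = k *\<^sub>R x t"
    and uniq_l: "(\<And>t. f (t + T) = f t) \<Longrightarrow>
      (\<And>s r w. bang_interval b c x l s r w \<Longrightarrow> f s = mexp (transpose (switched_matrix A b c w)) (r - s) *v f r) \<Longrightarrow> \<exists>k. \<forall>t. f t = k *\<^sub>R l t"
    and min_T: "(\<And>t. x (t + S) = x t) \<Longrightarrow> (\<And>t. l (t + S) = l t) \<Longrightarrow> \<exists>n::int. S = n * T"
    and p_sign: "\<exists>t. 0 < c \<bullet> x t" "\<exists>t. c \<bullet> x t < 0"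
    and q_sign: "\<exists>t. 0 < b \<bullet> l t" "\<exists>t. b \<bullet> l t < 0"
begin

lemma p_cont: "continuous_on S p" and q_cont: "continuous_on S q"
  unfolding p_def q_def
  by (auto intro!: continuous_intros continuous_on_subset[OF x_cont] continuous_on_subset[OF l_cont])

lemma x_T_int: "x (t + of_int n * T) = x t" and l_T_int: "l (t + of_int n * T) = l t"
  by (rule periodic_int[of x T, OF x_T], rule periodic_int[of l T, OF l_T])

text \<open>The face of the dual unit ball that supports at \<open>x t\<close>; \<open>l t\<close>
  is one of its points, not known to be the only one.\<close>

definition supp where "supp t = {\<eta>. \<eta> \<bullet> x t = 1 \<and> (\<forall>y. \<eta> \<bullet> y \<le> v y)}"

lemma l_supp: "l t \<in> supp t"
  by (simp add: supp_def l_x l_le)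

text \<open>Because an arc contracts \<open>v\<close>, its transpose carries supports to supports,
  against the direction of time.\<close>

lemma supp_mexp: "\<eta> \<in> supp r \<Longrightarrow> bang_interval b c x l s r w \<Longrightarrow> mexp (transpose (Mw w)) (r - s) *v \<eta> \<in> supp s"
proof -
  assume a: "\<eta> \<in> supp r" "bang_interval b c x l s r w"
  have "(mexp (transpose (Mw w)) (r - s) *v \<eta>) \<bullet> y = \<eta> \<bullet> (mexp (Mw w) (r - s) *v y)" for y
    by (simp add: inner_mexp)
  moreover have "v (mexp (Mw w) (r - s) *v y) \<le> v y" for y
    using a(2) by (intro contr) (auto simp: bang_iff)
  ultimately show ?thesis
    using a arc_x[OF a(2)] unfolding supp_def by (auto intro: order_trans)
qed

lemma supp_Mw_le: 
  assumes "\<eta> \<in> supp t" "w \<in> {0, 1}"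
  shows "\<eta> \<bullet> (Mw w *v x t) \<le> 0"
proof (rule ccontr)
  assume "\<not> ?thesis"
  moreover have d: "((\<lambda>h. \<eta> \<bullet> (mexp (Mw w) h *v x t)) has_real_derivative \<eta> \<bullet> (Mw w *v x t)) (at 0)"
    using bounded_linear.has_vector_derivative[OF bounded_linear_inner_right[of \<eta>] mexp_deriv[of "Mw w" "x t" 0 UNIV]]
    by (simp add: has_real_derivative_iff_has_vector_derivative)
  ultimately obtain e where e: "e > 0" "\<And>h. 0 < h \<Longrightarrow> h < e \<Longrightarrow> \<eta> \<bullet> x t < \<eta> \<bullet> (mexp (Mw w) h *v x t)"
    using DERIV_pos_inc_right[OF d] by auto
  have "\<eta> \<bullet> (mexp (Mw w) (e / 2) *v x t) \<le> v (mexp (Mw w) (e / 2) *v x t)" using assms(1) by (simp add: supp_def)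
  also have "\<dots> \<le> v (x t)" using e(1) assms(2) by (intro contr) auto
  finally show False using e(2)[of "e / 2"] e(1) assms(1) by (simp add: v_x supp_def)
qed

text \<open>Along the arc \<open>v (x (t + h)) = 1\<close>, so \<open>\<eta>\<close> is maximal at
  \<open>h = 0\<close>. If the second derivative vanished, so would the third, and
  \<open>\<eta>\<close> would annihilate the images under the invertible matrix of the basis formed
  by \<open>x t\<close> and its first two iterates, hence everything.\<close>

lemma supp_interior:
  assumes \<eta>: "\<eta> \<in> supp t" and w: "bang_interval b c x l s r w" and t: "s < t" "t < r"
  shows "\<eta> \<bullet> (Mw w *v x t) = 0" and "\<eta> \<bullet> (Mw w *v (Mw w *v x t)) < 0"
proof -
  let ?M = "Mw w"
  have w01: "w \<in> {0, 1}" using w by (simp add: bang_iff)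
  define e where "e = min (t - s) (r - t)"
  have "e > 0" using t by (simp add: e_def)
  define f where "f y = (\<lambda>h. \<eta> \<bullet> (mexp ?M h *v y))" for y
  have f: "(f y has_real_derivative f (?M *v y) h) (at h)" for y h
    using bounded_linear.has_vector_derivative[OF bounded_linear_inner_right[of \<eta>] mexp_deriv[of ?M y h UNIV]]
    unfolding f_def has_real_derivative_iff_has_vector_derivative mexp_commute_vec .
  have le: "f (x t) h \<le> f (x t) 0" if "\<bar>h\<bar> < e" for h
  proof -
    have "mexp ?M h *v x t = x (t + h)"
    proof (cases "0 \<le> h")
      case True
      have "bang_interval b c x l t (t + h) w" by (rule bang_sub[OF w]) (use that t True in \<open>auto simp: e_def\<close>)
      from arc_x[OF this] show ?thesis by simp
    next
      case False
      have "bang_interval b c x l (t + h) t w" by (rule bang_sub[OF w]) (use that t False in \<open>auto simp: e_def\<close>)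
      from arc_x[OF this] have "x t = mexp ?M (- h) *v x (t + h)" by simp
      then show ?thesis by simp
    qed
    then have "f (x t) h \<le> v (x (t + h))" using \<eta> by (simp add: f_def supp_def)
    then show ?thesis using \<eta> by (simp add: f_def supp_def v_x)
  qed
  note th = third_order_maximum[OF \<open>e > 0\<close> le f[of "x t"] f[of "?M *v x t"] f[of "?M *v (?M *v x t)" 0]]
  have 1: "f (?M *v x t) 0 = 0" by (rule th(1))
  have 2: "f (?M *v (?M *v x t)) 0 \<le> 0" by (rule th(2))
  have 3: "f (?M *v (?M *v x t)) 0 = 0 \<Longrightarrow> f (?M *v (?M *v (?M *v x t))) 0 = 0" by (rule th(3))
  show A1: "\<eta> \<bullet> (?M *v x t) = 0" using 1 by (simp add: f_def)
  have "\<eta> \<bullet> (?M *v (?M *v x t)) \<noteq> 0"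
  proof
    assume A2: "\<eta> \<bullet> (?M *v (?M *v x t)) = 0"
    then have A3: "\<eta> \<bullet> (?M *v (?M *v (?M *v x t))) = 0" using 3 by (simp add: f_def)
    have ns: "\<And>y. ?M *v y = 0 \<Longrightarrow> y = 0" using nonsing[OF w01] by blast
    have lx: "\<eta> \<bullet> x t = 1" using \<eta> by (simp add: supp_def)
    have ind: "\<alpha> = 0 \<and> \<beta> = 0 \<and> \<gamma> = 0"
      if z: "\<alpha> *\<^sub>R x t + \<beta> *\<^sub>R (?M *v x t) + \<gamma> *\<^sub>R (?M *v (?M *v x t)) = 0" for \<alpha> \<beta> \<gamma>
    proof -
      have "\<eta> \<bullet> (\<alpha> *\<^sub>R x t + \<beta> *\<^sub>R (?M *v x t) + \<gamma> *\<^sub>R (?M *v (?M *v x t))) = \<alpha>"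
        by (simp add: inner_add_right A1 A2 lx)
      then have "\<alpha> = 0" using z by simp
      then have "?M *v (\<beta> *\<^sub>R x t + \<gamma> *\<^sub>R (?M *v x t)) = 0"
        using z by (simp add: matrix_vector_right_distrib matrix_vector_mult_scaleR)
      then have z2: "\<beta> *\<^sub>R x t + \<gamma> *\<^sub>R (?M *v x t) = 0" by (rule ns)
      have "\<eta> \<bullet> (\<beta> *\<^sub>R x t + \<gamma> *\<^sub>R (?M *v x t)) = \<beta>" by (simp add: inner_add_right A1 lx)
      then have "\<beta> = 0" using z2 by simp
      moreover have "?M *v x t \<noteq> 0"
      proof
        assume "?M *v x t = 0"
        then have "x t = 0" by (rule ns)
        then show False using lx by simp
      qed
      ultimately show ?thesis using z2 \<open>\<alpha> = 0\<close> by simp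
    qed
    have "\<exists>\<phi>1 \<phi>2 \<phi>3 :: real^3 \<Rightarrow> real. \<forall>z. z = \<phi>1 z *\<^sub>R x t + \<phi>2 z *\<^sub>R (?M *v x t) + \<phi>3 z *\<^sub>R (?M *v (?M *v x t))"
    proof (rule basis3_decomposition)
      fix \<alpha> \<beta> \<gamma> assume "\<alpha> *\<^sub>R x t + \<beta> *\<^sub>R (?M *v x t) + \<gamma> *\<^sub>R (?M *v (?M *v x t)) = 0"
      then show "\<alpha> = 0 \<and> \<beta> = 0 \<and> \<gamma> = 0" by (rule ind)
    qed
    then obtain \<phi>1 \<phi>2 \<phi>3 :: "real^3 \<Rightarrow> real" where
      \<phi>: "\<forall>z. z = \<phi>1 z *\<^sub>R x t + \<phi>2 z *\<^sub>R (?M *v x t) + \<phi>3 z *\<^sub>R (?M *v (?M *v x t))"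
      by (elim exE)
    have lin: "linear ((*v) ?M)" by simp
    have "inj ((*v) ?M)"
      unfolding linear_injective_0[OF lin]
    proof (intro allI impI)
      show "y = 0" if "?M *v y = 0" for y using that by (rule ns)
    qed
    then have "surj ((*v) ?M)" by (rule linear_injective_imp_surjective[OF lin]) (rule refl)
    then obtain z where z: "x t = ?M *v z" by (rule surjE)
    have "?M *v z = \<phi>1 z *\<^sub>R (?M *v x t) + \<phi>2 z *\<^sub>R (?M *v (?M *v x t)) + \<phi>3 z *\<^sub>R (?M *v (?M *v (?M *v x t)))"
      using arg_cong[OF spec[OF \<phi>, of z], of "(*v) ?M"]
      by (simp only: matrix_vector_right_distrib matrix_vector_mult_scaleR)
    from arg_cong[OF this, of "inner \<eta>"] have "\<eta> \<bullet> x t = \<phi>1 z * 0 + \<phi>2 z * 0 + \<phi>3 z * 0"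
      by (simp only: z[symmetric] inner_add_right inner_scaleR_right A1 A2 A3)
    then show False using lx by simp
  qed
  then show "\<eta> \<bullet> (?M *v (?M *v x t)) < 0" using 2 by (simp add: f_def)
qed

text \<open>A support at \<open>t\<close> is pulled back to \<open>t - h\<close>, inside an arc,
  where the active control leaves it stationary and the other control may not increase it. The two
  matrices differ by a multiple of \<open>outer_product b c\<close>, which gives the sign of
  \<open>b\<close> on the functional; letting \<open>h\<close> tend to 0 makes it a weak
  inequality.\<close>

lemma supp_left:
  assumes \<eta>: "\<eta> \<in> supp t"
  shows "\<eta> \<bullet> (Mw (wL t) *v x t) = 0" and "\<eta> \<bullet> (Mw (wL t) *v (Mw (wL t) *v x t)) < 0"
    and "0 \<le> sgR Q b (l t) * (b \<bullet> \<eta>)"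
proof -
  let ?w = "wL t"
  obtain e where e: "e > 0" "bang_interval b c x l (t - e) t ?w" using left_bang by blast
  define \<mu> where "\<mu> h = mexp (transpose (Mw ?w)) h *v \<eta>" for h
  have \<mu>: "\<mu> h \<in> supp (t - h)" and xh: "x t = mexp (Mw ?w) h *v x (t - h)" if "0 < h" "h < e" for h
  proof -
    have bi: "bang_interval b c x l (t - h) t ?w" by (rule bang_sub[OF e(2)]) (use that in auto)
    show "\<mu> h \<in> supp (t - h)" using supp_mexp[OF \<eta> bi] by (simp add: \<mu>_def)
    show "x t = mexp (Mw ?w) h *v x (t - h)" using arc_x[OF bi] by simp
  qed
  have \<mu>i: "\<mu> h \<bullet> y = \<eta> \<bullet> (mexp (Mw ?w) h *v y)" for h y by (simp add: \<mu>_def inner_mexp)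
  have h2: "0 < e / 2" "e / 2 < e" using e(1) by auto
  note si = supp_interior[OF \<mu>[OF h2] e(2)]
  show "\<eta> \<bullet> (Mw ?w *v x t) = 0" using si(1) e(1) unfolding \<mu>i mexp_commute_vec[symmetric] xh[OF h2, symmetric] by simp
  show "\<eta> \<bullet> (Mw ?w *v (Mw ?w *v x t)) < 0" using si(2) e(1) unfolding \<mu>i mexp_commute_vec[symmetric] xh[OF h2, symmetric] by simp
  \<comment> \<open>Stationarity under \<open>?w\<close> is subtracted from the inequality under
    \<open>1 - ?w\<close>.\<close>
  have int: "0 \<le> (2 * ?w - 1) * ((b \<bullet> \<mu> h) * p (t - h))" if h: "0 < h" "h < e" for h
  proof -
    have "\<mu> h \<bullet> (Mw ?w *v x (t - h)) = 0"
      by (rule supp_interior(1)[OF \<mu>[OF h] e(2)]) (use h in auto)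
    moreover have "\<mu> h \<bullet> (Mw (1 - ?w) *v x (t - h)) \<le> 0"
      by (rule supp_Mw_le[OF \<mu>[OF h]]) (use wL_01[of t] in auto)
    ultimately have "(1 - 2 * ?w) * (p (t - h) * (\<mu> h \<bullet> b)) \<le> 0"
      by (simp add: switched_matrix_mult inner_add_right p_def algebra_simps)
    then show ?thesis by (simp add: algebra_simps inner_commute)
  qed
  obtain e' where e': "e' > 0" "\<And>h. 0 < h \<Longrightarrow> h < e' \<Longrightarrow> sgn (p (t - h)) = sgL A c (x t) \<and> sgn (q (t - h)) = sgR Q b (l t)"
    using left_signs by blast
  have "0 \<le> sgR Q b (l t) * (b \<bullet> \<mu> h)" if h: "0 < h" "h < min e e'" for h
  proof -
    have s: "sgn (p (t - h)) = sgL A c (x t)" using e'(2)[of h] h by simp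
    have "0 \<le> sgL A c (x t) * sgR Q b (l t) * ((b \<bullet> \<mu> h) * p (t - h))"
    proof -
      have "2 * wL t - 1 = sgL A c (x t) * sgR Q b (l t)" by (simp add: wL_def field_simps)
      then show ?thesis using int[of h] h by simp
    qed
    also have "sgL A c (x t) * sgR Q b (l t) * ((b \<bullet> \<mu> h) * p (t - h)) = (sgR Q b (l t) * (b \<bullet> \<mu> h)) * \<bar>p (t - h)\<bar>"
      unfolding s[symmetric] abs_sgn by (simp only: mult_ac)
    finally have "0 \<le> (sgR Q b (l t) * (b \<bullet> \<mu> h)) * \<bar>p (t - h)\<bar>" .
    moreover have "\<bar>p (t - h)\<bar> > 0" using s sg_x(2)[of t] by auto
    ultimately show ?thesis by (simp add: zero_le_mult_iff)
  qed
  then have ev: "\<forall>\<^sub>F h in at_right 0. 0 \<le> sgR Q b (l t) * (b \<bullet> \<mu> h)"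
    using e(1) e'(1) by (intro eventually_at_rightI[of 0 "min e e'"]) auto
  have "continuous_on UNIV (\<lambda>h. sgR Q b (l t) * (b \<bullet> \<mu> h))"
    unfolding \<mu>_def by (intro continuous_intros)
  then have "((\<lambda>h. sgR Q b (l t) * (b \<bullet> \<mu> h)) \<longlongrightarrow> sgR Q b (l t) * (b \<bullet> \<mu> 0)) (at_right 0)"
    by (simp add: continuous_on_def filterlim_at_split)
  then have "0 \<le> sgR Q b (l t) * (b \<bullet> \<mu> 0)"
    by (rule tendsto_lowerbound[OF _ ev]) simp
  then show "0 \<le> sgR Q b (l t) * (b \<bullet> \<eta>)" by (simp add: \<mu>_def)
qed

text \<open>Every support at \<open>t\<close> is constrained by the sign of
  \<open>b \<bullet> l\<close> before \<open>t\<close>; the constraint by the sign after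
  \<open>t\<close> is obtained for supports that are pulled back from a later time.\<close>

lemma supp_right:
  assumes bi: "bang_interval b c x l t (t + e) w" "0 < e" and \<eta>: "\<eta> \<in> supp (t + e)"
  shows "0 \<le> sgL Q b (l t) * (b \<bullet> (mexp (transpose (Mw w)) e *v \<eta>))"
proof -
  define \<mu> where "\<mu> h = mexp (transpose (Mw w)) (e - h) *v \<eta>" for h
  have \<mu>: "\<mu> h \<in> supp (t + h)" if "0 < h" "h < e" for h
  proof -
    have "bang_interval b c x l (t + h) (t + e) w" by (rule bang_sub[OF bi(1)]) (use that in auto)
    from supp_mexp[OF \<eta> this] show ?thesis by (simp add: \<mu>_def)
  qed
  obtain e' where e': "e' > 0" "\<And>h. 0 < h \<Longrightarrow> h < e' \<Longrightarrow> sgn (p (t + h)) = sgR A c (x t) \<and> sgn (q (t + h)) = sgL Q b (l t)"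
    using right_signs by blast
  have "0 \<le> sgL Q b (l t) * (b \<bullet> \<mu> h)" if h: "0 < h" "h < min e e'" for h
  proof -
    have s: "sgn (q (t + h)) = sgL Q b (l t)" using e'(2)[of h] h by simp
    then have "q (t + h) \<noteq> 0" using sg_l(2)[of t] by auto
    then have "sgR Q b (l (t + h)) = sgL Q b (l t)" using s by (simp add: sgR_def q_def)
    then show ?thesis using supp_left(3)[OF \<mu>[of h]] h by simp
  qed
  then have ev: "\<forall>\<^sub>F h in at_right 0. 0 \<le> sgL Q b (l t) * (b \<bullet> \<mu> h)"
    using bi(2) e'(1) by (intro eventually_at_rightI[of 0 "min e e'"]) auto
  have "continuous_on UNIV (\<lambda>h. sgL Q b (l t) * (b \<bullet> \<mu> h))"
    unfolding \<mu>_def by (intro continuous_intros)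
  then have "((\<lambda>h. sgL Q b (l t) * (b \<bullet> \<mu> h)) \<longlongrightarrow> sgL Q b (l t) * (b \<bullet> \<mu> 0)) (at_right 0)"
    by (simp add: continuous_on_def filterlim_at_split)
  then have "0 \<le> sgL Q b (l t) * (b \<bullet> \<mu> 0)"
    by (rule tendsto_lowerbound[OF _ ev]) simp
  then show ?thesis by (simp add: \<mu>_def)
qed

text \<open>Stands for a composition of arcs; only existence is recorded, since nothing is known yet
  about the number of switchings. Injectivity of the transpose keeps distinct functionals distinct
  under transport.\<close>

definition trans_mat :: "real \<Rightarrow> real \<Rightarrow> real^3^3 \<Rightarrow> bool" where
  "trans_mat s r F \<longleftrightarrow> (\<forall>y. transpose F *v y = 0 \<longrightarrow> y = 0) \<and> (\<forall>y. v (F *v y) \<le> v y) \<and>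
    x r = F *v x s \<and> l s = transpose F *v l r"

lemma trans_matD:
  assumes "trans_mat s r F"
  shows "v (F *v y) \<le> v y" "x r = F *v x s" "l s = transpose F *v l r"
    and "transpose F *v y = 0 \<Longrightarrow> y = 0"
  using assms unfolding trans_mat_def by blast+

lemma trans_mat_comp:
  assumes F: "trans_mat s m F" and G: "trans_mat m r G"
  shows "trans_mat s r (G ** F)"
  unfolding trans_mat_def
proof (intro conjI allI impI)
  show "x r = (G ** F) *v x s"
    by (simp only: trans_matD(2)[OF G] trans_matD(2)[OF F] matrix_vector_mul_assoc)
  show "l s = transpose (G ** F) *v l r"
    by (simp only: trans_matD(3)[OF F] trans_matD(3)[OF G] matrix_transpose_mul matrix_vector_mul_assoc)
  fix y
  have "v (G *v (F *v y)) \<le> v y" by (rule order_trans[OF trans_matD(1)[OF G] trans_matD(1)[OF F]])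
  then show "v ((G ** F) *v y) \<le> v y" by (simp add: matrix_vector_mul_assoc[symmetric])
  assume "transpose (G ** F) *v y = 0"
  then have "transpose F *v (transpose G *v y) = 0" by (simp add: matrix_transpose_mul matrix_vector_mul_assoc[symmetric])
  then have "transpose G *v y = 0" by (rule trans_matD(4)[OF F])
  then show "y = 0" by (rule trans_matD(4)[OF G])
qed

lemma trans_mat_bang:
  assumes bi: "bang_interval b c x l s r w"
  shows "trans_mat s r (mexp (Mw w) (r - s))"
  unfolding trans_mat_def
proof (intro conjI allI impI)
  show "x r = mexp (Mw w) (r - s) *v x s" by (rule arc_x[OF bi])
  show "l s = transpose (mexp (Mw w) (r - s)) *v l r" using arc_l[OF bi] by (simp add: transpose_mexp)
  show "v (mexp (Mw w) (r - s) *v y) \<le> v y" for y by (rule contr) (use bi in \<open>auto simp: bang_iff\<close>)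
  show "y = 0" if "transpose (mexp (Mw w) (r - s)) *v y = 0" for y using that by (simp add: transpose_mexp)
qed

text \<open>Bisection: near each time one arc on either side suffices.\<close>

lemma transition:
  assumes "s \<le> r"
  shows "\<exists>F. trans_mat s r F"
  using assms
proof (induction rule: Bolzano)
  case (trans s m r)
  then show ?case using trans_mat_comp by blast
next
  case (local t)
  obtain e1 where e1: "e1 > 0" "bang_interval b c x l t (t + e1) (wR t)" using right_bang by blast
  obtain e2 where e2: "e2 > 0" "bang_interval b c x l (t - e2) t (wL t)" using left_bang by blast
  show ?case
  proof (intro exI[of _ "min e1 e2"] conjI allI impI)
    fix s r assume sr: "s \<le> t \<and> t \<le> r \<and> r - s < min e1 e2"
    have "bang_interval b c x l s t (wL t)" by (rule bang_sub[OF e2(2)]) (use sr in auto)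
    note F = trans_mat_bang[OF this]
    have "bang_interval b c x l t r (wR t)" by (rule bang_sub[OF e1(2)]) (use sr in auto)
    note G = trans_mat_bang[OF this]
    show "\<exists>F. trans_mat s r F" using trans_mat_comp[OF F G] by blast
  qed (use e1 e2 in auto)
qed

lemma trans_mat_supp:
  assumes F: "trans_mat s r F" and \<eta>: "\<eta> \<in> supp r"
  shows "transpose F *v \<eta> \<in> supp s"
proof -
  have i: "(transpose F *v \<eta>) \<bullet> y = \<eta> \<bullet> (F *v y)" for y by (simp add: inner_transpose)
  have "(transpose F *v \<eta>) \<bullet> x s = 1"
    unfolding i trans_matD(2)[OF F, symmetric] using \<eta> by (simp add: supp_def)
  moreover have "(transpose F *v \<eta>) \<bullet> y \<le> v y" for y
  proof -
    have "\<eta> \<bullet> (F *v y) \<le> v (F *v y)" using \<eta> by (simp add: supp_def)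
    also have "\<dots> \<le> v y" by (rule trans_matD(1)[OF F])
    finally show ?thesis unfolding i .
  qed
  ultimately show ?thesis by (simp add: supp_def)
qed

text \<open>The first short arc supplies the sign condition, the rest of the way is any
  transition.\<close>

lemma future_support:
  assumes "t < r"
  obtains F where "trans_mat t r F" "\<And>\<eta>. \<eta> \<in> supp r \<Longrightarrow> 0 \<le> sgL Q b (l t) * (b \<bullet> (transpose F *v \<eta>))"
proof -
  obtain e0 where e0: "e0 > 0" "bang_interval b c x l t (t + e0) (wR t)" using right_bang by blast
  define e where "e = min e0 (r - t)"
  have e: "0 < e" "t + e \<le> r" using e0(1) assms by (auto simp: e_def)
  have bi: "bang_interval b c x l t (t + e) (wR t)" by (rule bang_sub[OF e0(2)]) (use e in \<open>auto simp: e_def\<close>)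
  obtain G where G: "trans_mat (t + e) r G" using transition[OF e(2)] by blast
  show ?thesis
  proof (rule that[OF trans_mat_comp[OF trans_mat_bang[OF bi] G]])
    fix \<eta> assume "\<eta> \<in> supp r"
    from supp_right[OF bi e(1) trans_mat_supp[OF G this]]
    show "0 \<le> sgL Q b (l t) * (b \<bullet> (transpose (G ** mexp (Mw (wR t)) (t + e - t)) *v \<eta>))"
      by (simp add: matrix_transpose_mul matrix_vector_mul_assoc[symmetric] transpose_mexp)
  qed
qed

lemma sgL_nz: "b \<bullet> \<eta> \<noteq> 0 \<Longrightarrow> sgL Q b \<eta> = sgn (b \<bullet> \<eta>) \<and> sgR Q b \<eta> = sgn (b \<bullet> \<eta>)"
  by (simp add: sgL_def sgR_def)

lemma supp_x_eq: "x t = x s \<Longrightarrow> supp t = supp s"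
  by (simp add: supp_def)

text \<open>The two supports also annihilate the left velocity \<open>Mw (wL t) *v x t\<close>;
  being independent, they determine its direction.\<close>

lemma supp_parallel:
  assumes "\<eta>1 \<in> supp t" "\<eta>2 \<in> supp t" "\<eta>1 \<noteq> \<eta>2" "b \<bullet> \<eta>1 = 0" "b \<bullet> \<eta>2 = 0"
  obtains k where "b = k *\<^sub>R (Mw (wL t) *v x t)"
proof -
  have "\<eta>1 \<noteq> 0" using assms(1) by (auto simp: supp_def)
  moreover have "\<eta>2 \<noteq> k *\<^sub>R \<eta>1" for k
  proof
    assume "\<eta>2 = k *\<^sub>R \<eta>1"
    then show False using assms(1-3) by (auto simp: supp_def)
  qed
  moreover have "Mw (wL t) *v x t \<noteq> 0"
    using nonsing[OF wL_01, of t "x t"] v_x[of t] is_normD(2)[OF norm_v, of "x t"] by auto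
  ultimately have "\<exists>k. b = k *\<^sub>R (Mw (wL t) *v x t)"
    using orthogonal_pair_parallel[of \<eta>1 b \<eta>2 "Mw (wL t) *v x t"] assms supp_left(1)[of \<eta>1 t] supp_left(1)[of \<eta>2 t]
    by (simp add: inner_commute)
  then show ?thesis using that by blast
qed

section \<open>Self-intersections of the orbit\<close>

text \<open>If \<open>b \<bullet> l t\<close> had a sign, opposite sign conditions would force
  \<open>b \<bullet> l s = 0\<close>, and the same for \<open>l s\<close> carried back from the
  later time \<open>t + n * T\<close> to \<open>s\<close>. Two independent supports that annihilate
  \<open>b\<close> make \<open>b\<close> parallel to the velocity, and then \<open>l t\<close>
  annihilates \<open>b\<close> too.\<close>

lemma local_signs_aux:
  assumes x: "x t = x s" and ne: "l t \<noteq> l s" and opp: "sgL Q b (l t) \<noteq> sgL Q b (l s)"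
  shows "b \<bullet> l t = 0"
proof (rule ccontr)
  assume nz: "b \<bullet> l t \<noteq> 0"
  define \<rho> where "\<rho> = sgn (b \<bullet> l t)"
  have \<rho>: "\<rho> = 1 \<or> \<rho> = - 1" using nz by (auto simp: \<rho>_def sgn_if)
  have st: "sgL Q b (l t) = \<rho>" "sgR Q b (l t) = \<rho>" using sgL_nz[OF nz] by (auto simp: \<rho>_def)
  have ss: "sgL Q b (l s) = - \<rho>" using sgn_cases(2)[OF sg_l(2), of s] opp \<rho> st by auto
  have S: "supp t = supp s" by (rule supp_x_eq[OF x])
  have lt: "l t \<in> supp s" "l s \<in> supp t" using l_supp S by auto
  have "0 \<le> \<rho> * (b \<bullet> l s)" using supp_left(3)[OF lt(2)] st by simp
  have ls0: "b \<bullet> l s = 0"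
  proof (rule ccontr)
    assume "b \<bullet> l s \<noteq> 0"
    then have "sgn (b \<bullet> l s) = - \<rho>" using sgL_nz ss by auto
    then show False using \<open>0 \<le> \<rho> * (b \<bullet> l s)\<close> \<open>b \<bullet> l s \<noteq> 0\<close> \<rho> by (auto simp: sgn_if split: if_splits)
  qed
  have "0 \<le> sgR Q b (l s) * (b \<bullet> l t)" by (rule supp_left(3)[OF lt(1)])
  then have ssR: "sgR Q b (l s) = \<rho>"
    using sgn_cases(1)[OF sg_l(1), of s] nz by (auto simp: \<rho>_def sgn_if split: if_splits)
  obtain n :: int where n: "s < t + n * T"
  proof -
    obtain n :: nat where "(s - t) / T < real n" using reals_Archimedean2 by blast
    then have "s < t + of_int (int n) * T" using T_pos by (simp add: field_simps)
    then show ?thesis using that by blast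
  qed
  obtain F where F: "trans_mat s (t + n * T) F"
    "\<And>\<eta>. \<eta> \<in> supp (t + n * T) \<Longrightarrow> 0 \<le> sgL Q b (l s) * (b \<bullet> (transpose F *v \<eta>))"
    by (rule future_support[OF n]) blast
  have St: "supp (t + n * T) = supp t" by (rule supp_x_eq) (simp add: x_T_int)
  \<comment> \<open>\<open>x (t + n * T) = x s\<close>, so \<open>l s\<close> also supports at the
    later time and may be transported back to \<open>s\<close>. The result differs from
    \<open>l s\<close> because \<open>l s\<close> is already the transport of
    \<open>l t\<close>.\<close>
  define \<eta> where "\<eta> = transpose F *v l s"
  have ls: "l s = transpose F *v l t" using trans_matD(3)[OF F(1)] by (simp add: l_T_int)
  have \<eta>: "\<eta> \<in> supp s" unfolding \<eta>_def by (rule trans_mat_supp[OF F(1)]) (simp add: St lt)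
  have "\<eta> \<noteq> l s"
  proof
    assume "\<eta> = l s"
    then have "transpose F *v (l s - l t) = 0" using ls by (simp add: \<eta>_def matrix_vector_mult_diff_distrib)
    then have "l s - l t = 0" by (rule trans_matD(4)[OF F(1)])
    then show False using ne by simp
  qed
  moreover have "b \<bullet> \<eta> = 0"
  proof -
    have "0 \<le> - \<rho> * (b \<bullet> \<eta>)" using F(2)[of "l s"] lt(2) St ss by (simp add: \<eta>_def)
    moreover have "0 \<le> \<rho> * (b \<bullet> \<eta>)" using supp_left(3)[OF \<eta>] ssR by simp
    ultimately show ?thesis using \<rho> by auto
  qed
  ultimately obtain k where k: "b = k *\<^sub>R (Mw (wL s) *v x s)"
    using supp_parallel[OF \<eta> l_supp] ls0 by blast
  have "l t \<bullet> (Mw (wL s) *v x s) = 0" by (rule supp_left(1)[OF lt(1)])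
  then have "l t \<bullet> (k *\<^sub>R (Mw (wL s) *v x s)) = 0" by simp
  then have "l t \<bullet> b = 0" unfolding k[symmetric] .
  then show False using nz by (simp add: inner_commute)
qed

text \<open>In the remaining case \<open>b\<close> vanishes on both functionals, hence is a multiple
  \<open>k\<close> of the velocity, and the strict second-order inequality fixes the sign of the
  next Taylor coefficient for both in the same way.\<close>

lemma local_signs:
  assumes x: "x t = x s"
  shows "sgL Q b (l t) = sgL Q b (l s)"
proof (cases "l t = l s")
  case False
  show ?thesis
  proof (rule ccontr)
    assume opp: "sgL Q b (l t) \<noteq> sgL Q b (l s)"
    have 1: "b \<bullet> l t = 0" by (rule local_signs_aux[OF x False opp])
    have 2: "b \<bullet> l s = 0" by (rule local_signs_aux[OF x[symmetric] False[symmetric] opp[symmetric]])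
    have lt: "l s \<in> supp t" using l_supp[of s] supp_x_eq[OF x] by simp
    obtain k where k: "b = k *\<^sub>R (Mw (wL t) *v x t)" using supp_parallel[OF l_supp lt False 1 2] by blast
    have b0: "b \<noteq> 0" using q_sign(1) by auto
    define y where "y = Mw (wL t) *v x t"
    have ky: "k *\<^sub>R y = b" unfolding y_def by (rule k[symmetric])
    have "k \<noteq> 0"
    proof
      assume "k = 0"
      then have "k *\<^sub>R y = 0" by simp
      then show False using b0 unfolding ky by simp
    qed
    \<comment> \<open>As \<open>y\<close> is \<open>b\<close> divided by \<open>k\<close> and
      \<open>\<eta> \<bullet> b = 0\<close>, the second derivative is
      \<open>b \<bullet> (Q *v \<eta>)\<close> divided by \<open>k\<close>. It is negative, and
      \<open>sgL\<close> takes the first-order coefficient with a minus sign, so \<open>sgL\<close>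
      is \<open>sgn k\<close>.\<close>
    have val: "sgL Q b \<eta> = sgn k" if \<eta>: "\<eta> \<in> supp t" "b \<bullet> \<eta> = 0" for \<eta>
    proof -
      have "\<eta> \<bullet> (Mw (wL t) *v y) < 0" unfolding y_def by (rule supp_left(2)[OF \<eta>(1)])
      moreover have "y = (1 / k) *\<^sub>R b" unfolding ky[symmetric] using \<open>k \<noteq> 0\<close> by simp
      ultimately have "(1 / k) * (\<eta> \<bullet> (Mw (wL t) *v b)) < 0" by (simp add: matrix_vector_mult_scaleR)
      moreover have "\<eta> \<bullet> (Mw (wL t) *v b) = b \<bullet> (Q *v \<eta>)"
      proof -
        have "\<eta> \<bullet> b = 0" using \<eta>(2) by (simp only: inner_commute)
        then have "\<eta> \<bullet> (Mw (wL t) *v b) = \<eta> \<bullet> (A *v b)"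
          by (simp only: switched_matrix_mult inner_add_right inner_scaleR_right mult_zero_right add_0_right)
        then show ?thesis by (simp only: inner_transpose[of \<eta> A b] inner_commute[of b])
      qed
      ultimately have "(1 / k) * (b \<bullet> (Q *v \<eta>)) < 0" by simp
      then show ?thesis using \<eta>(2) \<open>k \<noteq> 0\<close>
        by (auto simp: sgL_def sgn_if divide_less_0_iff split: if_splits)
    qed
    show False using opp val[OF l_supp 1] val[OF lt 2] by simp
  qed
qed simp

lemma nonneg_if_sgn_eq: "sgn a = sgn b' \<Longrightarrow> 0 \<le> b' \<Longrightarrow> 0 \<le> a" for a b' :: real
  by (simp add: sgn_if split: if_splits)

text \<open>A period of \<open>x\<close> is not yet known to be one of \<open>l\<close>. The signs
  of \<open>b \<bullet> l\<close> are therefore compared through \<open>local_signs\<close> just to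
  the right of each point and then passed to the point by continuity.\<close>

lemma bang_shift:
  assumes x: "\<And>t. x (t + S) = x t" and bi: "bang_interval b c x l s r w"
  shows "bang_interval b c x l (s + S) (r + S) w"
  unfolding bang_iff
proof (intro conjI allI impI)
  show "s + S \<le> r + S" "w \<in> {0, 1}" using bi by (auto simp: bang_iff)
  fix \<tau>' assume \<tau>': "s + S < \<tau>' \<and> \<tau>' < r + S"
  define \<tau> where "\<tau> = \<tau>' - S"
  have \<tau>: "s < \<tau>" "\<tau> < r" "\<tau>' = \<tau> + S" using \<tau>' by (auto simp: \<tau>_def)
  obtain e1 where e1: "e1 > 0" "\<And>h. 0 < h \<Longrightarrow> h < e1 \<Longrightarrow> sgn (p (\<tau> + h)) = sgR A c (x \<tau>) \<and> sgn (q (\<tau> + h)) = sgL Q b (l \<tau>)"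
    using right_signs by blast
  obtain e2 where e2: "e2 > 0" "\<And>h. 0 < h \<Longrightarrow> h < e2 \<Longrightarrow> sgn (p (\<tau> + S + h)) = sgR A c (x (\<tau> + S)) \<and> sgn (q (\<tau> + S + h)) = sgL Q b (l (\<tau> + S))"
    using right_signs by blast
  have same: "sgL Q b (l (\<tau> + S)) = sgL Q b (l \<tau>)" by (rule local_signs) (rule x)
  define e where "e = min (min e1 e2) (r - \<tau>)"
  have e: "e > 0" using e1 e2 \<tau> by (simp add: e_def)
  have "0 \<le> q (\<tau> + S + h) * p (\<tau> + S + h) * (2 * w - 1)" if h: "0 < h" "h < e" for h
  proof -
    have a: "0 \<le> q (\<tau> + h) * p (\<tau> + h) * (2 * w - 1)" using bi \<tau> h unfolding bang_iff e_def by auto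
    have b': "sgn (q (\<tau> + S + h)) = sgn (q (\<tau> + h))" "sgn (p (\<tau> + S + h)) = sgn (p (\<tau> + h))"
      using e1(2)[of h] e2(2)[of h] h same x[of \<tau>] by (auto simp: e_def)
    have "sgn (q (\<tau> + S + h) * p (\<tau> + S + h) * (2 * w - 1)) = sgn (q (\<tau> + h) * p (\<tau> + h) * (2 * w - 1))"
      by (simp add: sgn_mult b')
    from nonneg_if_sgn_eq[OF this a] show ?thesis .
  qed
  then have ev: "\<forall>\<^sub>F h in at_right 0. 0 \<le> q (\<tau> + S + h) * p (\<tau> + S + h) * (2 * w - 1)"
    using e by (intro eventually_at_rightI[of 0 e]) auto
  have "continuous_on UNIV (\<lambda>h. q (\<tau> + S + h) * p (\<tau> + S + h) * (2 * w - 1))"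
    by (intro continuous_intros continuous_on_compose2[OF p_cont[of UNIV]] continuous_on_compose2[OF q_cont[of UNIV]]) auto
  then have "((\<lambda>h. q (\<tau> + S + h) * p (\<tau> + S + h) * (2 * w - 1)) \<longlongrightarrow> q (\<tau> + S + 0) * p (\<tau> + S + 0) * (2 * w - 1)) (at_right 0)"
    unfolding continuous_on_def filterlim_at_split by blast
  from tendsto_lowerbound[OF this ev] show "0 \<le> q \<tau>' * p \<tau>' * (2 * w - 1)" by (simp add: \<tau>(3))
qed

text \<open>Equal points are followed by the same control, hence by the same curve at all later
  times and, by periodicity, at all times. The shift is then a period of \<open>x\<close>; the
  shifted \<open>l\<close> obeys the same arcs, so it is a multiple of \<open>l\<close>, with factor
  1 because \<open>l t \<bullet> x t = 1\<close>.\<close>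

lemma x_injective:
  assumes x: "x t = x s"
  shows "\<exists>n::int. s - t = n * T"
proof -
  have step: "\<exists>e>0. \<forall>h. 0 \<le> h \<and> h \<le> e \<longrightarrow> x (t' + h) = x (s' + h)" if "x t' = x s'" for t' s'
  proof -
    have w: "wR t' = wR s'" using local_signs[OF that] that by (simp add: wR_def)
    obtain e1 where e1: "e1 > 0" "bang_interval b c x l t' (t' + e1) (wR t')" using right_bang by blast
    obtain e2 where e2: "e2 > 0" "bang_interval b c x l s' (s' + e2) (wR s')" using right_bang by blast
    have "x (t' + h) = x (s' + h)" if h: "0 \<le> h" "h \<le> min e1 e2" for h
    proof -
      have "bang_interval b c x l t' (t' + h) (wR t')" by (rule bang_sub[OF e1(2)]) (use h in auto)
      moreover have "bang_interval b c x l s' (s' + h) (wR s')" by (rule bang_sub[OF e2(2)]) (use h in auto)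
      ultimately show ?thesis using arc_x[of t' "t' + h"] arc_x[of s' "s' + h"] \<open>x t' = x s'\<close> w by simp
    qed
    then show ?thesis using e1(1) e2(1) by (intro exI[of _ "min e1 e2"]) auto
  qed
  have fwd: "x (t + h) = x (s + h)" if "0 \<le> h" for h
  proof (rule ccontr)
    assume ne: "x (t + h) \<noteq> x (s + h)"
    define H where "H = {h. 0 \<le> h \<and> x (t + h) \<noteq> x (s + h)}"
    have "h \<in> H" using ne that by (simp add: H_def)
    have bdd: "bdd_below H" by (auto simp: H_def bdd_below_def)
    define m where "m = Inf H"
    have m0: "0 \<le> m" unfolding m_def by (rule cInf_greatest) (use \<open>h \<in> H\<close> in \<open>auto simp: H_def\<close>)
    have below: "x (t + h') = x (s + h')" if "0 \<le> h'" "h' < m" for h'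
    proof (rule ccontr)
      assume "x (t + h') \<noteq> x (s + h')"
      then have "h' \<in> H" using that by (simp add: H_def)
      from cInf_lower[OF this bdd] show False using that by (simp add: m_def)
    qed
    have "x (t + m) = x (s + m)"
    proof (cases "m = 0")
      case True
      then show ?thesis using x by simp
    next
      case False
      have c: "continuous_on UNIV (\<lambda>h. x (t + h) - x (s + h))"
        by (intro continuous_intros continuous_on_compose2[OF x_cont]) auto
      then have "((\<lambda>h. x (t + h) - x (s + h)) \<longlongrightarrow> x (t + m) - x (s + m)) (at_left m)"
        unfolding continuous_on_def filterlim_at_split by blast
      moreover have "\<forall>\<^sub>F h in at_left m. x (t + h) - x (s + h) = 0"
        by (rule eventually_at_leftI[of 0]) (use below m0 False in auto)
      ultimately have "x (t + m) - x (s + m) = 0"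
        by (intro tendsto_unique[OF trivial_limit_at_left_real _ tendsto_eventually])
      then show ?thesis by simp
    qed
    from step[OF this] obtain e where e: "e > 0" "\<And>h. 0 \<le> h \<Longrightarrow> h \<le> e \<Longrightarrow> x (t + m + h) = x (s + m + h)" by blast
    have "m + e \<le> h'" if "h' \<in> H" for h'
    proof (rule ccontr)
      assume "\<not> m + e \<le> h'"
      moreover have "m \<le> h'" unfolding m_def by (rule cInf_lower[OF that bdd])
      ultimately show False using e(2)[of "h' - m"] that by (simp add: H_def)
    qed
    then have "m + e \<le> m" unfolding m_def using \<open>h \<in> H\<close> by (intro cInf_greatest) auto
    then show False using e(1) by simp
  qed
  define S where "S = s - t"
  have xS: "x (r + S) = x r" for r
  proof -
    obtain n :: nat where "(t - r) / T < real n" using reals_Archimedean2 by blast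
    then have "0 \<le> r + of_int (int n) * T - t" using T_pos by (simp add: field_simps)
    from fwd[OF this] have "x (r + S + of_int (int n) * T) = x (r + of_int (int n) * T)" by (simp add: S_def algebra_simps)
    then show ?thesis by (simp only: x_T_int)
  qed
  have "\<exists>k. \<forall>t. l (t + S) = k *\<^sub>R l t"
  proof (rule uniq_l)
    show "l (t + T + S) = l (t + S)" for t using l_T[of "t + S"] by (simp add: algebra_simps)
    show "l (s + S) = mexp (transpose (Mw w)) (r - s) *v l (r + S)" if "bang_interval b c x l s r w" for s r w
      using arc_l[OF bang_shift[OF xS that]] by simp
  qed
  then obtain k where k: "\<And>t. l (t + S) = k *\<^sub>R l t" by blast
  have "k = 1" using l_x[of "0 + S"] l_x[of 0] xS[of 0] unfolding k by simp
  then have "\<exists>n::int. S = n * T" using k xS by (intro min_T) simp_all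
  then show ?thesis by (simp add: S_def)
qed

end

section \<open>Planar arcs and zero crossings\<close>

text \<open>The endpoints interlace on the boundary of the half-plane, so a box with its lower side
  on that line reduces the claim to \<open>fashoda_interlace\<close>.\<close>

lemma half_plane_arcs_meet:
  fixes f g :: "real \<Rightarrow> real^2"
  assumes "path f" "path g"
    and nonneg: "\<And>z. z \<in> path_image f \<union> path_image g \<Longrightarrow> 0 \<le> z $ 2"
    and "pathstart f $ 2 = 0" "pathfinish f $ 2 = 0" "pathstart g $ 2 = 0" "pathfinish g $ 2 = 0"
    and "pathstart f $ 1 < pathstart g $ 1" "pathstart g $ 1 < pathfinish f $ 1" "pathfinish f $ 1 < pathfinish g $ 1"
  obtains z where "z \<in> path_image f" "z \<in> path_image g"
proof -
  have "bounded (path_image f \<union> path_image g)"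
    using assms(1,2) by (simp add: bounded_path_image)
  then obtain B where B: "\<And>z. z \<in> path_image f \<union> path_image g \<Longrightarrow> norm z \<le> B"
    unfolding bounded_iff by blast
  define m M :: "real^2" where "m = - B *\<^sub>R axis 1 1" and "M = B *\<^sub>R axis 1 1 + B *\<^sub>R axis 2 1"
  have box: "z \<in> cbox m M" if "z \<in> path_image f \<union> path_image g" for z
    using B[OF that] nonneg[OF that] component_le_norm_cart[of z 1] component_le_norm_cart[of z 2]
    by (auto simp: mem_box_cart m_def M_def axis_def forall_2)
  show ?thesis
  proof (rule fashoda_interlace[of f g m M])
    show "path_image f \<subseteq> cbox m M" "path_image g \<subseteq> cbox m M" using box by auto
  qed (use assms that in \<open>auto simp: m_def axis_def\<close>)
qed

lemma nonzero_if_sgn_eq: "sgn a = s \<Longrightarrow> s \<noteq> 0 \<Longrightarrow> a \<noteq> 0" for a s :: real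
  by auto

text \<open>Here \<open>p\<close>, \<open>\<alpha>\<close>, \<open>\<beta>\<close> stand for
  \<open>c \<bullet> x\<close>, \<open>c \<bullet> (A *v x)\<close>,
  \<open>c \<bullet> (A *v (A *v x))\<close>. Injectivity is demanded of rays, which suits a curve
  on the sphere of an unknown norm. In \<open>touch\<close>, \<open>\<alpha>\<close> changes sign
  because \<open>\<beta>\<close> is its derivative there.\<close>

locale ray_curve =
  fixes p \<alpha> \<beta> :: "real \<Rightarrow> real" and T :: real
  assumes T_pos: "0 < T"
    and p_cont: "continuous_on UNIV p" and \<alpha>_cont: "continuous_on UNIV \<alpha>" and \<beta>_cont: "continuous_on UNIV \<beta>"
    and p_T: "p (t + T) = p t" and \<alpha>_T: "\<alpha> (t + T) = \<alpha> t" and \<beta>_T: "\<beta> (t + T) = \<beta> t"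
    and inj: "0 < k \<Longrightarrow> p t = k * p s \<Longrightarrow> \<alpha> t = k * \<alpha> s \<Longrightarrow> \<beta> t = k * \<beta> s \<Longrightarrow> \<exists>n::int. s - t = n * T"
    and nz: "p t = 0 \<Longrightarrow> \<alpha> t = 0 \<Longrightarrow> \<beta> t \<noteq> 0"
    and cross: "p t = 0 \<Longrightarrow> \<alpha> t \<noteq> 0 \<Longrightarrow> \<exists>e>0. \<forall>h. 0 < h \<and> h < e \<longrightarrow>
      sgn (p (t + h)) = sgn (\<alpha> t) \<and> sgn (p (t - h)) = - sgn (\<alpha> t)"
    and touch: "p t = 0 \<Longrightarrow> \<alpha> t = 0 \<Longrightarrow> \<exists>e>0. \<forall>h. 0 < h \<and> h < e \<longrightarrow>
      sgn (p (t + h)) = sgn (\<beta> t) \<and> sgn (p (t - h)) = sgn (\<beta> t) \<and>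
      sgn (\<alpha> (t + h)) = sgn (\<beta> t) \<and> sgn (\<alpha> (t - h)) = - sgn (\<beta> t)"
    and pos: "\<exists>t. 0 < p t" and neg: "\<exists>t. p t < 0"
begin

text \<open>Makes statements about arcs with \<open>p \<ge> 0\<close> available for arcs with
  \<open>p \<le> 0\<close>.\<close>

lemma uminus_ray_curve: "ray_curve (\<lambda>t. - p t) (\<lambda>t. - \<alpha> t) (\<lambda>t. - \<beta> t) T"
proof
  show "0 < T" by (rule T_pos)
  show "continuous_on UNIV (\<lambda>t. - p t)" "continuous_on UNIV (\<lambda>t. - \<alpha> t)" "continuous_on UNIV (\<lambda>t. - \<beta> t)"
    by (intro continuous_on_minus p_cont \<alpha>_cont \<beta>_cont)+
  show "- p (t + T) = - p t" "- \<alpha> (t + T) = - \<alpha> t" "- \<beta> (t + T) = - \<beta> t" for t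
    by (simp_all only: p_T \<alpha>_T \<beta>_T)
  show "\<exists>n::int. s - t = n * T" if "0 < k" "- p t = k * - p s" "- \<alpha> t = k * - \<alpha> s" "- \<beta> t = k * - \<beta> s" for k t s
    by (rule inj[OF that(1)]) (use that in auto)
  show "- \<beta> t \<noteq> 0" if "- p t = 0" "- \<alpha> t = 0" for t using nz[of t] that by simp
  show "\<exists>e>0. \<forall>h. 0 < h \<and> h < e \<longrightarrow> sgn (- p (t + h)) = sgn (- \<alpha> t) \<and> sgn (- p (t - h)) = - sgn (- \<alpha> t)"
    if "- p t = 0" "- \<alpha> t \<noteq> 0" for t using cross[of t] that by (simp only: sgn_minus neg_equal_iff_equal neg_equal_0_iff_equal) blast
  show "\<exists>e>0. \<forall>h. 0 < h \<and> h < e \<longrightarrow> sgn (- p (t + h)) = sgn (- \<beta> t) \<and> sgn (- p (t - h)) = sgn (- \<beta> t) \<and>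
      sgn (- \<alpha> (t + h)) = sgn (- \<beta> t) \<and> sgn (- \<alpha> (t - h)) = - sgn (- \<beta> t)"
    if "- p t = 0" "- \<alpha> t = 0" for t using touch[of t] that by (simp only: sgn_minus neg_equal_iff_equal neg_equal_0_iff_equal)
  show "\<exists>t. 0 < - p t" using neg by simp
  show "\<exists>t. - p t < 0" using pos by simp
qed

lemma p_T_int: "p (t + of_int n * T) = p t" and \<alpha>_T_int: "\<alpha> (t + of_int n * T) = \<alpha> t"
  and \<beta>_T_int: "\<beta> (t + of_int n * T) = \<beta> t"
  by (rule periodic_int[of p T, OF p_T], rule periodic_int[of \<alpha> T, OF \<alpha>_T], rule periodic_int[of \<beta> T, OF \<beta>_T])

lemma shift_beyond: "\<exists>n::int. s < t + n * T" and shift_before: "\<exists>n::int. t + n * T < s"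
proof -
  obtain n :: nat where "(s - t) / T < real n" using reals_Archimedean2 by blast
  then have "s < t + of_int (int n) * T" using T_pos by (simp add: field_simps)
  then show "\<exists>n::int. s < t + n * T" by blast
  obtain n :: nat where "(t - s) / T < real n" using reals_Archimedean2 by blast
  then have "t + of_int (- int n) * T < s" using T_pos by (simp add: field_simps)
  then show "\<exists>n::int. t + n * T < s" by blast
qed

lemma p_pos_nhds: "0 < p t \<Longrightarrow> \<exists>e>0. \<forall>s. \<bar>s - t\<bar> < e \<longrightarrow> 0 < p s"
proof -
  assume "0 < p t"
  moreover have "(p \<longlongrightarrow> p t) (at t)" using p_cont by (simp add: continuous_on_def)
  ultimately have "\<forall>\<^sub>F s in at t. 0 < p s" by (simp add: order_tendstoD(1))
  then obtain e where "e > 0" "\<And>s. s \<noteq> t \<Longrightarrow> dist s t < e \<Longrightarrow> 0 < p s"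
    unfolding eventually_at by blast
  moreover have "0 < p s" if "\<bar>s - t\<bar> < e" for s
    using \<open>0 < p t\<close> calculation(2)[of s] that by (cases "s = t") (auto simp: dist_real_def)
  ultimately show ?thesis by blast
qed

definition down where "down t \<longleftrightarrow> p t = 0 \<and> \<alpha> t < 0"
definition up where "up t \<longleftrightarrow> p t = 0 \<and> 0 < \<alpha> t"

lemma up_signs: "up t \<Longrightarrow> \<exists>e>0. \<forall>h. 0 < h \<and> h < e \<longrightarrow> 0 < p (t + h) \<and> p (t - h) < 0"
proof -
  assume "up t"
  then obtain e where "e > 0" "\<And>h. 0 < h \<Longrightarrow> h < e \<Longrightarrow> sgn (p (t + h)) = 1 \<and> sgn (p (t - h)) = - 1"
    using cross[of t] by (auto simp: up_def)
  then show ?thesis by (intro exI[of _ e]) (auto simp: sgn_1_pos sgn_1_neg)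
qed

lemma zero_right_pos:
  assumes z: "p t = 0" "\<not> down t" "\<not> (\<alpha> t = 0 \<and> \<beta> t < 0)"
  shows "\<exists>e>0. \<forall>h. 0 < h \<and> h < e \<longrightarrow> 0 < p (t + h)"
proof (cases "\<alpha> t = 0")
  case True
  then obtain e where e: "e > 0" "\<And>h. 0 < h \<Longrightarrow> h < e \<Longrightarrow> sgn (p (t + h)) = sgn (\<beta> t)"
    using touch[OF z(1)] by blast
  have "0 < \<beta> t" using nz[OF z(1)] z True by linarith
  then have "0 < p (t + h)" if "0 < h" "h < e" for h using e(2)[OF that] by (simp add: sgn_1_pos)
  then show ?thesis using e(1) by blast
next
  case False
  then have "up t" using z by (simp add: up_def down_def)
  then show ?thesis using up_signs by blast
qed

lemma zero_left_neg:
  assumes z: "p t = 0" "\<alpha> t = 0" "\<beta> t < 0"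
  shows "\<exists>e>0. \<forall>h. 0 < h \<and> h < e \<longrightarrow> p (t - h) < 0"
proof -
  obtain e where e: "e > 0" "\<And>h. 0 < h \<Longrightarrow> h < e \<Longrightarrow> sgn (p (t - h)) = sgn (\<beta> t)"
    using touch[OF z(1,2)] by blast
  have "p (t - h) < 0" if "0 < h" "h < e" for h using e(2)[OF that] z(3) by (simp add: sgn_1_neg)
  then show ?thesis using e(1) by blast
qed

text \<open>The infimum of the later times with \<open>p < 0\<close>. Zeros where \<open>p\<close>
  touches 0 from above are passed over, as they cannot be excluded yet; this is why the inequality
  on the way is weak.\<close>

lemma next_down:
  assumes s: "0 < p s"
  obtains b where "s < b" "down b" "\<And>t. s \<le> t \<Longrightarrow> t \<le> b \<Longrightarrow> 0 \<le> p t"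
proof -
  obtain r0 where "p r0 < 0" using neg by blast
  moreover obtain n :: int where n: "s < r0 + n * T" using shift_beyond by blast
  ultimately have r: "p (r0 + n * T) < 0" by (simp add: p_T_int)
  define B where "B = {t. s \<le> t \<and> p t < 0}"
  have B: "r0 + n * T \<in> B" "bdd_below B" using r n by (auto simp: B_def bdd_below_def)
  define b where "b = Inf B"
  have sb: "s \<le> b" unfolding b_def by (rule cInf_greatest) (use B in \<open>auto simp: B_def\<close>)
  have ge: "0 \<le> p t" if "s \<le> t" "t < b" for t
  proof (rule ccontr)
    assume "\<not> 0 \<le> p t"
    then have "t \<in> B" using that by (simp add: B_def)
    then show False using cInf_lower[OF _ B(2)] that by (fastforce simp: b_def)
  qed
  have near: "\<exists>t\<in>B. b \<le> t \<and> t < b + e" if "e > 0" for e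
  proof -
    have "\<exists>t\<in>B. t < b + e" using cInf_lessD[of B "b + e"] B that unfolding b_def by auto
    then show ?thesis using cInf_lower[OF _ B(2)] unfolding b_def by blast
  qed
  have nonneg: "0 \<le> p b"
  proof (cases "s = b")
    case False
    have "(p \<longlongrightarrow> p b) (at_left b)" using p_cont by (simp add: continuous_on_def filterlim_at_split)
    moreover have "\<forall>\<^sub>F t in at_left b. 0 \<le> p t"
      by (rule eventually_at_leftI[of s]) (use ge sb False in auto)
    ultimately show ?thesis by (intro tendsto_lowerbound[of p "p b" "at_left b"]) auto
  qed (use s in simp)
  have "p b = 0"
  proof (rule ccontr)
    assume "p b \<noteq> 0"
    then obtain e where e: "e > 0" "\<And>t. \<bar>t - b\<bar> < e \<Longrightarrow> 0 < p t" using p_pos_nhds[of b] nonneg by force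
    obtain t where "t \<in> B" "b \<le> t" "t < b + e" using near[OF e(1)] by blast
    then show False using e(2)[of t] by (simp add: B_def)
  qed
  then have sb': "s < b" using s sb by (cases "s = b") auto
  have no_right: False if "\<exists>e>0. \<forall>h. 0 < h \<and> h < e \<longrightarrow> 0 < p (b + h)"
  proof -
    obtain e where e: "e > 0" "\<And>h. 0 < h \<Longrightarrow> h < e \<Longrightarrow> 0 < p (b + h)" using \<open>\<exists>e>0. _\<close> by blast
    obtain t where t: "t \<in> B" "b \<le> t" "t < b + e" using near[OF e(1)] by blast
    then have "t \<noteq> b" using \<open>p b = 0\<close> by (auto simp: B_def)
    then show False using e(2)[of "t - b"] t by (simp add: B_def)
  qed
  have "\<not> (\<alpha> b = 0 \<and> \<beta> b < 0)"
  proof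
    assume "\<alpha> b = 0 \<and> \<beta> b < 0"
    then obtain e where e: "e > 0" "\<And>h. 0 < h \<Longrightarrow> h < e \<Longrightarrow> p (b - h) < 0" using zero_left_neg[OF \<open>p b = 0\<close>] by blast
    define h where "h = min e (b - s) / 2"
    have "0 < h" "h < e" "s \<le> b - h" using e(1) sb' by (auto simp: h_def min_def field_simps)
    then show False using e(2)[of h] ge[of "b - h"] by simp
  qed
  then have "down b" using zero_right_pos[OF \<open>p b = 0\<close>] no_right by blast
  moreover have "0 \<le> p t" if "s \<le> t" "t \<le> b" for t
    using ge[of t] that \<open>p b = 0\<close> by (cases "t = b") auto
  ultimately show ?thesis using that sb' by blast
qed

lemma next_down_from_up:
  assumes "up a"
  obtains b where "a < b" "down b" "\<And>t. a \<le> t \<Longrightarrow> t \<le> b \<Longrightarrow> 0 \<le> p t"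
proof -
  obtain e where e: "e > 0" "\<And>h. 0 < h \<Longrightarrow> h < e \<Longrightarrow> 0 < p (a + h)" using up_signs[OF assms] by blast
  have "0 < p (a + e / 2)" using e by simp
  then obtain b where b: "a + e / 2 < b" "down b" "\<And>t. a + e / 2 \<le> t \<Longrightarrow> t \<le> b \<Longrightarrow> 0 \<le> p t"
    using next_down by blast
  have "0 \<le> p t" if "a \<le> t" "t \<le> b" for t
  proof -
    consider "t = a" | "a < t" "t < a + e" | "a + e / 2 \<le> t" using \<open>a \<le> t\<close> e(1) by fastforce
    then show ?thesis
    proof cases
      case 1
      then show ?thesis using assms by (simp add: up_def)
    next
      case 2
      then show ?thesis using e(2)[of "t - a"] by simp
    next
      case 3
      then show ?thesis using b(3) \<open>t \<le> b\<close> by blast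
    qed
  qed
  then show ?thesis using that[of b] b e(1) by simp
qed

text \<open>One excursion above the plane and one below, up to the next upward crossing
  \<open>a'\<close>; touching zeros are still permitted.\<close>

definition loop where "loop a b a' \<longleftrightarrow> a < b \<and> b < a' \<and> up a \<and> down b \<and> up a' \<and>
  (\<forall>t. a \<le> t \<and> t \<le> b \<longrightarrow> 0 \<le> p t) \<and> (\<forall>t. b \<le> t \<and> t \<le> a' \<longrightarrow> p t \<le> 0)"

lemma loop_exists: "up a \<Longrightarrow> \<exists>b a'. loop a b a'"
proof -
  assume a: "up a"
  interpret neg: ray_curve "\<lambda>t. - p t" "\<lambda>t. - \<alpha> t" "\<lambda>t. - \<beta> t" T by (rule uminus_ray_curve)
  obtain b where b: "a < b" "down b" "\<And>t. a \<le> t \<Longrightarrow> t \<le> b \<Longrightarrow> 0 \<le> p t" using next_down_from_up[OF a] by blast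
  have "neg.up b" using b(2) by (simp add: neg.up_def down_def)
  then obtain a' where a': "b < a'" "neg.down a'" "\<And>t. b \<le> t \<Longrightarrow> t \<le> a' \<Longrightarrow> 0 \<le> - p t"
    using neg.next_down_from_up[of b] by blast
  have "up a'" using a'(2) by (simp add: neg.down_def up_def)
  then have "loop a b a'" using a b a' by (auto simp: loop_def)
  then show ?thesis by blast
qed

lemma loop_next:
  assumes L: "loop a b a'" and e: "up e" "a < e"
  shows "a' \<le> e"
proof (rule ccontr)
  assume "\<not> a' \<le> e"
  obtain r where r: "r > 0" "\<And>h. 0 < h \<Longrightarrow> h < r \<Longrightarrow> 0 < p (e + h) \<and> p (e - h) < 0" using up_signs[OF e(1)] by blast
  show False
  proof (cases "e \<le> b")
    case True
    define h where "h = min r (e - a) / 2"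
    have "0 < h" "h < r" "a \<le> e - h" using r(1) e(2) by (auto simp: h_def min_def field_simps)
    then show False using r(2)[of h] L True by (force simp: loop_def)
  next
    case False
    define h where "h = min r (a' - e) / 2"
    have "0 < h" "h < r" "e + h \<le> a'" using r(1) \<open>\<not> a' \<le> e\<close> by (auto simp: h_def min_def field_simps)
    then have "p (e + h) \<le> 0" using L False by (simp add: loop_def)
    then show False using r(2)[of h] \<open>0 < h\<close> \<open>h < r\<close> by simp
  qed
qed

lemma up_T_int: "up (t + of_int n * T) \<longleftrightarrow> up t"
  by (simp add: up_def p_T_int \<alpha>_T_int)

lemma up_exists: "\<exists>t. up t"
proof -
  interpret neg: ray_curve "\<lambda>t. - p t" "\<lambda>t. - \<alpha> t" "\<lambda>t. - \<beta> t" T by (rule uminus_ray_curve)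
  obtain s where "p s < 0" using neg by blast
  then have "0 < - p s" by simp
  then obtain b where "neg.down b" by (rule neg.next_down)
  then show ?thesis by (auto simp: neg.down_def up_def)
qed

lemma zero_isolated:
  assumes z: "p t = 0"
  obtains e where "e > 0" "\<And>h. 0 < h \<Longrightarrow> h < e \<Longrightarrow> p (t + h) \<noteq> 0" "\<And>h. 0 < h \<Longrightarrow> h < e \<Longrightarrow> p (t - h) \<noteq> 0"
proof (cases "\<alpha> t = 0")
  case True
  obtain e where e: "e > 0" "\<And>h. 0 < h \<Longrightarrow> h < e \<Longrightarrow> sgn (p (t + h)) = sgn (\<beta> t)"
    "\<And>h. 0 < h \<Longrightarrow> h < e \<Longrightarrow> sgn (p (t - h)) = sgn (\<beta> t)"
    using touch[OF z True] by blast
  have nz: "sgn (\<beta> t) \<noteq> 0" using nz[OF z True] by (simp only: sgn_zero_iff not_False_eq_True)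
  show ?thesis
    by (rule that[OF e(1)]) (erule (1) nonzero_if_sgn_eq[OF e(2) nz], erule (1) nonzero_if_sgn_eq[OF e(3) nz])
next
  case False
  obtain e where e: "e > 0" "\<And>h. 0 < h \<Longrightarrow> h < e \<Longrightarrow> sgn (p (t + h)) = sgn (\<alpha> t)"
    "\<And>h. 0 < h \<Longrightarrow> h < e \<Longrightarrow> sgn (p (t - h)) = - sgn (\<alpha> t)"
    using cross[OF z False] by blast
  have nz: "sgn (\<alpha> t) \<noteq> 0" "- sgn (\<alpha> t) \<noteq> 0" using False
    by (simp_all only: sgn_zero_iff neg_equal_0_iff_equal not_False_eq_True)
  show ?thesis
    by (rule that[OF e(1)]) (erule (1) nonzero_if_sgn_eq[OF e(2) nz(1)], erule (1) nonzero_if_sgn_eq[OF e(3) nz(2)])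
qed

lemma zeros_finite: "finite {t \<in> {r..s}. p t = 0}"
proof -
  have "\<not> t islimpt {t. p t = 0}" for t
  proof -
    have "\<exists>e>0. \<forall>s. s \<noteq> t \<and> \<bar>s - t\<bar> < e \<longrightarrow> p s \<noteq> 0"
    proof (cases "p t = 0")
      case False
      have "(p \<longlongrightarrow> p t) (at t)" using p_cont by (simp add: continuous_on_def)
      then have "\<forall>\<^sub>F s in at t. p s \<noteq> 0" using False by (rule tendsto_imp_eventually_ne)
      then show ?thesis unfolding eventually_at dist_real_def by blast
    next
      case True
      obtain e where e: "e > 0" "\<And>h. 0 < h \<Longrightarrow> h < e \<Longrightarrow> p (t + h) \<noteq> 0" "\<And>h. 0 < h \<Longrightarrow> h < e \<Longrightarrow> p (t - h) \<noteq> 0"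
        using zero_isolated[OF True] by blast
      have "p s \<noteq> 0" if s: "s \<noteq> t" "\<bar>s - t\<bar> < e" for s
      proof (cases "t < s")
        case True
        then show ?thesis using e(2)[of "s - t"] s by simp
      next
        case False
        then show ?thesis using e(3)[of "t - s"] s by simp
      qed
      then show ?thesis using e(1) by blast
    qed
    then obtain e where "e > 0" "\<And>s. s \<noteq> t \<Longrightarrow> \<bar>s - t\<bar> < e \<Longrightarrow> p s \<noteq> 0" by blast
    then show ?thesis unfolding islimpt_approachable_real by blast
  qed
  moreover have "{t \<in> {r..s}. p t = 0} = {r..s} \<inter> {t. p t = 0}" by auto
  ultimately show ?thesis by (simp add: finite_not_islimpt_in_compact)
qed

text \<open>The last upward crossing before \<open>a\<close> starts it: the preceding period
  contains only finitely many zeros, and \<open>a - T\<close> is one of the crossings.\<close>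

lemma loop_before:
  assumes a: "up a"
  shows "\<exists>c b. loop c b a"
proof -
  define U where "U = {t \<in> {a - T..a}. up t \<and> t < a}"
  have fin: "finite U" by (rule finite_subset[OF _ zeros_finite[of "a - T" a]]) (auto simp: U_def up_def)
  have "a - T \<in> U" using up_T_int[of a "- 1"] a T_pos by (simp add: U_def)
  then have "U \<noteq> {}" by auto
  define c where "c = Max U"
  have c: "c \<in> U" unfolding c_def by (rule Max_in) fact+
  then obtain b a' where L: "loop c b a'" using loop_exists[of c] by (auto simp: U_def)
  have "a' \<le> a" by (rule loop_next[OF L a]) (use c in \<open>simp add: U_def\<close>)
  moreover have "\<not> a' < a"
  proof
    assume "a' < a"
    then have "a' \<in> U" using L c by (auto simp: U_def loop_def)
    then have "a' \<le> c" unfolding c_def by (rule Max_ge[OF fin])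
    then show False using L by (simp add: loop_def)
  qed
  ultimately show ?thesis using L by auto
qed

section \<open>Stereographic projection and disjoint arcs in the half-plane\<close>

definition N where "N t = sqrt ((p t)\<^sup>2 + (\<alpha> t)\<^sup>2 + (\<beta> t)\<^sup>2)"
definition D where "D t = N t + \<beta> t"
definition X where "X t = \<alpha> t / D t"
definition Y where "Y t = p t / D t"

text \<open>Stereographic projection of the ray through \<open>(p t, \<alpha> t, \<beta> t)\<close> from \<open>(0, 0, - 1)\<close>; it is only
  meaningful where \<open>D t > 0\<close>.\<close>

definition C :: "real \<Rightarrow> real^2" where "C t = X t *\<^sub>R axis 1 1 + Y t *\<^sub>R axis 2 1"

lemma C_nth [simp]: "C t $ 1 = X t" "C t $ 2 = Y t"
  by (simp_all add: C_def axis_def)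

lemma N_sq: "(N t)\<^sup>2 = (p t)\<^sup>2 + (\<alpha> t)\<^sup>2 + (\<beta> t)\<^sup>2" and N_ge: "\<bar>\<beta> t\<bar> \<le> N t" and N_nonneg: "0 \<le> N t"
proof -
  show "(N t)\<^sup>2 = (p t)\<^sup>2 + (\<alpha> t)\<^sup>2 + (\<beta> t)\<^sup>2" "0 \<le> N t" by (simp_all add: N_def)
  have "sqrt ((\<beta> t)\<^sup>2) \<le> N t" unfolding N_def by (intro real_sqrt_le_mono) simp
  then show "\<bar>\<beta> t\<bar> \<le> N t" by simp
qed

lemma D_prod: "D t * (N t - \<beta> t) = (p t)\<^sup>2 + (\<alpha> t)\<^sup>2"
  using N_sq[of t] by (simp add: D_def algebra_simps power2_eq_square)

lemma D_pos: "(p t = 0 \<Longrightarrow> \<alpha> t = 0 \<Longrightarrow> 0 < \<beta> t) \<Longrightarrow> 0 < D t"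
proof -
  assume a: "p t = 0 \<Longrightarrow> \<alpha> t = 0 \<Longrightarrow> 0 < \<beta> t"
  have "0 \<le> D t" using N_ge[of t] by (simp add: D_def)
  moreover have "D t \<noteq> 0"
  proof
    assume "D t = 0"
    then have "(p t)\<^sup>2 + (\<alpha> t)\<^sup>2 = 0" using D_prod[of t] by simp
    then have "p t = 0" "\<alpha> t = 0" by (simp_all add: sum_power2_eq_zero_iff)
    then show False using a \<open>D t = 0\<close> N_nonneg[of t] by (simp add: D_def)
  qed
  ultimately show ?thesis by simp
qed

text \<open>Inverse projection: \<open>p\<close>, \<open>\<alpha>\<close>, \<open>\<beta>\<close>
  are \<open>D\<close> times \<open>Y\<close>, \<open>X\<close> and
  \<open>(1 - X\<^sup>2 - Y\<^sup>2) / 2\<close>, so equal images come from proportional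
  triples.\<close>

lemma C_eq:
  assumes "0 < D t" "0 < D s" "C t = C s"
  shows "\<exists>n::int. s - t = n * T"
proof -
  have rep: "p r = D r * Y r" "\<alpha> r = D r * X r" "\<beta> r = D r * ((1 - (X r)\<^sup>2 - (Y r)\<^sup>2) / 2)" if "0 < D r" for r
  proof -
    show 1: "p r = D r * Y r" "\<alpha> r = D r * X r" using that by (simp_all add: X_def Y_def)
    have "D r * (N r - \<beta> r) = (D r)\<^sup>2 * ((X r)\<^sup>2 + (Y r)\<^sup>2)"
      unfolding D_prod 1 by (simp add: power_mult_distrib algebra_simps)
    then have "N r - \<beta> r = D r * ((X r)\<^sup>2 + (Y r)\<^sup>2)" using that by (simp add: power2_eq_square)
    then show "\<beta> r = D r * ((1 - (X r)\<^sup>2 - (Y r)\<^sup>2) / 2)" unfolding D_def by (simp add: algebra_simps)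
  qed
  have eq: "X t = X s" "Y t = Y s" using assms(3) by (metis C_nth(1), metis C_nth(2))
  define k where "k = D t / D s"
  have "0 < k" and k: "D t = k * D s" using assms by (simp_all add: k_def)
  show ?thesis
    using rep[OF assms(1)] rep[OF assms(2)] unfolding eq k
    by (intro inj[OF \<open>0 < k\<close>]) (simp_all only: mult.assoc)
qed

lemma C_cont: "(\<And>t. t \<in> S \<Longrightarrow> 0 < D t) \<Longrightarrow> continuous_on S C"
  unfolding C_def X_def Y_def D_def N_def
  by (intro continuous_intros continuous_on_subset[OF p_cont] continuous_on_subset[OF \<alpha>_cont] continuous_on_subset[OF \<beta>_cont])
    (force simp: D_def N_def)+

lemma C_path:
  assumes "\<And>t. a \<le> t \<Longrightarrow> t \<le> b \<Longrightarrow> 0 < D t" "a \<le> b"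
  shows "path (subpath b a C)" "path_image (subpath b a C) = C ` {a..b}"
proof -
  show im: "path_image (subpath b a C) = C ` {a..b}" using assms(2) by (auto simp: path_image_subpath)
  have "continuous_on {0..1} (C \<circ> (\<lambda>x. (a - b) * x + b))"
  proof (rule continuous_on_compose)
    have "a \<le> (a - b) * x + b \<and> (a - b) * x + b \<le> b" if "0 \<le> x" "x \<le> 1" for x
      using mult_left_mono[of x 1 "b - a"] mult_nonneg_nonneg[of "b - a" x] that assms(2) by (simp add: algebra_simps)
    then show "continuous_on ((\<lambda>x. (a - b) * x + b) ` {0..1}) C"
      by (intro C_cont) (use assms(1) in auto)
  qed (intro continuous_intros)
  then show "path (subpath b a C)" by (simp add: path_def subpath_def o_def)
qed

text \<open>The centre of projection is the direction with \<open>p = \<alpha> = 0\<close> and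
  \<open>\<beta> < 0\<close>; just before reaching it \<open>p\<close> would be negative.\<close>

lemma arc_dom:
  assumes ab: "up a" "down b" "a < b" and ge: "\<And>t. a \<le> t \<Longrightarrow> t \<le> b \<Longrightarrow> 0 \<le> p t" and t: "a \<le> t" "t \<le> b"
  shows "0 < D t"
proof (rule D_pos, rule ccontr)
  assume z: "p t = 0" "\<alpha> t = 0" "\<not> 0 < \<beta> t"
  then have "\<beta> t < 0" using nz[of t] by auto
  then obtain e where e: "e > 0" "\<And>h. 0 < h \<Longrightarrow> h < e \<Longrightarrow> p (t - h) < 0" using zero_left_neg[OF z(1,2)] by blast
  have "a < t" using ab z t by (cases "a = t") (auto simp: up_def)
  define h where "h = min e (t - a) / 2"
  have "0 < h" "h < e" "a \<le> t - h" using e(1) \<open>a < t\<close> by (auto simp: h_def min_def field_simps)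
  then show False using e(2)[of h] ge[of "t - h"] t by simp
qed

text \<open>Upward crossings lie at \<open>X > 0\<close> and downward ones at \<open>X < 0\<close>.
  Arcs that are not nested would have interlaced endpoints and would meet, against
  injectivity.\<close>

lemma upper_nested:
  assumes ab: "up a" "down b" "a < b" "\<And>t. a \<le> t \<Longrightarrow> t \<le> b \<Longrightarrow> 0 \<le> p t"
    and cd: "up c" "down d" "c < d" "\<And>t. c \<le> t \<Longrightarrow> t \<le> d \<Longrightarrow> 0 \<le> p t"
    and disj: "\<And>t s n. a \<le> t \<Longrightarrow> t \<le> b \<Longrightarrow> c \<le> s \<Longrightarrow> s \<le> d \<Longrightarrow> s - t \<noteq> of_int n * T"
    and X: "X a < X c"
  shows "X d \<le> X b"
proof (rule ccontr)
  assume "\<not> X d \<le> X b"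
  have dom1: "0 < D t" if "a \<le> t" "t \<le> b" for t by (rule arc_dom[OF ab(1-3) _ that]) (rule ab(4))
  have dom2: "0 < D t" if "c \<le> t" "t \<le> d" for t by (rule arc_dom[OF cd(1-3) _ that]) (rule cd(4))
  have ends: "Y a = 0" "Y b = 0" "Y c = 0" "Y d = 0" using ab cd by (simp_all add: Y_def up_def down_def)
  have signs: "X d < 0" "0 < X a"
    using ab cd dom1[of a] dom2[of d] by (simp_all add: X_def up_def down_def divide_less_0_iff)
  have P1: "path (subpath b a C)" "path_image (subpath b a C) = C ` {a..b}"
    using C_path[of a b] dom1 ab(3) by auto
  have P2: "path (subpath d c C)" "path_image (subpath d c C) = C ` {c..d}"
    using C_path[of c d] dom2 cd(3) by auto
  have Y: "0 \<le> Y t" if "a \<le> t \<and> t \<le> b \<or> c \<le> t \<and> t \<le> d" for t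
    using that ab(4)[of t] cd(4)[of t] dom1[of t] dom2[of t] by (auto simp: Y_def)
  obtain z where z: "z \<in> path_image (subpath b a C)" "z \<in> path_image (subpath d c C)"
  proof (rule half_plane_arcs_meet[of "subpath b a C" "subpath d c C"])
    show "path (subpath b a C)" by (rule P1(1)) 
    show "path (subpath d c C)" by (rule P2(1)) 
    show "0 \<le> z $ 2" if "z \<in> path_image (subpath b a C) \<union> path_image (subpath d c C)" for z
      using that Y unfolding P1(2) P2(2) by auto
  qed (use \<open>\<not> X d \<le> X b\<close> signs X ends in \<open>auto simp: \<close>)
  then obtain t s where ts: "a \<le> t" "t \<le> b" "c \<le> s" "s \<le> d" "C t = C s"
    unfolding P1(2) P2(2) by auto
  then show False using C_eq[OF dom1 dom2, of t s] disj[of t s] by auto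
qed

text \<open>For the negated curve the abscissa at a zero of \<open>p\<close> is
  \<open>- 1 / X\<close>, increasing on each half-line, so the order of the crossings survives the
  change of side.\<close>

lemma lower_nested:
  assumes ab: "down a" "up b" "a < b" "\<And>t. a \<le> t \<Longrightarrow> t \<le> b \<Longrightarrow> p t \<le> 0"
    and cd: "down c" "up d" "c < d" "\<And>t. c \<le> t \<Longrightarrow> t \<le> d \<Longrightarrow> p t \<le> 0"
    and disj: "\<And>t s n. a \<le> t \<Longrightarrow> t \<le> b \<Longrightarrow> c \<le> s \<Longrightarrow> s \<le> d \<Longrightarrow> s - t \<noteq> of_int n * T"
    and X: "X a < X c"
  shows "X d \<le> X b"
proof -
  interpret neg: ray_curve "\<lambda>t. - p t" "\<lambda>t. - \<alpha> t" "\<lambda>t. - \<beta> t" T by (rule uminus_ray_curve)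
  have rel: "neg.X t = - 1 / X t" "X t \<noteq> 0" "0 < D t" if "p t = 0" "\<alpha> t \<noteq> 0" for t
  proof -
    have N: "neg.N t = N t" by (simp add: neg.N_def N_def)
    show d: "0 < D t" using that by (intro D_pos) auto
    have "neg.D t > 0" using that by (intro neg.D_pos) auto
    moreover have "D t * neg.D t = (\<alpha> t)\<^sup>2" using D_prod[of t] that N by (simp add: neg.D_def)
    ultimately show "neg.X t = - 1 / X t"
      using d that unfolding neg.X_def X_def by (simp add: field_simps power2_eq_square)
    show "X t \<noteq> 0" using d that by (simp add: X_def)
  qed
  have sg: "down t \<Longrightarrow> X t < 0 \<and> neg.X t = - 1 / X t" "up t \<Longrightarrow> 0 < X t \<and> neg.X t = - 1 / X t" for t
    using rel[of t] by (auto simp: X_def up_def down_def divide_less_0_iff zero_less_divide_iff)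
  have "neg.X a < neg.X c"
  proof -
    have "inverse (X c) < inverse (X a)"
      using sg(1)[OF ab(1)] sg(1)[OF cd(1)] X by (simp add: inverse_less_iff_less_neg)
    then show ?thesis using sg(1)[OF ab(1)] sg(1)[OF cd(1)] by (simp add: inverse_eq_divide)
  qed
  have "neg.X d \<le> neg.X b"
    by (rule neg.upper_nested[of a b c d])
      (use assms \<open>neg.X a < neg.X c\<close> in \<open>auto simp: neg.up_def neg.down_def up_def down_def\<close>)
  then show ?thesis using sg(2)[OF ab(2)] sg(2)[OF cd(2)] by (simp add: field_simps)
qed

lemma crossing_ray:
  assumes "up a \<and> up c \<or> down a \<and> down c" "X a = X c"
  shows "\<exists>n::int. c - a = n * T"
proof (rule C_eq)
  show "0 < D a" "0 < D c" using assms(1) by (auto intro!: D_pos simp: up_def down_def)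
  have "Y a = Y c" using assms(1) by (auto simp: Y_def up_def down_def)
  then show "C a = C c" using assms(2) by (simp add: C_def)
qed

text \<open>At a touching point the projected arc passes through the origin with \<open>X\<close>
  turning from negative to positive, although the arc begins at positive and ends at negative
  \<open>X\<close>. Cut open near the origin and dropped to the axis, its two halves would have
  interlaced endpoints and would meet.\<close>

lemma no_touch:
  assumes ab: "up a" "down b" "a < b" "b < a + T" and ge: "\<And>t. a \<le> t \<Longrightarrow> t \<le> b \<Longrightarrow> 0 \<le> p t"
    and t0: "a < t0" "t0 < b"
  shows "0 < p t0"
proof (rule ccontr)
  assume "\<not> 0 < p t0"
  then have p0: "p t0 = 0" using ge[of t0] t0 by simp
  have dom: "0 < D t" if "a \<le> t" "t \<le> b" for t by (rule arc_dom[OF ab(1-3) _ that]) (rule ge)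
  have inside: "\<exists>h>0. h < e \<and> a \<le> t0 - h \<and> t0 + h \<le> b" if "e > 0" for e
    using that t0 by (intro exI[of _ "min e (min (t0 - a) (b - t0)) / 2"]) (auto simp: min_def field_simps)
  have \<alpha>0: "\<alpha> t0 = 0"
  proof (rule ccontr)
    assume "\<alpha> t0 \<noteq> 0"
    then obtain e where e: "e > 0" "\<And>h. 0 < h \<Longrightarrow> h < e \<Longrightarrow> sgn (p (t0 + h)) = sgn (\<alpha> t0) \<and> sgn (p (t0 - h)) = - sgn (\<alpha> t0)"
      using cross[OF p0] by blast
    obtain h where h: "h > 0" "h < e" "a \<le> t0 - h" "t0 + h \<le> b" using inside[OF e(1)] by blast
    have "0 \<le> sgn (p (t0 + h))" "0 \<le> sgn (p (t0 - h))" using ge h by simp_all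
    then show False using e(2)[OF h(1,2)] \<open>\<alpha> t0 \<noteq> 0\<close> by (auto simp: sgn_if split: if_splits)
  qed
  obtain e where e: "e > 0" "\<And>h. 0 < h \<Longrightarrow> h < e \<Longrightarrow> sgn (\<alpha> (t0 + h)) = sgn (\<beta> t0)"
      "\<And>h. 0 < h \<Longrightarrow> h < e \<Longrightarrow> sgn (\<alpha> (t0 - h)) = - sgn (\<beta> t0)"
    using touch[OF p0 \<alpha>0] by blast
  have \<beta>0: "sgn (\<beta> t0) = 1"
  proof -
    have "0 < D t0" using dom t0 by simp
    then have "0 < \<beta> t0" using p0 \<alpha>0 nz[OF p0 \<alpha>0] by (simp add: D_def N_def abs_if split: if_splits)
    then show ?thesis by simp
  qed
  have right: "0 < X t" if "t0 < t" "t < t0 + e" "t \<le> b" for t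
  proof -
    have "0 < \<alpha> t" using e(2)[of "t - t0"] \<beta>0 that by (simp add: sgn_1_pos)
    then show ?thesis using dom[of t] that t0 by (simp add: X_def)
  qed
  have left: "X t < 0" if "t < t0" "t0 - e < t" "a \<le> t" for t
  proof -
    have "\<alpha> t < 0" using e(3)[of "t0 - t"] \<beta>0 that by (simp add: sgn_1_neg)
    then show ?thesis using dom[of t] that t0 by (simp add: X_def divide_less_0_iff)
  qed
  obtain r where r: "r > 0" "r < e" "a \<le> t0 - r" "t0 + r \<le> b" using inside[OF e(1)] by blast
  have C0: "C t0 = 0" using p0 \<alpha>0 by (simp add: C_def X_def Y_def)
  have C_nz: "C t \<noteq> 0" if t: "a \<le> t" "t \<le> b" "t \<noteq> t0" for t
  proof
    assume "C t = 0"
    then obtain n :: int where n: "t0 - t = n * T" using C_eq[of t t0] dom t t0 C0 by auto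
    have "\<bar>t0 - t\<bar> < T" using t t0 ab by auto
    then have "\<bar>real_of_int n\<bar> * T < 1 * T" using T_pos unfolding n by (simp add: abs_mult)
    then have "\<bar>real_of_int n\<bar> < 1" by (simp only: mult_less_cancel_right_pos[OF T_pos])
    then have "n = 0" by linarith
    then show False using n t(3) by simp
  qed
  define K where "K = {a..t0 - r} \<union> {t0 + r..b}"
  have contC: "continuous_on {a..b} C" by (rule C_cont) (use dom in auto)
  have "continuous_on K (\<lambda>t. norm (C t))"
    by (intro continuous_on_norm continuous_on_subset[OF contC]) (use r in \<open>auto simp: K_def\<close>)
  moreover have "compact K" "K \<noteq> {}" using r by (auto simp: K_def)
  ultimately obtain k where k: "k \<in> K" "\<And>t. t \<in> K \<Longrightarrow> norm (C k) \<le> norm (C t)"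
    using continuous_attains_inf[of K "\<lambda>t. norm (C t)"] by blast
  \<comment> \<open>The distance from the origin to the part of the arc away from \<open>t0\<close>.
    Segments inside the ball of radius \<open>m\<close> stay clear of that part.\<close>
  define m where "m = norm (C k)"
  have m: "0 < m" using C_nz[of k] k(1) r by (auto simp: m_def K_def)
  have far: "m \<le> norm (C t)" if "a \<le> t" "t \<le> t0 - r \<or> t0 + r \<le> t" "t \<le> b" for t
    using k(2)[of t] that r by (auto simp: m_def K_def)
  obtain \<delta> where \<delta>: "\<delta> > 0" "\<And>t. t \<in> {a..b} \<Longrightarrow> \<bar>t - t0\<bar> < \<delta> \<Longrightarrow> norm (C t) < m"
    using contC[unfolded continuous_on_iff] t0 m C0 by (force simp: dist_real_def dist_norm)
  define h where "h = min \<delta> r / 2"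
  have h: "0 < h" "h < \<delta>" "h < r" using \<delta>(1) r(1) by (auto simp: h_def min_def field_simps)
  define u w where "u = t0 - h" and "w = t0 + h"
  have uw: "a < u" "u < t0" "t0 < w" "w < b" using h r by (auto simp: u_def w_def)
  have small: "norm (C u) < m" "norm (C w) < m" using \<delta>(2) uw h by (auto simp: u_def w_def)
  have Xu: "X u < 0" and Xw: "0 < X w" using left[of u] right[of w] uw h r by (auto simp: u_def w_def)
  have Xle: "\<bar>X t\<bar> \<le> norm (C t)" for t using component_le_norm_cart[of "C t" 1] by simp
  have Ends: "C a = X a *\<^sub>R axis 1 1" "C b = X b *\<^sub>R axis 1 1" using ab by (simp_all add: C_def Y_def up_def down_def)
  have XaXb: "X w < X a" "X b < X u"
  proof -
    have "m \<le> \<bar>X a\<bar>" "m \<le> \<bar>X b\<bar>" using far[of a] far[of b] r t0 by (simp_all add: Ends)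
    moreover have "0 < X a" "X b < 0"
      using ab dom[of a] dom[of b] by (simp_all add: X_def up_def down_def divide_less_0_iff)
    ultimately show "X w < X a" "X b < X u" using Xle[of u] Xle[of w] small by auto
  qed
  define E :: "real \<Rightarrow> real^2" where "E t = X t *\<^sub>R axis 1 1" for t
  have nE: "norm (E t) \<le> norm (C t)" for t using Xle[of t] by (simp add: E_def)
  have Y: "0 \<le> Y t" if "a \<le> t" "t \<le> b" for t using ge[OF that] dom[OF that] by (simp add: Y_def)
  have seg: "z $ 1 = X t \<and> 0 \<le> z $ 2 \<and> norm z < m"
    if z: "z \<in> closed_segment (C t) (E t)" and t: "a \<le> t" "t \<le> b" "norm (C t) < m" for z t
  proof (intro conjI)
    obtain \<mu> where \<mu>: "0 \<le> \<mu>" "\<mu> \<le> 1" "z = (1 - \<mu>) *\<^sub>R C t + \<mu> *\<^sub>R E t" using z by (auto simp: in_segment)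
    show "z $ 1 = X t" unfolding \<mu>(3) by (simp add: E_def algebra_simps)
    show "0 \<le> z $ 2" unfolding \<mu>(3) using \<mu>(2) Y[OF t(1,2)] by (simp add: E_def axis_def)
    have "closed_segment (C t) (E t) \<subseteq> ball 0 m"
      by (rule closed_segment_subset) (use t(3) nE[of t] in auto)
    then show "norm z < m" using z by auto
  qed
  \<comment> \<open>Each half is closed up by the vertical segment between its cut point and the
    axis; the endpoints are ordered \<open>X b < X u < X w < X a\<close>.\<close>
  define f where "f = subpath b w C +++ linepath (C w) (E w)"
  define g where "g = linepath (E u) (C u) +++ subpath u a C"
  have P1: "path (subpath b w C)" "path_image (subpath b w C) = C ` {w..b}"
    using C_path[of w b] dom uw by auto
  have P2: "path (subpath u a C)" "path_image (subpath u a C) = C ` {a..u}"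
    using C_path[of a u] dom uw by auto
  have f: "path f" "path_image f = C ` {w..b} \<union> closed_segment (C w) (E w)"
    unfolding f_def using P1 by (simp_all add: path_image_join)
  have g: "path g" "path_image g = closed_segment (C u) (E u) \<union> C ` {a..u}"
    unfolding g_def using P2 by (simp_all add: path_image_join closed_segment_commute)
  obtain z where z: "z \<in> path_image f" "z \<in> path_image g"
  proof (rule half_plane_arcs_meet[OF f(1) g(1)])
    show "0 \<le> z $ 2" if "z \<in> path_image f \<union> path_image g" for z
      using that seg[of z w] seg[of z u] Y uw small unfolding f(2) g(2) by auto
  qed (use XaXb Xu Xw Ends in \<open>auto simp: f_def g_def E_def axis_def\<close>)
  have fz: "(\<exists>t. w \<le> t \<and> t \<le> b \<and> z = C t) \<or> z $ 1 = X w \<and> norm z < m"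
    using z(1) seg[of z w] uw small unfolding f(2) by auto
  have gz: "(\<exists>t. a \<le> t \<and> t \<le> u \<and> z = C t) \<or> z $ 1 = X u \<and> norm z < m"
    using z(2) seg[of z u] uw small unfolding g(2) by auto
  \<comment> \<open>Inside the ball the two halves are separated by the sign of the abscissa, and
    outside it there are no segments; so the meeting point must lie on both pieces of the arc
    itself.\<close>
  have fX: "0 < z $ 1 \<or> m \<le> norm z"
    using fz
  proof
    assume "\<exists>t. w \<le> t \<and> t \<le> b \<and> z = C t"
    then obtain t where t: "w \<le> t" "t \<le> b" "z = C t" by blast
    show ?thesis using far[of t] right[of t] t uw r by (cases "t0 + r \<le> t") auto
  qed (use Xw in simp)
  have gX: "z $ 1 < 0 \<or> m \<le> norm z"
    using gz
  proof
    assume "\<exists>t. a \<le> t \<and> t \<le> u \<and> z = C t"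
    then obtain t where t: "a \<le> t" "t \<le> u" "z = C t" by blast
    show ?thesis using far[of t] left[of t] t uw r by (cases "t \<le> t0 - r") auto
  qed (use Xu in simp)
  have "(\<exists>t. w \<le> t \<and> t \<le> b \<and> z = C t) \<and> (\<exists>t. a \<le> t \<and> t \<le> u \<and> z = C t)"
    using fz gz fX gX Xu Xw by auto
  then obtain t s where ts: "w \<le> t" "t \<le> b" "a \<le> s" "s \<le> u" "C t = C s" by auto
  then obtain n :: int where n: "s - t = n * T" using C_eq[OF dom dom, of t s] uw by auto
  have "- T < s - t" "s - t < 0" using ts uw ab by auto
  then have "real_of_int n * T < 0 * T" "(- 1) * T < real_of_int n * T" unfolding n by simp_all
  then have "real_of_int n < 0" "- 1 < real_of_int n" by (simp_all only: mult_less_cancel_right_pos[OF T_pos])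
  then have "real_of_int (- 1) < real_of_int n" "real_of_int n < real_of_int 0" by simp_all
  then have "- 1 < n" "n < 0" by (simp_all only: of_int_less_iff)
  then show False by linarith
qed

text \<open>An upward crossing with the smallest \<open>X\<close> is compared with its neighbours:
  nesting passes the order through the excursions above and below the plane to the following upward
  crossing, which minimality then identifies with \<open>a + T\<close>.\<close>

theorem two_crossings:
  "\<exists>a b. a < b \<and> b < a + T \<and> up a \<and> down b \<and> (\<forall>t. a < t \<and> t < b \<longrightarrow> 0 < p t) \<and> (\<forall>t. b < t \<and> t < a + T \<longrightarrow> p t < 0)"
proof -
  have "\<exists>a b. loop a b (a + T)"
  proof -
    obtain t where t: "up t" using up_exists by blast
    define U where "U = {s \<in> {t..t + T}. up s}"
    have fin: "finite U" by (rule finite_subset[OF _ zeros_finite[of t "t + T"]]) (auto simp: U_def up_def)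
    have "t \<in> U" using t T_pos by (simp add: U_def)
    then have "U \<noteq> {}" by blast
    \<comment> \<open>The minimum exists because a period contains finitely many zeros; as
      \<open>X\<close> is periodic, it is a minimum over all upward crossings.\<close>
    obtain a where a: "a \<in> U" "\<And>s. s \<in> U \<Longrightarrow> X a \<le> X s"
      using arg_min_if_finite[OF fin \<open>U \<noteq> {}\<close>, of X] by (metis linorder_not_less)
    have X_T: "X (s + of_int n * T) = X s" for s n by (simp add: X_def D_def N_def p_T_int \<alpha>_T_int \<beta>_T_int)
    have min: "X a \<le> X s" if "up s" for s
    proof -
      define n where "n = - \<lfloor>(s - t) / T\<rfloor>"
      have "real_of_int \<lfloor>(s - t) / T\<rfloor> * T \<le> s - t" "s - t < (real_of_int \<lfloor>(s - t) / T\<rfloor> + 1) * T"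
        using T_pos by (simp_all only: pos_le_divide_eq[symmetric] pos_divide_less_eq[symmetric]) linarith+
      then have "s + of_int n * T \<in> U" using that up_T_int[of s n] by (simp add: U_def n_def algebra_simps)
      then show ?thesis using a(2) X_T by metis
    qed
    have ua: "up a" using a by (simp add: U_def)
    obtain c b' where c: "loop c b' a" using loop_before[OF ua] by blast
    obtain b a' where L: "loop a b a'" using loop_exists[OF ua] by blast
    have upT: "up (s + T)" if "up s" for s using up_T_int[of s 1] that by simp
    have a'T: "a' \<le> a + T" by (rule loop_next[OF L upT[OF ua]]) (use T_pos in simp)
    have acT: "a \<le> c + T" by (rule loop_next[OF c upT]) (use c T_pos in \<open>auto simp: loop_def\<close>)
    have eq_T: "s' = s + T" if s: "up s" "up s'" "s < s'" "s' \<le> s + T" "X s = X s'" for s s'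
    proof -
      obtain n :: int where n: "s' - s = n * T" using crossing_ray[of s s'] s by blast
      have "0 * T < real_of_int n * T" "real_of_int n * T \<le> 1 * T" unfolding n[symmetric] using s by simp_all
      then have "0 < real_of_int n" "real_of_int n \<le> 1" by (simp_all only: mult_less_cancel_right_pos[OF T_pos] mult_le_cancel_right_pos[OF T_pos])
      then have "n = 1" by linarith
      then show ?thesis using n by simp
    qed
    show ?thesis
    proof (cases "a = c + T")
      case True
      then show ?thesis using c by blast
    next
      case False
      then have "a < c + T" using acT by simp
      have a'cT: "a' \<le> c + T" by (rule loop_next[OF L upT]) (use c \<open>a < c + T\<close> in \<open>auto simp: loop_def\<close>)
      have ord: "c < b'" "b' < a" "a < b" "b < a'" using c L by (auto simp: loop_def)
      have no_int: "s - r \<noteq> real_of_int n * T" if "0 < s - r" "s - r < T" for s r n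
      proof
        assume n: "s - r = real_of_int n * T"
        have "0 * T < real_of_int n * T" "real_of_int n * T < 1 * T" unfolding n[symmetric] using that by simp_all
        then have "0 < real_of_int n" "real_of_int n < 1" by (simp_all only: mult_less_cancel_right_pos[OF T_pos])
        then have "0 < n" "n < 1" by simp_all
        then show False by linarith
      qed
      have no_int': "s - r \<noteq> real_of_int n * T" if "0 < r - s" "r - s < T" for s r n
        using no_int[OF that, of "- n"] by auto
      have uc: "up c" using c by (simp add: loop_def)
      have "X a \<noteq> X c" using eq_T[OF uc ua _ acT] False ord by auto
      then have "X a < X c" using min[OF uc] by simp
      \<comment> \<open>The order of \<open>a\<close> and \<open>c\<close> at the upward ends passes
        through the upper arcs to their downward ends \<open>b\<close> and \<open>b'\<close>; the
        lower arcs then pass it on to \<open>a\<close> and \<open>a'\<close>.\<close>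
      have "X b' \<le> X b"
      proof (rule upper_nested[of a b c b'])
        show "s - t \<noteq> of_int n * T" if "a \<le> t" "t \<le> b" "c \<le> s" "s \<le> b'" for t s n
          by (rule no_int') (use that ord a'cT in linarith)+
      qed (use c[unfolded loop_def] L[unfolded loop_def] \<open>X a < X c\<close> in \<open>blast+\<close>)
      moreover have "X b' \<noteq> X b"
      proof
        assume "X b' = X b"
        then obtain n :: int where "b - b' = n * T" using crossing_ray[of b' b] c L by (auto simp: loop_def)
        then show False using no_int[of b b' n] ord a'cT by auto
      qed
      ultimately have "X b' < X b" by simp
      have "X a' \<le> X a"
      proof (rule lower_nested[of b' a b a'])
        show "s - t \<noteq> of_int n * T" if "b' \<le> t" "t \<le> a" "b \<le> s" "s \<le> a'" for t s n
          by (rule no_int) (use that ord a'cT in linarith)+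
      qed (use c[unfolded loop_def] L[unfolded loop_def] \<open>X b' < X b\<close> in \<open>blast+\<close>)
      moreover have ua': "up a'" using L by (simp add: loop_def)
      ultimately have "X a = X a'" using min[OF ua'] by simp
      then have "a' = a + T" using eq_T[OF ua ua' _ a'T] ord by simp
      then show ?thesis using L by blast
    qed
  qed
  then obtain a b where L: "loop a b (a + T)" by blast
  interpret neg: ray_curve "\<lambda>t. - p t" "\<lambda>t. - \<alpha> t" "\<lambda>t. - \<beta> t" T by (rule uminus_ray_curve)
  have "0 < p t" if "a < t" "t < b" for t
    by (rule no_touch[of a b t]) (use L that in \<open>auto simp: loop_def\<close>)
  moreover have "0 < - p t" if "b < t" "t < a + T" for t
    by (rule neg.no_touch[of b "a + T" t])
      (use L that in \<open>auto simp: loop_def neg.up_def neg.down_def up_def down_def\<close>)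
  moreover have "a < b" "b < a + T" "up a" "down b" using L by (simp_all add: loop_def)
  ultimately show ?thesis by (intro exI[of _ a] exI[of _ b] conjI allI impI) simp_all
qed

end

section \<open>Normalization of a periodic trajectory\<close>

text \<open>\<open>p + i q\<close> would be an eigenvector for the eigenvalue with real part
  \<open>a\<close> and imaginary part \<open>\<omega>\<close>. Real eigenvectors are the case
  \<open>q = 0\<close>, \<open>\<omega> = 0\<close>.\<close>

lemma hurwitz_no_unstable_eigenvalue:
  fixes M :: "real^'n^'n"
  assumes M: "hurwitz M" and "0 \<le> a"
    and p: "M *v p = a *\<^sub>R p - \<omega> *\<^sub>R q" and q: "M *v q = a *\<^sub>R q + \<omega> *\<^sub>R p"
  shows "p = 0 \<and> q = 0"
proof -
  define z where "z = (\<chi> i. Complex (p $ i) (q $ i))"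
  have "map_matrix complex_of_real M *v z = Complex a \<omega> *s z"
    unfolding vec_eq_iff
  proof
    fix i
    have "(map_matrix complex_of_real M *v z) $ i = Complex ((M *v p) $ i) ((M *v q) $ i)"
      by (simp add: complex_eq_iff matrix_vector_mult_def map_matrix_def z_def)
    also have "\<dots> = (Complex a \<omega> *s z) $ i"
      unfolding p q by (simp add: complex_eq_iff z_def)
    finally show "(map_matrix complex_of_real M *v z) $ i = (Complex a \<omega> *s z) $ i" .
  qed
  then have "z = 0" using M \<open>0 \<le> a\<close> unfolding hurwitz_def by fastforce
  then have "Complex (p $ i) (q $ i) = 0" for i by (simp add: z_def vec_eq_iff)
  then show ?thesis by (simp add: complex_eq_iff vec_eq_iff)
qed

lemma hurwitz_det_neg:
  fixes M :: "real^3^3"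
  assumes "hurwitz M"
  shows "det M < 0"
proof (rule det_neg_if_no_nonneg_eigenvalue)
  fix t y assume "0 \<le> t" "M *v y = t *\<^sub>R y"
  then show "y = 0" using hurwitz_no_unstable_eigenvalue[OF assms, of t y 0 0] by simp
qed

lemma det_mat_1_plus_outer: "det (mat 1 + outer_product d \<xi> :: real^3^3) = 1 + \<xi> \<bullet> d"
  by (simp add: det_3 mat_def outer_product_def inner_vec_def sum_3 algebra_simps)

lemma AE_interval_point:
  fixes r s :: real
  assumes "AE t in lebesgue. P t" "r < s"
  obtains t where "r < t" "t < s" "P t"
proof -
  obtain N where N: "N \<in> null_sets lebesgue" "{t \<in> space lebesgue. \<not> P t} \<subseteq> N"
    using assms(1) unfolding eventually_ae_filter by blast
  have "\<exists>t. r < t \<and> t < s \<and> P t"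
  proof (rule ccontr)
    assume "\<not> ?thesis"
    then have "box r s \<subseteq> N" using N(2) by auto
    then have "negligible (box r s)" using N(1) negligible_iff_null_sets negligible_subset by blast
    then show False using \<open>r < s\<close> unfolding negligible_interval by simp
  qed
  then show ?thesis using that by blast
qed

lemma AE_reflect:
  assumes "AE t in lebesgue. P t"
  shows "AE t in lebesgue. P (- t :: real)"
proof -
  obtain N where N: "N \<in> null_sets lebesgue" "{t \<in> space lebesgue. \<not> P t} \<subseteq> N"
    using assms(1) unfolding eventually_ae_filter by blast
  have "negligible (uminus ` N)"
    using N(1) by (intro negligible_differentiable_image_negligible)
      (auto simp: negligible_iff_null_sets differentiable_on_def intro!: differentiable_minus differentiable_ident)
  moreover have "{t \<in> space lebesgue. \<not> P (- t)} \<subseteq> uminus ` N"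
    using N(2) by (auto simp: image_iff intro!: bexI[of _ "- _"])
  ultimately show ?thesis unfolding eventually_ae_filter negligible_iff_null_sets by blast
qed

text \<open>A bounded derivative makes \<open>f\<close> Lipschitz on compact intervals, a property
  that reflects at once; divisions of intervals need not be transported.\<close>

lemma ae_deriv_reflect:
  fixes f D :: "real \<Rightarrow> 'a::real_normed_vector"
  assumes f: "ae_deriv f D" and bound: "\<And>a b. \<exists>K\<ge>0. AE t in lebesgue. t \<in> {a..b} \<longrightarrow> norm (D t) \<le> K"
  shows "ae_deriv (\<lambda>t. f (- t)) (\<lambda>t. - D (- t))"
  unfolding ae_deriv_def
proof (intro conjI allI)
  fix a b
  obtain K where K: "K \<ge> 0" "AE t in lebesgue. t \<in> {- b..- a} \<longrightarrow> norm (D t) \<le> K" using bound by blast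
  show "absolutely_continuous_on {a..b} (\<lambda>t. f (- t))"
  proof (rule lipschitz_imp_ac[OF K(1)])
    fix s r assume sr: "a \<le> s" "s \<le> r" "r \<le> b"
    have "norm (f (- s) - f (- r)) \<le> K * (- s - - r)"
    proof (rule ac_mean_value_bound[OF _ _ K(1)])
      show "absolutely_continuous_on {- r..- s} f" using f by (simp add: ae_deriv_def)
      have "AE t in lebesgue. (f has_vector_derivative D t) (at t)" using f by (simp add: ae_deriv_def)
      then show "AE t in lebesgue. t \<in> {- r..- s} \<longrightarrow>
          (\<exists>D. (f has_vector_derivative D) (at t within {- r..- s}) \<and> norm D \<le> K)"
        using K(2)
      proof eventually_elim
        case (elim t)
        then show ?case using sr has_vector_derivative_at_within by fastforce
      qed
    qed (use sr in simp)
    then show "norm (f (- r) - f (- s)) \<le> K * (r - s)" by (simp add: norm_minus_commute)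
  qed
next
  have "AE t in lebesgue. (f has_vector_derivative D t) (at t)" using f by (simp add: ae_deriv_def)
  from AE_reflect[OF this] show "AE t in lebesgue. ((\<lambda>t. f (- t)) has_vector_derivative - D (- t)) (at t)"
  proof eventually_elim
    case (elim t)
    have m: "(uminus has_vector_derivative - 1) (at t)" by (auto intro!: derivative_eq_intros)
    from vector_diff_chain_at[OF m elim] show ?case by (simp add: o_def)
  qed
qed

text \<open>Let \<open>transpose N *v \<xi> = e\<close>. The derivative of
  \<open>\<xi> \<bullet> z\<close> is \<open>e \<bullet> z\<close> times
  \<open>1 + u t * \<kappa>\<close>, and \<open>1 + \<kappa>\<close> is the quotient of the two
  negative determinants. If \<open>e \<bullet> z\<close> were never positive,
  \<open>\<xi> \<bullet> z\<close> would decrease over a period, strictly near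
  \<open>t1\<close>.\<close>

lemma control_solution_reaches_positive:
  fixes N :: "real^3^3"
  assumes z: "control_solution N d e u z" and per: "z (t1 + T) = z t1" and "0 < T"
    and dN: "det N < 0" and d1: "det (N + outer_product d e) < 0" and nz: "e \<bullet> z t1 \<noteq> 0"
  shows "\<exists>t. 0 < e \<bullet> z t"
proof (rule ccontr)
  assume "\<not> ?thesis"
  then have le: "e \<bullet> z t \<le> 0" for t by (meson linorder_not_le)
  have "det (transpose N) \<noteq> 0" using dN by (simp add: det_transpose)
  then obtain B where B: "transpose N ** B = mat 1"
    using invertible_det_nz[of "transpose N"] unfolding invertible_def by blast
  define \<xi> where "\<xi> = B *v e"
  have \<xi>: "transpose N *v \<xi> = e" unfolding \<xi>_def matrix_vector_mul_assoc B by simp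
  define \<kappa> where "\<kappa> = \<xi> \<bullet> d"
  have "outer_product d e = outer_product d \<xi> ** N"
    unfolding \<xi>[symmetric]
    by (simp add: vec_eq_iff outer_product_def matrix_matrix_mult_def matrix_vector_mult_def transpose_def sum_distrib_left mult_ac del: transpose_matrix_vector)
  then have "N + outer_product d e = (mat 1 + outer_product d \<xi>) ** N"
    by (simp add: vec_eq_iff matrix_matrix_mult_def distrib_right sum.distrib mat_def if_distrib[of "\<lambda>x. x * _"] cong: if_cong)
  then have "det (N + outer_product d e) = (1 + \<kappa>) * det N"
    by (simp add: det_mul det_mat_1_plus_outer \<kappa>_def)
  then have \<kappa>: "0 < 1 + \<kappa>" using d1 dN by (simp add: mult_less_0_iff)
  \<comment> \<open>\<open>1 + w * \<kappa>\<close> is affine in \<open>w\<close>, so on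
    \<open>[0, 1]\<close> it is at least the smaller of its two end values.\<close>
  define \<delta> where "\<delta> = min 1 (1 + \<kappa>)"
  have \<delta>: "0 < \<delta>" using \<kappa> by (simp add: \<delta>_def)
  have w: "\<delta> \<le> 1 + w * \<kappa>" if "0 \<le> w" "w \<le> 1" for w
  proof -
    have "(1 - w) * \<delta> + w * \<delta> \<le> (1 - w) * 1 + w * (1 + \<kappa>)"
      by (intro add_mono mult_left_mono) (use that in \<open>auto simp: \<delta>_def\<close>)
    then show ?thesis by (simp add: algebra_simps)
  qed
  define D where "D t = (e \<bullet> z t) * (1 + u t * \<kappa>)" for t
  have zd: "ae_deriv z (\<lambda>t. N *v z t + (u t * (e \<bullet> z t)) *\<^sub>R d)" and u: "AE t in lebesgue. 0 \<le> u t \<and> u t \<le> 1"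
    using z by (auto simp: control_solution_def)
  have "\<xi> \<bullet> (N *v z t) = e \<bullet> z t" for t
    using inner_transpose[of \<xi> N "z t"] unfolding \<xi> .
  then have "\<xi> \<bullet> (N *v z t + (u t * (e \<bullet> z t)) *\<^sub>R d) = D t" for t
    by (simp add: D_def inner_add_right \<kappa>_def algebra_simps)
  then have y: "ae_deriv (\<lambda>t. \<xi> \<bullet> z t) D"
    using ae_deriv_inner[OF zd, of \<xi>] by simp
  have cont: "continuous_on S (\<lambda>t. e \<bullet> z t)" for S
    by (intro continuous_intros ae_deriv_continuous[OF zd])
  obtain C where C: "\<And>t. t \<in> {t1..t1 + T} \<Longrightarrow> norm (e \<bullet> z t) \<le> C"
  proof -
    have "bounded ((\<lambda>t. e \<bullet> z t) ` {t1..t1 + T})"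
      by (intro compact_imp_bounded compact_continuous_image cont) simp
    then show ?thesis using that unfolding bounded_iff by blast
  qed
  have "0 \<le> C" using C[of t1] \<open>0 < T\<close> norm_ge_zero order_trans by fastforce
  define m where "m = - (C * (1 + \<bar>\<kappa>\<bar>))"
  have m: "m \<le> 0" using \<open>0 \<le> C\<close> by (simp add: m_def)
  have Dm: "m \<le> D t" if "t \<in> {t1..t1 + T}" "0 \<le> u t" "u t \<le> 1" for t
  proof -
    have "\<bar>1 + u t * \<kappa>\<bar> \<le> 1 + \<bar>\<kappa>\<bar>"
    proof -
      have "\<bar>u t * \<kappa>\<bar> \<le> 1 * \<bar>\<kappa>\<bar>" unfolding abs_mult by (rule mult_right_mono) (use that in auto)
      then show ?thesis by linarith
    qed
    then have "\<bar>D t\<bar> \<le> C * (1 + \<bar>\<kappa>\<bar>)"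
      unfolding D_def abs_mult by (intro mult_mono) (use C[OF that(1)] \<open>0 \<le> C\<close> in auto)
    then show ?thesis by (simp add: m_def)
  qed
  have D0: "D t \<le> (e \<bullet> z t) * \<delta>" if "0 \<le> u t" "u t \<le> 1" for t
    unfolding D_def using w[OF that] le[of t] by (rule mult_left_mono_neg)
  have e1: "e \<bullet> z t1 < 0" using le[of t1] nz by simp
  obtain h where h: "0 < h" "h < T" "\<And>t. t1 \<le> t \<Longrightarrow> t \<le> t1 + h \<Longrightarrow> e \<bullet> z t \<le> (e \<bullet> z t1) / 2"
  proof -
    obtain \<epsilon> where \<epsilon>: "\<epsilon> > 0" "\<And>t. dist t t1 < \<epsilon> \<Longrightarrow> dist (e \<bullet> z t) (e \<bullet> z t1) < - (e \<bullet> z t1) / 2"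
      using cont[of UNIV] e1 unfolding continuous_on_iff by (metis UNIV_I half_gt_zero_iff neg_0_less_iff_less)
    show ?thesis
    proof (rule that[of "min \<epsilon> T / 2"])
      show "0 < min \<epsilon> T / 2" "min \<epsilon> T / 2 < T" using \<epsilon>(1) \<open>0 < T\<close> by (auto simp: min_def)
      fix t assume "t1 \<le> t" "t \<le> t1 + min \<epsilon> T / 2"
      then have "dist t t1 < \<epsilon>" using \<epsilon>(1) \<open>0 < T\<close> by (auto simp: dist_real_def min_def split: if_splits)
      then have "\<bar>e \<bullet> z t - e \<bullet> z t1\<bar> < - (e \<bullet> z t1) / 2" using \<epsilon>(2) by (simp add: dist_real_def)
      then show "e \<bullet> z t \<le> (e \<bullet> z t1) / 2" by linarith
    qed
  qed
  have neg: "(e \<bullet> z t1) / 2 * \<delta> < 0" using e1 \<delta> by (simp add: mult_less_0_iff)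
  have "\<xi> \<bullet> z (t1 + h) - \<xi> \<bullet> z t1 \<le> (e \<bullet> z t1) / 2 * \<delta> * (t1 + h - t1)"
  proof (rule ae_deriv_between(2)[OF y, of t1 "t1 + h" "min m ((e \<bullet> z t1) / 2 * \<delta>)"])
    show "AE t in lebesgue. t \<in> {t1..t1 + h} \<longrightarrow> min m ((e \<bullet> z t1) / 2 * \<delta>) \<le> D t \<and> D t \<le> (e \<bullet> z t1) / 2 * \<delta>"
      using u
    proof eventually_elim
      case (elim t)
      have "D t \<le> (e \<bullet> z t1) / 2 * \<delta>" if "t \<in> {t1..t1 + h}"
      proof -
        have "D t \<le> (e \<bullet> z t) * \<delta>" using D0 elim by blast
        also have "\<dots> \<le> (e \<bullet> z t1) / 2 * \<delta>" by (rule mult_right_mono) (use h(3) that \<delta> in auto)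
        finally show ?thesis .
      qed
      then show ?case using Dm[of t] elim h by auto
    qed
  qed (use h in auto)
  moreover have "\<xi> \<bullet> z (t1 + T) - \<xi> \<bullet> z (t1 + h) \<le> 0 * (t1 + T - (t1 + h))"
  proof (rule ae_deriv_between(2)[OF y, of "t1 + h" "t1 + T" m])
    show "AE t in lebesgue. t \<in> {t1 + h..t1 + T} \<longrightarrow> m \<le> D t \<and> D t \<le> 0"
      using u
    proof eventually_elim
      case (elim t)
      have "(e \<bullet> z t) * \<delta> \<le> 0" using le[of t] \<delta> by (simp add: mult_le_0_iff)
      then show ?case using Dm[of t] D0[of t] elim h by auto
    qed
  qed (use h m in auto)
  moreover have "(e \<bullet> z t1) / 2 * \<delta> * (t1 + h - t1) < 0" using mult_neg_pos[OF neg h(1)] by simp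
  ultimately show False by (simp add: per)
qed

section \<open>Propagators along the orbit and the normalised pair\<close>

context bang_signs begin

text \<open>Besides \<open>x\<close> and \<open>l\<close>, arbitrary curves that obey the same arcs
  are considered, because uniqueness compares \<open>x\<close> and \<open>l\<close> with all of
  them; accordingly \<open>flow_map\<close> asks one matrix to propagate every \<open>flow\<close>
  and every \<open>coflow\<close>.\<close>

definition flow where
  "flow f \<longleftrightarrow> (\<forall>s r w. bang_interval b c x l s r w \<longrightarrow> f r = mexp (Mw w) (r - s) *v f s)"

definition coflow where
  "coflow g \<longleftrightarrow> (\<forall>s r w. bang_interval b c x l s r w \<longrightarrow> g s = mexp (transpose (Mw w)) (r - s) *v g r)"

definition flow_map where
  "flow_map v s r F \<longleftrightarrow> (\<forall>y. v (F *v y) \<le> (v y :: real)) \<and> (\<forall>f. flow f \<longrightarrow> f r = F *v f s) \<and>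
     (\<forall>g. coflow g \<longrightarrow> g s = transpose F *v g r)"

lemma flow_mapD:
  assumes "flow_map v s r F"
  shows "v (F *v y) \<le> v y" "flow f \<Longrightarrow> f r = F *v f s" "coflow g \<Longrightarrow> g s = transpose F *v g r"
  using assms unfolding flow_map_def by blast+

lemma flow_map_comp:
  assumes F: "flow_map v s m F" and G: "flow_map v m r G"
  shows "flow_map v s r (G ** F)"
  unfolding flow_map_def
proof (intro conjI allI impI)
  fix y
  have "v (G *v (F *v y)) \<le> v y" by (rule order_trans[OF flow_mapD(1)[OF G] flow_mapD(1)[OF F]])
  then show "v ((G ** F) *v y) \<le> v y" by (simp only: matrix_vector_mul_assoc)
next
  fix f assume f: "flow f"
  show "f r = (G ** F) *v f s"
    by (simp only: flow_mapD(2)[OF G f] flow_mapD(2)[OF F f] matrix_vector_mul_assoc)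
next
  fix g assume g: "coflow g"
  show "g s = transpose (G ** F) *v g r"
    by (simp only: flow_mapD(3)[OF F g] flow_mapD(3)[OF G g] matrix_transpose_mul matrix_vector_mul_assoc)
qed

lemma flow_map_bang:
  assumes v: "\<And>w h y. w \<in> {0, 1} \<Longrightarrow> 0 \<le> h \<Longrightarrow> v (mexp (Mw w) h *v y) \<le> v y"
    and bi: "bang_interval b c x l s r w"
  shows "flow_map v s r (mexp (Mw w) (r - s))"
  unfolding flow_map_def
proof (intro conjI allI impI)
  show "v (mexp (Mw w) (r - s) *v y) \<le> v y" for y by (rule v) (use bi in \<open>auto simp: bang_iff\<close>)
  show "f r = mexp (Mw w) (r - s) *v f s" if "flow f" for f using that bi unfolding flow_def by blast
  show "g s = transpose (mexp (Mw w) (r - s)) *v g r" if "coflow g" for g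
    unfolding transpose_mexp using that bi unfolding coflow_def by blast
qed

lemma flow_map_exists:
  assumes v: "\<And>w h y. w \<in> {0, 1} \<Longrightarrow> 0 \<le> h \<Longrightarrow> v (mexp (Mw w) h *v y) \<le> v y" and "s \<le> r"
  shows "\<exists>F. flow_map v s r F"
  using \<open>s \<le> r\<close>
proof (induction rule: Bolzano)
  case (trans s m r)
  then show ?case using flow_map_comp by blast
next
  case (local t)
  obtain e1 where e1: "e1 > 0" "bang_interval b c x l t (t + e1) (wR t)" using right_bang by blast
  obtain e2 where e2: "e2 > 0" "bang_interval b c x l (t - e2) t (wL t)" using left_bang by blast
  show ?case
  proof (intro exI[of _ "min e1 e2"] conjI allI impI)
    fix s r assume sr: "s \<le> t \<and> t \<le> r \<and> r - s < min e1 e2"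
    have "bang_interval b c x l s t (wL t)" by (rule bang_sub[OF e2(2)]) (use sr in auto)
    note F = flow_map_bang[OF v this]
    have "bang_interval b c x l t r (wR t)" by (rule bang_sub[OF e1(2)]) (use sr in auto)
    note G = flow_map_bang[OF v this]
    show "\<exists>F. flow_map v s r F" using flow_map_comp[OF F G] by blast
  qed (use e1 e2 in auto)
qed

end

lemma bang_interval_scaleR:
  assumes "0 < k"
  shows "bang_interval b c (\<lambda>t. k *\<^sub>R x t) l s r w \<longleftrightarrow> bang_interval b c x l s r w"
    and "bang_interval b c x (\<lambda>t. k *\<^sub>R l t) s r w \<longleftrightarrow> bang_interval b c x l s r w"
proof -
  have "0 \<le> k * a \<longleftrightarrow> 0 \<le> a" for a :: real using mult_le_cancel_left_pos[OF assms, of 0 a] by simp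
  moreover have "(b \<bullet> l \<tau>) * (c \<bullet> (k *\<^sub>R x \<tau>)) * (2 * w - 1) = k * ((b \<bullet> l \<tau>) * (c \<bullet> x \<tau>) * (2 * w - 1))"
    "(b \<bullet> (k *\<^sub>R l \<tau>)) * (c \<bullet> x \<tau>) * (2 * w - 1) = k * ((b \<bullet> l \<tau>) * (c \<bullet> x \<tau>) * (2 * w - 1))" for \<tau>
    by (simp_all add: algebra_simps)
  ultimately show "bang_interval b c (\<lambda>t. k *\<^sub>R x t) l s r w \<longleftrightarrow> bang_interval b c x l s r w"
    "bang_interval b c x (\<lambda>t. k *\<^sub>R l t) s r w \<longleftrightarrow> bang_interval b c x l s r w"
    unfolding bang_interval_def by presburger+
qed

text \<open>\<open>l\<close> enters through its time reversal, and the control law is recorded only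
  off the zeros of the switching function, a set that \<open>phi_nonzero_ae\<close> shows to be
  negligible.\<close>

locale switched_orbit =
  fixes A :: "real^3^3" and b c :: "real^3" and x l :: "real \<Rightarrow> real^3" and u :: "real \<Rightarrow> real" and T :: real
  assumes T_pos: "0 < T" and x_T: "x (t + T) = x t" and l_T: "l (t + T) = l t"
    and sol_x: "control_solution A b c u x"
    and sol_l: "control_solution (transpose A) c b (\<lambda>t. u (- t)) (\<lambda>t. l (- t))"
    and u_ae: "AE t in lebesgue. (0 < (b \<bullet> l t) * (c \<bullet> x t) \<longrightarrow> u t = 1) \<and> ((b \<bullet> l t) * (c \<bullet> x t) < 0 \<longrightarrow> u t = 0)"
    and ctrl: "controllable_pair A b" "controllable_pair (transpose A) c"
    and rate: "max_growth_rate A b c = 0"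
    and hur: "hurwitz A" "hurwitz (A + outer_product b c)"
    and x_nz: "x t \<noteq> 0" and l_nz: "l t \<noteq> 0"
    and min_T: "(\<And>t. x (t + S) = x t) \<Longrightarrow> (\<And>t. l (t + S) = l t) \<Longrightarrow> \<exists>n::int. S = n * T"
begin

lemma ctrl': "controllable_pair (transpose (transpose A)) b"
  using ctrl(1) by simp

sublocale bang_signs A b c x l
proof
  fix t
  note S = control_solution_signs[OF sol_x ctrl(2) x_nz] and L = control_solution_signs[OF sol_l ctrl' l_nz]
  show "sgR A c (x t) \<noteq> 0" "sgL A c (x t) \<noteq> 0" by (rule S(1), rule S(2))
  show "\<exists>r>0. \<forall>h. 0 < h \<and> h < r \<longrightarrow> sgn (c \<bullet> x (t + h)) = sgR A c (x t) \<and> sgn (c \<bullet> x (t - h)) = sgL A c (x t)"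
    by (rule S(3))
  show "sgR (transpose A) b (l t) \<noteq> 0" "sgL (transpose A) b (l t) \<noteq> 0"
    using L(1)[of "- t"] L(2)[of "- t"] unfolding minus_minus .
  have eq: "- (- t + h) = t - h" "- (- t - h) = t + h" for h by simp_all
  show "\<exists>r>0. \<forall>h. 0 < h \<and> h < r \<longrightarrow>
      sgn (b \<bullet> l (t - h)) = sgR (transpose A) b (l t) \<and> sgn (b \<bullet> l (t + h)) = sgL (transpose A) b (l t)"
    using L(3)[of "- t"] unfolding eq minus_minus .
qed

text \<open>The one-sided signs isolate the zeros, so a compact interval contains finitely
  many.\<close>

lemma phi_nonzero_ae: "AE t in lebesgue. t \<in> {s..r} \<longrightarrow> q t * p t \<noteq> 0"
proof -
  have "\<not> t islimpt {t. q t * p t = 0}" for t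
  proof -
    obtain e1 where e1: "e1 > 0" "\<And>h. 0 < h \<Longrightarrow> h < e1 \<Longrightarrow> sgn (p (t + h)) = sgR A c (x t) \<and> sgn (q (t + h)) = sgL Q b (l t)"
      using right_signs by blast
    obtain e2 where e2: "e2 > 0" "\<And>h. 0 < h \<Longrightarrow> h < e2 \<Longrightarrow> sgn (p (t - h)) = sgL A c (x t) \<and> sgn (q (t - h)) = sgR Q b (l t)"
      using left_signs by blast
    have nz: "q \<tau> * p \<tau> \<noteq> 0" if \<tau>: "\<tau> \<noteq> t" "\<bar>\<tau> - t\<bar> < min e1 e2" for \<tau>
    proof -
      have "sgn (p \<tau>) \<noteq> 0 \<and> sgn (q \<tau>) \<noteq> 0"
      proof (cases "t < \<tau>")
        case True
        then show ?thesis using e1(2)[of "\<tau> - t"] \<tau> sg_x(1)[of t] sg_l(2)[of t] by auto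
      next
        case False
        then show ?thesis using e2(2)[of "t - \<tau>"] \<tau> sg_x(2)[of t] sg_l(1)[of t] by auto
      qed
      then show ?thesis by auto
    qed
    show ?thesis
    proof
      assume "t islimpt {t. q t * p t = 0}"
      moreover have "0 < min e1 e2" using e1 e2 by simp
      ultimately obtain \<tau> where "\<tau> \<in> {t. q t * p t = 0}" "\<tau> \<noteq> t" "\<bar>\<tau> - t\<bar> < min e1 e2"
        unfolding islimpt_approachable_real by blast
      then show False using nz by blast
    qed
  qed
  then have "finite ({s..r} \<inter> {t. q t * p t = 0})"
    by (intro finite_not_islimpt_in_compact) auto
  then have "{s..r} \<inter> {t. q t * p t = 0} \<in> null_sets lebesgue"
    using negligible_finite negligible_iff_null_sets by blast
  from AE_not_in[OF this] show ?thesis by eventually_elim auto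
qed

lemma control_ae:
  assumes bi: "bang_interval b c x l s r w"
  shows "AE t in lebesgue. t \<in> {s<..<r} \<longrightarrow> u t = w"
  using u_ae phi_nonzero_ae[of s r]
proof eventually_elim
  case (elim t)
  show ?case
  proof
    assume t: "t \<in> {s<..<r}"
    then have "0 \<le> q t * p t * (2 * w - 1)" "w \<in> {0, 1}" using bi by (auto simp: bang_iff)
    moreover have "q t * p t \<noteq> 0" using elim(2) t by simp
    ultimately show "u t = w" using elim(1) unfolding p_def q_def by (auto simp: not_less)
  qed
qed

lemma flow_x: "flow x"
  unfolding flow_def
proof (intro allI impI)
  fix s r w assume bi: "bang_interval b c x l s r w"
  show "x r = mexp (Mw w) (r - s) *v x s"
    by (rule control_solution_arc[OF sol_x control_ae[OF bi]]) (use bi in \<open>simp add: bang_iff\<close>)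
qed

lemma coflow_l: "coflow l"
  unfolding coflow_def
proof (intro allI impI)
  fix s r w assume bi: "bang_interval b c x l s r w"
  have ae: "AE t in lebesgue. t \<in> {- r<..<- s} \<longrightarrow> u (- t) = w"
    using AE_reflect[OF control_ae[OF bi]] by eventually_elim auto
  have "l (- (- s)) = mexp (switched_matrix Q c b w) (- s - - r) *v l (- (- r))"
    by (rule control_solution_arc[OF sol_l ae]) (use bi in \<open>simp add: bang_iff\<close>)
  then show "l s = mexp (transpose (Mw w)) (r - s) *v l r" by (simp add: transpose_switched_matrix)
qed

lemma bang_T:
  assumes "bang_interval b c x l s r w"
  shows "bang_interval b c x l (s + T) (r + T) w"
  unfolding bang_interval_def
proof (intro conjI allI impI)
  show "s + T \<le> r + T" "w \<in> {0, 1}" using assms by (simp_all add: bang_interval_def)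
  fix \<tau> assume "s + T < \<tau> \<and> \<tau> < r + T"
  then have "0 \<le> (b \<bullet> l (\<tau> - T)) * (c \<bullet> x (\<tau> - T)) * (2 * w - 1)" using assms by (simp add: bang_interval_def)
  then show "0 \<le> (b \<bullet> l \<tau>) * (c \<bullet> x \<tau>) * (2 * w - 1)" using x_T[of "\<tau> - T"] l_T[of "\<tau> - T"] by simp
qed

lemma hurwitz_Mw: "w \<in> {0, 1} \<Longrightarrow> hurwitz (Mw w)"
  using hur by (auto simp: switched_matrix_def)

lemma bc_nz: "b \<noteq> 0" "c \<noteq> 0"
proof -
  have "axis 1 1 \<noteq> (0 :: real^3)" by simp
  then show "b \<noteq> 0" "c \<noteq> 0"
    using controllable_pair_observable[OF ctrl', of "axis 1 1"] controllable_pair_observable[OF ctrl(2), of "axis 1 1"]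
    by auto
qed

lemma shift_nat: "f (t + real n * T) = f t" if "\<And>t. f (t + T) = f t" for f :: "real \<Rightarrow> 'a"
  using periodic_int[of f T t "int n", OF that] by simp

lemma later: "\<exists>n::nat. s \<le> t + real n * T"
proof -
  obtain n :: nat where "(s - t) / T < real n" using reals_Archimedean2 by blast
  then show ?thesis using T_pos by (intro exI[of _ n]) (simp add: field_simps)
qed

text \<open>Non-increasing and periodic.\<close>

lemma extremal_norm_const:
  assumes v: "\<And>w h y. w \<in> {0, 1} \<Longrightarrow> 0 \<le> h \<Longrightarrow> v (mexp (Mw w) h *v y) \<le> (v y :: real)"
  shows "v (x t) = v (x s)"
proof -
  have le: "v (x t) \<le> v (x s)" for s t
  proof -
    obtain n :: nat where n: "s \<le> t + real n * T" using later by blast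
    obtain F where F: "flow_map v s (t + real n * T) F" using flow_map_exists[OF v n] by blast
    have "x (t + real n * T) = F *v x s" by (rule flow_mapD(2)[OF F flow_x])
    then have "x t = F *v x s" by (simp only: shift_nat[of x, OF x_T])
    then show ?thesis using flow_mapD(1)[OF F] by simp
  qed
  show ?thesis by (rule order_antisym[OF le le])
qed

text \<open>Hurwitz matrices of order three have negative determinant, which excludes a constant
  sign; the opposite sign comes from \<open>- x\<close>, and \<open>l\<close> is treated in reversed
  time.\<close>

lemma sign_p: "\<exists>t. 0 < p t" "\<exists>t. p t < 0" and sign_q: "\<exists>t. 0 < q t" "\<exists>t. q t < 0"
proof -
  obtain e where e: "e > 0" "\<And>h. 0 < h \<Longrightarrow> h < e \<Longrightarrow> sgn (p (0 + h)) = sgR A c (x 0) \<and> sgn (q (0 + h)) = sgL Q b (l 0)"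
    using right_signs by blast
  define t1 where "t1 = e / 2"
  have nz: "c \<bullet> x t1 \<noteq> 0" "b \<bullet> l t1 \<noteq> 0"
    using e(2)[of t1] e(1) sg_x(1)[of 0] sg_l(2)[of 0] by (auto simp: t1_def p_def q_def)
  have dA: "det A < 0" "det (A + outer_product b c) < 0" by (intro hurwitz_det_neg hur)+
  have "det (transpose (A + outer_product b c)) < 0" using dA(2) by (simp only: det_transpose)
  moreover have "transpose (A + outer_product b c) = Q + outer_product c b"
    by (simp add: vec_eq_iff transpose_def outer_product_def mult.commute)
  ultimately have dQ: "det Q < 0" "det (Q + outer_product c b) < 0" using dA(1) by (simp_all only: det_transpose)
  show "\<exists>t. 0 < p t" unfolding p_def
    by (rule control_solution_reaches_positive[OF sol_x x_T T_pos dA nz(1)])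
  have "\<exists>t. 0 < c \<bullet> (- 1 *\<^sub>R x t)"
    by (rule control_solution_reaches_positive[OF control_solution_scale[OF sol_x] _ T_pos dA, where ?t1.0 = t1])
      (simp_all add: x_T nz)
  then show "\<exists>t. p t < 0" by (simp add: p_def)
  have lT: "l (- (- t1 + T)) = l (- (- t1))" using l_T[of "t1 - T"] by simp
  have "\<exists>t. 0 < b \<bullet> l (- t)"
    by (rule control_solution_reaches_positive[OF sol_l lT T_pos dQ]) (simp add: nz)
  then show "\<exists>t. 0 < q t" by (auto simp: q_def)
  have "\<exists>t. 0 < b \<bullet> (- 1 *\<^sub>R l (- t))"
    by (rule control_solution_reaches_positive[OF control_solution_scale[OF sol_l] _ T_pos dQ, where ?t1.0 = "- t1"])
      (simp_all add: lT[simplified] nz)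
  then show "\<exists>t. q t < 0" by (auto simp: q_def)
qed

text \<open>The base point \<open>m\<close> is the middle of a bang interval of length
  \<open>2 * m\<close>, so the period map \<open>F\<close> from \<open>m\<close> begins and ends
  with arcs of the same control. This leaves room to lengthen, shorten and interrupt the first arc,
  and the fixed space of \<open>F\<close> is a line.\<close>

lemma orbit_core:
  assumes v: "is_norm v" and v_x: "\<And>t. v (x t) = 1"
    and contr: "\<And>w h y. w \<in> {0, 1} \<Longrightarrow> 0 \<le> h \<Longrightarrow> v (mexp (Mw w) h *v y) \<le> (v y :: real)"
  obtains k where "0 < k" "\<And>t. l t \<bullet> x t = k" "\<And>t y. l t \<bullet> y \<le> k * v y"
    "\<And>f. flow f \<Longrightarrow> (\<And>t. f (t + T) = f t) \<Longrightarrow> \<exists>k. \<forall>t. f t = k *\<^sub>R x t"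
    "\<And>g. coflow g \<Longrightarrow> (\<And>t. g (t + T) = g t) \<Longrightarrow> \<exists>k. \<forall>t. g t = k *\<^sub>R l t"
proof -
  obtain e1 where e1: "e1 > 0" "bang_interval b c x l 0 (0 + e1) (wR 0)" using right_bang by blast
  obtain e2 where e2: "e2 > 0" "\<And>h. 0 < h \<Longrightarrow> h < e2 \<Longrightarrow> sgn (p (0 + h)) = sgR A c (x 0) \<and> sgn (q (0 + h)) = sgL Q b (l 0)"
    using right_signs by blast
  define w where "w = wR 0"
  have w: "w \<in> {0, 1}" unfolding w_def by (rule wR_01)
  define M where "M = Mw w"
  define e where "e = min e1 (min e2 T)"
  define m where "m = e / 2"
  have e: "0 < e" "e \<le> T" "e \<le> e2" and m: "0 < m" "m < e" "e - m = m" "m < T"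
    using e1(1) e2(1) T_pos by (auto simp: e_def m_def)
  have bi: "bang_interval b c x l 0 e w" unfolding w_def by (rule bang_sub[OF e1(2)]) (use e in \<open>auto simp: e_def\<close>)
  have b0: "bang_interval b c x l 0 m w" by (rule bang_sub[OF bi]) (use m in auto)
  have b1: "bang_interval b c x l m e w" by (rule bang_sub[OF bi]) (use m in auto)
  have b2: "bang_interval b c x l T (m + T) w" using bang_T[OF b0] by simp
  have nz: "p m \<noteq> 0" "q m \<noteq> 0" using e2(2)[of m] m e sg_x(1)[of 0] sg_l(2)[of 0] by auto
  obtain G where G: "flow_map v e T G" using flow_map_exists[OF contr e(2)] by blast
  \<comment> \<open>The arcs from \<open>m\<close> to \<open>e\<close> and from \<open>T\<close> to
    \<open>m + T\<close> are the outer factors; \<open>G\<close> covers the rest of the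
    period.\<close>
  define F where "F = mexp M m ** (G ** mexp M m)"
  have E1: "flow_map v m e (mexp M m)" using flow_map_bang[OF contr b1] by (simp add: m(3) M_def)
  have E2: "flow_map v T (m + T) (mexp M m)" using flow_map_bang[OF contr b2] by (simp add: M_def)
  have F: "flow_map v m (m + T) F" unfolding F_def by (rule flow_map_comp[OF flow_map_comp[OF E1 G] E2])
  have FM: "v (F *v (mexp M h *v z)) \<le> v (mexp M (m + h) *v z)" for h z
  proof -
    have "F *v (mexp M h *v z) = mexp M m *v (G *v (mexp M (m + h) *v z))"
      by (simp add: F_def mexp_add matrix_vector_mul_assoc[symmetric])
    then show ?thesis using order_trans[OF contr[OF w less_imp_le[OF m(1)]] flow_mapD(1)[OF G]] by (simp add: M_def)
  qed
  \<comment> \<open>\<open>F\<close> starts with \<open>mexp M m\<close>, so preceding it by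
    \<open>mexp M h\<close> leaves a genuine arc of length \<open>m + h\<close> even when
    \<open>h\<close> is negative.\<close>
  have con: "v (F *v (mexp M h *v y)) \<le> v y" if "\<bar>h\<bar> \<le> m / 2" for h y
  proof -
    have "0 \<le> m + h" using that m(1) by linarith
    from contr[OF w this, of y] have "v (mexp M (m + h) *v y) \<le> v y" unfolding M_def .
    with FM show ?thesis by (rule order_trans)
  qed
  define M' where "M' = Mw (1 - w)"
  have M': "M' *v y = M *v y + ((1 - 2 * w) * (c \<bullet> y)) *\<^sub>R b" for y
  proof -
    have "(1 - w) * (c \<bullet> y) = w * (c \<bullet> y) + (1 - 2 * w) * (c \<bullet> y)" by (simp add: algebra_simps)
    then show ?thesis unfolding M'_def M_def switched_matrix_mult by (simp only: scaleR_add_left add.assoc)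
  qed
  have w': "1 - w \<in> {0, 1}" using w by auto
  have fixed: "\<exists>k. y = k *\<^sub>R x m" if "F *v y = y" for y
  proof (rule extremal_fixed_space[where R = "(*v) F" and M = M and M' = M' and \<sigma> = "1 - 2 * w" and b = b and c = c and v = v])
    show "is_norm v" by (rule v)
    show "0 < m / 2" using m by simp
    show "v (F *v (mexp M h *v y)) \<le> v y" if "\<bar>h\<bar> \<le> m / 2" for h y by (rule con[OF that])
    show "v (F *v (mexp M (- (h + \<delta>)) *v (mexp M' \<delta> *v (mexp M h *v y)))) \<le> v y"
      if h: "0 \<le> h" "h \<le> m / 2" "0 \<le> \<delta>" "\<delta> \<le> m / 2" for h \<delta> y
    proof -
      \<comment> \<open>The backward time \<open>h + \<delta>\<close> is taken out of the initial
        arc of \<open>F\<close>, which is long enough as both numbers are at most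
        \<open>m / 2\<close>.\<close>
      have "0 \<le> m + - (h + \<delta>)" using h by linarith
      have "v (F *v (mexp M (- (h + \<delta>)) *v (mexp M' \<delta> *v (mexp M h *v y)))) \<le> v (mexp M' \<delta> *v (mexp M h *v y))"
        by (rule order_trans[OF FM]) (unfold M_def, rule contr[OF w \<open>0 \<le> m + - (h + \<delta>)\<close>])
      also have "\<dots> \<le> v (mexp M h *v y)" unfolding M'_def by (rule contr[OF w' h(3)])
      also have "\<dots> \<le> v y" unfolding M_def by (rule contr[OF w h(1)])
      finally show ?thesis .
    qed
    show "M' *v y = M *v y + ((1 - 2 * w) * (c \<bullet> y)) *\<^sub>R b" for y by (rule M')
    show "1 - 2 * w \<noteq> 0" using w by auto
    show "b \<noteq> 0" "c \<noteq> 0" by (rule bc_nz)+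
    show "p' = 0" if "M *v p' = (- \<omega>) *\<^sub>R q'" "M *v q' = \<omega> *\<^sub>R p'" for p' q' \<omega>
      using hurwitz_no_unstable_eigenvalue[OF hurwitz_Mw[OF w], of 0 p' \<omega> q'] that by (simp add: M_def)
    have "x (m + T) = F *v x m" by (rule flow_mapD(2)[OF F flow_x])
    then show "F *v x m = x m" by (simp add: x_T)
  qed (use x_nz that in auto)
  obtain P where P: "linear P" "\<And>y. v (P y) \<le> v y" "\<And>y. F *v P y = P y" "\<And>y. P (F *v y) = P y"
    "\<And>y. F *v y = y \<Longrightarrow> P y = y"
  proof (rule mean_ergodic_projection[of v "(*v) F"])
    show "v (F *v y) \<le> v y" for y by (rule flow_mapD(1)[OF F])
  qed (use v in \<open>auto intro: matrix_vector_mul_linear\<close>)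
  \<comment> \<open>The projection has rank one and \<open>\<Lambda>\<close> is its coefficient; it
    will turn out to be the supporting functional at \<open>x m\<close> of which \<open>l m\<close>
    is a positive multiple.\<close>
  define \<Lambda> where "\<Lambda> y = (x m \<bullet> P y) / (x m \<bullet> x m)" for y
  have xm: "x m \<bullet> x m \<noteq> 0" using x_nz by simp
  have PL: "P y = \<Lambda> y *\<^sub>R x m" for y
  proof -
    obtain k where k: "P y = k *\<^sub>R x m" using fixed[OF P(3)] by blast
    then show ?thesis using xm by (simp add: \<Lambda>_def)
  qed
  have L_le: "\<bar>\<Lambda> y\<bar> \<le> v y" for y
    using P(2)[of y] unfolding PL is_normD(3)[OF v] v_x by simp
  \<comment> \<open>The transposed period map fixes only multiples of \<open>\<Lambda>\<close>:
    \<open>F - 1 + P\<close> is injective, hence onto, and an invariant functional sees only its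
    contribution in the range of \<open>P\<close>.\<close>
  have fun_fixed: "\<eta> \<bullet> y = \<Lambda> y * (\<eta> \<bullet> x m)" if \<eta>: "\<And>y. \<eta> \<bullet> (F *v y) = \<eta> \<bullet> y" for \<eta> y
  proof -
    define R where "R y = F *v y - y + P y" for y
    have lin: "linear R" unfolding R_def
      by (intro linear_compose_add linear_compose_sub P(1) linear_ident matrix_vector_mul_linear)
    have PP: "P (P y) = P y" for y by (rule P(5)[OF P(3)])
    have PR: "P (R y) = P y" for y
      by (simp add: R_def linear_add[OF P(1)] linear_diff[OF P(1)] P(4) PP)
    have "inj R" unfolding linear_injective_0[OF lin]
    proof (intro allI impI)
      fix y assume "R y = 0"
      then have "P y = 0" using PR[of y] linear_0[OF P(1)] by simp
      then have "F *v y = y" using \<open>R y = 0\<close> by (simp add: R_def)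
      from P(5)[OF this] show "y = 0" using \<open>P y = 0\<close> by simp
    qed
    then have "surj R" by (rule linear_injective_imp_surjective[OF lin]) (rule refl)
    then obtain z where z: "y = R z" by (rule surjE)
    have "\<eta> \<bullet> R z = \<eta> \<bullet> P z" unfolding R_def by (simp add: inner_add_right inner_diff_right \<eta>)
    also have "P z = P y" unfolding z PR ..
    finally show ?thesis unfolding z[symmetric] PL by simp
  qed
  have cofix: "g m \<bullet> y = \<Lambda> y * (g m \<bullet> x m)" if g: "coflow g" "\<And>t. g (t + T) = g t" for g y
  proof (rule fun_fixed)
    have "g m = transpose F *v g m" using flow_mapD(3)[OF F g(1)] unfolding g(2) .
    then show "g m \<bullet> (F *v y) = g m \<bullet> y" for y using inner_transpose[of "g m" F y] by simp
  qed
  define k where "k = l m \<bullet> x m"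
  have lk: "l m \<bullet> y = \<Lambda> y * k" for y unfolding k_def by (rule cofix[OF coflow_l l_T])
  have "k \<noteq> 0"
  proof
    assume "k = 0"
    then have "l m \<bullet> l m = 0" using lk[of "l m"] by simp
    then show False using l_nz[of m] by simp
  qed
  have Lx: "\<Lambda> (x m) = 1" using lk[of "x m"] \<open>k \<noteq> 0\<close> by (simp add: k_def)
  define \<eta> where "\<eta> = (1 / k) *\<^sub>R l m"
  have \<eta>: "\<eta> \<bullet> y = \<Lambda> y" for y using lk[of y] \<open>k \<noteq> 0\<close> by (simp add: \<eta>_def)
  have d: "((\<lambda>h. \<eta> \<bullet> (mexp N h *v x m)) has_real_derivative \<eta> \<bullet> (N *v x m)) (at 0)" for N
    using bounded_linear.has_vector_derivative[OF bounded_linear_inner_right[of \<eta>] mexp_deriv[of N "x m" 0 UNIV]]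
    by (simp add: has_real_derivative_iff_has_vector_derivative)
  have max: "\<eta> \<bullet> (mexp M h *v x m) \<le> 1" if h: "\<bar>h\<bar> < m" for h
  proof -
    have "mexp M h *v x m = x (m + h)"
    proof (cases "0 \<le> h")
      case True
      have "bang_interval b c x l m (m + h) w" by (rule bang_sub[OF bi]) (use h m True in auto)
      then have "x (m + h) = mexp (Mw w) (m + h - m) *v x m" using flow_x unfolding flow_def by blast
      then show ?thesis by (simp add: M_def)
    next
      case False
      have "bang_interval b c x l (m + h) m w" by (rule bang_sub[OF bi]) (use h m False in auto)
      then have "x m = mexp (Mw w) (m - (m + h)) *v x (m + h)" using flow_x unfolding flow_def by blast
      then show ?thesis by (simp add: M_def)
    qed
    then show ?thesis using L_le[of "x (m + h)"] by (simp add: \<eta> v_x)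
  qed
  have 0: "\<eta> \<bullet> (M *v x m) = 0"
    by (rule DERIV_local_max[OF d m(1)]) (use max Lx in \<open>simp add: \<eta>\<close>)
  have le: "\<eta> \<bullet> (M' *v x m) \<le> 0"
  proof (rule ccontr)
    assume "\<not> ?thesis"
    then obtain r where r: "r > 0" "\<And>h. 0 < h \<Longrightarrow> h < r \<Longrightarrow> \<eta> \<bullet> x m < \<eta> \<bullet> (mexp M' h *v x m)"
      using DERIV_pos_inc_right[OF d[of M']] by auto
    have "\<eta> \<bullet> (mexp M' (r / 2) *v x m) \<le> v (mexp M' (r / 2) *v x m)"
      unfolding \<eta> using L_le[of "mexp M' (r / 2) *v x m"] by simp
    also have "\<dots> \<le> v (x m)" unfolding M'_def by (rule contr[OF w']) (use r(1) in simp)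
    finally show False using r(2)[of "r / 2"] r(1) Lx by (simp add: v_x \<eta>)
  qed
  \<comment> \<open>The support inequality gives the sign of \<open>q m / k\<close> relative to the
    control, and the bang law gives the sign of \<open>q m\<close>; comparison yields
    \<open>k > 0\<close>.\<close>
  have "(1 - 2 * w) * p m * (\<eta> \<bullet> b) \<le> 0"
    using le 0 unfolding M' by (simp add: inner_add_right p_def)
  moreover have "\<eta> \<bullet> b = q m / k" by (simp add: \<eta>_def q_def inner_commute)
  ultimately have "(1 - 2 * w) * p m * q m / k \<le> 0" by simp
  moreover have "(1 - 2 * w) * p m * q m < 0"
  proof -
    have "0 \<le> q m * p m * (2 * w - 1)" using bi m by (simp add: bang_iff)
    then have "(1 - 2 * w) * p m * q m \<le> 0" by (simp add: algebra_simps)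
    moreover have "(1 - 2 * w) * p m * q m \<noteq> 0" using nz w by auto
    ultimately show ?thesis by (rule order_le_neq_trans)
  qed
  ultimately have "0 < k" using \<open>k \<noteq> 0\<close> by (simp add: divide_le_0_iff)
  \<comment> \<open>Every time is followed by a translate of \<open>m\<close>, so what is known
    about functionals at \<open>m\<close> can be pulled back to all times.\<close>
  have onward: "\<exists>n H. flow_map v t (m + real n * T) H" for t
  proof -
    obtain n :: nat where n: "t \<le> m + real n * T" using later by blast
    show ?thesis using flow_map_exists[OF contr n] by blast
  qed
  have lt: "\<exists>H. x m = H *v x t \<and> (\<forall>y. v (H *v y) \<le> v y) \<and> (\<forall>g. coflow g \<longrightarrow> (\<forall>t. g (t + T) = g t) \<longrightarrow> g t = transpose H *v g m)" for t
  proof -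
    obtain n H where H: "flow_map v t (m + real n * T) H" using onward by blast
    have "x m = H *v x t" using flow_mapD(2)[OF H flow_x] by (simp only: shift_nat[of x, OF x_T])
    moreover have "g t = transpose H *v g m" if g: "coflow g" "\<forall>t. g (t + T) = g t" for g
    proof -
      have "g (m + real n * T) = g m" by (rule shift_nat) (use g(2) in blast)
      then show ?thesis using flow_mapD(3)[OF H g(1)] by simp
    qed
    ultimately show ?thesis using flow_mapD(1)[OF H] by blast
  qed
  have ltl: "\<exists>H. x m = H *v x t \<and> (\<forall>y. v (H *v y) \<le> v y) \<and> (\<forall>y. l t \<bullet> y = l m \<bullet> (H *v y))" for t
  proof -
    obtain H where H: "x m = H *v x t" "\<forall>y. v (H *v y) \<le> v y" "l t = transpose H *v l m"
      using lt[of t] coflow_l l_T by blast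
    have "l t \<bullet> y = l m \<bullet> (H *v y)" for y unfolding H(3) by (rule inner_transpose[symmetric])
    then show ?thesis using H by blast
  qed
  show ?thesis
  proof (rule that[OF \<open>0 < k\<close>])
    show "l t \<bullet> x t = k" for t
    proof -
      obtain H where "x m = H *v x t" "\<forall>y. l t \<bullet> y = l m \<bullet> (H *v y)" using ltl[of t] by blast
      then show ?thesis by (simp add: k_def)
    qed
    show "l t \<bullet> y \<le> k * v y" for t y
    proof -
      obtain H where H: "\<forall>y. v (H *v y) \<le> v y" "\<forall>y. l t \<bullet> y = l m \<bullet> (H *v y)" using ltl[of t] by blast
      have "\<Lambda> (H *v y) \<le> v y" using L_le[of "H *v y"] H(1)[rule_format, of y] by linarith
      then have "k * \<Lambda> (H *v y) \<le> k * v y" using \<open>0 < k\<close> by simp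
      then show ?thesis using H(2) lk[of "H *v y"] by (simp add: mult.commute)
    qed
    show "\<exists>k. \<forall>t. f t = k *\<^sub>R x t" if f: "flow f" "\<And>t. f (t + T) = f t" for f
    proof -
      have "F *v f m = f m" using flow_mapD(2)[OF F f(1)] unfolding f(2) by (rule sym)
      then obtain k where k: "f m = k *\<^sub>R x m" using fixed by blast
      have "f t = k *\<^sub>R x t" for t
      proof -
        obtain n :: nat where n: "m \<le> t + real n * T" using later by blast
        obtain H where H: "flow_map v m (t + real n * T) H" using flow_map_exists[OF contr n] by blast
        have "f t = H *v f m" using flow_mapD(2)[OF H f(1)] by (simp only: shift_nat[of f, OF f(2)])
        moreover have "x t = H *v x m" using flow_mapD(2)[OF H flow_x] by (simp only: shift_nat[of x, OF x_T])
        ultimately show ?thesis by (simp add: k matrix_vector_mult_scaleR)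
      qed
      then show ?thesis by blast
    qed
    show "\<exists>k. \<forall>t. g t = k *\<^sub>R l t" if g: "coflow g" "\<And>t. g (t + T) = g t" for g
    proof -
      define k' where "k' = (g m \<bullet> x m) / k"
      have "(g m - k' *\<^sub>R l m) \<bullet> y = 0" for y
        using cofix[OF g, of y] lk[of y] \<open>k \<noteq> 0\<close> by (simp add: inner_diff_left k'_def)
      from this[of "g m - k' *\<^sub>R l m"] have gm: "g m = k' *\<^sub>R l m" by simp
      have "g t = k' *\<^sub>R l t" for t
      proof -
        obtain H where H: "\<forall>g. coflow g \<longrightarrow> (\<forall>t. g (t + T) = g t) \<longrightarrow> g t = transpose H *v g m" using lt[of t] by blast
        have "g t = transpose H *v g m" "l t = transpose H *v l m" using H g coflow_l l_T by blast+
        then show ?thesis by (simp only: gm matrix_vector_mult_scaleR)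
      qed
      then show ?thesis by blast
    qed
  qed
qed

lemma bang_pair_if:
  assumes v: "is_norm v" and v_x: "\<And>t. v (x t) = 1"
    and contr: "\<And>w h y. w \<in> {0, 1} \<Longrightarrow> 0 \<le> h \<Longrightarrow> v (mexp (Mw w) h *v y) \<le> (v y :: real)"
    and l_x: "\<And>t. l t \<bullet> x t = 1" and l_le: "\<And>t y. l t \<bullet> y \<le> v y"
    and uniq: "\<And>f. flow f \<Longrightarrow> (\<And>t. f (t + T) = f t) \<Longrightarrow> \<exists>k. \<forall>t. f t = k *\<^sub>R x t"
      "\<And>g. coflow g \<Longrightarrow> (\<And>t. g (t + T) = g t) \<Longrightarrow> \<exists>k. \<forall>t. g t = k *\<^sub>R l t"
  shows "bang_pair A b c x l v T"
proof
  show "0 < T" by (rule T_pos)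
  show "x (t + T) = x t" "l (t + T) = l t" for t by (rule x_T, rule l_T)
  show "continuous_on UNIV x" using sol_x ae_deriv_continuous unfolding control_solution_def by blast
  have "continuous_on UNIV (\<lambda>t. l (- t))" using sol_l ae_deriv_continuous unfolding control_solution_def by blast
  from continuous_on_compose2[OF this, of UNIV uminus] show "continuous_on UNIV l" by (simp add: continuous_on_minus)
  show "x r = mexp (Mw w) (r - s) *v x s" if "bang_interval b c x l s r w" for s r w
    using that flow_x unfolding flow_def by blast
  show "l s = mexp (transpose (Mw w)) (r - s) *v l r" if "bang_interval b c x l s r w" for s r w
    using that coflow_l unfolding coflow_def by blast
  show "y = 0" if "w \<in> {0, 1}" "Mw w *v y = 0" for w y
    using hurwitz_no_unstable_eigenvalue[OF hurwitz_Mw[OF that(1)], of 0 y 0 0] that(2) by simp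
  show "is_norm v" by (rule v)
  show "v (mexp (Mw w) h *v y) \<le> v y" if "w \<in> {0, 1}" "0 \<le> h" for w h y by (rule contr[OF that])
  show "v (x t) = 1" "l t \<bullet> x t = 1" "l t \<bullet> y \<le> v y" for t y by (rule v_x, rule l_x, rule l_le)
  show "\<exists>k. \<forall>t. f t = k *\<^sub>R x t" if "\<And>t. f (t + T) = f t"
    "\<And>s r w. bang_interval b c x l s r w \<Longrightarrow> f r = mexp (Mw w) (r - s) *v f s" for f
    by (rule uniq(1)) (use that in \<open>auto simp: flow_def\<close>)
  show "\<exists>k. \<forall>t. f t = k *\<^sub>R l t" if "\<And>t. f (t + T) = f t"
    "\<And>s r w. bang_interval b c x l s r w \<Longrightarrow> f s = mexp (transpose (Mw w)) (r - s) *v f r" for f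
    by (rule uniq(2)) (use that in \<open>auto simp: coflow_def\<close>)
  show "\<exists>n::int. S = n * T" if "\<And>t. x (t + S) = x t" "\<And>t. l (t + S) = l t" for S by (rule min_T[OF that])
  show "\<exists>t. 0 < c \<bullet> x t" "\<exists>t. c \<bullet> x t < 0" "\<exists>t. 0 < b \<bullet> l t" "\<exists>t. b \<bullet> l t < 0"
    using sign_p sign_q unfolding p_def q_def by blast+
qed

end

lemma switched_orbit_scale:
  assumes so: "switched_orbit A b c x l u T" and k: "0 < k" "0 < k'"
  shows "switched_orbit A b c (\<lambda>t. k *\<^sub>R x t) (\<lambda>t. k' *\<^sub>R l t) u T"
proof -
  interpret switched_orbit A b c x l u T by (rule so)
  show ?thesis
  proof
    show "control_solution A b c u (\<lambda>t. k *\<^sub>R x t)" by (rule control_solution_scale[OF sol_x])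
    show "control_solution Q c b (\<lambda>t. u (- t)) (\<lambda>t. k' *\<^sub>R l (- t))" by (rule control_solution_scale[OF sol_l])
    have kk: "0 < k * k'" using k by simp
    have eq: "(b \<bullet> (k' *\<^sub>R l t)) * (c \<bullet> (k *\<^sub>R x t)) = (k * k') * ((b \<bullet> l t) * (c \<bullet> x t))" for t by simp
    have pos: "0 < (k * k') * a \<longleftrightarrow> 0 < a" "(k * k') * a < 0 \<longleftrightarrow> a < 0" for a
      using mult_less_cancel_left_pos[OF kk, of 0 a] mult_less_cancel_left_pos[OF kk, of a 0] by simp_all
    show "AE t in lebesgue. (0 < (b \<bullet> (k' *\<^sub>R l t)) * (c \<bullet> (k *\<^sub>R x t)) \<longrightarrow> u t = 1) \<and>
        ((b \<bullet> (k' *\<^sub>R l t)) * (c \<bullet> (k *\<^sub>R x t)) < 0 \<longrightarrow> u t = 0)"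
      unfolding eq pos by (rule u_ae)
    show "\<exists>n::int. S = n * T" if "\<And>t. k *\<^sub>R x (t + S) = k *\<^sub>R x t" "\<And>t. k' *\<^sub>R l (t + S) = k' *\<^sub>R l t" for S
      by (rule min_T) (use that k in auto)
  qed (use T_pos x_T l_T ctrl rate hur x_nz l_nz k in simp_all)
qed

text \<open>\<open>x\<close> is scaled to the unit sphere of \<open>v\<close> and then
  \<open>l\<close> to unit pairing with \<open>x\<close>; the second factor is available only after
  the first scaling. Positive factors leave the bang intervals unchanged.\<close>

theorem (in switched_orbit) bang_pair_exists:
  obtains k k' v where "0 < k" "0 < k'" "bang_pair A b c (\<lambda>t. k *\<^sub>R x t) (\<lambda>t. k' *\<^sub>R l t) v T"
proof -
  obtain v where v: "is_norm v" "\<And>w h y. w \<in> {0, 1} \<Longrightarrow> 0 \<le> h \<Longrightarrow> v (mexp (Mw w) h *v y) \<le> v y"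
    using extremal_norm_exists[OF ctrl rate] by blast
  define k where "k = 1 / v (x 0)"
  have "v (x 0) \<noteq> 0" "0 \<le> v (x 0)" using x_nz is_normD(1,2)[OF v(1), of "x 0"] by auto
  then have k: "0 < k" by (simp add: k_def)
  interpret S1: switched_orbit A b c "\<lambda>t. k *\<^sub>R x t" "\<lambda>t. 1 *\<^sub>R l t" u T
    by (rule switched_orbit_scale[OF _ k]) (unfold_locales, simp)
  have v_x: "v (k *\<^sub>R x t) = 1" for t
    using extremal_norm_const[of v t 0, OF v(2)] \<open>v (x 0) \<noteq> 0\<close> k by (simp add: is_normD(3)[OF v(1)] k_def)
  obtain \<kappa> where \<kappa>: "0 < \<kappa>" "\<And>t. (1 *\<^sub>R l t) \<bullet> (k *\<^sub>R x t) = \<kappa>" "\<And>t y. (1 *\<^sub>R l t) \<bullet> y \<le> \<kappa> * v y"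
    "\<And>f. S1.flow f \<Longrightarrow> (\<And>t. f (t + T) = f t) \<Longrightarrow> \<exists>j. \<forall>t. f t = j *\<^sub>R k *\<^sub>R x t"
    "\<And>g. S1.coflow g \<Longrightarrow> (\<And>t. g (t + T) = g t) \<Longrightarrow> \<exists>j. \<forall>t. g t = j *\<^sub>R 1 *\<^sub>R l t"
    using S1.orbit_core[OF v(1) v_x v(2)] by blast
  have \<kappa>': "0 < 1 / \<kappa>" using \<kappa>(1) by simp
  interpret S2: switched_orbit A b c "\<lambda>t. k *\<^sub>R x t" "\<lambda>t. (1 / \<kappa>) *\<^sub>R l t" u T
    by (rule switched_orbit_scale[OF _ k \<kappa>']) unfold_locales
  have fl: "S2.flow f \<longleftrightarrow> S1.flow f" "S2.coflow f \<longleftrightarrow> S1.coflow f" for f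
    unfolding S1.flow_def S2.flow_def S1.coflow_def S2.coflow_def
    using bang_interval_scaleR(2)[OF \<kappa>', of b c _ l] bang_interval_scaleR(2)[OF zero_less_one, of b c _ l] by simp_all
  have "bang_pair A b c (\<lambda>t. k *\<^sub>R x t) (\<lambda>t. (1 / \<kappa>) *\<^sub>R l t) v T"
  proof (rule S2.bang_pair_if[OF v(1) v_x v(2)])
    show "(1 / \<kappa>) *\<^sub>R l t \<bullet> k *\<^sub>R x t = 1" for t using \<kappa>(1) \<kappa>(2)[of t] by simp
    show "(1 / \<kappa>) *\<^sub>R l t \<bullet> y \<le> v y" for t y using \<kappa>(1) \<kappa>(3)[of t y] by (simp add: field_simps)
    show "\<exists>j. \<forall>t. f t = j *\<^sub>R k *\<^sub>R x t" if "S2.flow f" "\<And>t. f (t + T) = f t" for f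
      by (rule \<kappa>(4)) (use that fl in auto)
    show "\<exists>j. \<forall>t. g t = j *\<^sub>R (1 / \<kappa>) *\<^sub>R l t" if g: "S2.coflow g" "\<And>t. g (t + T) = g t" for g
    proof -
      obtain j where j: "\<forall>t. g t = j *\<^sub>R 1 *\<^sub>R l t" using \<kappa>(5)[of g] g fl by auto
      then show ?thesis using \<kappa>(1) by (intro exI[of _ "j * \<kappa>"]) simp
    qed
  qed
  then show ?thesis using that[OF k \<kappa>'] by blast
qed

section \<open>Duality\<close>

definition dual_norm :: "('a::euclidean_space \<Rightarrow> real) \<Rightarrow> 'a \<Rightarrow> real" where
  "dual_norm v \<eta> = Sup {\<eta> \<bullet> y | y. v y \<le> 1}"

lemma dual_norm:
  fixes v :: "'a::euclidean_space \<Rightarrow> real"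
  assumes v: "is_norm v"
  shows dual_norm_inner: "\<eta> \<bullet> y \<le> dual_norm v \<eta> * v y" and dual_norm_nonneg: "0 \<le> dual_norm v \<eta>"
    and dual_norm_least: "0 \<le> K \<Longrightarrow> (\<And>y. \<eta> \<bullet> y \<le> K * v y) \<Longrightarrow> dual_norm v \<eta> \<le> K"
proof -
  obtain C where C: "C > 0" "\<And>y. norm y \<le> C * v y" using is_norm_lower[OF v] by blast
  have "\<eta> \<bullet> y \<le> norm \<eta> * C" if "v y \<le> 1" for y
  proof -
    have "\<eta> \<bullet> y \<le> norm \<eta> * norm y" by (rule norm_cauchy_schwarz)
    also have "\<dots> \<le> norm \<eta> * (C * 1)"
      using C(1) that by (intro mult_left_mono order_trans[OF C(2)]) auto
    finally show ?thesis by simp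
  qed
  then have bdd: "bdd_above {\<eta> \<bullet> y | y. v y \<le> 1}" by (auto simp: bdd_above_def)
  have v0: "v 0 = 0" using is_normD(2)[OF v] by simp
  then have ne: "0 \<in> {\<eta> \<bullet> y | y. v y \<le> 1}" by (auto intro!: exI[of _ 0])
  show nn: "0 \<le> dual_norm v \<eta>" unfolding dual_norm_def by (rule cSup_upper[OF ne bdd])
  show "\<eta> \<bullet> y \<le> dual_norm v \<eta> * v y"
  proof (cases "y = 0")
    case False
    then have vy: "0 < v y" using is_normD(1,2)[OF v, of y] by auto
    have "\<eta> \<bullet> ((1 / v y) *\<^sub>R y) \<le> dual_norm v \<eta>"
      unfolding dual_norm_def
    proof (rule cSup_upper[OF _ bdd])
      have "v ((1 / v y) *\<^sub>R y) \<le> 1" using vy by (simp add: is_normD(3)[OF v])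
      then show "\<eta> \<bullet> ((1 / v y) *\<^sub>R y) \<in> {\<eta> \<bullet> y | y. v y \<le> 1}" by blast
    qed
    then show ?thesis using vy by (simp add: field_simps)
  qed (simp add: v0)
  show "dual_norm v \<eta> \<le> K" if K: "0 \<le> K" "\<And>y. \<eta> \<bullet> y \<le> K * v y"
    unfolding dual_norm_def
  proof (rule cSup_least)
    fix a assume "a \<in> {\<eta> \<bullet> y | y. v y \<le> 1}"
    then obtain y where y: "a = \<eta> \<bullet> y" "v y \<le> 1" by blast
    have "K * v y \<le> K * 1" using K(1) y(2) by (rule mult_left_mono[rotated])
    then show "a \<le> K" using K(2)[of y] y(1) by simp
  qed (use ne in blast)
qed

lemma is_norm_dual_norm:
  fixes v :: "'a::euclidean_space \<Rightarrow> real"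
  assumes v: "is_norm v"
  shows "is_norm (dual_norm v)"
proof -
  note inner = dual_norm_inner[OF v] and nonneg = dual_norm_nonneg[OF v] and least = dual_norm_least[OF v]
  have scale_le: "dual_norm v (k *\<^sub>R \<eta>) \<le> \<bar>k\<bar> * dual_norm v \<eta>" for k \<eta>
  proof (rule least)
    show "0 \<le> \<bar>k\<bar> * dual_norm v \<eta>" using nonneg by simp
    show "(k *\<^sub>R \<eta>) \<bullet> y \<le> \<bar>k\<bar> * dual_norm v \<eta> * v y" for y
      using inner[of \<eta> "k *\<^sub>R y"] by (simp add: is_normD(3)[OF v] mult_ac)
  qed
  show ?thesis
    unfolding is_norm_def
  proof (intro conjI allI)
    show "0 \<le> dual_norm v \<eta>" for \<eta> by (rule nonneg)
    show "dual_norm v \<eta> = 0 \<longleftrightarrow> \<eta> = 0" for \<eta>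
    proof
      assume "dual_norm v \<eta> = 0"
      then have "\<eta> \<bullet> \<eta> \<le> 0" using inner[of \<eta> \<eta>] by simp
      then show "\<eta> = 0" by (metis inner_gt_zero_iff not_less)
    next
      assume "\<eta> = 0"
      then show "dual_norm v \<eta> = 0" using scale_le[of 0 \<eta>] nonneg[of \<eta>] by simp
    qed
    show "dual_norm v (k *\<^sub>R \<eta>) = \<bar>k\<bar> * dual_norm v \<eta>" for k \<eta>
    proof (cases "k = 0")
      case True
      then show ?thesis using scale_le[of 0 \<eta>] nonneg[of 0] by simp
    next
      case False
      then have "\<bar>k\<bar> * dual_norm v \<eta> \<le> dual_norm v (k *\<^sub>R \<eta>)"
        using scale_le[of "1 / k" "k *\<^sub>R \<eta>"] by (simp add: field_simps)
      then show ?thesis using scale_le[of k \<eta>] by simp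
    qed
    show "dual_norm v (\<eta> + \<xi>) \<le> dual_norm v \<eta> + dual_norm v \<xi>" for \<eta> \<xi>
    proof (rule least)
      show "0 \<le> dual_norm v \<eta> + dual_norm v \<xi>" using nonneg[of \<eta>] nonneg[of \<xi>] by simp
      show "(\<eta> + \<xi>) \<bullet> y \<le> (dual_norm v \<eta> + dual_norm v \<xi>) * v y" for y
        using inner[of \<eta> y] inner[of \<xi> y] by (simp add: inner_add_left distrib_right)
    qed
  qed
qed

text \<open>Transposition and time reversal exchange the orbit and its functional. As
  \<open>v (x t) = 1\<close>, the relations \<open>l t \<bullet> x t = 1\<close> and
  \<open>l t \<bullet> y \<le> v y\<close> put \<open>l t\<close> on the dual unit sphere with
  \<open>x t\<close> as a support, so whatever holds for \<open>x\<close> holds for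
  \<open>l\<close>.\<close>

lemma bang_pair_dual:
  assumes bp: "bang_pair A b c x l v T"
  shows "bang_pair (transpose A) c b (\<lambda>t. l (- t)) (\<lambda>t. x (- t)) (dual_norm v) T"
proof -
  interpret bang_pair A b c x l v T by (rule bp)
  have bi: "bang_interval c b (\<lambda>t. l (- t)) (\<lambda>t. x (- t)) s r w \<longleftrightarrow> bang_interval b c x l (- r) (- s) w" for s r w
  proof -
    have "(\<forall>\<tau>. s < \<tau> \<and> \<tau> < r \<longrightarrow> P (- \<tau>)) \<longleftrightarrow> (\<forall>\<tau>. - r < \<tau> \<and> \<tau> < - s \<longrightarrow> P \<tau>)" for P :: "real \<Rightarrow> bool"
    proof (intro iffI allI impI)
      fix \<tau> assume "\<forall>\<tau>. s < \<tau> \<and> \<tau> < r \<longrightarrow> P (- \<tau>)" "- r < \<tau> \<and> \<tau> < - s"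
      then show "P \<tau>" by (auto dest: spec[of _ "- \<tau>"])
    next
      fix \<tau> assume "\<forall>\<tau>. - r < \<tau> \<and> \<tau> < - s \<longrightarrow> P \<tau>" "s < \<tau> \<and> \<tau> < r"
      then show "P (- \<tau>)" by simp
    qed
    from this[of "\<lambda>\<tau>. 0 \<le> (b \<bullet> l \<tau>) * (c \<bullet> x \<tau>) * (2 * w - 1)"]
    show ?thesis unfolding bang_interval_def by (simp add: mult.commute[of "c \<bullet> _"])
  qed
  have M: "switched_matrix Q c b w = transpose (Mw w)" for w by (simp add: transpose_switched_matrix)
  note inner = dual_norm_inner[OF norm_v] and least = dual_norm_least[OF norm_v]
  show ?thesis
  proof
    fix t :: real
    have neg: "- (t + h) = - t - h" "- (t - h) = - t + h" for h by simp_all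
    show "sgR Q b (l (- t)) \<noteq> 0" "sgL Q b (l (- t)) \<noteq> 0" by (rule sg_l)+
    show "\<exists>r>0. \<forall>h. 0 < h \<and> h < r \<longrightarrow> sgn (b \<bullet> l (- (t + h))) = sgR Q b (l (- t)) \<and> sgn (b \<bullet> l (- (t - h))) = sgL Q b (l (- t))"
      unfolding neg by (rule sg_l(3))
    show "sgR (transpose Q) c (x (- t)) \<noteq> 0" "sgL (transpose Q) c (x (- t)) \<noteq> 0"
      unfolding transpose_transpose by (rule sg_x)+
    show "\<exists>r>0. \<forall>h. 0 < h \<and> h < r \<longrightarrow> sgn (c \<bullet> x (- (t - h))) = sgR (transpose Q) c (x (- t)) \<and>
        sgn (c \<bullet> x (- (t + h))) = sgL (transpose Q) c (x (- t))"
      unfolding neg transpose_transpose by (rule sg_x(3))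
    show "l (- (t + T)) = l (- t)" using l_T[of "- t - T"] by simp
    show "x (- (t + T)) = x (- t)" using x_T[of "- t - T"] by simp
    show "dual_norm v (l (- t)) = 1"
    proof (rule antisym)
      show "dual_norm v (l (- t)) \<le> 1" by (rule least) (simp_all add: l_le)
      show "1 \<le> dual_norm v (l (- t))" using inner[of "l (- t)" "x (- t)"] by (simp add: l_x v_x)
    qed
    show "x (- t) \<bullet> l (- t) = 1" using l_x by (simp add: inner_commute)
    show "x (- t) \<bullet> \<eta> \<le> dual_norm v \<eta>" for \<eta> using inner[of \<eta> "x (- t)"] by (simp add: v_x inner_commute)
  next
    show "continuous_on UNIV (\<lambda>t. l (- t))" "continuous_on UNIV (\<lambda>t. x (- t))"
      by (intro continuous_on_compose2[OF l_cont] continuous_on_compose2[OF x_cont] continuous_intros subset_UNIV)+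
    fix s r w assume "bang_interval c b (\<lambda>t. l (- t)) (\<lambda>t. x (- t)) s r w"
    then have i: "bang_interval b c x l (- r) (- s) w" unfolding bi .
    show "l (- r) = mexp (switched_matrix Q c b w) (r - s) *v l (- s)" using arc_l[OF i] unfolding M by simp
    show "x (- s) = mexp (transpose (switched_matrix Q c b w)) (r - s) *v x (- r)"
      using arc_x[OF i] unfolding M transpose_transpose by simp
  next
    fix w y assume w: "w \<in> {0, 1}" and y: "switched_matrix Q c b w *v y = 0"
    have lin: "linear ((*v) (Mw w))" by simp
    have "inj ((*v) (Mw w))"
      unfolding linear_injective_0[OF lin]
    proof (intro allI impI)
      show "z = 0" if "Mw w *v z = 0" for z using w that by (rule nonsing)
    qed
    then have "surj ((*v) (Mw w))" by (rule linear_injective_imp_surjective[OF lin]) (rule refl)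
    then obtain z where z: "y = Mw w *v z" by (rule surjE)
    have "y \<bullet> y = (transpose (Mw w) *v y) \<bullet> z" by (subst (2) z) (rule inner_transpose)
    then show "y = 0" using y unfolding M by simp
  next
    show "is_norm (dual_norm v)" by (rule is_norm_dual_norm[OF norm_v])
    fix w h :: real and \<eta> assume w: "w \<in> {0, 1}" and h: "(0::real) \<le> h"
    show "dual_norm v (mexp (switched_matrix Q c b w) h *v \<eta>) \<le> dual_norm v \<eta>"
    proof (rule least[OF dual_norm_nonneg[OF norm_v]])
      fix y
      have "(mexp (switched_matrix Q c b w) h *v \<eta>) \<bullet> y = \<eta> \<bullet> (mexp (Mw w) h *v y)" unfolding M inner_mexp ..
      also have "\<dots> \<le> dual_norm v \<eta> * v (mexp (Mw w) h *v y)" by (rule inner)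
      also have "\<dots> \<le> dual_norm v \<eta> * v y" by (rule mult_left_mono[OF contr[OF w h] dual_norm_nonneg[OF norm_v]])
      finally show "(mexp (switched_matrix Q c b w) h *v \<eta>) \<bullet> y \<le> dual_norm v \<eta> * v y" .
    qed
  next
    fix f :: "real \<Rightarrow> real^3"
    assume f: "\<And>t. f (t + T) = f t"
    have per: "f (- (t + T)) = f (- t)" for t using f[of "- t - T"] by simp
    show "\<exists>k. \<forall>t. f t = k *\<^sub>R l (- t)"
      if d: "\<And>s r w. bang_interval c b (\<lambda>t. l (- t)) (\<lambda>t. x (- t)) s r w \<Longrightarrow> f r = mexp (switched_matrix Q c b w) (r - s) *v f s"
    proof -
      have "\<exists>k. \<forall>t. f (- t) = k *\<^sub>R l t"
      proof (rule uniq_l[of "\<lambda>t. f (- t)"])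
        show "f (- (t + T)) = f (- t)" for t by (rule per)
        fix s r w assume "bang_interval b c x l s r w"
        then show "f (- s) = mexp (transpose (Mw w)) (r - s) *v f (- r)" using d[of "- r" "- s" w] unfolding bi M by simp
      qed
      then show ?thesis by (metis minus_minus)
    qed
    show "\<exists>k. \<forall>t. f t = k *\<^sub>R x (- t)"
      if d: "\<And>s r w. bang_interval c b (\<lambda>t. l (- t)) (\<lambda>t. x (- t)) s r w \<Longrightarrow> f s = mexp (transpose (switched_matrix Q c b w)) (r - s) *v f r"
    proof -
      have "\<exists>k. \<forall>t. f (- t) = k *\<^sub>R x t"
      proof (rule uniq_x[of "\<lambda>t. f (- t)"])
        show "f (- (t + T)) = f (- t)" for t by (rule per)
        fix s r w assume "bang_interval b c x l s r w"
        then show "f (- r) = mexp (Mw w) (r - s) *v f (- s)" using d[of "- r" "- s" w] unfolding bi M transpose_transpose by simp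
      qed
      then show ?thesis by (metis minus_minus)
    qed
  next
    fix S :: real assume S: "\<And>t. l (- (t + S)) = l (- t)" "\<And>t. x (- (t + S)) = x (- t)"
    have "l (t + S) = l t" "x (t + S) = x t" for t using S(1)[of "- t - S"] S(2)[of "- t - S"] by (simp_all add: add.commute)
    then show "\<exists>n::int. S = n * T" by (intro min_T)
  next
    show "0 < T" by (rule T_pos)
    show "\<exists>t. 0 < b \<bullet> l (- t)" "\<exists>t. b \<bullet> l (- t) < 0" "\<exists>t. 0 < c \<bullet> x (- t)" "\<exists>t. c \<bullet> x (- t) < 0"
      using p_sign q_sign by (metis minus_minus)+
  qed
qed

section \<open>The orbit as a curve of rays\<close>

lemma sgn_near_zero:
  assumes d: "(g has_real_derivative \<beta>) (at 0)" and "g 0 = 0" "\<beta> \<noteq> 0"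
  shows "\<exists>e>0. \<forall>h. 0 < h \<and> h < e \<longrightarrow> sgn (g h) = sgn \<beta> \<and> sgn (g (- h)) = - sgn \<beta>"
proof (cases "0 < \<beta>")
  case True
  obtain d1 where d1: "d1 > 0" "\<And>h. 0 < h \<Longrightarrow> h < d1 \<Longrightarrow> g 0 < g (0 + h)" using DERIV_pos_inc_right[OF d True] by blast
  obtain d2 where d2: "d2 > 0" "\<And>h. 0 < h \<Longrightarrow> h < d2 \<Longrightarrow> g (0 - h) < g 0" using DERIV_pos_inc_left[OF d True] by blast
  show ?thesis
    by (intro exI[of _ "min d1 d2"]) (use d1 d2 True \<open>g 0 = 0\<close> in auto)
next
  case False
  then have n: "\<beta> < 0" using \<open>\<beta> \<noteq> 0\<close> by simp
  obtain d1 where d1: "d1 > 0" "\<And>h. 0 < h \<Longrightarrow> h < d1 \<Longrightarrow> g (0 + h) < g 0" using DERIV_neg_dec_right[OF d n] by blast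
  obtain d2 where d2: "d2 > 0" "\<And>h. 0 < h \<Longrightarrow> h < d2 \<Longrightarrow> g 0 < g (0 - h)" using DERIV_neg_dec_left[OF d n] by blast
  show ?thesis
    by (intro exI[of _ "min d1 d2"]) (use d1 d2 n \<open>g 0 = 0\<close> in auto)
qed

text \<open>The delicate condition is the one at touching zeros: on either side \<open>x\<close> is
  an exponential with its own matrix, but both matrices act alike on \<open>x t\<close> because
  \<open>c \<bullet> x t = 0\<close>, so \<open>c \<bullet> (A *v x)\<close> has the same one-sided
  derivatives.\<close>

lemma (in bang_pair) ray_curve_p:
  assumes obs: "\<And>y. c \<bullet> y = 0 \<Longrightarrow> c \<bullet> (A *v y) = 0 \<Longrightarrow> c \<bullet> (A *v (A *v y)) = 0 \<Longrightarrow> y = 0"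
  shows "ray_curve p (\<lambda>t. c \<bullet> (A *v x t)) (\<lambda>t. c \<bullet> (A *v (A *v x t))) T"
proof
  show "0 < T" by (rule T_pos)
  show "continuous_on UNIV p" by (rule p_cont)
  have lin: "continuous_on UNIV (\<lambda>y. A *v y)" by (intro linear_continuous_on linear_conv_bounded_linear[THEN iffD1] matrix_vector_mul_linear)
  have 1: "continuous_on UNIV (\<lambda>t. A *v x t)" by (rule continuous_on_compose2[OF lin x_cont]) simp
  have 2: "continuous_on UNIV (\<lambda>t. A *v (A *v x t))" by (rule continuous_on_compose2[OF lin 1]) simp
  show "continuous_on UNIV (\<lambda>t. c \<bullet> (A *v x t))" "continuous_on UNIV (\<lambda>t. c \<bullet> (A *v (A *v x t)))"
    by (intro continuous_on_inner continuous_on_const 1 2)+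
  fix t
  show "p (t + T) = p t" "c \<bullet> (A *v x (t + T)) = c \<bullet> (A *v x t)" "c \<bullet> (A *v (A *v x (t + T))) = c \<bullet> (A *v (A *v x t))"
    by (simp_all add: p_def x_T)
  show "\<exists>n::int. s - t = n * T"
    if k: "0 < k" "p t = k * p s" "c \<bullet> (A *v x t) = k * (c \<bullet> (A *v x s))" "c \<bullet> (A *v (A *v x t)) = k * (c \<bullet> (A *v (A *v x s)))" for k s
  proof (rule x_injective)
    \<comment> \<open>Observability turns proportional coordinates into proportional vectors, and
      \<open>v = 1\<close> along the orbit makes the factor 1.\<close>
    have "x t - k *\<^sub>R x s = 0"
      by (rule obs) (use k in \<open>simp_all add: p_def inner_diff_right matrix_vector_mult_diff_distrib matrix_vector_mult_scaleR\<close>)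
    then have xt: "x t = k *\<^sub>R x s" by simp
    then have "k = 1" using v_x[of t] v_x[of s] k(1) by (simp add: is_normD(3)[OF norm_v])
    then show "x t = x s" using xt by simp
  qed
  show "c \<bullet> (A *v (A *v x t)) \<noteq> 0" if "p t = 0" "c \<bullet> (A *v x t) = 0"
    using sg_x(1)[of t] that by (auto simp: sgR_def p_def)
  show "\<exists>e>0. \<forall>h. 0 < h \<and> h < e \<longrightarrow>
      sgn (p (t + h)) = sgn (c \<bullet> (A *v x t)) \<and> sgn (p (t - h)) = - sgn (c \<bullet> (A *v x t))"
    if "p t = 0" "c \<bullet> (A *v x t) \<noteq> 0"
    using sg_x(3)[of t] that unfolding p_def sgR_def sgL_def by simp
  show "\<exists>e>0. \<forall>h. 0 < h \<and> h < e \<longrightarrow>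
      sgn (p (t + h)) = sgn (c \<bullet> (A *v (A *v x t))) \<and> sgn (p (t - h)) = sgn (c \<bullet> (A *v (A *v x t))) \<and>
      sgn (c \<bullet> (A *v x (t + h))) = sgn (c \<bullet> (A *v (A *v x t))) \<and> sgn (c \<bullet> (A *v x (t - h))) = - sgn (c \<bullet> (A *v (A *v x t)))"
    if z: "p t = 0" "c \<bullet> (A *v x t) = 0"
  proof -
    define \<beta> where "\<beta> = c \<bullet> (A *v (A *v x t))"
    have \<beta>: "\<beta> \<noteq> 0" using sg_x(1)[of t] z by (auto simp: sgR_def p_def \<beta>_def)
    obtain r where r: "r > 0" "\<And>h. 0 < h \<Longrightarrow> h < r \<Longrightarrow> sgn (p (t + h)) = sgn \<beta> \<and> sgn (p (t - h)) = sgn \<beta>"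
      using sg_x(3)[of t] z unfolding p_def sgR_def sgL_def \<beta>_def by auto
    define g where "g w h = (transpose A *v c) \<bullet> (mexp (Mw w) h *v x t)" for w h
    have gA: "g w h = c \<bullet> (A *v (mexp (Mw w) h *v x t))" for w h unfolding g_def by (rule inner_transpose[symmetric])
    have "(transpose A *v c) \<bullet> (Mw w *v x t) = \<beta>" for w
    proof -
      have "Mw w *v x t = A *v x t" using z(1) by (simp add: switched_matrix_mult p_def)
      then show ?thesis unfolding \<beta>_def by (simp only: inner_transpose[symmetric])
    qed
    then have d: "(g w has_real_derivative \<beta>) (at 0)" for w
      using bounded_linear.has_vector_derivative[OF bounded_linear_inner_right[of "transpose A *v c"] mexp_deriv[of "Mw w" "x t" 0 UNIV]]
      unfolding g_def by (simp add: has_real_derivative_iff_has_vector_derivative)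
    have g0: "g w 0 = 0" for w unfolding gA using z(2) by simp
    obtain eR where eR: "eR > 0" "\<And>h. 0 < h \<Longrightarrow> h < eR \<Longrightarrow> sgn (g (wR t) h) = sgn \<beta>"
      using sgn_near_zero[OF d[of "wR t"] g0 \<beta>] by blast
    obtain eL where eL: "eL > 0" "\<And>h. 0 < h \<Longrightarrow> h < eL \<Longrightarrow> sgn (g (wL t) (- h)) = - sgn \<beta>"
      using sgn_near_zero[OF d[of "wL t"] g0 \<beta>] by blast
    obtain e1 where e1: "e1 > 0" "bang_interval b c x l t (t + e1) (wR t)" using right_bang by blast
    obtain e2 where e2: "e2 > 0" "bang_interval b c x l (t - e2) t (wL t)" using left_bang by blast
    have xR: "g (wR t) h = c \<bullet> (A *v x (t + h))" if "0 < h" "h < e1" for h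
    proof -
      have "bang_interval b c x l t (t + h) (wR t)" by (rule bang_sub[OF e1(2)]) (use that in auto)
      from arc_x[OF this] show ?thesis by (simp add: gA)
    qed
    have xL: "g (wL t) (- h) = c \<bullet> (A *v x (t - h))" if "0 < h" "h < e2" for h
    proof -
      have "bang_interval b c x l (t - h) t (wL t)" by (rule bang_sub[OF e2(2)]) (use that in auto)
      from arc_x[OF this] have "x t = mexp (Mw (wL t)) h *v x (t - h)" by simp
      then show ?thesis by (simp add: gA)
    qed
    show ?thesis unfolding \<beta>_def[symmetric]
    proof (intro exI[of _ "min r (min (min eR eL) (min e1 e2))"] conjI allI impI)
      fix h assume "0 < h \<and> h < min r (min (min eR eL) (min e1 e2))"
      then have h: "0 < h" "h < r" "h < eR" "h < eL" "h < e1" "h < e2" by auto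
      show "sgn (p (t + h)) = sgn \<beta>" "sgn (p (t - h)) = sgn \<beta>" using r(2)[OF h(1,2)] by auto
      show "sgn (c \<bullet> (A *v x (t + h))) = sgn \<beta>" using eR(2)[OF h(1,3)] xR[OF h(1,5)] by simp
      show "sgn (c \<bullet> (A *v x (t - h))) = - sgn \<beta>" using eL(2)[OF h(1,4)] xL[OF h(1,6)] by simp
    qed (use r eR eL e1 e2 in simp)
  qed
next
  show "\<exists>t. 0 < p t" "\<exists>t. p t < 0" using p_sign by (simp_all add: p_def)
qed

text \<open>Under a constant control every time shift of \<open>x\<close> obeys the same arcs, hence
  is a multiple of \<open>x\<close> by \<open>uniq_x\<close>; a zero of \<open>p\<close> would then
  be carried to every other time.\<close>

lemma (in bang_pair) control_not_constant:
  assumes w: "w \<in> {0, 1}"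
  shows "\<exists>t. q t * p t * (2 * w - 1) < 0"
proof (rule ccontr)
  assume "\<not> ?thesis"
  then have bi: "bang_interval b c x l s r w" if "s \<le> r" for s r
    using that w by (auto simp: bang_iff not_less)
  obtain t1 t2 where t: "0 < p t1" "p t2 < 0" using p_sign unfolding p_def by blast
  \<comment> \<open>A bang interval of positive length determines its control value, because the
    signs of \<open>p\<close> and \<open>q\<close> just after its midpoint are non-zero.\<close>
  have wr: "w = w'" if "bang_interval b c x l s r w'" "s < r" for s r w'
  proof (rule ccontr)
    assume "w \<noteq> w'"
    define m where "m = (s + r) / 2"
    obtain e where e: "e > 0" "\<And>h. 0 < h \<Longrightarrow> h < e \<Longrightarrow> sgn (p (m + h)) = sgR A c (x m) \<and> sgn (q (m + h)) = sgL Q b (l m)"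
      using right_signs by blast
    define h where "h = min e (r - m) / 2"
    have h: "0 < h" "h < e" "s < m + h" "m + h < r" using e(1) \<open>s < r\<close> by (auto simp: h_def m_def min_def field_simps)
    have "p (m + h) \<noteq> 0" "q (m + h) \<noteq> 0" using e(2)[OF h(1,2)] sg_x(1)[of m] sg_l(2)[of m] by auto
    moreover have "0 \<le> q (m + h) * p (m + h) * (2 * w' - 1)" "w' \<in> {0, 1}" using that(1) h by (auto simp: bang_iff)
    moreover have "0 \<le> q (m + h) * p (m + h) * (2 * w - 1)" using bi[OF less_imp_le[OF that(2)]] h by (auto simp: bang_iff)
    ultimately show False using \<open>w \<noteq> w'\<close> w by (auto simp: mult_le_0_iff zero_le_mult_iff)
  qed
  have "\<exists>k. \<forall>t. x (t + S) = k *\<^sub>R x t" for S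
  proof (rule uniq_x)
    show "x (t + T + S) = x (t + S)" for t using x_T[of "t + S"] by (simp add: algebra_simps)
    fix s r w' assume b': "bang_interval b c x l s r w'"
    show "x (r + S) = mexp (Mw w') (r - s) *v x (s + S)"
    proof (cases "s < r")
      case True
      then have "w' = w" using wr[OF b'] by simp
      then show ?thesis using arc_x[OF bi[of "s + S" "r + S"]] True by simp
    next
      case False
      then have "s = r" using b' by (simp add: bang_iff)
      then show ?thesis by simp
    qed
  qed
  then have k: "\<exists>k. \<forall>t. p (t + S) = k * p t" for S unfolding p_def by (metis inner_scaleR_right)
  obtain t0 where t0: "p t0 = 0"
  proof (cases "t1 \<le> t2")
    case True
    then show ?thesis using IVT2'[of p t2 0 t1] t p_cont that by force
  next
    case False
    then show ?thesis using IVT'[of p t2 0 t1] t p_cont that by force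
  qed
  obtain k where "\<forall>t. p (t + (t1 - t0)) = k * p t" using k by blast
  from this[rule_format, of t0] show False using t0 t by simp
qed

lemma shift_into_period:
  fixes t a T :: real
  assumes "0 < T"
  obtains n :: int where "a \<le> t + n * T" "t + n * T < a + T"
proof -
  have "real_of_int \<lfloor>(t - a) / T\<rfloor> \<le> (t - a) / T" "(t - a) / T < real_of_int \<lfloor>(t - a) / T\<rfloor> + 1"
    by linarith+
  then have "real_of_int \<lfloor>(t - a) / T\<rfloor> * T \<le> t - a" "t - a < (real_of_int \<lfloor>(t - a) / T\<rfloor> + 1) * T"
    using assms by (simp_all only: pos_le_divide_eq pos_divide_less_eq)
  then show ?thesis by (intro that[of "- \<lfloor>(t - a) / T\<rfloor>"]) (simp_all add: algebra_simps)
qed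

section \<open>Counting bang arcs\<close>

text \<open>What two transversal crossings per period leave of a function. Only signs are recorded,
  so that \<open>f\<close> may be replaced by \<open>- f\<close> and the period may start at either
  zero.\<close>

definition sign_pattern :: "(real \<Rightarrow> real) \<Rightarrow> real \<Rightarrow> real \<Rightarrow> real \<Rightarrow> bool" where
  "sign_pattern f T a b \<longleftrightarrow> a < b \<and> b < a + T \<and> f a = 0 \<and> f b = 0 \<and>
     (\<forall>t. a < t \<and> t < b \<longrightarrow> 0 < f t) \<and> (\<forall>t. b < t \<and> t < a + T \<longrightarrow> f t < 0)"

lemma sign_patternD:
  assumes "sign_pattern f T a b"
  shows "a < b" "b < a + T" "f a = 0" "f b = 0" "a < t \<Longrightarrow> t < b \<Longrightarrow> 0 < f t" "b < t \<Longrightarrow> t < a + T \<Longrightarrow> f t < 0"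
  using assms unfolding sign_pattern_def by blast+

lemma sign_pattern_shift:
  assumes per: "\<And>t. f (t + T) = f t" and pat: "sign_pattern f T a b"
  shows "sign_pattern f T (a + of_int n * T) (b + of_int n * T)"
  unfolding sign_pattern_def
proof (intro conjI allI impI)
  note P = sign_patternD[OF pat]
  show "f (a + of_int n * T) = 0" "f (b + of_int n * T) = 0" using P(3,4) periodic_int[of f T, OF per] by simp_all
  have unshift: "f t = f (t - of_int n * T)" for t using periodic_int[of f T "t - of_int n * T" n, OF per] by simp
  show "0 < f t" if "a + of_int n * T < t \<and> t < b + of_int n * T" for t
    unfolding unshift[of t] by (rule P(5)) (use that in auto)
  show "f t < 0" if "b + of_int n * T < t \<and> t < a + of_int n * T + T" for t
    unfolding unshift[of t] by (rule P(6)) (use that in auto)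
qed (use sign_patternD(1,2)[OF pat] in auto)

lemma sign_pattern_uminus:
  assumes per: "\<And>t. f (t + T) = f t" and pat: "sign_pattern f T a b"
  shows "sign_pattern (\<lambda>t. - f t) T b (a + T)"
  unfolding sign_pattern_def
proof (intro conjI allI impI)
  note P = sign_patternD[OF pat]
  show "- f t < 0" if "a + T < t \<and> t < b + T" for t
    using P(5)[of "t - T"] that per[of "t - T"] by auto
  show "0 < - f t" if "b < t \<and> t < a + T" for t using P(6)[of t] that by auto
qed (use sign_patternD(1-4)[OF pat] per in auto)

text \<open>Either zero can open the pattern, at the price of a sign if it is a downward
  crossing.\<close>

lemma sign_pattern_at_zero:
  assumes per: "\<And>t. f (t + T) = f t" and pat: "sign_pattern f T a b" and "0 < T" and "f t = 0"
  obtains \<sigma> b' where "\<sigma> = 1 \<or> \<sigma> = - 1" "sign_pattern (\<lambda>s. \<sigma> * f s) T t b'"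
proof -
  obtain n :: int where n: "a \<le> t + n * T" "t + n * T < a + T" using shift_into_period[OF \<open>0 < T\<close>] by blast
  have "f (t + n * T) = 0" using \<open>f t = 0\<close> periodic_int[of f T, OF per] by simp
  then have "t + n * T = a \<or> t + n * T = b"
    using sign_patternD(5,6)[OF pat, of "t + n * T"] n by (metis less_irrefl not_less_iff_gr_or_eq order_le_less)
  then show ?thesis
  proof
    assume "t + n * T = a"
    then have "sign_pattern f T t (b + of_int (- n) * T)"
      using sign_pattern_shift[of f T a b "- n", OF per pat] by auto
    then show ?thesis by (intro that[of 1]) auto
  next
    assume b: "t + n * T = b"
    have "sign_pattern (\<lambda>t. - f t) T (b + of_int (- n) * T) (a + T + of_int (- n) * T)"
      by (rule sign_pattern_shift[OF _ sign_pattern_uminus[OF per pat]]) (simp add: per)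
    moreover have "b + of_int (- n) * T = t" using b by simp
    ultimately show ?thesis by (intro that[of "- 1"]) simp_all
  qed
qed

lemma switched_matrix_inj:
  assumes "switched_matrix A b c r = switched_matrix A b c r'" "b \<noteq> 0" "c \<noteq> 0"
  shows "r = r'"
proof -
  obtain i j where ij: "b $ i \<noteq> 0" "c $ j \<noteq> 0" using assms(2,3) by (auto simp: vec_eq_iff)
  have "switched_matrix A b c r $ i $ j = switched_matrix A b c r' $ i $ j" using assms(1) by simp
  then show ?thesis using ij by (simp add: switched_matrix_def outer_product_def)
qed

text \<open>\<open>z\<close> is a point inside the arc where \<open>g\<close> may vanish without
  changing sign, as a product does at a common zero of its factors; where there is none, an endpoint
  is passed. The opposite sign on adjacent intervals, from \<open>s'\<close> to \<open>s\<close> and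
  from \<open>e\<close> to \<open>e'\<close>, prevents any extension.\<close>

lemma maximal_arc:
  assumes ae: "AE t in lebesgue. (0 < g t \<longrightarrow> u t = w1) \<and> (g t < 0 \<longrightarrow> u t = (w2 :: real))"
    and "w1 \<noteq> w2" "b \<noteq> 0" "c \<noteq> 0" and ord: "s' < s" "s < e" "e < e'"
    and mid: "\<And>t. s < t \<Longrightarrow> t < e \<Longrightarrow> t \<noteq> z \<Longrightarrow> 0 < g t"
    and left: "\<And>t. s' < t \<Longrightarrow> t < s \<Longrightarrow> g t < 0" and right: "\<And>t. e < t \<Longrightarrow> t < e' \<Longrightarrow> g t < (0 :: real)"
  shows "maximal_bang_arc A b c u s e"
proof -
  have "{s, e, z} \<in> null_sets lebesgue"
    using negligible_iff_null_sets[of "{s, e, z}"] negligible_finite[of "{s, e, z}"] by simp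
  from AE_not_in[OF this] ae have m: "AE t in lebesgue. t \<in> {s..e} \<longrightarrow> u t = w1"
  proof eventually_elim
    case (elim t)
    then show ?case using mid[of t] by (auto simp: order_le_less)
  qed
  then have "AE t in lebesgue. t \<in> {s..e} \<longrightarrow> switched_matrix A b c (u t) = switched_matrix A b c w1"
    by eventually_elim simp
  then have ba: "bang_arc A b c u s e" using ord by (auto simp: bang_arc_def)
  have "s'' = s \<and> e'' = e" if se: "s'' \<le> s" "e \<le> e''" and arc: "bang_arc A b c u s'' e''" for s'' e''
  proof -
    obtain M where M: "AE t in lebesgue. t \<in> {s''..e''} \<longrightarrow> switched_matrix A b c (u t) = M"
      using arc unfolding bang_arc_def by blast
    have "AE t in lebesgue. (t \<in> {s''..e''} \<longrightarrow> switched_matrix A b c (u t) = M) \<and> (t \<in> {s..e} \<longrightarrow> u t = w1)"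
      using M m by eventually_elim simp
    then obtain t where t: "s < t" "t < e"
      "(t \<in> {s''..e''} \<longrightarrow> switched_matrix A b c (u t) = M) \<and> (t \<in> {s..e} \<longrightarrow> u t = w1)"
      by (rule AE_interval_point[OF _ ord(2)])
    then have M1: "M = switched_matrix A b c w1" using se by auto
    have no: False if "y < z" "\<And>t. y < t \<Longrightarrow> t < z \<Longrightarrow> g t < 0" "s'' \<le> y" "z \<le> e''" for y z
    proof -
      have "AE t in lebesgue. (t \<in> {s''..e''} \<longrightarrow> switched_matrix A b c (u t) = M) \<and> (g t < 0 \<longrightarrow> u t = w2)"
        using M ae by eventually_elim simp
      then obtain t where t: "y < t" "t < z"
        "(t \<in> {s''..e''} \<longrightarrow> switched_matrix A b c (u t) = M) \<and> (g t < 0 \<longrightarrow> u t = w2)"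
        by (rule AE_interval_point[OF _ \<open>y < z\<close>])
      then have "switched_matrix A b c w2 = switched_matrix A b c w1" using that M1 by auto
      then have "w2 = w1" by (rule switched_matrix_inj[OF _ \<open>b \<noteq> 0\<close> \<open>c \<noteq> 0\<close>])
      then show False using \<open>w1 \<noteq> w2\<close> by simp
    qed
    have "\<not> s'' < s"
    proof
      assume "s'' < s"
      show False by (rule no[of "max s'' s'" s]) (use \<open>s'' < s\<close> ord se left in auto)
    qed
    moreover have "\<not> e < e''"
    proof
      assume "e < e''"
      show False by (rule no[of e "min e'' e'"]) (use \<open>e < e''\<close> ord se right in auto)
    qed
    ultimately show ?thesis using se by simp
  qed
  then show ?thesis using ba unfolding maximal_bang_arc_def by blast
qed

lemma maximal_arc_neg:
  assumes ae: "AE t in lebesgue. (0 < g t \<longrightarrow> u t = w1) \<and> (g t < 0 \<longrightarrow> u t = (w2 :: real))"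
    and "w1 \<noteq> w2" "b \<noteq> 0" "c \<noteq> 0" and ord: "s' < s" "s < e" "e < e'"
    and mid: "\<And>t. s < t \<Longrightarrow> t < e \<Longrightarrow> g t < 0"
    and left: "\<And>t. s' < t \<Longrightarrow> t < s \<Longrightarrow> 0 < g t" and right: "\<And>t. e < t \<Longrightarrow> t < e' \<Longrightarrow> (0 :: real) < g t"
  shows "maximal_bang_arc A b c u s e"
proof (rule maximal_arc[where g = "\<lambda>t. - g t" and ?w1.0 = w2 and ?w2.0 = w1 and z = s])
  show "AE t in lebesgue. (0 < - g t \<longrightarrow> u t = w2) \<and> (- g t < 0 \<longrightarrow> u t = w1)"
    using ae by eventually_elim simp
qed (use assms in auto)

text \<open>The period is counted from the start of the negative arc, so that the exceptional point
  \<open>z\<close> lies inside the positive one.\<close>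

lemma formed_by_two:
  assumes ae: "AE t in lebesgue. (0 < g t \<longrightarrow> u t = w1) \<and> (g t < 0 \<longrightarrow> u t = (w2 :: real))"
    and nz: "w1 \<noteq> w2" "b \<noteq> 0" "c \<noteq> 0" and per: "\<And>t. g (t + T) = (g t :: real)"
    and ord: "t0 < t1" "t1 < z" "z < t0 + T"
    and neg: "\<And>t. t0 < t \<Longrightarrow> t < t1 \<Longrightarrow> g t < 0" and pos: "\<And>t. t1 < t \<Longrightarrow> t < t0 + T \<Longrightarrow> t \<noteq> z \<Longrightarrow> 0 < g t"
  shows "formed_by_bang_arcs A b c u T 2"
proof -
  have A0: "maximal_bang_arc A b c u t0 t1"
  proof (rule maximal_arc_neg[OF ae nz, of "z - T" _ _ z])
    show "0 < g t" if "z - T < t" "t < t0" for t using pos[of "t + T"] that ord per[of t] by auto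
    show "0 < g t" if "t1 < t" "t < z" for t using pos[of t] that ord by auto
  qed (use ord neg in auto)
  have A1: "maximal_bang_arc A b c u t1 (t0 + T)"
  proof (rule maximal_arc[OF ae nz, of t0 _ _ "t1 + T" z])
    show "g t < 0" if "t0 + T < t" "t < t1 + T" for t using neg[of "t - T"] that per[of "t - T"] by auto
  qed (use ord neg pos in auto)
  define \<tau> where "\<tau> = (\<lambda>i::nat. if i = 0 then t0 else if i = 1 then t1 else t0 + T)"
  have "maximal_bang_arc A b c u (\<tau> i) (\<tau> (Suc i))" if "i < 2" for i
  proof -
    have "i = 0 \<or> i = 1" using that by linarith
    then show ?thesis using A0 A1 by (auto simp: \<tau>_def)
  qed
  moreover have "\<tau> 2 = \<tau> 0 + T" by (simp add: \<tau>_def)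
  ultimately show ?thesis unfolding formed_by_bang_arcs_def by blast
qed

lemma formed_by_four:
  assumes ae: "AE t in lebesgue. (0 < g t \<longrightarrow> u t = w1) \<and> (g t < 0 \<longrightarrow> u t = (w2 :: real))"
    and nz: "w1 \<noteq> w2" "b \<noteq> 0" "c \<noteq> 0" and per: "\<And>t. g (t + T) = (g t :: real)"
    and ord: "t0 < t1" "t1 < t2" "t2 < t3" "t3 < t0 + T"
    and sg: "\<And>t. t0 < t \<Longrightarrow> t < t1 \<Longrightarrow> g t < 0" "\<And>t. t1 < t \<Longrightarrow> t < t2 \<Longrightarrow> 0 < g t"
      "\<And>t. t2 < t \<Longrightarrow> t < t3 \<Longrightarrow> g t < 0" "\<And>t. t3 < t \<Longrightarrow> t < t0 + T \<Longrightarrow> 0 < g t"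
  shows "formed_by_bang_arcs A b c u T 4"
proof -
  have A0: "maximal_bang_arc A b c u t0 t1"
  proof (rule maximal_arc_neg[OF ae nz, of "t3 - T" _ _ t2])
    show "0 < g t" if "t3 - T < t" "t < t0" for t using sg(4)[of "t + T"] that per[of t] by auto
  qed (use ord sg in auto)
  have A1: "maximal_bang_arc A b c u t1 t2"
    by (rule maximal_arc[OF ae nz, of t0 _ _ t3 t1]) (use ord sg in auto)
  have A2: "maximal_bang_arc A b c u t2 t3"
    by (rule maximal_arc_neg[OF ae nz, of t1 _ _ "t0 + T"]) (use ord sg in auto)
  have A3: "maximal_bang_arc A b c u t3 (t0 + T)"
  proof (rule maximal_arc[OF ae nz, of t2 _ _ "t1 + T" t3])
    show "g t < 0" if "t0 + T < t" "t < t1 + T" for t using sg(1)[of "t - T"] that per[of "t - T"] by auto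
  qed (use ord sg in auto)
  define \<tau> where "\<tau> = (\<lambda>i::nat. if i = 0 then t0 else if i = 1 then t1 else if i = 2 then t2 else if i = 3 then t3 else t0 + T)"
  have "maximal_bang_arc A b c u (\<tau> i) (\<tau> (Suc i))" if "i < 4" for i
  proof -
    have "i = 0 \<or> i = 1 \<or> i = 2 \<or> i = 3" using that by linarith
    then show ?thesis using A0 A1 A2 A3 by (auto simp: \<tau>_def)
  qed
  moreover have "\<tau> 4 = \<tau> 0 + T" by (simp add: \<tau>_def)
  ultimately show ?thesis unfolding formed_by_bang_arcs_def by blast
qed

text \<open>Both functions become positive at the common zero \<open>t0\<close>. Their product is
  negative only between the downward zeros \<open>b1\<close> and \<open>b2\<close>, and one positive
  arc runs from \<open>b2\<close> through \<open>t0 + T\<close> to \<open>b1 + T\<close>.\<close>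

lemma two_arcs:
  assumes ae: "AE t in lebesgue. (0 < f t * h t \<longrightarrow> u t = w1) \<and> (f t * h t < 0 \<longrightarrow> u t = (w2 :: real))"
    and nz: "w1 \<noteq> w2" "b \<noteq> 0" "c \<noteq> 0" and per: "\<And>t. f (t + T) = f t" "\<And>t. h (t + T) = h t"
    and f: "sign_pattern f T t0 b1" and h: "sign_pattern h T t0 b2" and "b1 < b2"
  shows "formed_by_bang_arcs A b c u T 2"
proof (rule formed_by_two[OF ae nz, where ?t0.0 = b1 and ?t1.0 = b2 and z = "t0 + T"])
  note F = sign_patternD[OF f] and H = sign_patternD[OF h]
  show "f (t + T) * h (t + T) = f t * h t" for t by (simp add: per)
  show "b1 < b2" "b2 < t0 + T" "t0 + T < b1 + T" using F H \<open>b1 < b2\<close> by auto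
  show "f t * h t < 0" if "b1 < t" "t < b2" for t
    by (rule mult_neg_pos[OF F(6) H(5)]) (use that F(1) H(2) in auto)
  show "0 < f t * h t" if t: "b2 < t" "t < b1 + T" "t \<noteq> t0 + T" for t
  proof (cases "t < t0 + T")
    case True
    show ?thesis by (rule mult_neg_neg[OF F(6) H(6)]) (use t True \<open>b1 < b2\<close> in auto)
  next
    case False
    have "0 < f (t - T) * h (t - T)" by (rule mult_pos_pos[OF F(5) H(5)]) (use t False \<open>b1 < b2\<close> in auto)
    then show ?thesis using per(1)[of "t - T"] per(2)[of "t - T"] by simp
  qed
qed

text \<open>Flipping signs makes the common zero an upward crossing of both factors; if this
  reverses the sign of the product, the two control values are exchanged.\<close>

lemma arcs_common_zero:
  assumes ae: "AE t in lebesgue. (0 < f t * h t \<longrightarrow> u t = w1) \<and> (f t * h t < 0 \<longrightarrow> u t = (w2 :: real))"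
    and nz: "w1 \<noteq> w2" "b \<noteq> 0" "c \<noteq> 0" and per: "\<And>t. f (t + T) = f t" "\<And>t. h (t + T) = h t" and "0 < T"
    and f: "sign_pattern f T a1 b1" and h: "sign_pattern h T a2 b2"
    and both: "\<exists>t. 0 < f t * h t" "\<exists>t. f t * h t < 0" and zero: "f t0 = 0" "h t0 = 0"
  shows "formed_by_bang_arcs A b c u T 2"
proof -
  obtain \<sigma>1 d1 where 1: "\<sigma>1 = 1 \<or> \<sigma>1 = - 1" "sign_pattern (\<lambda>s. \<sigma>1 * f s) T t0 d1"
    using sign_pattern_at_zero[of f T, OF per(1) f \<open>0 < T\<close> zero(1)] by metis
  obtain \<sigma>2 d2 where 2: "\<sigma>2 = 1 \<or> \<sigma>2 = - 1" "sign_pattern (\<lambda>s. \<sigma>2 * h s) T t0 d2"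
    using sign_pattern_at_zero[of h T, OF per(2) h \<open>0 < T\<close> zero(2)] by metis
  define F H where "F t = \<sigma>1 * f t" and "H t = \<sigma>2 * h t" for t
  have F: "sign_pattern F T t0 d1" and H: "sign_pattern H T t0 d2"
    using 1(2) 2(2) unfolding F_def H_def .
  have perF: "F (t + T) = F t" and perH: "H (t + T) = H t" for t by (simp_all add: F_def H_def per)
  have eq: "F t * H t = (\<sigma>1 * \<sigma>2) * (f t * h t)" for t by (simp add: F_def H_def)
  have s: "\<sigma>1 * \<sigma>2 = 1 \<or> \<sigma>1 * \<sigma>2 = - 1" using 1(1) 2(1) by auto
  obtain v1 v2 where v: "v1 \<noteq> v2"
    "AE t in lebesgue. (0 < F t * H t \<longrightarrow> u t = v1) \<and> (F t * H t < 0 \<longrightarrow> u t = v2)"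
    using s
  proof
    assume "\<sigma>1 * \<sigma>2 = 1"
    then show ?thesis using that[OF nz(1)] ae unfolding eq by simp
  next
    assume m: "\<sigma>1 * \<sigma>2 = - 1"
    have "AE t in lebesgue. (0 < F t * H t \<longrightarrow> u t = w2) \<and> (F t * H t < 0 \<longrightarrow> u t = w1)"
      using ae unfolding eq m by eventually_elim auto
    then show ?thesis using that[OF nz(1)[symmetric]] by blast
  qed
  \<comment> \<open>Equal downward zeros would make the product nonnegative everywhere.\<close>
  have "d1 \<noteq> d2"
  proof
    assume "d1 = d2"
    obtain r where r: "F r * H r < 0" using s both unfolding eq by (metis mult_1 mult_minus_left neg_less_0_iff_less)
    obtain n :: int where n: "t0 \<le> r + n * T" "r + n * T < t0 + T" using shift_into_period[OF \<open>0 < T\<close>] by blast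
    define y where "y = r + n * T"
    have FH: "F y = F r" "H y = H r"
      unfolding y_def by (rule periodic_int[of F T, OF perF], rule periodic_int[of H T, OF perH])
    note PF = sign_patternD[OF F] and PH = sign_patternD[OF H[folded \<open>d1 = d2\<close>]]
    consider "y = t0" | "t0 < y" "y < d1" | "y = d1" | "d1 < y" "y < t0 + T" using n unfolding y_def by linarith
    then have "0 \<le> F y * H y"
    proof cases
      case 2
      then show ?thesis using mult_pos_pos[OF PF(5)[OF 2] PH(5)[OF 2]] by simp
    next
      case 4
      then show ?thesis using mult_neg_neg[OF PF(6)[OF 4] PH(6)[OF 4]] by simp
    qed (use PF PH in simp_all)
    then show False using r FH by simp
  qed
  then consider "d1 < d2" | "d2 < d1" by linarith
  then show ?thesis
  proof cases
    case 1
    show ?thesis by (rule two_arcs[OF v(2) v(1) nz(2,3) perF perH F H 1])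
  next
    case 2
    have "AE t in lebesgue. (0 < H t * F t \<longrightarrow> u t = v1) \<and> (H t * F t < 0 \<longrightarrow> u t = v2)"
      using v(2) by (simp only: mult.commute)
    from two_arcs[OF this v(1) nz(2,3) perH perF H F 2] show ?thesis .
  qed
qed

text \<open>\<open>de\<close> places the positive phase of \<open>h\<close> inside the period of
  \<open>f\<close>, so \<open>h\<close> is negative near both ends and the product starts negative
  and ends positive; the cases are the positions of \<open>s\<close> relative to \<open>d\<close>
  and \<open>e\<close>.\<close>

lemma four_arcs:
  assumes ae: "AE t in lebesgue. (0 < f t * h t \<longrightarrow> u t = w1) \<and> (f t * h t < 0 \<longrightarrow> u t = (w2 :: real))"
    and nz: "w1 \<noteq> w2" "b \<noteq> 0" "c \<noteq> 0" and per: "\<And>t. f (t + T) = f t" "\<And>t. h (t + T) = h t"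
    and f: "sign_pattern f T t0 s" and h: "sign_pattern h T d e"
    and de: "t0 < d" "e < t0 + T" and no: "\<And>t. f t = 0 \<Longrightarrow> h t \<noteq> 0"
  shows "formed_by_bang_arcs A b c u T 4"
proof -
  note F = sign_patternD[OF f] and H = sign_patternD[OF h]
  have hneg: "h t < 0" if "t0 \<le> t" "t < d" for t
    using H(6)[of "t + T"] that de per(2)[of t] by simp
  have hneg': "h t < 0" if "e < t" "t < t0 + T" for t using H(6)[of t] that de by simp
  have perg: "f (t + T) * h (t + T) = f t * h t" for t by (simp add: per)
  have "s \<noteq> d" "s \<noteq> e" using no[of s] F(4) H(3,4) by auto
  then consider "s < d" | "d < s" "s < e" | "e < s" by linarith
  then show ?thesis
  proof cases
    case 1
    show ?thesis
    proof (rule formed_by_four[OF ae nz perg, of t0 s d e])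
      show "f t * h t < 0" if "t0 < t" "t < s" for t by (rule mult_pos_neg[OF F(5) hneg]) (use that 1 in auto)
      show "0 < f t * h t" if "s < t" "t < d" for t by (rule mult_neg_neg[OF F(6) hneg]) (use that F H de in auto)
      show "f t * h t < 0" if "d < t" "t < e" for t by (rule mult_neg_pos[OF F(6) H(5)]) (use that 1 de in auto)
      show "0 < f t * h t" if "e < t" "t < t0 + T" for t by (rule mult_neg_neg[OF F(6) hneg']) (use that 1 H in auto)
    qed (use F(1) 1 H(1) de in auto)
  next
    case 2
    show ?thesis
    proof (rule formed_by_four[OF ae nz perg, of t0 d s e])
      show "f t * h t < 0" if "t0 < t" "t < d" for t by (rule mult_pos_neg[OF F(5) hneg]) (use that 2 in auto)
      show "0 < f t * h t" if "d < t" "t < s" for t by (rule mult_pos_pos[OF F(5) H(5)]) (use that 2 de in auto)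
      show "f t * h t < 0" if "s < t" "t < e" for t by (rule mult_neg_pos[OF F(6) H(5)]) (use that 2 de in auto)
      show "0 < f t * h t" if "e < t" "t < t0 + T" for t by (rule mult_neg_neg[OF F(6) hneg']) (use that 2 in auto)
    qed (use 2 de in auto)
  next
    case 3
    show ?thesis
    proof (rule formed_by_four[OF ae nz perg, of t0 d e s])
      show "f t * h t < 0" if "t0 < t" "t < d" for t by (rule mult_pos_neg[OF F(5) hneg]) (use that 3 H in auto)
      show "0 < f t * h t" if "d < t" "t < e" for t by (rule mult_pos_pos[OF F(5) H(5)]) (use that 3 de in auto)
      show "f t * h t < 0" if "e < t" "t < s" for t by (rule mult_pos_neg[OF F(5) hneg']) (use that 3 de F H in auto)
      show "0 < f t * h t" if "s < t" "t < t0 + T" for t by (rule mult_neg_neg[OF F(6) hneg']) (use that 3 in auto)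
    qed (use F 3 H(1) de in auto)
  qed
qed

text \<open>If the positive phase of \<open>h\<close> runs beyond the end of the period, the
  negative phase before it lies inside; then \<open>- h\<close> is used with the control values
  exchanged.\<close>

lemma arcs_no_common_zero:
  assumes ae: "AE t in lebesgue. (0 < f t * h t \<longrightarrow> u t = w1) \<and> (f t * h t < 0 \<longrightarrow> u t = (w2 :: real))"
    and nz: "w1 \<noteq> w2" "b \<noteq> 0" "c \<noteq> 0" and per: "\<And>t. f (t + T) = f t" "\<And>t. h (t + T) = h t" and "0 < T"
    and f: "sign_pattern f T t0 s" and h: "sign_pattern h T a2 b2" and no: "\<And>t. f t = 0 \<Longrightarrow> h t \<noteq> 0"
  shows "formed_by_bang_arcs A b c u T 4"
proof -
  obtain n :: int where n: "t0 \<le> a2 + n * T" "a2 + n * T < t0 + T" using shift_into_period[OF \<open>0 < T\<close>] by blast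
  define d e where "d = a2 + n * T" and "e = b2 + n * T"
  have H: "sign_pattern h T d e" unfolding d_def e_def by (rule sign_pattern_shift[OF per(2) h])
  have "t0 \<noteq> d" using no[of t0] sign_patternD(3)[OF f] sign_patternD(3)[OF H] by auto
  then have d: "t0 < d" "d < t0 + T" using n by (auto simp: d_def)
  have "f (t0 + T) = 0" using per sign_patternD(3)[OF f] by simp
  then have "e \<noteq> t0 + T" using no[of "t0 + T"] sign_patternD(4)[OF H] by auto
  then consider "e < t0 + T" | "t0 + T < e" by linarith
  then show ?thesis
  proof cases
    case 1
    show ?thesis by (rule four_arcs[OF ae nz per f H d(1) 1 no])
  next
    case 2
    have "sign_pattern (\<lambda>t. - h t) T (e + of_int (- 1) * T) (d + T + of_int (- 1) * T)"
      by (rule sign_pattern_shift[OF _ sign_pattern_uminus[OF per(2) H]]) (simp add: per)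
    then have H': "sign_pattern (\<lambda>t. - h t) T (e - T) d" by simp
    have "AE t in lebesgue. (0 < f t * - h t \<longrightarrow> u t = w2) \<and> (f t * - h t < 0 \<longrightarrow> u t = w1)"
      using ae by eventually_elim simp
    then show ?thesis
      by (rule four_arcs[where d = "e - T" and e = d]) (use nz per f H' d 2 no in auto)
  qed
qed

section \<open>From a trajectory to the count of its arcs\<close>

lemma minimal_period_multiple:
  assumes mp: "minimal_period f T" and S: "\<And>t. f (t + S) = f t"
  shows "\<exists>n::int. S = n * T"
proof -
  have T: "0 < T" "\<And>t. f (t + T) = f t" using mp by (auto simp: minimal_period_def)
  obtain n :: int where n: "0 \<le> S + n * T" "S + n * T < 0 + T" using shift_into_period[OF T(1), of 0] by blast
  have r: "f (t + (S + n * T)) = f t" for t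
    using periodic_int[of f T "t + S" n, OF T(2)] S[of t] by (simp add: add.assoc)
  have "\<not> 0 < S + n * T"
  proof
    assume "0 < S + n * T"
    moreover have "S + n * T < T" using n(2) by simp
    ultimately have "\<not> (\<forall>t. f (t + (S + n * T)) = f t)" using mp unfolding minimal_period_def by blast
    then show False using r by blast
  qed
  then have "S = (- n) * T" using n by simp
  then show ?thesis by (intro exI[of _ "- n"]) simp
qed

text \<open>Uniqueness for linear equations turns solutions that are not identically zero into
  nowhere vanishing ones; the adjoint equation takes the form of \<open>control_solution\<close>
  after time reversal.\<close>

lemma trajectory_switched_orbit:
  assumes bar: "barabanov_system A b c" and traj: "trajectory A b c x l u"
    and ex: "\<exists>t. x t \<noteq> 0" "\<exists>t. l t \<noteq> 0" and mp: "minimal_period (\<lambda>t. (x t, l t)) T"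
  shows "switched_orbit A b c x l u T"
proof -
  let ?Q = "transpose A"
  have per: "x (t + T) = x t" "l (t + T) = l t" for t using mp by (simp_all add: minimal_period_def)
  have u01: "AE t in lebesgue. u t \<in> (\<lambda>s. (1 + s) / 2) ` set_sgn (switching_function b c x l t)"
    using traj by (simp add: trajectory_def)
  have u: "AE t in lebesgue. 0 \<le> u t \<and> u t \<le> 1"
    using u01
  proof eventually_elim
    case (elim t)
    then obtain s where s: "s \<in> set_sgn (switching_function b c x l t)" "u t = (1 + s) / 2" by blast
    have "- 1 \<le> s \<and> s \<le> 1" using s(1) by (auto simp: set_sgn_def divide_le_eq le_divide_eq split: if_splits)
    then show ?case using s(2) by simp
  qed
  have sx: "control_solution A b c u x"
    unfolding control_solution_def ae_deriv_def
    using u traj unfolding trajectory_def caratheodory_solution_def by (simp add: outer_product_mult)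
  define D where "D t = - (?Q *v l t) - (u t * (b \<bullet> l t)) *\<^sub>R c" for t
  have ld: "ae_deriv l D"
    unfolding ae_deriv_def D_def
    using traj unfolding trajectory_def caratheodory_solution_def by (simp add: outer_product_mult)
  \<comment> \<open>A local bound on the derivative of \<open>l\<close>, needed to reflect absolute
    continuity in time.\<close>
  have bound: "\<exists>K\<ge>0. AE t in lebesgue. t \<in> {r..s} \<longrightarrow> norm (D t) \<le> K" for r s
  proof -
    obtain L where L: "L > 0" "\<And>w y. w \<in> {0, 1} \<Longrightarrow> norm (switched_matrix ?Q c b w *v y) \<le> L * norm y"
      using switched_mult_bound by blast
    have LQ: "norm (?Q *v y) \<le> L * norm y" for y using L(2)[of 0 y] by (simp add: switched_matrix_mult)
    have "bounded (l ` {r..s})"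
      by (intro compact_imp_bounded compact_continuous_image ae_deriv_continuous[OF ld]) simp
    then obtain B where B: "0 < B" "\<And>t. t \<in> {r..s} \<Longrightarrow> norm (l t) \<le> B" unfolding bounded_pos by blast
    have "AE t in lebesgue. t \<in> {r..s} \<longrightarrow> norm (D t) \<le> L * B + 1 * (norm b * B) * norm c"
      using u
    proof eventually_elim
      case (elim t)
      show ?case
      proof
        assume t: "t \<in> {r..s}"
        have "norm (D t) \<le> norm (?Q *v l t) + norm ((u t * (b \<bullet> l t)) *\<^sub>R c)"
          using norm_triangle_ineq4[of "- (?Q *v l t)" "(u t * (b \<bullet> l t)) *\<^sub>R c"]
          unfolding D_def norm_minus_cancel .
        also have "\<dots> \<le> L * B + 1 * (norm b * B) * norm c"
        proof (rule add_mono)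
          show "norm (?Q *v l t) \<le> L * B" by (rule order_trans[OF LQ mult_left_mono[OF B(2)[OF t]]]) (use L in simp)
          have "\<bar>b \<bullet> l t\<bar> \<le> norm b * B"
            by (rule order_trans[OF Cauchy_Schwarz_ineq2 mult_left_mono[OF B(2)[OF t]]]) simp
          then show "norm ((u t * (b \<bullet> l t)) *\<^sub>R c) \<le> 1 * (norm b * B) * norm c"
            unfolding norm_scaleR abs_mult by (intro mult_right_mono mult_mono) (use elim B(1) in auto)
        qed
        finally show "norm (D t) \<le> L * B + 1 * (norm b * B) * norm c" .
      qed
    qed
    moreover have "0 \<le> L * B + 1 * (norm b * B) * norm c" using L(1) B(1) by simp
    ultimately show ?thesis by blast
  qed
  have "ae_deriv (\<lambda>t. l (- t)) (\<lambda>t. - D (- t))" by (rule ae_deriv_reflect[OF ld bound])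
  moreover have "(\<lambda>t. - D (- t)) = (\<lambda>t. ?Q *v l (- t) + (u (- t) * (b \<bullet> l (- t))) *\<^sub>R c)" by (simp add: D_def fun_eq_iff)
  ultimately have sl: "control_solution ?Q c b (\<lambda>t. u (- t)) (\<lambda>t. l (- t))"
    unfolding control_solution_def using AE_reflect[OF u] by simp
  show ?thesis
  proof
    show "0 < T" using mp by (simp add: minimal_period_def)
    show "control_solution A b c u x" "control_solution ?Q c b (\<lambda>t. u (- t)) (\<lambda>t. l (- t))" by fact+
    show "AE t in lebesgue. (0 < (b \<bullet> l t) * (c \<bullet> x t) \<longrightarrow> u t = 1) \<and> ((b \<bullet> l t) * (c \<bullet> x t) < 0 \<longrightarrow> u t = 0)"
      using u01 by eventually_elim (auto simp: set_sgn_def switching_function_def split: if_splits)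
    show "controllable_pair A b" "controllable_pair ?Q c" "max_growth_rate A b c = 0" "hurwitz A" "hurwitz (A + outer_product b c)"
      using bar by (simp_all add: barabanov_system_def)
    show "x t \<noteq> 0" for t using ex(1) control_solution_zero[OF sx] by blast
    show "l t \<noteq> 0" for t
    proof
      assume "l t = 0"
      then have "l (- (- t)) = 0" by simp
      then have z: "l (- s) = 0" for s by (rule control_solution_zero[OF sl])
      have "l s = 0" for s using z[of "- s"] by simp
      then show False using ex(2) by blast
    qed
    show "\<exists>n::int. S = n * T" if "\<And>t. x (t + S) = x t" "\<And>t. l (t + S) = l t" for S
      by (rule minimal_period_multiple[OF mp]) (simp add: that)
  qed (use per in auto)
qed

lemma (in bang_pair) sign_pattern_p:
  assumes obs: "\<And>y. c \<bullet> y = 0 \<Longrightarrow> c \<bullet> (A *v y) = 0 \<Longrightarrow> c \<bullet> (A *v (A *v y)) = 0 \<Longrightarrow> y = 0"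
  shows "\<exists>t0 t1. sign_pattern p T t0 t1"
proof -
  interpret R: ray_curve p "\<lambda>t. c \<bullet> (A *v x t)" "\<lambda>t. c \<bullet> (A *v (A *v x t))" T by (rule ray_curve_p[OF obs])
  obtain t0 t1 where "t0 < t1" "t1 < t0 + T" "R.up t0" "R.down t1" "\<forall>t. t0 < t \<and> t < t1 \<longrightarrow> 0 < p t"
    "\<forall>t. t1 < t \<and> t < t0 + T \<longrightarrow> p t < 0"
    using R.two_crossings by blast
  then have "sign_pattern p T t0 t1" by (simp add: sign_pattern_def R.up_def R.down_def)
  then show ?thesis by blast
qed

theorem corollary5:
  fixes A :: "real ^ 3 ^ 3" and b c :: "real ^ 3"
    and x l :: "real \<Rightarrow> real ^ 3" and u :: "real \<Rightarrow> real" and T :: real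
  assumes "barabanov_system A b c"
    and "trajectory A b c x l u"
    and "\<exists>t. x t \<noteq> 0" and "\<exists>t. l t \<noteq> 0"
    and "minimal_period (\<lambda>t. (x t, l t)) T"
  shows "(formed_by_bang_arcs A b c u T 2 \<or> formed_by_bang_arcs A b c u T 4) \<and>
         ((\<exists>t. b \<bullet> l t = 0 \<and> c \<bullet> x t = 0) \<longrightarrow> formed_by_bang_arcs A b c u T 2)"
proof -
  interpret O: switched_orbit A b c x l u T by (rule trajectory_switched_orbit[OF assms])
  obtain k k' v where k: "0 < k" "0 < k'" and bp: "bang_pair A b c (\<lambda>t. k *\<^sub>R x t) (\<lambda>t. k' *\<^sub>R l t) v T"
    by (rule O.bang_pair_exists)
  interpret P: bang_pair A b c "\<lambda>t. k *\<^sub>R x t" "\<lambda>t. k' *\<^sub>R l t" v T by (rule bp)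
  interpret Q: bang_pair "transpose A" c b "\<lambda>t. k' *\<^sub>R l (- t)" "\<lambda>t. k *\<^sub>R x (- t)" "dual_norm v" T
    by (rule bang_pair_dual[OF bp])
  obtain t0 t1 where "sign_pattern P.p T t0 t1"
    using P.sign_pattern_p controllable_pair_observable[OF O.ctrl(2)] by blast
  then have f: "sign_pattern P.p T t0 t1" .
  obtain s0 s1 where "sign_pattern Q.p T s0 s1"
    using Q.sign_pattern_p controllable_pair_observable[OF O.ctrl'] by blast
  note S = sign_patternD[OF this]
  have PQ: "P.q t = Q.p (- t)" for t by (simp add: P.q_def Q.p_def)
  have perp: "P.p (t + T) = P.p t" and perq: "P.q (t + T) = P.q t" for t
    by (simp_all add: P.p_def P.q_def O.x_T O.l_T)
  \<comment> \<open>Time reversal turns the pattern around: the downward crossing \<open>s1\<close>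
    of the reversed function becomes the upward crossing \<open>- s1\<close>.\<close>
  have h: "sign_pattern P.q T (- s1) (- s0)"
    unfolding sign_pattern_def
  proof (intro conjI allI impI)
    show "0 < P.q t" if "- s1 < t \<and> t < - s0" for t unfolding PQ by (rule S(5)) (use that in auto)
    show "P.q t < 0" if t: "- s0 < t \<and> t < - s1 + T" for t
    proof -
      have "Q.p (- (t - T)) < 0" by (rule S(6)) (use t in auto)
      then show ?thesis using perq[of "t - T"] unfolding PQ[symmetric] by simp
    qed
  qed (use S(1-4) PQ in auto)
  have kk: "0 < k' * k" using k by simp
  have eq: "P.q t * P.p t = (k' * k) * ((b \<bullet> l t) * (c \<bullet> x t))" for t by (simp add: P.q_def P.p_def)
  have pos: "0 < (k' * k) * a \<longleftrightarrow> 0 < a" "(k' * k) * a < 0 \<longleftrightarrow> a < 0" for a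
    using mult_less_cancel_left_pos[OF kk, of 0 a] mult_less_cancel_left_pos[OF kk, of a 0] by simp_all
  have ae: "AE t in lebesgue. (0 < P.q t * P.p t \<longrightarrow> u t = 1) \<and> (P.q t * P.p t < 0 \<longrightarrow> u t = 0)"
    unfolding eq pos by (rule O.u_ae)
  have both: "\<exists>t. 0 < P.q t * P.p t" "\<exists>t. P.q t * P.p t < 0"
    using P.control_not_constant[of 0] P.control_not_constant[of 1] by auto
  have zero: "P.q t = 0 \<longleftrightarrow> b \<bullet> l t = 0" "P.p t = 0 \<longleftrightarrow> c \<bullet> x t = 0" for t using k by (simp_all add: P.q_def P.p_def)
  show ?thesis
  proof (cases "\<exists>t. b \<bullet> l t = 0 \<and> c \<bullet> x t = 0")
    case True
    then obtain t where t: "P.q t = 0" "P.p t = 0" using zero by blast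
    have "formed_by_bang_arcs A b c u T 2"
      by (rule arcs_common_zero[OF ae _ O.bc_nz perq perp O.T_pos h f both t]) simp
    then show ?thesis by simp
  next
    case False
    have "formed_by_bang_arcs A b c u T 4"
      by (rule arcs_no_common_zero[OF ae _ O.bc_nz perq perp O.T_pos h f]) (use False zero in auto)
    then show ?thesis using False by blast
  qed
qed

end
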